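(* Let $k\ge1$ and $n\geq 2k+8$ be integers. There are constants $D_{n,k}$ and $D'_{n,k}$ depending only on $n$ and $k$ such that the following holds. Let $g:\mathbb{R}\to\mathbb{R}$ be a locally Lipschitz function and let $u\in W^{1,k+1}(B_1,|x|^{1-k})$ be a semistable radial solution of $S_k(D^2u)=g(u)$ in $B_1$. (i) If $g$ is nonnegative, then $$u'(r)\leq D_{n,k}\,\|\nabla u\|_{L^{k+1}(B_1\setminus\overline{B_{1/2}},|x|^{1-k})}\;r^{\frac{-(k+1)n+2\sqrt{2(k+1)n-4k}+k^2+4k-1}{(k+1)^2}}\quad\text{for all } r\in(0,1/2].$$ (ii) If $g$ is nonnegative and nonincreasing, then for $i\in\{1,2\}$ $$|u^{(i)}(r)|\leq D'_{n,k}\left(\min_{t\in[1/2,1]}u'(t)\right)r^{\frac{-(k+1)n+2\sqrt{2(k+1)n-4k}+(2-i)k^2+2(3-i)k-i}{(k+1)^2}}\quad\text{for all } r\in(0,1].$$ (iii) If $g$ is nonnegative, nonincreasing and convex, then $$|u^{(3)}(r)|\leq D'_{n,k}\left(\min_{t\in[1/2,1]}u'(t)\right)r^{\frac{-(k+1)n+2\sqrt{2(k+1)n-4k}-k^2-3}{(k+1)^2}}\quad\text{for all } r\in(0,1].$$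
   Context: $B_\rho$ is the open ball of radius $\rho$ centered at $0$ in $\mathbb{R}^n$, $c_{n,k}=\binom{n}{k}/n$, $(\cdot,\cdot)$ is the Euclidean inner product. A function is radial if $u(x)=u(r)$, $r=|x|$; $u'$ and $u^{(i)}$ are its derivatives in $r$. $W^{1,k+1}(B_1,|x|^{1-k})$ is the space of weakly differentiable $u\in L^{k+1}(B_1)$ with $\int_{B_1}|x|^{1-k}|\nabla u|^{k+1}dx<\infty$, and $\|\nabla u\|_{L^{k+1}(A,|x|^{1-k})}=\left(\int_A|x|^{1-k}|\nabla u|^{k+1}dx\right)^{1/(k+1)}$. $S_k(D^2u)=\sigma_k(\lambda(D^2u))$ is the $k$-th elementary symmetric function of the eigenvalues of the Hessian $D^2u$, and $S_k^{ij}(D^2u)=\frac{\partial}{\partial u_{ij}}S_k(D^2u)$, where $u_i=u_{x_i}$, $u_{ij}=u_{x_ix_j}$. For radial $u$, with $\lambda_1=u''$ and $\lambda_2=u'/r$, one has at $x\neq0$ $$S_k^{ij}(D^2u)=k\,c_{n,k}\left(\lambda_2^{k-1}\delta_{ij}+\frac{k-1}{n-1}\lambda_2^{k-2}(\lambda_1-\lambda_2)\Big(\delta_{ij}-\frac{x_ix_j}{|x|^2}\Big)\right)$$ (the second term is absent when $k=1$). Classical solution: $u\in C^2(B_1)\cap C(\overline{B_1})$, $u=0$ on $\partial B_1$, $\sigma_i(\lambda(D^2u))>0$ in $B_1$ for $i=1,\dots,k$, and $S_k(D^2u)=g(u)$ in $B_1$. Weak solution: $u\in L^{k+1}(B_1)$,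 $\int_{B_1}\sum u_iu_jS_k^{ij}(D^2u)<\infty$, $g(u)\in L^1(B_1)$ and $\int_{B_1}\{\frac1k\sum u_i\eta_jS_k^{ij}(D^2u)+g(u)\eta\}=0$ for all $\eta\in C_c^1(B_1)$ (for radial $u$, $\sum u_iu_jS_k^{ij}(D^2u)=k\,c_{n,k}(u'/r)^{k-1}(u')^2$ and $\sum u_i\eta_jS_k^{ij}(D^2u)=k\,c_{n,k}(u'/r)^k(x,\nabla\eta)$, which do not involve $u''$). "Solution" means classical or weak solution. Radial solutions are understood with $u'\ge0$. A solution $u$ is semistable if $\int_{B_1}\{\sum\varphi_i\varphi_jS_k^{ij}(D^2u)+g'(u)\varphi^2\}dx\ge0$ for all $\varphi\in C_c^1(B_1\setminus\{0\})$.
   Formalization: In (iii), u^{(3)} need not exist at every r when g is convex but not differentiable; the statement proved is that u^{(3)} exists outside a countable subset of (0,1] and the bound holds at every r in (0,1] where it exists. *)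

theory Defs
  imports "HOL-Analysis.Analysis" "HOL-Computational_Algebra.Polynomial"
begin

definition pdiff :: "'n \<Rightarrow> (real^'n \<Rightarrow> real) \<Rightarrow> real^'n \<Rightarrow> real" where
  "pdiff i f x = deriv (\<lambda>t. f (x + t *\<^sub>R axis i 1)) 0"

definition gradient :: "(real^'n \<Rightarrow> real) \<Rightarrow> real^'n \<Rightarrow> real^'n" where
  "gradient f x = (\<chi> i. pdiff i f x)"

definition hessian :: "(real^'n \<Rightarrow> real) \<Rightarrow> real^'n \<Rightarrow> real^'n^'n" where
  "hessian f x = (\<chi> i j. pdiff j (pdiff i f) x)"

text \<open>The following two predicates are meant for open sets only.\<close>

definition C1_on :: "(real^'n) set \<Rightarrow> (real^'n \<Rightarrow> real) \<Rightarrow> bool" where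
  "C1_on S f \<longleftrightarrow> f differentiable_on S \<and> (\<forall>i. continuous_on S (pdiff i f))"

definition C2_on :: "(real^'n) set \<Rightarrow> (real^'n \<Rightarrow> real) \<Rightarrow> bool" where
  "C2_on S f \<longleftrightarrow> C1_on S f \<and> (\<forall>i. C1_on S (pdiff i f))"

text \<open>\<open>C\<^sub>c\<^sup>1(\<Omega>)\<close>, each function being extended by \<open>0\<close> to the whole space.\<close>

definition C1_compact_support :: "(real^'n) set \<Rightarrow> (real^'n \<Rightarrow> real) \<Rightarrow> bool" where
  "C1_compact_support \<Omega> \<eta> \<longleftrightarrow>
     C1_on UNIV \<eta> \<and> compact (closure {x. \<eta> x \<noteq> 0}) \<and> closure {x. \<eta> x \<noteq> 0} \<subseteq> \<Omega>"

definition locally_lipschitz :: "(real \<Rightarrow> real) \<Rightarrow> bool" where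
  "locally_lipschitz g \<longleftrightarrow> (\<forall>x. \<exists>e>0. \<exists>L. L-lipschitz_on (ball x e) g)"

definition weak_gradient_on ::
    "(real^'n) set \<Rightarrow> (real^'n \<Rightarrow> real) \<Rightarrow> (real^'n \<Rightarrow> real^'n) \<Rightarrow> bool" where
  "weak_gradient_on \<Omega> u G \<longleftrightarrow>
     (\<forall>K. compact K \<and> K \<subseteq> \<Omega> \<longrightarrow> integrable (lebesgue_on K) u \<and> integrable (lebesgue_on K) G) \<and>
     (\<forall>\<eta> i. C1_compact_support \<Omega> \<eta> \<longrightarrow>
        (LINT x|lebesgue_on \<Omega>. u x * pdiff i \<eta> x) = - (LINT x|lebesgue_on \<Omega>. G x $ i * \<eta> x))"

definition in_Lp_ball :: "nat \<Rightarrow> (real^'n \<Rightarrow> real) \<Rightarrow> bool" where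
  "in_Lp_ball p u \<longleftrightarrow> u \<in> borel_measurable (lebesgue_on (ball 0 1)) \<and>
     integrable (lebesgue_on (ball 0 1)) (\<lambda>x. \<bar>u x\<bar> ^ p)"

text \<open>Membership in \<open>W^{1,k+1}(B_1, |x|^{1-k})\<close>, with \<open>G\<close> naming the weak gradient, which \<open>u\<close> determines almost everywhere.\<close>

definition weighted_sobolev ::
    "nat \<Rightarrow> (real^'n \<Rightarrow> real) \<Rightarrow> (real^'n \<Rightarrow> real^'n) \<Rightarrow> bool" where
  "weighted_sobolev k u G \<longleftrightarrow>
     in_Lp_ball (k + 1) u \<and> weak_gradient_on (ball 0 1) u G \<and>
     integrable (lebesgue_on (ball 0 1)) (\<lambda>x. norm x powr (1 - real k) * norm (G x) ^ (k + 1))"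

definition weighted_grad_norm :: "nat \<Rightarrow> (real^'n) set \<Rightarrow> (real^'n \<Rightarrow> real^'n) \<Rightarrow> real" where
  "weighted_grad_norm k A G =
     (LINT x|lebesgue_on A. norm x powr (1 - real k) * norm (G x) ^ (k + 1)) powr (1 / real (k + 1))"

definition elem_sym :: "nat \<Rightarrow> complex^'n \<Rightarrow> complex" where
  "elem_sym k l = (\<Sum>S\<in>{S. card S = k}. \<Prod>i\<in>S. l $ i)"

definition char_polynomial :: "real^'n^'n \<Rightarrow> complex poly" where
  "char_polynomial A =
     det (\<chi> i j. (if i = j then [:0, 1:] else 0) - [:complex_of_real (A $ i $ j):])"

text \<open>The eigenvalues with algebraic multiplicity, in an unspecified order.\<close>

definition eigenvalues :: "real^'n^'n \<Rightarrow> complex^'n" where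
  "eigenvalues A = (SOME l. char_polynomial A = (\<Prod>i\<in>UNIV. [:- (l $ i), 1:]))"

text \<open>
  The eigenvalues are real for symmetric \<open>A\<close>, in particular for Hessians of \<open>C\<^sup>2\<close> functions. Complex
  eigenvalues are admitted because the entries are varied independently in \<open>hess_coeff\<close>, which
  leaves the symmetric matrices; \<open>elem_sym k (eigenvalues A)\<close> is real for every real matrix, being up
  to sign a coefficient of the characteristic polynomial.
\<close>

definition hess_op :: "nat \<Rightarrow> real^'n^'n \<Rightarrow> real" where
  "hess_op k A = Re (elem_sym k (eigenvalues A))"

definition hess_coeff :: "nat \<Rightarrow> real^'n^'n \<Rightarrow> 'n \<Rightarrow> 'n \<Rightarrow> real" where
  "hess_coeff k A i j =
     deriv (\<lambda>t. hess_op k (\<chi> a b. A $ a $ b + (if a = i \<and> b = j then t else 0))) 0"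

definition classical_solution ::
    "nat \<Rightarrow> (real \<Rightarrow> real) \<Rightarrow> (real^'n \<Rightarrow> real) \<Rightarrow> bool" where
  "classical_solution k g u \<longleftrightarrow>
     C2_on (ball 0 1) u \<and> continuous_on (cball 0 1) u \<and> (\<forall>x\<in>sphere 0 1. u x = 0) \<and>
     (\<forall>x\<in>ball 0 1. (\<forall>i\<in>{1..k}. hess_op i (hessian u x) > 0) \<and>
                    hess_op k (hessian u x) = g (u x))"

definition c_const :: "nat \<Rightarrow> nat \<Rightarrow> real" where
  "c_const n k = real (n choose k) / real n"

text \<open>
  Weak solutions, for radial \<open>u\<close> with weak gradient \<open>G\<close>. Then \<open>u' = (G x \<bullet> x) / |x|\<close>, and for smooth \<open>u\<close>
  one has \<open>\<Sum> u_i u_j S_k^{ij} = k c_{n,k} (u'/r)^{k-1} (u')^2\<close> and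
  \<open>\<Sum> u_i \<eta>_j S_k^{ij} = k c_{n,k} (u'/r)^k (x \<bullet> grad \<eta>)\<close>. These expressions define the left-hand sides, as
  second derivatives of \<open>u\<close> need not be available.
\<close>

definition weak_radial_solution ::
    "nat \<Rightarrow> (real \<Rightarrow> real) \<Rightarrow> (real^'n \<Rightarrow> real) \<Rightarrow> (real^'n \<Rightarrow> real^'n) \<Rightarrow> bool" where
  "weak_radial_solution k g u G \<longleftrightarrow>
     in_Lp_ball (k + 1) u \<and> weak_gradient_on (ball 0 1) u G \<and>
     integrable (lebesgue_on (ball 0 1))
       (\<lambda>x. real k * c_const CARD('n) k * ((G x \<bullet> x) / (norm x)\<^sup>2) ^ (k - 1) * ((G x \<bullet> x) / norm x)\<^sup>2) \<and>
     integrable (lebesgue_on (ball 0 1)) (\<lambda>x. g (u x)) \<and>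
     (\<forall>\<eta>. C1_compact_support (ball 0 1) \<eta> \<longrightarrow>
        (LINT x|lebesgue_on (ball 0 1).
           1 / real k * (real k * c_const CARD('n) k * ((G x \<bullet> x) / (norm x)\<^sup>2) ^ k * (x \<bullet> gradient \<eta> x))
             + g (u x) * \<eta> x) = 0)"

text \<open>
  \<open>u\<close> is radial with profile \<open>v\<close>. A radial function of the weighted Sobolev space has a
  representative that is continuous in \<open>r\<close> on \<open>(0, 1]\<close>; it is this one that is called \<open>u\<close>.
  The condition \<open>u' \<ge> 0\<close> is expressed through the weak gradient.
\<close>

definition radial_solution ::
    "nat \<Rightarrow> (real \<Rightarrow> real) \<Rightarrow> (real^'n \<Rightarrow> real) \<Rightarrow> (real^'n \<Rightarrow> real^'n) \<Rightarrow> (real \<Rightarrow> real) \<Rightarrow> bool" where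
  "radial_solution k g u G v \<longleftrightarrow>
     continuous_on {0<..1} v \<and> (\<forall>x\<in>cball 0 1. u x = v (norm x)) \<and>
     (AE x in lebesgue_on (ball 0 1). G x \<bullet> x \<ge> 0) \<and>
     (classical_solution k g u \<or> weak_radial_solution k g u G)"

text \<open>
  A locally Lipschitz \<open>g\<close> need not be differentiable everywhere, and \<open>u\<close> may be constant on a ball.
  Hence \<open>g'\<close> is allowed to take any values at the points where \<open>g\<close> is not differentiable. The
  integrability condition excludes the default value \<open>0\<close> of the integral of a non-integrable function.
\<close>

definition semistable :: "nat \<Rightarrow> (real \<Rightarrow> real) \<Rightarrow> (real^'n \<Rightarrow> real) \<Rightarrow> bool" where
  "semistable k g u \<longleftrightarrow>
     (\<exists>g'. (\<forall>t D. (g has_real_derivative D) (at t) \<longrightarrow> g' t = D) \<and>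
       (\<forall>\<phi>. C1_compact_support (ball 0 1 - {0}) \<phi> \<longrightarrow>
          (let q = (\<lambda>x. (\<Sum>i\<in>UNIV. \<Sum>j\<in>UNIV. pdiff i \<phi> x * pdiff j \<phi> x * hess_coeff k (hessian u x) i j)
                         + g' (u x) * (\<phi> x)\<^sup>2)
           in integrable (lebesgue_on (ball 0 1)) q \<and> (LINT x|lebesgue_on (ball 0 1). q x) \<ge> 0)))"

text \<open>
  Derivative with respect to \<open>r \<in> (0, 1]\<close>: two-sided for \<open>r < 1\<close>, one-sided at \<open>r = 1\<close>. Iterates
  \<open>rderiv ^^ i\<close> give \<open>u^{(i)}\<close>. Where the derivative does not exist, the value is unspecified.
\<close>

definition rderiv :: "(real \<Rightarrow> real) \<Rightarrow> real \<Rightarrow> real" where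
  "rderiv v r = vector_derivative v (at r within {0<..1})"

definition rdifferentiable :: "(real \<Rightarrow> real) \<Rightarrow> real \<Rightarrow> bool" where
  "rdifferentiable v r \<longleftrightarrow> v differentiable (at r within {0<..1})"

end

theory Submission
  imports Defs "HOL-Computational_Algebra.Fundamental_Theorem_Algebra"
begin

text \<open>
  Write \<open>z = u'\<close> and \<open>n\<close> for the dimension. A radial solution satisfies the equation
  \<open>(r\<^bsup>n-k\<^esup> z\<^sup>k)' = r\<^bsup>n-1\<^esup> g(u) / c\<^bsub>n,k\<^esub>\<close> on \<open>{0<..1}\<close>, and the flux \<open>r\<^bsup>n-k\<^esup> z\<^sup>k\<close> vanishes at the origin
  (\<open>classical_solution_profile\<close>, \<open>weak_solution_profile\<close>). For weak solutions neither \<open>z\<close> nor the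
  weak gradient is known to be continuous, and mollification is replaced by dilations: a function \<open>Z\<close> with
  \<open>\<integral> Z x \<bullet> \<nabla>\<zeta> = 0\<close> for all test functions is homogeneous of degree \<open>- n\<close>, hence zero if it is small
  enough at the origin.

  The heart of the proof is the stability condition for the test functions \<open>z \<xi>\<close>. The derivative \<open>g'(u) z\<close> is
  the derivative of \<open>g(u)\<close> in \<open>r\<close>; after integration by parts and elimination of \<open>g(u)\<close> by the equation
  there remains \<open>0 \<le> \<integral> r\<^bsup>n-k\<^esup> z\<^bsup>k+1\<^esup> Q(\<xi>)\<close> with a quadratic form \<open>Q\<close> in \<open>\<xi>'\<close> and \<open>\<xi> / r\<close> whose
  coefficients depend on \<open>n\<close> and \<open>k\<close> only (\<open>semistable_radial_inequality\<close>). As \<open>g\<close> is merely locally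
  Lipschitz, the chain rule and the integration by parts rest on the almost everywhere differentiability
  of Lipschitz functions (\<open>lipschitz_fundamental_theorem\<close>).

  On a power \<open>r\<^sup>p\<close> the form is a quadratic polynomial in \<open>p\<close> times \<open>r\<^bsup>2p-2\<^esup>\<close>, negative between its roots \<open>- s\<close> and
  \<open>t > 1\<close>. A weight that behaves like \<open>r\<close> below \<open>\<rho>\<close> and like a multiple of \<open>r\<^bsup>-s\<^esup>\<close> above therefore
  contributes negatively, except where it is cut off near the boundary, and this yields
  \<open>\<integral> r\<^bsup>n-k\<^esup> z\<^bsup>k+1\<^esup> \<le> C \<rho>\<^bsup>2s+2\<^esup>\<close> for the integral up to \<open>\<rho>\<close>, in terms of the energy in \<open>[1/2, 3/4]\<close>
  (\<open>energy_decay\<close>). The cut-off at the inner end costs nothing: at the origin because the energy is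
  finite, and at a radius where \<open>z\<close> starts from \<open>0\<close> because \<open>g\<close> is Lipschitz and vanishes at the value of \<open>u\<close> there.

  If \<open>g \<ge> 0\<close>, the flux is nondecreasing, so that \<open>z r\<close> is bounded by a mean over \<open>[r, 2r]\<close>. This gives the first
  estimate (\<open>profile_bound\<close>). If \<open>g\<close> is also nonincreasing, then \<open>z / r\<close> is nonincreasing. Hence \<open>z\<close> is
  comparable to its minimum near the boundary, and the equation gives \<open>\<bar>z'\<bar> \<le> n z / r\<close>. If moreover \<open>g\<close> is convex, it is
  differentiable up to countably many points, its slopes are controlled by those of secants, and
  differentiating the equation once more gives \<open>\<bar>z''\<bar> \<le> C z / r\<^sup>2\<close>.
\<close>

section \<open>Continuously differentiable and radial functions\<close>

lemma pdiff_eq_has_derivative: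
  assumes "(f has_derivative f') (at x)"
  shows "pdiff i f x = f' (axis i 1)"
proof -
  have "((\<lambda>t. x + t *\<^sub>R axis i 1) has_derivative (\<lambda>t. t *\<^sub>R axis i 1)) (at (0::real))"
    by (auto intro!: derivative_eq_intros)
  then have "((\<lambda>t. f (x + t *\<^sub>R axis i 1)) has_derivative (\<lambda>t. f' (t *\<^sub>R axis i 1))) (at 0)"
    using has_derivative_compose[of "\<lambda>t. x + t *\<^sub>R axis i 1" _ 0 UNIV f f'] assms by simp
  moreover have "(\<lambda>t. f' (t *\<^sub>R axis i 1)) = (*) (f' (axis i 1))"
    using assms by (auto simp: linear_scale has_derivative_linear)
  ultimately show ?thesis
    unfolding pdiff_def has_field_derivative_def[symmetric] by (metis DERIV_imp_deriv has_field_derivative_def)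
qed

lemma gradient_eqI:
  assumes "(f has_derivative (\<lambda>h. y \<bullet> h)) (at x)"
  shows "gradient f x = y"
  by (simp add: vec_eq_iff gradient_def pdiff_eq_has_derivative[OF assms] inner_axis)

lemma C1_on_has_derivative:
  assumes "C1_on S f" "open S" "x \<in> S"
  shows "(f has_derivative (\<lambda>h. gradient f x \<bullet> h)) (at x)"
proof -
  have "f differentiable (at x)"
    using assms by (metis C1_on_def differentiable_on_def at_within_open)
  then obtain f' where f': "(f has_derivative f') (at x)" by (auto simp: differentiable_def)
  have "f' h = gradient f x \<bullet> h" for h
  proof -
    have "f' h = f' (\<Sum>i\<in>UNIV. h $ i *\<^sub>R axis i 1)"
      by (simp only: basis_expansion[of h, unfolded scalar_mult_eq_scaleR])
    also have "\<dots> = (\<Sum>i\<in>UNIV. h $ i * f' (axis i 1))"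
      using f' by (simp add: linear_sum has_derivative_linear linear_scale)
    also have "\<dots> = gradient f x \<bullet> h"
      by (simp add: inner_vec_def gradient_def pdiff_eq_has_derivative[OF f'] mult.commute)
    finally show ?thesis .
  qed
  then show ?thesis using f' by (metis has_derivative_eq_rhs ext)
qed

lemma C1_on_continuous_gradient:
  assumes "C1_on S f"
  shows "continuous_on S (gradient f)"
  using assms unfolding gradient_def C1_on_def by (intro continuous_on_vec_lambda) auto

lemma C1_onI:
  fixes f :: "real^'n \<Rightarrow> real"
  assumes "\<And>x. x \<in> S \<Longrightarrow> (f has_derivative (\<lambda>h. F x \<bullet> h)) (at x)" "continuous_on S F"
  shows "C1_on S f"
proof -
  have "f differentiable_on S"
    using assms(1) by (auto simp: differentiable_on_def differentiable_def intro: has_derivative_at_withinI)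
  moreover have "continuous_on S (pdiff i f)" for i
  proof -
    have "continuous_on S (\<lambda>x. F x $ i)" using assms(2) by (intro continuous_on_component)
    then show ?thesis
      by (rule continuous_on_eq) (simp add: pdiff_eq_has_derivative[OF assms(1)] inner_axis)
  qed
  ultimately show ?thesis by (simp add: C1_on_def)
qed

lemma C1_on_const: "C1_on UNIV (\<lambda>x::real^'n. c)"
  by (rule C1_onI[where F="\<lambda>_. 0"]) auto

lemma C1_on_inner: "C1_on UNIV (\<lambda>x::real^'n. x \<bullet> a)"
  by (rule C1_onI[where F="\<lambda>_. a"]) (auto intro!: derivative_eq_intros simp: inner_commute)

lemma has_gradient_mult:
  fixes f g :: "real^'n \<Rightarrow> real"
  assumes "(f has_derivative (\<lambda>h. F \<bullet> h)) (at x)" "(g has_derivative (\<lambda>h. G \<bullet> h)) (at x)"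
  shows "((\<lambda>x. f x * g x) has_derivative (\<lambda>h. (f x *\<^sub>R G + g x *\<^sub>R F) \<bullet> h)) (at x)"
  using has_derivative_mult[OF assms] by (rule has_derivative_eq_rhs) (auto simp: inner_add_left algebra_simps)

lemma C1_on_mult:
  assumes "C1_on S f" "C1_on S g" "open S"
  shows "C1_on S (\<lambda>x. f x * g x)"
proof -
  have "continuous_on S f" "continuous_on S g"
    using assms differentiable_imp_continuous_on by (auto simp: C1_on_def)
  then have "continuous_on S (\<lambda>x. f x *\<^sub>R gradient g x + g x *\<^sub>R gradient f x)"
    using assms by (intro continuous_intros C1_on_continuous_gradient)
  moreover have "((\<lambda>x. f x * g x) has_derivative (\<lambda>h. (f x *\<^sub>R gradient g x + g x *\<^sub>R gradient f x) \<bullet> h)) (at x)"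
    if "x \<in> S" for x
    using that assms by (intro has_gradient_mult C1_on_has_derivative)
  ultimately show ?thesis by (rule C1_onI[rotated])
qed

lemma C1_on_add:
  assumes "C1_on S f" "C1_on S g" "open S"
  shows "C1_on S (\<lambda>x. f x + g x)"
  by (rule C1_onI[where F = "\<lambda>x. gradient f x + gradient g x"])
    (use assms in \<open>auto intro!: continuous_intros C1_on_continuous_gradient derivative_eq_intros
       C1_on_has_derivative simp: inner_add_left\<close>)

lemma has_derivative_radial:
  assumes "x \<noteq> 0" "(\<Phi> has_real_derivative d) (at (norm x))"
  shows "((\<lambda>x. \<Phi> (norm x)) has_derivative (\<lambda>h. ((d / norm x) *\<^sub>R x) \<bullet> h)) (at (x::'a::real_inner))"
proof -
  have "(norm has_derivative (\<lambda>h. h \<bullet> sgn x)) (at x)"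
    using has_derivative_norm[OF \<open>x \<noteq> 0\<close>] by (simp add: inner_commute)
  from has_derivative_compose[OF this assms(2)[unfolded has_field_derivative_def]]
  show ?thesis
    by (rule has_derivative_eq_rhs) (auto simp: sgn_div_norm inner_commute divide_inverse)
qed

lemma C1_on_radial:
  fixes S :: "(real^'n) set"
  assumes "0 \<notin> S" "\<And>x. x \<in> S \<Longrightarrow> (\<Phi> has_real_derivative d (norm x)) (at (norm x))"
    and "continuous_on (norm ` S) d"
  shows "C1_on S (\<lambda>x. \<Phi> (norm x))"
  by (rule C1_onI[OF has_derivative_radial])
    (use assms in \<open>auto intro!: continuous_intros continuous_on_compose2[OF assms(3)]\<close>)

lemma C1_compact_support_D:
  assumes "C1_compact_support \<Omega> \<eta>"
  shows "(\<eta> has_derivative (\<lambda>h. gradient \<eta> x \<bullet> h)) (at x)" "continuous_on UNIV (gradient \<eta>)"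
    "continuous_on UNIV \<eta>"
  using assms by (auto simp: C1_compact_support_def C1_on_def intro: C1_on_has_derivative[of UNIV]
      C1_on_continuous_gradient differentiable_imp_continuous_on)

lemma C1_compact_supportI:
  fixes \<eta> :: "real^'n \<Rightarrow> real"
  assumes "C1_on UNIV \<eta>" "compact K" "K \<subseteq> \<Omega>" "\<And>x. x \<notin> K \<Longrightarrow> \<eta> x = 0"
  shows "C1_compact_support \<Omega> \<eta>"
proof -
  have "closure {x. \<eta> x \<noteq> 0} \<subseteq> K"
    using assms by (intro closure_minimal compact_imp_closed) auto
  then show ?thesis using assms unfolding C1_compact_support_def
    by (meson closed_closure compact_Int_closed compact_closure order_trans bounded_subset compact_imp_bounded closure_subset)
qed

lemma gradient_zero_outside:
  assumes "C1_compact_support \<Omega> \<eta>" "x \<notin> closure {x. \<eta> x \<noteq> 0}"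
  shows "gradient \<eta> x = 0"
proof (rule gradient_eqI)
  have "((\<lambda>_. 0) has_derivative (\<lambda>h. 0 \<bullet> h)) (at x)" by simp
  then show "(\<eta> has_derivative (\<lambda>h. 0 \<bullet> h)) (at x)"
    by (rule has_derivative_transform_within_open[where s = "- closure {x. \<eta> x \<noteq> 0}"])
      (use assms(2) closure_subset[of "{x. \<eta> x \<noteq> 0}"] in auto)
qed

text \<open>As \<open>\<Phi>\<close> vanishes near \<open>0\<close>, the composition with the norm is \<open>C\<^sup>1\<close> at the origin as well.\<close>

lemma C1_on_radial_test:
  fixes \<Phi> d :: "real \<Rightarrow> real"
  assumes "0 < a" "\<And>r. (\<Phi> has_real_derivative d r) (at r)" "continuous_on UNIV d"
    and "\<And>r. r \<notin> {a..b} \<Longrightarrow> \<Phi> r = 0"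
  shows "C1_on UNIV (\<lambda>x::real^'n. \<Phi> (norm x))"
    and "gradient (\<lambda>x::real^'n. \<Phi> (norm x)) x = (d (norm x) / norm x) *\<^sub>R x"
proof -
  have d0: "d r = 0" if "r < a" for r
  proof -
    have "((\<lambda>_. 0) has_real_derivative 0) (at r)" by simp
    then have "(\<Phi> has_real_derivative 0) (at r)"
      by (rule DERIV_cong_ev[THEN iffD1, rotated 3])
        (use that assms(4) in \<open>auto intro!: eventually_mono[OF eventually_nhds_in_open[of "{..<a}"]]\<close>)
    then show ?thesis using assms(2) DERIV_unique by blast
  qed
  let ?F = "\<lambda>x::real^'n. (d (norm x) / norm x) *\<^sub>R x"
  have der: "((\<lambda>x. \<Phi> (norm x)) has_derivative (\<lambda>h. ?F x \<bullet> h)) (at x)" for x :: "real^'n"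
  proof (cases "x = 0")
    case True
    have "((\<lambda>_. 0) has_derivative (\<lambda>h. ?F x \<bullet> h)) (at x)" using True by simp
    then show ?thesis
      by (rule has_derivative_transform_within_open[where s = "ball 0 a"])
        (use assms(1,4) True in auto)
  qed (use has_derivative_radial[OF _ assms(2)] in auto)
  have "continuous_on (ball 0 a) ?F"
    by (rule continuous_on_eq[where f = "\<lambda>_. 0"]) (auto simp: d0)
  moreover have "continuous_on (- {0}) ?F"
    by (auto intro!: continuous_intros continuous_on_compose2[OF assms(3)])
  moreover have "UNIV = ball 0 a \<union> - {0::real^'n}" using assms(1) by auto
  ultimately have "continuous_on UNIV ?F"
    using continuous_on_open_Un[of "ball 0 a" "- {0}" ?F] by (simp add: open_Compl)
  then show "C1_on UNIV (\<lambda>x::real^'n. \<Phi> (norm x))" by (rule C1_onI[OF der])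
  show "gradient (\<lambda>x::real^'n. \<Phi> (norm x)) x = (d (norm x) / norm x) *\<^sub>R x"
    by (rule gradient_eqI[OF der])
qed

lemma compact_annulus: "compact {x::'a::euclidean_space. a \<le> norm x \<and> norm x \<le> b}"
proof -
  have "{x::'a. a \<le> norm x \<and> norm x \<le> b} = cball 0 b - ball 0 a" by (auto simp: not_less)
  then show ?thesis by (simp add: compact_diff)
qed

lemma C1_compact_support_radial:
  fixes \<Phi> d :: "real \<Rightarrow> real"
  assumes "0 < a" "b < 1" "\<And>r. (\<Phi> has_real_derivative d r) (at r)" "continuous_on UNIV d"
    and "\<And>r. r \<notin> {a..b} \<Longrightarrow> \<Phi> r = 0"
  shows "C1_compact_support (ball 0 1 - {0}) (\<lambda>x::real^'n. \<Phi> (norm x))"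
  by (rule C1_compact_supportI[where K = "{x. a \<le> norm x \<and> norm x \<le> b}", OF C1_on_radial_test(1)[OF assms(1,3-5)]
        compact_annulus])
    (use assms in auto)

lemma compact_punctured_ball_annulus:
  assumes "compact K" "K \<subseteq> ball 0 1 - {0::'a::euclidean_space}"
  obtains a b where "0 < a" "a < b" "b < 1" "K \<subseteq> {x. a \<le> norm x \<and> norm x \<le> b}"
proof (cases "K = {}")
  case True then show ?thesis using that[of "1/3" "1/2"] by auto
next
  case False
  have c: "continuous_on K norm" by (intro continuous_intros)
  obtain p where p: "p \<in> K" "\<And>x. x \<in> K \<Longrightarrow> norm p \<le> norm x"
    using continuous_attains_inf[OF assms(1) False c] by blast
  obtain q where q: "q \<in> K" "\<And>x. x \<in> K \<Longrightarrow> norm x \<le> norm q"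
    using continuous_attains_sup[OF assms(1) False c] by blast
  have "0 < norm p" "norm q < 1" "norm p \<le> norm q" using p q assms(2) by auto
  moreover have "norm p / 2 \<le> norm p" "norm q \<le> (1 + norm q) / 2"
    using \<open>0 < norm p\<close> \<open>norm q < 1\<close> by (auto simp: field_simps)
  then have "norm p / 2 \<le> norm x \<and> norm x \<le> (1 + norm q)/2" if "x \<in> K" for x
    using p(2)[OF that] q(2)[OF that] by (blast intro: order_trans)
  ultimately show ?thesis by (intro that[of "norm p / 2" "(1 + norm q)/2"]) auto
qed

text \<open>
  Near \<open>x\<close> the gradient is \<open>y \<mapsto> (z \<bar>y\<bar> / \<bar>y\<bar>) y\<close>. It is then differentiated at \<open>x\<close>, where only the
  radial part sees \<open>z'\<close>.
\<close>

lemma hessian_radial: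
  fixes u :: "real^'n \<Rightarrow> real"
  assumes "open T" "x \<noteq> 0" "norm x \<in> T" "open S" "x \<in> S" "\<And>y. y \<in> S \<Longrightarrow> u y = v (norm y)"
    and "\<And>r. r \<in> T \<Longrightarrow> (v has_real_derivative z r) (at r)"
    and "(z has_real_derivative z') (at (norm x))"
  shows "hessian u x = (\<chi> i j. (if i = j then z (norm x) / norm x else 0)
            + (z' - z (norm x) / norm x) * (x $ i * x $ j) / (norm x)\<^sup>2)"
proof -
  let ?U = "S \<inter> norm -` T \<inter> - {0}"
  have oU: "open ?U" "x \<in> ?U" using assms by (auto intro!: open_Int open_vimage continuous_intros)
  have grad: "pdiff i u y = (z (norm y) / norm y) * y $ i" if "y \<in> ?U" for i y
  proof -
    have "((\<lambda>x. v (norm x)) has_derivative (\<lambda>h. ((z (norm y) / norm y) *\<^sub>R y) \<bullet> h)) (at y)"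
      using that assms(7) by (intro has_derivative_radial) auto
    then have "(u has_derivative (\<lambda>h. ((z (norm y) / norm y) *\<^sub>R y) \<bullet> h)) (at y)"
      by (rule has_derivative_transform_within_open[OF _ oU(1) that]) (use assms(6) in auto)
    from pdiff_eq_has_derivative[OF this] show ?thesis by (simp add: inner_axis)
  qed
  have "pdiff j (pdiff i u) x = (if i = j then z (norm x) / norm x else 0)
            + (z' - z (norm x) / norm x) * (x $ i * x $ j) / (norm x)\<^sup>2" for i j
  proof -
    have "((\<lambda>r. z r / r) has_real_derivative (z' * norm x - z (norm x)) / (norm x)\<^sup>2) (at (norm x))"
      using assms(2) by (auto intro!: derivative_eq_intros assms(8) simp: power2_eq_square)
    from has_derivative_radial[OF assms(2) this]
    have "((\<lambda>y. (z (norm y) / norm y) * y $ i) has_derivative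
        (\<lambda>h. (z (norm x) / norm x) * h $ i + ((((z' * norm x - z (norm x)) / (norm x)\<^sup>2) / norm x) *\<^sub>R x) \<bullet> h * x $ i)) (at x)"
      by (rule has_derivative_mult) (intro bounded_linear_imp_has_derivative bounded_linear_vec_nth)
    then have "(pdiff i u has_derivative
        (\<lambda>h. (z (norm x) / norm x) * h $ i + ((((z' * norm x - z (norm x)) / (norm x)\<^sup>2) / norm x) *\<^sub>R x) \<bullet> h * x $ i)) (at x)"
      by (rule has_derivative_transform_within_open[OF _ oU]) (use grad in auto)
    moreover have "axis j (1::real) $ i = (if i = j then 1 else 0)" by (simp add: axis_def)
    ultimately show ?thesis
      using assms(2) pdiff_eq_has_derivative[of "pdiff i u" _ x j]
      by (auto simp: inner_axis field_simps power2_eq_square)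
  qed
  then show ?thesis by (simp add: hessian_def vec_eq_iff)
qed

section \<open>The Hessian operator at radial Hessians\<close>

lemma prod_linear_factors_expand:
  fixes l :: "'n::finite \<Rightarrow> 'a::comm_ring_1"
  assumes "finite A"
  shows "(\<Prod>i\<in>A. [:- l i, 1:]) = (\<Sum>S\<in>Pow A. monom ((- 1) ^ card S * prod l S) (card A - card S))"
  using assms
proof (induction A)
  case (insert a A)
  have sp: "Pow (insert a A) = Pow A \<union> insert a ` Pow A" "Pow A \<inter> insert a ` Pow A = {}"
    using insert by (auto simp: Pow_insert)
  have inj: "inj_on (insert a) (Pow A)" using insert by (auto simp: inj_on_def)
  have fin: "finite S" "card S \<le> card A" "a \<notin> S" if "S \<in> Pow A" for S
    using that insert finite_subset by (auto intro: card_mono)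
  have "(\<Prod>i\<in>insert a A. [:- l i, 1:]) = [:- l a, 1:] * (\<Sum>S\<in>Pow A. monom ((- 1) ^ card S * prod l S) (card A - card S))"
    using insert by simp
  also have "\<dots> = (\<Sum>S\<in>Pow A. monom ((- 1) ^ card S * prod l S) (Suc (card A - card S)))
      + (\<Sum>S\<in>Pow A. smult (- l a) (monom ((- 1) ^ card S * prod l S) (card A - card S)))"
  proof -
    have "[:- l a, 1:] * monom c m = monom c (Suc m) + smult (- l a) (monom c m)" for c m
      by (simp add: monom_Suc)
    then show ?thesis by (simp only: sum_distrib_left sum.distrib)
  qed
  also have "(\<Sum>S\<in>Pow A. monom ((- 1) ^ card S * prod l S) (Suc (card A - card S)))
      = (\<Sum>S\<in>Pow A. monom ((- 1) ^ card S * prod l S) (card (insert a A) - card S))"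
    using insert fin by (intro sum.cong) (auto simp: Suc_diff_le)
  also have "(\<Sum>S\<in>Pow A. smult (- l a) (monom ((- 1) ^ card S * prod l S) (card A - card S)))
      = (\<Sum>S\<in>Pow A. monom ((- 1) ^ card (insert a S) * prod l (insert a S)) (card (insert a A) - card (insert a S)))"
    using insert fin by (intro sum.cong) (auto simp: smult_monom algebra_simps)
  also have "\<dots> = (\<Sum>S\<in>insert a ` Pow A. monom ((- 1) ^ card S * prod l S) (card (insert a A) - card S))"
    by (simp add: sum.reindex[OF inj])
  finally show ?case
    using insert by (simp only: sp(1)) (subst sum.union_disjoint, use sp in auto)
qed simp

text \<open>Vieta's formula.\<close>

lemma elem_sym_eq_coeff:
  fixes l :: "complex^'n"
  assumes "p = (\<Prod>i\<in>UNIV. [:- (l $ i), 1:])" "k \<le> CARD('n)"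
  shows "elem_sym k l = (-1) ^ k * coeff p (CARD('n) - k)"
proof -
  have "coeff p (CARD('n) - k)
      = (\<Sum>S\<in>UNIV. if card S = k then (-1) ^ card S * (\<Prod>i\<in>S. l $ i) else 0)"
    unfolding assms(1) prod_linear_factors_expand[OF finite] coeff_sum
  proof (intro sum.cong)
    fix S :: "'n set"
    have "card S \<le> CARD('n)" by (intro card_mono) auto
    then show "coeff (monom ((- 1) ^ card S * (\<Prod>i\<in>S. l $ i)) (CARD('n) - card S)) (CARD('n) - k) =
         (if card S = k then (- 1) ^ card S * (\<Prod>i\<in>S. l $ i) else 0)"
      using assms(2) by auto
  qed auto
  also have "\<dots> = (\<Sum>S | card S = k. (-1) ^ card S * (\<Prod>i\<in>S. l $ i))"
    by (subst sum.If_cases) auto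
  also have "\<dots> = (-1) ^ k * elem_sym k l"
    by (simp add: elem_sym_def sum_distrib_left)
  finally show ?thesis by (simp add: power_mult_distrib[symmetric] mult.assoc[symmetric])
qed

text \<open>Only the identity permutation contributes to the top coefficient of the characteristic polynomial.\<close>

lemma char_polynomial_monic:
  fixes A :: "real^'n^'n"
  shows "degree (char_polynomial A) = CARD('n) \<and> lead_coeff (char_polynomial A) = 1"
proof -
  define M where "M = (\<lambda>i j. (if i = j then [:0, 1:] else 0) - [:complex_of_real (A $ i $ j):])"
  define t where "t = (\<lambda>p. of_int (sign p) * (\<Prod>i\<in>UNIV. M i (p i)) :: complex poly)"
  have cp: "char_polynomial A = (\<Sum>p | p permutes UNIV. t p)"
    by (simp add: char_polynomial_def det_def M_def t_def)
  have "coeff (char_polynomial A) (CARD('n)) = (\<Sum>p | p permutes UNIV. coeff (t p) CARD('n))"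
    by (simp add: cp coeff_sum)
  have degM: "degree (M i j) \<le> (if i = j then 1 else 0)" for i j
    by (auto simp: M_def)
  have tp: "degree (t p) < CARD('n)" if "p permutes UNIV" and ne: "p \<noteq> id" for p :: "'n \<Rightarrow> 'n"
  proof -
    obtain a where a: "p a \<noteq> a" using ne by (metis eq_id_iff)
    have "degree (t p) \<le> degree (\<Prod>i\<in>UNIV. M i (p i))"
      unfolding t_def by (rule order_trans[OF degree_mult_le]) simp
    also have "\<dots> \<le> (\<Sum>i\<in>UNIV. degree (M i (p i)))"
      using degree_prod_sum_le[of UNIV "\<lambda>i. M i (p i)"] by (simp add: o_def)
    also have "\<dots> \<le> (\<Sum>i\<in>UNIV. if i = p i then 1 else 0)" by (intro sum_mono degM)
    also have "\<dots> = card {i. i = p i}" by (simp add: sum.If_cases)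
    also have "\<dots> < CARD('n)" 
    proof (rule psubset_card_mono)
      have "a \<notin> {i. i = p i}" using a by simp
      then show "{i. i = p i} \<subset> UNIV" by blast
    qed simp
    finally show ?thesis .
  qed
  have tid: "t id = (\<Prod>i\<in>UNIV. [:- complex_of_real (A $ i $ i), 1:])"
    by (simp add: t_def M_def sign_id)
  have "degree (t id) = (\<Sum>i\<in>(UNIV::'n set). degree [:- complex_of_real (A $ i $ i), 1:])"
    unfolding tid by (intro degree_prod_eq_sum_degree) auto
  then have did: "degree (t id) = CARD('n)" by simp
  have lid: "lead_coeff (t id) = 1" unfolding tid by (simp add: lead_coeff_prod)
  have split: "char_polynomial A = t id + (\<Sum>p \<in> {p. p permutes UNIV} - {id}. t p)"
    unfolding cp by (rule sum.remove) (auto simp: permutes_id)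
  have n0: "0 < CARD('n)" by simp
  have "degree (\<Sum>p \<in> {p. p permutes (UNIV::'n set)} - {id}. t p) < degree (t id)"
    unfolding did by (rule degree_sum_less) (use tp n0 in auto)
  then show ?thesis
    unfolding split using did lid by (simp add: degree_add_eq_left coeff_eq_0)
qed

text \<open>
  The fundamental theorem of algebra; a list of roots of length \<open>n\<close> is turned into a vector. This is
  what makes the choice in the definition of the eigenvalues meaningful.
\<close>

lemma char_polynomial_factors:
  fixes A :: "real^'n^'n"
  obtains l :: "complex^'n" where "char_polynomial A = (\<Prod>i\<in>UNIV. [:- (l $ i), 1:])"
proof -
  have "char_polynomial A \<noteq> 0" using char_polynomial_monic[of A] by auto
  then obtain B where B: "size B = CARD('n)" "char_polynomial A = (\<Prod>x\<in>#B. [:-x, 1:])"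
    using alg_closed_imp_factorization[of "char_polynomial A"] char_polynomial_monic[of A] by auto
  obtain xs where xs: "mset xs = B" using ex_mset by blast
  have len: "length xs = CARD('n)" using xs B(1) by (metis size_mset)
  obtain h where h: "bij_betw h (UNIV::'n set) {0..<CARD('n)}"
    using ex_bij_betw_finite_nat[of "UNIV::'n set"] by auto
  have "char_polynomial A = (\<Prod>x\<leftarrow>xs. [:-x, 1:])"
    using B(2) xs by (metis prod_mset_prod_list mset_map)
  also have "\<dots> = (\<Prod>j\<in>{0..<CARD('n)}. [:-(xs ! j), 1:])"
    by (simp add: prod.list_conv_set_nth len)
  also have "\<dots> = (\<Prod>i\<in>UNIV. [:-(xs ! h i), 1:])"
    by (rule prod.reindex_bij_betw[OF h, symmetric])
  finally show ?thesis by (intro that[of "\<chi> i. xs ! h i"]) simp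
qed

text \<open>
  In this form the operator no longer refers to an ordering of the eigenvalues, and it is visibly
  polynomial in the entries of the matrix.
\<close>

lemma hess_op_eq_coeff:
  fixes A :: "real^'n^'n"
  assumes "k \<le> CARD('n)"
  shows "hess_op k A = Re ((-1) ^ k * coeff (char_polynomial A) (CARD('n) - k))"
proof -
  have "char_polynomial A = (\<Prod>i\<in>UNIV. [:- (eigenvalues A $ i), 1:])"
    unfolding eigenvalues_def by (rule someI_ex) (use char_polynomial_factors in blast)
  from elem_sym_eq_coeff[OF this assms] show ?thesis by (simp add: hess_op_def)
qed

text \<open>
  This property passes through the sums and products that form a determinant, so it holds for the
  characteristic polynomial as a function of the matrix.
\<close>

definition coeffs_differentiable :: "('a::real_normed_vector \<Rightarrow> complex poly) \<Rightarrow> bool" where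
  "coeffs_differentiable P \<longleftrightarrow> (\<forall>m A. (\<lambda>A. coeff (P A) m) differentiable at A)"

lemma coeffs_differentiable_sum:
  "(\<And>i. i \<in> I \<Longrightarrow> coeffs_differentiable (P i)) \<Longrightarrow> finite I \<Longrightarrow> coeffs_differentiable (\<lambda>A. \<Sum>i\<in>I. P i A)"
  by (auto simp: coeffs_differentiable_def coeff_sum intro!: differentiable_sum)

lemma coeffs_differentiable_mult:
  "coeffs_differentiable P \<Longrightarrow> coeffs_differentiable Q \<Longrightarrow> coeffs_differentiable (\<lambda>A. P A * Q A)"
  by (auto simp: coeffs_differentiable_def coeff_mult intro!: differentiable_sum differentiable_mult)

lemma coeffs_differentiable_const: "coeffs_differentiable (\<lambda>A. p)"
  by (auto simp: coeffs_differentiable_def)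

lemma coeffs_differentiable_prod:
  "finite I \<Longrightarrow> (\<And>i. i \<in> I \<Longrightarrow> coeffs_differentiable (P i)) \<Longrightarrow> coeffs_differentiable (\<lambda>A. \<Prod>i\<in>I. P i A)"
  by (induction I rule: finite_induct) (auto intro: coeffs_differentiable_mult coeffs_differentiable_const)

lemma differentiable_hess_op:
  fixes A :: "real^'n^'n"
  assumes "k \<le> CARD('n)"
  shows "hess_op k differentiable (at A)"
proof -
  have ent: "coeffs_differentiable (\<lambda>A::real^'n^'n. (if i = j then [:0, 1:] else 0) - [:complex_of_real (A $ i $ j):])" for i j
  proof -
    have bl: "bounded_linear (\<lambda>A::real^'n^'n. complex_of_real (A $ i $ j))"
      by (intro bounded_linear_compose[OF bounded_linear_of_real]
        bounded_linear_compose[OF bounded_linear_vec_nth] bounded_linear_vec_nth)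
    have "(\<lambda>A::real^'n^'n. complex_of_real (A $ i $ j)) differentiable at B" for B
      using bounded_linear_imp_has_derivative[OF bl] unfolding differentiable_def by blast
    then show ?thesis
      unfolding coeffs_differentiable_def
    proof (intro allI)
      fix m and B :: "real^'n^'n"
      show "(\<lambda>A::real^'n^'n. coeff ((if i = j then [:0, 1:] else 0) - [:complex_of_real (A $ i $ j):]) m) differentiable at B"
        using \<open>(\<lambda>A::real^'n^'n. complex_of_real (A $ i $ j)) differentiable at B\<close> by (cases m) auto
    qed
  qed
  have "coeffs_differentiable (char_polynomial :: real^'n^'n \<Rightarrow> complex poly)"
    unfolding char_polynomial_def det_def
    by (intro coeffs_differentiable_sum coeffs_differentiable_mult coeffs_differentiable_prod
        coeffs_differentiable_const) (auto simp: ent)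
  then have "(\<lambda>A::real^'n^'n. coeff (char_polynomial A) (CARD('n) - k)) differentiable at A"
    by (auto simp: coeffs_differentiable_def)
  then have d: "(\<lambda>A::real^'n^'n. (-1) ^ k * coeff (char_polynomial A) (CARD('n) - k)) differentiable at A"
    by (intro differentiable_mult) auto
  then obtain D where D: "((\<lambda>A::real^'n^'n. (-1) ^ k * coeff (char_polynomial A) (CARD('n) - k)) has_derivative D) (at A)"
    by (auto simp: differentiable_def)
  have "((\<lambda>A::real^'n^'n. Re ((-1) ^ k * coeff (char_polynomial A) (CARD('n) - k))) has_derivative (\<lambda>h. Re (D h))) (at A)"
    by (rule has_derivative_compose[OF D bounded_linear_imp_has_derivative[OF bounded_linear_Re]])
  then show ?thesis
    unfolding differentiable_def by (intro exI) (simp only: hess_op_eq_coeff[OF assms, abs_def])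
qed

text \<open>
  The sum is the total derivative at \<open>A\<close> applied to \<open>y y\<^sup>T\<close>. Differentiability of the operator is
  needed for this, the existence of the partial derivatives would not do.
\<close>

lemma sum_hess_coeff_eq_deriv:
  fixes A :: "real^'n^'n" and y :: "real^'n"
  assumes "k \<le> CARD('n)"
    and "((\<lambda>t. hess_op k (\<chi> a b. A $ a $ b + t * (y $ a * y $ b))) has_real_derivative d) (at 0)"
  shows "(\<Sum>i\<in>UNIV. \<Sum>j\<in>UNIV. y $ i * y $ j * hess_coeff k A i j) = d"
proof -
  obtain D where D: "(hess_op k has_derivative D) (at A)"
    using differentiable_hess_op[OF assms(1)] by (auto simp: differentiable_def)
  have lin: "linear D" using D by (rule has_derivative_linear)
  have dir: "((\<lambda>t. hess_op k (A + t *\<^sub>R B)) has_real_derivative D B) (at 0)" for B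
  proof -
    have "((\<lambda>t. A + t *\<^sub>R B) has_derivative (\<lambda>t. t *\<^sub>R B)) (at (0::real))"
      by (auto intro!: derivative_eq_intros)
    from has_derivative_compose[OF this, of "hess_op k" D] D
    have "((\<lambda>t. hess_op k (A + t *\<^sub>R B)) has_derivative (\<lambda>t. D (t *\<^sub>R B))) (at 0)" by simp
    then show ?thesis unfolding has_field_derivative_def
      by (rule has_derivative_eq_rhs) (simp add: linear_scale[OF lin] fun_eq_iff mult.commute)
  qed
  define E :: "'n \<Rightarrow> 'n \<Rightarrow> real^'n^'n" where "E = (\<lambda>i j. \<chi> a b. if a = i \<and> b = j then 1 else 0)"
  have "(\<chi> a b. A $ a $ b + (if a = i \<and> b = j then t else 0)) = A + t *\<^sub>R E i j" for i j t
    by (simp add: vec_eq_iff E_def)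
  then have hc: "hess_coeff k A i j = D (E i j)" for i j
    unfolding hess_coeff_def using DERIV_imp_deriv[OF dir] by simp
  have "(\<Sum>i\<in>UNIV. \<Sum>j\<in>UNIV. y $ i * y $ j * hess_coeff k A i j)
      = D (\<Sum>i\<in>UNIV. \<Sum>j\<in>UNIV. (y $ i * y $ j) *\<^sub>R E i j)"
    by (simp add: hc linear_sum[OF lin] linear_scale[OF lin])
  also have "(\<Sum>i\<in>UNIV. \<Sum>j\<in>UNIV. (y $ i * y $ j) *\<^sub>R E i j) = (\<chi> a b. y $ a * y $ b)"
  proof -
    have "(\<Sum>i\<in>UNIV. \<Sum>j\<in>UNIV. y $ i * y $ j * (if a = i \<and> b = j then 1 else 0)) = y $ a * y $ b" for a b
    proof -
      have "(\<Sum>j\<in>UNIV. y $ i * y $ j * (if a = i \<and> b = j then 1 else 0)) = (if a = i then y $ i * y $ b else 0)" for i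
        by (cases "a = i") (simp_all add: if_distrib cong: if_cong)
      then show ?thesis by simp
    qed
    then show ?thesis by (simp add: vec_eq_iff E_def sum_component)
  qed
  also have "D (\<chi> a b. y $ a * y $ b) = d"
  proof -
    have "A + t *\<^sub>R (\<chi> a b. y $ a * y $ b) = (\<chi> a b. A $ a $ b + t * (y $ a * y $ b))" for t
      by (simp add: vec_eq_iff)
    then show ?thesis using dir[of "\<chi> a b. y $ a * y $ b"] assms(2) DERIV_unique by simp
  qed
  finally show ?thesis .
qed

text \<open>
  A rotation that takes a basis vector to \<open>y\<close> diagonalises the matrix: the eigenvalue in direction
  \<open>y\<close> is \<open>\<alpha> + s\<close>, all the others are \<open>\<alpha>\<close>.
\<close>

lemma char_polynomial_rank_one:
  fixes y :: "real^'n" and i0 :: 'n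
  assumes "norm y = 1"
  shows "char_polynomial (\<chi> i j. (if i = j then \<alpha> else 0) + s * (y $ i * y $ j))
    = (\<Prod>i\<in>UNIV. [:- ((\<chi> i. if i = i0 then complex_of_real (\<alpha> + s) else of_real \<alpha>) $ i), 1:])"
proof -
  define c where "c = (\<lambda>x. [:complex_of_real x:])"
  have c_mult: "c (a * b) = c a * c b" and c_add: "c (a + b) = c a + c b" and c_0: "c 0 = 0" for a b
    by (auto simp: c_def)
  have c_sum: "c (sum f I) = (\<Sum>i\<in>I. c (f i))" for f :: "'n \<Rightarrow> real" and I
    by (induction I rule: infinite_finite_induct) (auto simp: c_add c_0)
  obtain Q where Q: "orthogonal_matrix Q" "Q *v axis i0 1 = y"
    using orthogonal_matrix_exists_basis[OF assms] by blast
  have QQ: "(\<Sum>a\<in>UNIV. Q $ i $ a * Q $ j $ a) = (if i = j then 1 else 0)" for i j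
  proof -
    have "(Q ** transpose Q) $ i $ j = (mat 1 :: real^'n^'n) $ i $ j" using Q(1) by (simp add: orthogonal_matrix_def)
    then show ?thesis by (simp add: matrix_matrix_mult_def transpose_def mat_def)
  qed
  have Qy: "Q $ i $ i0 = y $ i" for i
    using Q(2) by (metis matrix_vector_mul_component inner_axis mult.right_neutral real_inner_1_right)
  define Qc :: "complex poly^'n^'n" where "Qc = (\<chi> i j. c (Q $ i $ j))"
  define d where "d = (\<lambda>a. [:- ((\<chi> i. if i = i0 then complex_of_real (\<alpha> + s) else of_real \<alpha>) $ a), 1:])"
  define D :: "complex poly^'n^'n" where "D = (\<chi> i j. if i = j then d i else 0)"
  define X where "X = [:- complex_of_real \<alpha>, 1:]"
  have d: "d a = X - (if a = i0 then c s else 0)" for a by (simp add: d_def X_def c_def)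
  have cQQ: "(\<Sum>a\<in>UNIV. c (Q $ i $ a) * c (Q $ j $ a)) = (if i = j then 1 else 0)" for i j
    using arg_cong[OF QQ[of i j], of c] by (simp add: c_sum c_mult) (simp add: c_def)
  have QDQ: "Qc ** D ** transpose Qc
     = (\<chi> i j. (if i = j then [:0, 1:] else 0) - c ((if i = j then \<alpha> else 0) + s * (y $ i * y $ j)))"
  proof -
    have "(Qc ** D ** transpose Qc) $ i $ j = (if i = j then X else 0) - c (s * (y $ i * y $ j))" for i j
    proof -
      have "(Qc ** D) $ i $ a = c (Q $ i $ a) * d a" for a
        by (simp add: matrix_matrix_mult_def Qc_def D_def if_distrib cong: if_cong)
      then have "(Qc ** D ** transpose Qc) $ i $ j = (\<Sum>a\<in>UNIV. c (Q $ i $ a) * d a * c (Q $ j $ a))"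
        by (simp add: matrix_matrix_mult_def[of "Qc ** D"] transpose_def) (simp add: Qc_def)
      also have "\<dots> = (\<Sum>a\<in>UNIV. X * (c (Q $ i $ a) * c (Q $ j $ a)) -
           (if a = i0 then c s * (c (Q $ i $ a) * c (Q $ j $ a)) else 0))"
        by (intro sum.cong refl) (auto simp: d algebra_simps)
      also have "\<dots> = X * (if i = j then 1 else 0) - c s * (c (y $ i) * c (y $ j))"
        by (simp add: sum_subtractf sum_distrib_left[symmetric] cQQ Qy)
      finally show ?thesis by (simp add: c_mult)
    qed
    then show ?thesis by (auto simp: vec_eq_iff X_def c_def)
  qed
  have "Qc ** transpose Qc = mat 1"
    by (simp add: vec_eq_iff matrix_matrix_mult_def transpose_def Qc_def cQQ mat_def)
  then have "det Qc * det (transpose Qc) = 1" by (metis det_mul det_I)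
  then have "det (Qc ** D ** transpose Qc) = det D" by (simp add: det_mul algebra_simps)
  also have "det D = (\<Prod>i\<in>UNIV. d i)" by (subst det_diagonal) (auto simp: D_def)
  finally show ?thesis
    unfolding QDQ by (simp add: char_polynomial_def c_def d_def)
qed

text \<open>
  The \<open>k\<close>-subsets of the eigenvalues are counted according to whether they contain the exceptional
  one.
\<close>

lemma hess_op_rank_one:
  fixes y :: "real^'n"
  assumes "norm y = 1" "1 \<le> k" "k \<le> CARD('n)"
  shows "hess_op k (\<chi> i j. (if i = j then \<alpha> else 0) + s * (y $ i * y $ j))
    = real (CARD('n) - 1 choose (k - 1)) * \<alpha> ^ (k - 1) * (\<alpha> + s) + real (CARD('n) - 1 choose k) * \<alpha> ^ k"
proof -
  (* Which index carries the exceptional eigenvalue does not matter. *)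
  define i0 :: 'n where "i0 = undefined"
  define l :: "complex^'n" where "l = (\<chi> i. if i = i0 then complex_of_real (\<alpha> + s) else of_real \<alpha>)"
  have "hess_op k (\<chi> i j. (if i = j then \<alpha> else 0) + s * (y $ i * y $ j)) = Re (elem_sym k l)"
    unfolding hess_op_eq_coeff[OF assms(3)]
    using elem_sym_eq_coeff[OF char_polynomial_rank_one[OF assms(1)] assms(3)] l_def by simp
  also have "elem_sym k l = complex_of_real
     (real (CARD('n) - 1 choose (k - 1)) * \<alpha> ^ (k - 1) * (\<alpha> + s) + real (CARD('n) - 1 choose k) * \<alpha> ^ k)"
  proof -
    define U where "U = (UNIV - {i0} :: 'n set)"
    have U: "finite U" "card U = CARD('n) - 1" "i0 \<notin> U" by (auto simp: U_def)
    let ?A = "{S. S \<subseteq> U \<and> card S = k}" and ?B = "{S. S \<subseteq> U \<and> card S = k - 1}"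
    have finS: "finite S" for S :: "'n set" by simp
    have split: "{S::'n set. card S = k} = ?A \<union> insert i0 ` ?B"
    proof (intro equalityI subsetI)
      fix S :: "'n set" assume S: "S \<in> {S. card S = k}"
      show "S \<in> ?A \<union> insert i0 ` ?B"
      proof (cases "i0 \<in> S")
        case True
        then have "S = insert i0 (S - {i0})" "S - {i0} \<in> ?B" using S by (auto simp: U_def)
        then show ?thesis by blast
      qed (use S in \<open>auto simp: U_def\<close>)
    next
      fix S :: "'n set" assume "S \<in> ?A \<union> insert i0 ` ?B"
      then show "S \<in> {S. card S = k}"
      proof
        assume "S \<in> insert i0 ` ?B"
        then obtain T where T: "S = insert i0 T" "T \<subseteq> U" "card T = k - 1" by auto
        then have "i0 \<notin> T" using U by auto
        then show ?thesis using T assms(2) by simp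
      qed simp
    qed
    have inj: "inj_on (insert i0) ?B" using U by (auto simp: inj_on_def)
    have pU: "(\<Prod>i\<in>S. l $ i) = of_real \<alpha> ^ card S" if "S \<subseteq> U" for S
      using that U(3) by (subst prod.cong[of S S _ "\<lambda>_. of_real \<alpha>"]) (auto simp: l_def)
    have "elem_sym k l = (\<Sum>S\<in>?A. \<Prod>i\<in>S. l $ i) + (\<Sum>S\<in>insert i0 ` ?B. \<Prod>i\<in>S. l $ i)"
      unfolding elem_sym_def split by (rule sum.union_disjoint) (use U in auto)
    also have "(\<Sum>S\<in>?A. \<Prod>i\<in>S. l $ i) = of_nat (CARD('n) - 1 choose k) * of_real \<alpha> ^ k"
      using pU n_subsets[OF U(1), of k] U(2) by simp
    also have "(\<Sum>S\<in>insert i0 ` ?B. \<Prod>i\<in>S. l $ i) = (\<Sum>S\<in>?B. of_real (\<alpha> + s) * of_real \<alpha> ^ (k - 1))"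
      unfolding sum.reindex[OF inj] o_def
    proof (intro sum.cong refl)
      fix S assume S: "S \<in> ?B"
      then have "i0 \<notin> S" using U by auto
      then show "(\<Prod>i\<in>insert i0 S. l $ i) = of_real (\<alpha> + s) * of_real \<alpha> ^ (k - 1)"
        using pU[of S] S by (simp add: l_def)
    qed
    also have "\<dots> = of_nat (CARD('n) - 1 choose (k - 1)) * (of_real (\<alpha> + s) * of_real \<alpha> ^ (k - 1))"
      using n_subsets[OF U(1), of "k - 1"] U(2) by simp
    finally show ?thesis by simp
  qed
  finally show ?thesis by simp
qed

text \<open>With the radial Hessian in this form, the two constants are \<open>k c\<^bsub>n,k\<^esub>\<close> and \<open>(n - k) c\<^bsub>n,k\<^esub>\<close>.\<close>

lemma binomial_c_const:
  assumes "1 \<le> k" "k \<le> n"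
  shows "real (n - 1 choose (k - 1)) = real k * c_const n k"
    and "real (n - 1 choose k) = (real n - real k) * c_const n k"
proof -
  obtain m where m: "n = Suc m" using assms by (cases n) auto
  obtain j where j: "k = Suc j" using assms by (cases k) auto
  have "real (Suc m) * real (m choose j) = real (Suc m choose Suc j) * real (Suc j)"
    unfolding of_nat_mult[symmetric] by (simp only: Suc_times_binomial_eq)
  then show 1: "real (n - 1 choose (k - 1)) = real k * c_const n k"
    using m j by (simp add: c_const_def field_simps del: binomial_Suc_Suc)
  have "real (n choose k) = real (n - 1 choose (k - 1)) + real (n - 1 choose k)"
    using m j by simp
  moreover have "real (n choose k) = real n * c_const n k"
    using m by (simp add: c_const_def)
  ultimately show "real (n - 1 choose k) = (real n - real k) * c_const n k"
    using 1 by (simp add: algebra_simps)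
qed

lemma hess_op_radial:
  fixes x :: "real^'n"
  assumes "x \<noteq> 0" "1 \<le> k" "k \<le> CARD('n)"
  shows "hess_op k (\<chi> i j. (if i = j then \<alpha> else 0) + (\<beta> - \<alpha>) * (x $ i * x $ j) / (norm x)\<^sup>2)
    = c_const CARD('n) k * (real k * \<alpha> ^ (k - 1) * \<beta> + (real CARD('n) - real k) * \<alpha> ^ k)"
proof -
  define y where "y = x /\<^sub>R norm x"
  have y: "norm y = 1" using assms by (simp add: y_def)
  have "(\<chi> i j. (if i = j then \<alpha> else 0) + (\<beta> - \<alpha>) * (x $ i * x $ j) / (norm x)\<^sup>2)
     = (\<chi> i j. (if i = j then \<alpha> else 0) + (\<beta> - \<alpha>) * (y $ i * y $ j))"
    by (simp add: vec_eq_iff y_def power2_eq_square divide_inverse algebra_simps)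
  then have "hess_op k (\<chi> i j. (if i = j then \<alpha> else 0) + (\<beta> - \<alpha>) * (x $ i * x $ j) / (norm x)\<^sup>2)
     = real k * c_const CARD('n) k * \<alpha> ^ (k - 1) * (\<alpha> + (\<beta> - \<alpha>)) + (real CARD('n) - real k) * c_const CARD('n) k * \<alpha> ^ k"
    by (simp only: hess_op_rank_one[OF y assms(2,3)] binomial_c_const[OF assms(2,3)])
  then show ?thesis by (simp add: algebra_simps)
qed

text \<open>
  A perturbation in direction \<open>x x\<^sup>T\<close> moves the radial eigenvalue \<open>\<beta>\<close> only, and the operator is
  affine in \<open>\<beta>\<close>.
\<close>

lemma sum_hess_coeff_radial:
  fixes x :: "real^'n"
  assumes "x \<noteq> 0" "1 \<le> k" "k \<le> CARD('n)"
  shows "(\<Sum>i\<in>UNIV. \<Sum>j\<in>UNIV. x $ i * x $ j * hess_coeff k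
     (\<chi> i j. (if i = j then \<alpha> else 0) + (\<beta> - \<alpha>) * (x $ i * x $ j) / (norm x)\<^sup>2) i j)
    = real k * c_const CARD('n) k * \<alpha> ^ (k - 1) * (norm x)\<^sup>2"
proof (rule sum_hess_coeff_eq_deriv[OF assms(3)])
  have nz: "norm x \<noteq> 0" using assms by simp
  have "(\<chi> a b. (\<chi> i j. (if i = j then \<alpha> else 0) + (\<beta> - \<alpha>) * (x $ i * x $ j) / (norm x)\<^sup>2) $ a $ b + t * (x $ a * x $ b))
    = (\<chi> i j. (if i = j then \<alpha> else 0) + ((\<beta> + t * (norm x)\<^sup>2) - \<alpha>) * (x $ i * x $ j) / (norm x)\<^sup>2)" for t
    using nz by (auto simp: vec_eq_iff field_simps)
  then show "((\<lambda>t. hess_op k (\<chi> a b. (\<chi> i j. (if i = j then \<alpha> else 0) + (\<beta> - \<alpha>) * (x $ i * x $ j) / (norm x)\<^sup>2) $ a $ b + t * (x $ a * x $ b)))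
     has_real_derivative real k * c_const CARD('n) k * \<alpha> ^ (k - 1) * (norm x)\<^sup>2) (at 0)"
    by (simp only: hess_op_radial[OF assms]) (auto intro!: derivative_eq_intros simp: algebra_simps)
qed

section \<open>Polar coordinates\<close>

lemma emeasure_ball_scale:
  assumes "0 \<le> r"
  shows "emeasure lborel (ball (0::'a::euclidean_space) r) = ennreal (measure lborel (ball (0::'a) 1) * r ^ DIM('a))"
    and "emeasure lborel (cball (0::'a::euclidean_space) r) = ennreal (measure lborel (ball (0::'a) 1) * r ^ DIM('a))"
proof -
  have 1: "measure lborel (ball (0::'a) 1) = unit_ball_vol (real DIM('a))"
    using content_ball[of 1 "0::'a"] by simp
  show "emeasure lborel (ball (0::'a) r) = ennreal (measure lborel (ball (0::'a) 1) * r ^ DIM('a))"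
    using emeasure_ball[OF assms, of "0::'a"] by (simp add: 1)
  show "emeasure lborel (cball (0::'a) r) = ennreal (measure lborel (ball (0::'a) 1) * r ^ DIM('a))"
    using emeasure_cball[OF assms, of "0::'a"] by (simp add: 1)
qed

definition sphere_area :: "'a::euclidean_space itself \<Rightarrow> real" where
  "sphere_area _ = real DIM('a) * measure lborel (ball (0::'a) 1)"

lemma sphere_area_pos: "0 < sphere_area TYPE('a::euclidean_space)"
proof -
  have "0 < measure lborel (ball (0::'a) 1)" using content_ball_gt_0_iff[of "0::'a" 1] by (simp del: content_ball_gt_0_iff)
  then show ?thesis unfolding sphere_area_def by simp
qed

text \<open>
  Both measures are determined by their values on the half-lines \<open>{t<..}\<close>, which for the left-hand
  side are volumes of spherical shells.
\<close>

lemma distr_norm_ball: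
  "distr (restrict_space lborel (ball (0::'a::euclidean_space) 1)) borel norm
   = density lborel (\<lambda>r. ennreal (indicator {0<..<1} r * (sphere_area TYPE('a) * r ^ (DIM('a) - 1))))"
  (is "?L = ?R")
proof (rule measure_eqI_lessThan)
  define \<omega> where "\<omega> = measure lborel (ball (0::'a) 1)"
  have \<omega>: "0 \<le> \<omega>" by (simp add: \<omega>_def)
  have eL: "emeasure ?L {t<..} = ennreal (\<omega> * (1 - (max 0 (min 1 t)) ^ DIM('a)))" if "0 \<le> t" for t
  proof -
    let ?s = "max 0 (min 1 t)"
    have "emeasure ?L {t<..} = emeasure (restrict_space lborel (ball (0::'a) 1)) (norm -` {t<..} \<inter> ball 0 1)"
      by (subst emeasure_distr) (auto simp: space_restrict_space intro!: measurable_restrict_space1)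
    also have "\<dots> = emeasure lborel (norm -` {t<..} \<inter> ball (0::'a) 1)"
      by (rule emeasure_restrict_space) auto
    also have "norm -` {t<..} \<inter> ball (0::'a) 1 = ball 0 1 - (ball 0 1 \<inter> cball 0 t)"
      by auto
    also have "emeasure lborel \<dots> = emeasure lborel (ball (0::'a) 1) - emeasure lborel (ball (0::'a) 1 \<inter> cball 0 t)"
      by (rule emeasure_Diff) (use emeasure_bounded_finite[of "ball (0::'a) 1 \<inter> cball 0 t"] in \<open>auto simp: less_top\<close>)
    also have "emeasure lborel (ball (0::'a) 1 \<inter> cball 0 t) = ennreal (\<omega> * ?s ^ DIM('a))"
    proof (cases "t < 1")
      case True
      then have "ball (0::'a) 1 \<inter> cball 0 t = cball 0 t" by auto
      then show ?thesis using True that emeasure_ball_scale(2)[OF that] by (simp add: \<omega>_def)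
    next
      case False
      then have "ball (0::'a) 1 \<inter> cball 0 t = ball 0 1" by auto
      then show ?thesis using False emeasure_ball_scale(1)[of 1, where 'a='a] by (simp add: \<omega>_def)
    qed
    finally show ?thesis
      using emeasure_ball_scale(1)[of 1, where 'a='a] \<omega>
      by (simp add: \<omega>_def[symmetric] ennreal_minus algebra_simps)
  qed
  have eR: "emeasure ?R {t<..} = ennreal (\<omega> * (1 - (max 0 (min 1 t)) ^ DIM('a)))" for t
  proof -
    let ?s = "max 0 (min 1 t)"
    have "emeasure ?R {t<..} = (\<integral>\<^sup>+r. ennreal (indicator {0<..<1} r * (sphere_area TYPE('a) * r ^ (DIM('a) - 1))) * indicator {t<..} r \<partial>lborel)"
      by (rule emeasure_density) auto
    also have "\<dots> = (\<integral>\<^sup>+r. ennreal (sphere_area TYPE('a) * r ^ (DIM('a) - 1)) * indicator {?s..1} r \<partial>lborel)"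
    proof (rule nn_integral_cong_AE)
      have "AE r in lborel. r \<noteq> 0" "AE r in lborel. r \<noteq> 1" "AE r in lborel. r \<noteq> t"
        by (rule AE_lborel_singleton)+
      then show "AE r in lborel. ennreal (indicator {0<..<1} r * (sphere_area TYPE('a) * r ^ (DIM('a) - 1))) * indicator {t<..} r
         = ennreal (sphere_area TYPE('a) * r ^ (DIM('a) - 1)) * indicator {?s..1} r"
        by eventually_elim (auto simp: indicator_def)
    qed
    also have "\<dots> = ennreal (\<omega> * 1 ^ DIM('a) - \<omega> * ?s ^ DIM('a))"
    proof (rule nn_integral_FTC_Icc[where F = "\<lambda>r. \<omega> * r ^ DIM('a)"])
      show "((\<lambda>r. \<omega> * r ^ DIM('a)) has_real_derivative sphere_area TYPE('a) * r ^ (DIM('a) - 1)) (at r)" for r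
        by (auto intro!: derivative_eq_intros simp: sphere_area_def \<omega>_def)
      show "0 \<le> sphere_area TYPE('a) * r ^ (DIM('a) - 1)" if "r \<in> {?s..1}" for r
        using that sphere_area_pos[where 'a='a] by auto
    qed auto
    finally show ?thesis by (simp add: algebra_simps)
  qed
  show "emeasure ?L {t<..} = emeasure ?R {t<..}" for t
  proof (cases "0 \<le> t")
    case True then show ?thesis using eL eR by simp
  next
    case False
    have "emeasure ?L {t<..} = emeasure lborel (norm -` {t<..} \<inter> ball (0::'a) 1)"
      by (subst emeasure_distr) (auto simp: space_restrict_space emeasure_restrict_space intro!: measurable_restrict_space1)
    also have "norm -` {t<..} \<inter> ball (0::'a) 1 = ball 0 1"
    proof -
      have "t < norm x" for x :: 'a by (rule less_le_trans[OF _ norm_ge_zero]) (use False in simp)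
      then show ?thesis by auto
    qed
    finally show ?thesis unfolding eR
      using False emeasure_ball_scale(1)[of 1, where 'a='a] by (simp add: \<omega>_def zero_power)
  qed
  then have "emeasure ?L {t<..} = ennreal (\<omega> * (1 - (max 0 (min 1 t)) ^ DIM('a)))" for t by (simp only: eR)
  then show "emeasure ?L {t<..} < \<infinity>" for t by (simp only: ennreal_less_top infinity_ennreal_def)
qed auto

lemma polar_integral:
  fixes f :: "real \<Rightarrow> real"
  assumes [measurable]: "f \<in> borel_measurable borel"
  shows "integrable (lebesgue_on (ball (0::'a::euclidean_space) 1)) (\<lambda>x. f (norm x)) \<longleftrightarrow>
         set_integrable lborel {0<..<1} (\<lambda>r. r ^ (DIM('a) - 1) * f r)"
    and "(LINT x|lebesgue_on (ball (0::'a) 1). f (norm x)) =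
         sphere_area TYPE('a) * (LINT r:{0<..<1}|lborel. r ^ (DIM('a) - 1) * f r)"
proof -
  let ?B = "ball (0::'a) 1"
  let ?w = "\<lambda>r. indicator {0<..<1} r * (sphere_area TYPE('a) * r ^ (DIM('a) - 1)) :: real"
  have w: "0 \<le> ?w r" for r using sphere_area_pos[where 'a='a] by (auto simp: indicator_def)
  have [measurable]: "norm \<in> measurable (restrict_space lborel ?B) borel"
    by (intro measurable_restrict_space1) auto
  have m: "(\<lambda>x::'a. indicator ?B x *\<^sub>R f (norm x)) \<in> borel_measurable lborel"
    by (intro borel_measurable_scaleR borel_measurable_indicator measurable_compose[OF _ assms]) auto
  have "integrable (lebesgue_on ?B) (\<lambda>x. f (norm x)) \<longleftrightarrow> integrable (restrict_space lborel ?B) (\<lambda>x. f (norm x))"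
    by (simp only: integrable_restrict_space sets_completionI_sets sets.Int_space_eq2 sets_lborel borel_open open_ball space_completion)
      (rule integrable_completion[OF m])
  also have "\<dots> \<longleftrightarrow> integrable (distr (restrict_space lborel ?B) borel norm) f"
    by (rule integrable_distr_eq[symmetric]) auto
  also have "\<dots> \<longleftrightarrow> integrable lborel (\<lambda>r. ?w r *\<^sub>R f r)"
    unfolding distr_norm_ball by (rule integrable_density) (use w in auto)
  also have "(\<lambda>r. ?w r *\<^sub>R f r) = (\<lambda>r. sphere_area TYPE('a) * (indicator {0<..<1} r *\<^sub>R (r ^ (DIM('a) - 1) * f r)))"
    by (auto simp: fun_eq_iff)
  also have "integrable lborel \<dots> \<longleftrightarrow> set_integrable lborel {0<..<1} (\<lambda>r. r ^ (DIM('a) - 1) * f r)"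
    using sphere_area_pos[where 'a='a] unfolding set_integrable_def by (subst integrable_mult_left_iff) auto
  finally show "integrable (lebesgue_on ?B) (\<lambda>x. f (norm x)) \<longleftrightarrow>
         set_integrable lborel {0<..<1} (\<lambda>r. r ^ (DIM('a) - 1) * f r)" .
  have "(LINT x|lebesgue_on ?B. f (norm x)) = (LINT x|restrict_space lborel ?B. f (norm x))"
    by (simp only: integral_restrict_space sets_completionI_sets sets.Int_space_eq2 sets_lborel borel_open open_ball space_completion)
      (rule integral_completion[OF m])
  also have "\<dots> = (LINT r|distr (restrict_space lborel ?B) borel norm. f r)"
    by (rule integral_distr[symmetric]) auto
  also have "\<dots> = (LINT r|lborel. ?w r *\<^sub>R f r)"
    unfolding distr_norm_ball by (rule integral_density) (use w in auto)
  also have "(\<lambda>r. ?w r *\<^sub>R f r) = (\<lambda>r. sphere_area TYPE('a) * (indicator {0<..<1} r *\<^sub>R (r ^ (DIM('a) - 1) * f r)))"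
    by (auto simp: fun_eq_iff)
  also have "(LINT r|lborel. sphere_area TYPE('a) * (indicator {0<..<1} r *\<^sub>R (r ^ (DIM('a) - 1) * f r)))
     = sphere_area TYPE('a) * (LINT r:{0<..<1}|lborel. r ^ (DIM('a) - 1) * f r)"
    by (simp add: set_lebesgue_integral_def)
  finally show "(LINT x|lebesgue_on ?B. f (norm x)) =
         sphere_area TYPE('a) * (LINT r:{0<..<1}|lborel. r ^ (DIM('a) - 1) * f r)" .
qed

lemma polar_AE:
  assumes "AE r in lborel. P r"
  shows "AE x in lebesgue_on (ball (0::'a::euclidean_space) 1). P (norm x)"
proof -
  let ?B = "ball (0::'a) 1"
  obtain N where N: "N \<in> sets lborel" "emeasure lborel N = 0" "{r. \<not> P r} \<subseteq> N"
    using assms by (auto elim!: AE_E)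
  have [measurable]: "N \<in> sets borel" using N by simp
  have "AE r in lborel. r \<notin> N" using N by (intro AE_not_in) (auto simp: null_sets_def)
  then have "AE r in density lborel (\<lambda>r. ennreal (indicator {0<..<1} r * (sphere_area TYPE('a) * r ^ (DIM('a) - 1)))). r \<notin> N"
    by (subst AE_density) (auto elim: eventually_mono)
  then have "AE x in restrict_space lborel ?B. norm x \<notin> N"
    unfolding distr_norm_ball[symmetric]
    by (subst (asm) AE_distr_iff) (auto intro!: measurable_restrict_space1)
  then have "AE x in lborel. x \<in> ?B \<longrightarrow> norm x \<notin> N"
    by (subst (asm) AE_restrict_space_iff) auto
  then have "AE x in lebesgue. x \<in> ?B \<longrightarrow> norm x \<notin> N" by (rule AE_completion)
  then have "AE x in lebesgue_on ?B. norm x \<notin> N"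
    by (subst AE_restrict_space_iff) auto
  then show ?thesis by eventually_elim (use N in auto)
qed

section \<open>Dilations and the fundamental lemma\<close>

lemma lebesgue_on_zero_outside:
  fixes h :: "real^'n \<Rightarrow> real"
  assumes "K \<in> sets lebesgue" "B \<in> sets lebesgue" "K \<subseteq> B" "\<And>x. x \<in> B - K \<Longrightarrow> h x = 0"
  shows "integrable (lebesgue_on B) h \<longleftrightarrow> integrable (lebesgue_on K) h"
    and "(LINT x|lebesgue_on B. h x) = (LINT x|lebesgue_on K. h x)"
proof -
  have eq: "indicator B x *\<^sub>R h x = indicator K x *\<^sub>R h x" for x
    using assms(3) assms(4)[of x] by (cases "x \<in> K") (auto simp: indicator_def)
  show "integrable (lebesgue_on B) h \<longleftrightarrow> integrable (lebesgue_on K) h"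
    using assms(1,2) by (simp only: integrable_restrict_space sets.Int_space_eq2 eq)
  show "(LINT x|lebesgue_on B. h x) = (LINT x|lebesgue_on K. h x)"
    using assms(1,2) by (simp only: integral_restrict_space sets.Int_space_eq2 eq)
qed

text \<open>
  Test functions are supported in the punctured ball, so nothing is required near the origin and
  near the boundary.
\<close>

definition loc_integrable :: "(real^'n \<Rightarrow> real) \<Rightarrow> bool" where
  "loc_integrable Z \<longleftrightarrow> (\<forall>K. compact K \<and> K \<subseteq> ball 0 1 - {0} \<longrightarrow> integrable (lebesgue_on K) Z)"

abbreviation test_fun :: "(real^'n \<Rightarrow> real) \<Rightarrow> bool" where
  "test_fun \<equiv> C1_compact_support (ball 0 1 - {0})"

lemma compact_lebesgue: "compact K \<Longrightarrow> K \<in> sets lebesgue"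
  by (simp add: borel_compact lmeasurable_compact fmeasurableD)

lemma integrable_mult_continuous_compact:
  fixes Z a :: "real^'n \<Rightarrow> real"
  assumes "integrable (lebesgue_on K) Z" "compact K" "continuous_on K a"
  shows "integrable (lebesgue_on K) (\<lambda>x. a x * Z x)"
proof -
  have "bounded (a ` K)" using assms by (simp add: compact_continuous_image compact_imp_bounded)
  then obtain C where C: "\<And>x. x \<in> K \<Longrightarrow> \<bar>a x\<bar> \<le> C" by (auto simp: bounded_iff)
  have am: "a \<in> borel_measurable (lebesgue_on K)"
    using assms by (intro continuous_imp_measurable_on_sets_lebesgue compact_lebesgue)
  show ?thesis
  proof (rule Bochner_Integration.integrable_bound)
    show "integrable (lebesgue_on K) (\<lambda>x. C * Z x)" using assms(1) by simp
    show "(\<lambda>x. a x * Z x) \<in> borel_measurable (lebesgue_on K)"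
      using am borel_measurable_integrable[OF assms(1)] by measurable
    show "AE x in lebesgue_on K. norm (a x * Z x) \<le> norm (C * Z x)"
    proof (rule AE_I2)
      fix x assume "x \<in> space (lebesgue_on K)"
      then have "\<bar>a x\<bar> \<le> \<bar>C\<bar>" using C by (force simp: space_restrict_space)
      then show "norm (a x * Z x) \<le> norm (C * Z x)" by (simp add: abs_mult mult_right_mono)
    qed
  qed
qed

lemma loc_integrable_continuous_mult:
  assumes "loc_integrable Z" "continuous_on (ball 0 1 - {0}) a"
  shows "loc_integrable (\<lambda>x. a x * Z x)"
  unfolding loc_integrable_def
proof (intro allI impI)
  fix K :: "(real^'a) set" assume K: "compact K \<and> K \<subseteq> ball 0 1 - {0}"
  then show "integrable (lebesgue_on K) (\<lambda>x. a x * Z x)"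
    using assms by (intro integrable_mult_continuous_compact continuous_on_subset[OF assms(2)]) (auto simp: loc_integrable_def)
qed

lemma loc_integrable_one: "loc_integrable (\<lambda>x. 1)"
  unfolding loc_integrable_def
  by (auto intro!: finite_measure.integrable_const finite_measure_lebesgue_on lmeasurable_compact)

lemma loc_integrable_continuous:
  assumes "continuous_on (ball 0 1 - {0}) a"
  shows "loc_integrable a"
  using loc_integrable_continuous_mult[OF loc_integrable_one assms] by simp

lemma loc_integrable_diff:
  "loc_integrable Y \<Longrightarrow> loc_integrable Z \<Longrightarrow> loc_integrable (\<lambda>x. Y x - Z x)"
  by (auto simp: loc_integrable_def)

lemma loc_integrable_of_integrable:
  fixes Z :: "real^'n \<Rightarrow> real"
  assumes "integrable (lebesgue_on (ball 0 1)) Z"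
  shows "loc_integrable Z"
  unfolding loc_integrable_def
proof (intro allI impI)
  fix K :: "(real^'n) set" assume K: "compact K \<and> K \<subseteq> ball 0 1 - {0}"
  have "integrable lebesgue (\<lambda>x. indicator K x *\<^sub>R (indicator (ball 0 1) x *\<^sub>R Z x))"
    by (rule integrable_mult_indicator) (use assms K in \<open>auto simp: integrable_restrict_space compact_lebesgue\<close>)
  moreover have "(\<lambda>x. indicator K x *\<^sub>R (indicator (ball 0 1) x *\<^sub>R Z x)) = (\<lambda>x. indicator K x *\<^sub>R Z x)"
    using K by (auto simp: indicator_def fun_eq_iff)
  ultimately show "integrable (lebesgue_on K) Z"
    using K compact_lebesgue[of K] by (simp add: integrable_restrict_space)
qed

lemma loc_integrable_pairing:
  fixes Z f :: "real^'n \<Rightarrow> real"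
  assumes "loc_integrable Z" "continuous_on UNIV f" "compact K" "K \<subseteq> ball 0 1 - {0}" "\<And>x. x \<notin> K \<Longrightarrow> f x = 0"
  shows "integrable (lebesgue_on (ball 0 1)) (\<lambda>x. Z x * f x)"
proof -
  have "integrable (lebesgue_on K) (\<lambda>x. f x * Z x)"
    using assms by (intro integrable_mult_continuous_compact) (auto simp: loc_integrable_def intro: continuous_on_subset)
  then show ?thesis
    using assms by (subst lebesgue_on_zero_outside(1)[of K]) (auto simp: compact_lebesgue mult.commute)
qed

lemma test_fun_support:
  assumes "test_fun \<zeta>"
  obtains a b where "0 < a" "a < b" "b < 1" "\<And>x. norm x < a \<or> b < norm x \<Longrightarrow> \<zeta> x = 0"
    "\<And>x. norm x < a \<or> b < norm x \<Longrightarrow> gradient \<zeta> x = 0"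
proof -
  let ?K = "closure {x. \<zeta> x \<noteq> 0}"
  have K: "compact ?K" "?K \<subseteq> ball 0 1 - {0}" using assms by (auto simp: C1_compact_support_def)
  obtain a b where ab: "0 < a" "a < b" "b < 1" "?K \<subseteq> {x. a \<le> norm x \<and> norm x \<le> b}"
    using compact_punctured_ball_annulus[OF K] by blast
  show ?thesis
  proof (rule that[OF ab(1-3)])
    fix x :: "real^'a" assume "norm x < a \<or> b < norm x"
    then have x: "x \<notin> ?K" using ab(4) by auto
    then show "\<zeta> x = 0" using closure_subset[of "{x. \<zeta> x \<noteq> 0}"] by auto
    show "gradient \<zeta> x = 0" by (rule gradient_zero_outside[OF assms x])
  qed
qed

lemma test_fun_pairing:
  fixes Z \<zeta> :: "real^'n \<Rightarrow> real"
  assumes "loc_integrable Z" "test_fun \<zeta>"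
  shows "integrable (lebesgue_on (ball 0 1)) (\<lambda>x. Z x * \<zeta> x)"
    and "integrable (lebesgue_on (ball 0 1)) (\<lambda>x. Z x * (x \<bullet> gradient \<zeta> x))"
proof -
  obtain a b where ab: "0 < a" "a < b" "b < 1" "\<And>x. norm x < a \<or> b < norm x \<Longrightarrow> \<zeta> x = 0"
    "\<And>x. norm x < a \<or> b < norm x \<Longrightarrow> gradient \<zeta> x = 0"
    using test_fun_support[OF assms(2)] by blast
  let ?K = "{x::real^'n. a \<le> norm x \<and> norm x \<le> b}"
  have K: "compact ?K" "?K \<subseteq> ball 0 1 - {0}" by (rule compact_annulus) (use ab(1,3) in auto)
  show "integrable (lebesgue_on (ball 0 1)) (\<lambda>x. Z x * \<zeta> x)"
    by (rule loc_integrable_pairing[OF assms(1) C1_compact_support_D(3)[OF assms(2)] K]) (use ab(4) in auto)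
  show "integrable (lebesgue_on (ball 0 1)) (\<lambda>x. Z x * (x \<bullet> gradient \<zeta> x))"
    by (rule loc_integrable_pairing[OF assms(1) _ K])
      (use ab(5) C1_compact_support_D(2)[OF assms(2)] in \<open>auto intro!: continuous_intros\<close>)
qed

lemma test_fun_lipschitz:
  fixes \<zeta> :: "real^'n \<Rightarrow> real"
  assumes "test_fun \<zeta>"
  obtains L where "0 \<le> L" "\<And>x y. \<bar>\<zeta> x - \<zeta> y\<bar> \<le> L * norm (x - y)" "\<And>x. \<bar>\<zeta> x\<bar> \<le> L"
proof -
  obtain a b where ab: "0 < a" "a < b" "b < 1" "\<And>x. norm x < a \<or> b < norm x \<Longrightarrow> \<zeta> x = 0"
    "\<And>x. norm x < a \<or> b < norm x \<Longrightarrow> gradient \<zeta> x = 0"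
    using test_fun_support[OF assms] by blast
  have "compact (gradient \<zeta> ` cball 0 b)" "compact (\<zeta> ` cball 0 b)"
    using C1_compact_support_D(2,3)[OF assms] by (auto intro!: compact_continuous_image intro: continuous_on_subset)
  then have "bounded (gradient \<zeta> ` cball 0 b)" "bounded (\<zeta> ` cball 0 b)" by (auto intro: compact_imp_bounded)
  then obtain C D where "\<forall>x\<in>cball 0 b. norm (gradient \<zeta> x) \<le> C" "\<forall>x\<in>cball 0 b. norm (\<zeta> x) \<le> D"
    unfolding bounded_iff ball_simps by blast
  then have CD: "\<And>x. x \<in> cball 0 b \<Longrightarrow> norm (gradient \<zeta> x) \<le> C" "\<And>x. x \<in> cball 0 b \<Longrightarrow> \<bar>\<zeta> x\<bar> \<le> D"
    by auto
  define L where "L = max (max C D) 0"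
  have C: "norm (gradient \<zeta> x) \<le> L" for x
    using CD(1)[of x] ab(5)[of x] by (cases "norm x \<le> b") (auto simp: L_def)
  have D: "\<bar>\<zeta> x\<bar> \<le> L" for x
    using CD(2)[of x] ab(4)[of x] by (cases "norm x \<le> b") (auto simp: L_def)
  have "\<bar>\<zeta> x - \<zeta> y\<bar> \<le> L * norm (x - y)" for x y
  proof -
    have "norm (\<zeta> x - \<zeta> y) \<le> L * norm (x - y)"
    proof (rule differentiable_bound[of UNIV])
      show "(\<zeta> has_derivative (\<lambda>h. gradient \<zeta> x \<bullet> h)) (at x within UNIV)" for x
        using C1_compact_support_D(1)[OF assms] by simp
      show "onorm (\<lambda>h. gradient \<zeta> x \<bullet> h) \<le> L" for x
      proof (rule onorm_le)
        fix h :: "real^'n"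
        have "\<bar>gradient \<zeta> x \<bullet> h\<bar> \<le> norm (gradient \<zeta> x) * norm h" by (rule Cauchy_Schwarz_ineq2)
        also have "\<dots> \<le> L * norm h" using C by (intro mult_right_mono) auto
        finally show "norm (gradient \<zeta> x \<bullet> h) \<le> L * norm h" by simp
      qed
    qed auto
    then show ?thesis by simp
  qed
  with D show ?thesis by (intro that[of L]) (auto simp: L_def)
qed

text \<open>
  The dilations move the test function, so \<open>Z\<close> needs no regularity. All dilated test functions with
  bounded factor live in one annulus, which provides the dominating function.
\<close>

lemma dilation_derivative:
  fixes Z \<zeta> :: "real^'n \<Rightarrow> real"
  assumes "loc_integrable Z" "test_fun \<zeta>" "1 \<le> T"
  shows "((\<lambda>T. LINT x|lebesgue_on (ball 0 1). Z x * \<zeta> (T *\<^sub>R x)) has_real_derivative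
           (LINT x|lebesgue_on (ball 0 1). Z x * (x \<bullet> gradient \<zeta> (T *\<^sub>R x)))) (at T within {1..})"
  unfolding has_field_derivative_iff tendsto_at_iff_sequentially
proof (intro allI impI)
  fix X :: "nat \<Rightarrow> real" assume X: "\<forall>i. X i \<in> {1..} - {T}" "X \<longlonglongrightarrow> T"
  let ?B = "ball 0 1 :: (real^'n) set"
  obtain a b where ab: "0 < a" "a < b" "b < 1" "\<And>x. norm x < a \<or> b < norm x \<Longrightarrow> \<zeta> x = 0"
    "\<And>x. norm x < a \<or> b < norm x \<Longrightarrow> gradient \<zeta> x = 0"
    using test_fun_support[OF assms(2)] by blast
  obtain L where L: "0 \<le> L" "\<And>x y. \<bar>\<zeta> x - \<zeta> y\<bar> \<le> L * norm (x - y)"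
    using test_fun_lipschitz[OF assms(2)] by metis
  have "Bseq X" using X(2) by (intro convergent_imp_Bseq) (auto simp: convergent_def)
  then obtain T1 where "0 < T1" "\<And>i. \<bar>X i\<bar> \<le> T1" by (auto simp: Bseq_def)
  define T2 where "T2 = max T1 T"
  have T2: "1 \<le> T2" "T \<le> T2" "\<And>i. X i \<le> T2"
    using assms(3) \<open>\<And>i. \<bar>X i\<bar> \<le> T1\<close> by (auto simp: T2_def abs_le_iff max.coboundedI1)
  (* Contains the supports of all the dilations of the test function by factors from 1 to T2. *)
  define K where "K = {x::real^'n. a / T2 \<le> norm x \<and> norm x \<le> b}"
  have K: "compact K" "K \<subseteq> ?B - {0}"
    unfolding K_def by (rule compact_annulus) (use ab(1,3) T2(1) in \<open>auto simp: divide_le_eq\<close>)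
  have out: "\<zeta> (y *\<^sub>R x) = 0" "gradient \<zeta> (y *\<^sub>R x) = 0" if "x \<notin> K" "1 \<le> y" "y \<le> T2" for x y
  proof -
    have "norm (y *\<^sub>R x) < a" if "norm x < a / T2"
    proof -
      have "norm (y *\<^sub>R x) \<le> T2 * norm x" using \<open>1 \<le> y\<close> \<open>y \<le> T2\<close> by (simp add: mult_right_mono)
      also have "\<dots> < a" using that T2(1) by (simp add: field_simps)
      finally show ?thesis .
    qed
    moreover have "b < norm (y *\<^sub>R x)" if "b < norm x"
      using that \<open>1 \<le> y\<close> mult_right_mono[of 1 y "norm x"] by simp
    ultimately show "\<zeta> (y *\<^sub>R x) = 0" "gradient \<zeta> (y *\<^sub>R x) = 0"
      using that(1) ab(4,5)[of "y *\<^sub>R x"] by (auto simp: K_def not_le)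
  qed
  have K_on: "continuous_on UNIV \<zeta>" by (rule C1_compact_support_D(3)[OF assms(2)])
  have int: "integrable (lebesgue_on ?B) (\<lambda>x. Z x * \<zeta> (y *\<^sub>R x))" if "1 \<le> y" "y \<le> T2" for y
    by (rule loc_integrable_pairing[OF assms(1) _ K])
      (use out that in \<open>auto intro!: continuous_on_compose2[OF K_on] continuous_intros\<close>)
  let ?q = "\<lambda>i x. Z x * ((\<zeta> (X i *\<^sub>R x) - \<zeta> (T *\<^sub>R x)) / (X i - T))"
  have "(\<lambda>i. LINT x|lebesgue_on ?B. ?q i x) \<longlonglongrightarrow> (LINT x|lebesgue_on ?B. Z x * (x \<bullet> gradient \<zeta> (T *\<^sub>R x)))"
  proof (rule integral_dominated_convergence[where w = "\<lambda>x. indicator K x * (L * \<bar>Z x\<bar>)"])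
    have Zm: "integrable (lebesgue_on K) (\<lambda>x. L * \<bar>Z x\<bar>)"
      using assms(1) K by (auto simp: loc_integrable_def)
    show "integrable (lebesgue_on ?B) (\<lambda>x. indicator K x * (L * \<bar>Z x\<bar>))"
    proof (subst lebesgue_on_zero_outside(1)[of K])
      show "integrable (lebesgue_on K) (\<lambda>x. indicator K x * (L * \<bar>Z x\<bar>))"
        by (rule Bochner_Integration.integrable_cong[THEN iffD2, OF refl _ Zm]) (simp add: space_restrict_space)
    qed (use K in \<open>auto simp: compact_lebesgue\<close>)
    show "?q i \<in> borel_measurable (lebesgue_on ?B)" for i
    proof -
      have "integrable (lebesgue_on ?B) (\<lambda>x. (Z x * \<zeta> (X i *\<^sub>R x) - Z x * \<zeta> (T *\<^sub>R x)) / (X i - T))"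
        using int[of "X i"] int[of T] X T2 assms(3) by auto
      then show ?thesis
        by (rule borel_measurable_integrable[THEN measurable_cong[THEN iffD1, rotated]]) (simp add: algebra_simps)
    qed
    show "AE x in lebesgue_on ?B. (\<lambda>i. ?q i x) \<longlonglongrightarrow> Z x * (x \<bullet> gradient \<zeta> (T *\<^sub>R x))"
    proof (rule AE_I2)
      fix x :: "real^'n"
      have "((\<lambda>y. y *\<^sub>R x) has_derivative (\<lambda>h. h *\<^sub>R x)) (at T)" by (auto intro!: derivative_eq_intros)
      from has_derivative_compose[OF this C1_compact_support_D(1)[OF assms(2), of "T *\<^sub>R x"]]
      have "((\<lambda>y. \<zeta> (y *\<^sub>R x)) has_real_derivative (x \<bullet> gradient \<zeta> (T *\<^sub>R x))) (at T)"
        unfolding has_field_derivative_def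
        by (rule has_derivative_eq_rhs) (auto simp: inner_commute mult.commute)
      then have "(\<lambda>i. (\<zeta> (X i *\<^sub>R x) - \<zeta> (T *\<^sub>R x)) / (X i - T)) \<longlonglongrightarrow> x \<bullet> gradient \<zeta> (T *\<^sub>R x)"
        using X unfolding has_field_derivative_iff tendsto_at_iff_sequentially by (auto simp: o_def)
      then show "(\<lambda>i. ?q i x) \<longlonglongrightarrow> Z x * (x \<bullet> gradient \<zeta> (T *\<^sub>R x))" by (rule tendsto_mult_left)
    qed
    show "AE x in lebesgue_on ?B. norm (?q i x) \<le> indicator K x * (L * \<bar>Z x\<bar>)" for i
    proof (rule AE_I2)
      fix x assume "x \<in> space (lebesgue_on ?B)"
      then have x: "norm x < 1" by (auto simp: space_restrict_space)
      have Xi: "X i \<noteq> T" "1 \<le> X i" using X by auto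
      show "norm (?q i x) \<le> indicator K x * (L * \<bar>Z x\<bar>)"
      proof (cases "x \<in> K")
        case True
        have "\<bar>\<zeta> (X i *\<^sub>R x) - \<zeta> (T *\<^sub>R x)\<bar> \<le> L * norm (X i *\<^sub>R x - T *\<^sub>R x)" by (rule L(2))
        also have "\<dots> = L * (\<bar>X i - T\<bar> * norm x)" by (simp add: scaleR_diff_left[symmetric])
        also have "\<dots> \<le> L * (\<bar>X i - T\<bar> * 1)" using x L(1) by (intro mult_left_mono) auto
        finally have "\<bar>(\<zeta> (X i *\<^sub>R x) - \<zeta> (T *\<^sub>R x)) / (X i - T)\<bar> \<le> L"
          using Xi(1) by (simp add: abs_divide divide_le_eq)
        then have "\<bar>Z x\<bar> * \<bar>(\<zeta> (X i *\<^sub>R x) - \<zeta> (T *\<^sub>R x)) / (X i - T)\<bar> \<le> \<bar>Z x\<bar> * L" by (rule mult_left_mono) simp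
        then show ?thesis using True by (simp add: abs_mult mult.commute)
      next
        case False
        then show ?thesis using out(1)[OF False, of "X i"] out(1)[OF False, of T] Xi T2 assms(3) by simp
      qed
    qed
    show "(\<lambda>x. Z x * (x \<bullet> gradient \<zeta> (T *\<^sub>R x))) \<in> borel_measurable (lebesgue_on ?B)"
      by (rule borel_measurable_integrable[OF loc_integrable_pairing[OF assms(1) _ K]])
        (use out(2) T2 assms(3) in \<open>auto intro!: continuous_intros continuous_on_compose2[OF C1_compact_support_D(2)[OF assms(2)]]\<close>)
  qed
  moreover have "(LINT x|lebesgue_on ?B. ?q i x) = ((LINT x|lebesgue_on ?B. Z x * \<zeta> (X i *\<^sub>R x)) - (LINT x|lebesgue_on ?B. Z x * \<zeta> (T *\<^sub>R x))) / (X i - T)" for i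
  proof -
    have "(LINT x|lebesgue_on ?B. Z x * \<zeta> (X i *\<^sub>R x)) - (LINT x|lebesgue_on ?B. Z x * \<zeta> (T *\<^sub>R x))
      = (LINT x|lebesgue_on ?B. Z x * \<zeta> (X i *\<^sub>R x) - Z x * \<zeta> (T *\<^sub>R x))"
      by (rule Bochner_Integration.integral_diff[symmetric]) (use int[of "X i"] int[of T] X T2 assms(3) in auto)
    then show ?thesis by (simp add: right_diff_distrib diff_divide_distrib flip: integral_divide_zero)
  qed
  ultimately show "((\<lambda>y. ((LINT x|lebesgue_on ?B. Z x * \<zeta> (y *\<^sub>R x)) - (LINT x|lebesgue_on ?B. Z x * \<zeta> (T *\<^sub>R x))) / (y - T)) \<circ> X)
      \<longlonglongrightarrow> (LINT x|lebesgue_on ?B. Z x * (x \<bullet> gradient \<zeta> (T *\<^sub>R x)))"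
    by (simp only: o_def)
qed

lemma test_fun_scale:
  fixes \<zeta> :: "real^'n \<Rightarrow> real"
  assumes "test_fun \<zeta>" "1 \<le> T"
  shows "test_fun (\<lambda>x. \<zeta> (T *\<^sub>R x))" "gradient (\<lambda>x. \<zeta> (T *\<^sub>R x)) x = T *\<^sub>R gradient \<zeta> (T *\<^sub>R x)"
proof -
  obtain a b where ab: "0 < a" "a < b" "b < 1" "\<And>x. norm x < a \<or> b < norm x \<Longrightarrow> \<zeta> x = 0"
    using test_fun_support[OF assms(1)] by metis
  have der: "((\<lambda>x. \<zeta> (T *\<^sub>R x)) has_derivative (\<lambda>h. (T *\<^sub>R gradient \<zeta> (T *\<^sub>R x)) \<bullet> h)) (at x)" for x
  proof -
    have "((\<lambda>x. T *\<^sub>R x) has_derivative (\<lambda>h. T *\<^sub>R h)) (at x)" by (auto intro!: derivative_eq_intros)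
    from has_derivative_compose[OF this C1_compact_support_D(1)[OF assms(1), of "T *\<^sub>R x"]] show ?thesis
      by (rule has_derivative_eq_rhs) simp
  qed
  show "gradient (\<lambda>x. \<zeta> (T *\<^sub>R x)) x = T *\<^sub>R gradient \<zeta> (T *\<^sub>R x)" by (rule gradient_eqI[OF der])
  let ?K = "{x::real^'n. a / T \<le> norm x \<and> norm x \<le> b / T}"
  show "test_fun (\<lambda>x. \<zeta> (T *\<^sub>R x))"
  proof (rule C1_compact_supportI[where K = ?K])
    show "C1_on UNIV (\<lambda>x. \<zeta> (T *\<^sub>R x))"
      by (rule C1_onI[OF der])
        (auto intro!: continuous_intros continuous_on_compose2[OF C1_compact_support_D(2)[OF assms(1)]])
    show "compact ?K" by (rule compact_annulus)
    have "b / T < 1" "0 < a / T" using ab assms(2) by (auto simp: divide_less_eq)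
    then show "?K \<subseteq> ball 0 1 - {0}" by auto
    fix x assume "x \<notin> ?K"
    then show "\<zeta> (T *\<^sub>R x) = 0"
      using assms(2) by (intro ab(4)) (auto simp: not_le field_simps)
  qed
qed

text \<open>Weak form of the fact that \<open>x \<bullet> \<nabla>Z = - n Z\<close> makes \<open>Z\<close> homogeneous of degree \<open>- n\<close>.\<close>

lemma dilation_constant:
  fixes Z \<zeta> :: "real^'n \<Rightarrow> real"
  assumes "loc_integrable Z" "test_fun \<zeta>" "1 \<le> T"
    and "\<And>\<eta>. test_fun \<eta> \<Longrightarrow> (LINT x|lebesgue_on (ball 0 1). Z x * (x \<bullet> gradient \<eta> x)) = 0"
  shows "(LINT x|lebesgue_on (ball 0 1). Z x * \<zeta> (T *\<^sub>R x)) = (LINT x|lebesgue_on (ball 0 1). Z x * \<zeta> x)"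
proof -
  have "\<exists>c. \<forall>T\<in>{1..}. (LINT x|lebesgue_on (ball 0 1). Z x * \<zeta> (T *\<^sub>R x)) = c"
  proof (rule has_field_derivative_zero_constant)
    fix T :: real assume T: "T \<in> {1..}"
    have "(LINT x|lebesgue_on (ball 0 1). Z x * (x \<bullet> (T *\<^sub>R gradient \<zeta> (T *\<^sub>R x)))) = 0"
      using assms(4)[OF test_fun_scale(1)[OF assms(2)]] test_fun_scale(2)[OF assms(2)] T by simp
    then have "T * (LINT x|lebesgue_on (ball 0 1). Z x * (x \<bullet> gradient \<zeta> (T *\<^sub>R x))) = 0"
      by (simp add: mult.left_commute)
    then show "((\<lambda>T. LINT x|lebesgue_on (ball 0 1). Z x * \<zeta> (T *\<^sub>R x)) has_real_derivative 0) (at T within {1..})"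
      using dilation_derivative[OF assms(1,2), of T] T by simp
  qed auto
  then obtain c where "\<And>T. 1 \<le> T \<Longrightarrow> (LINT x|lebesgue_on (ball 0 1). Z x * \<zeta> (T *\<^sub>R x)) = c" by auto
  from this[OF assms(3)] this[of 1] show ?thesis by simp
qed

lemma LINT_scaleR:
  fixes f :: "'a::euclidean_space \<Rightarrow> real"
  assumes "f \<in> borel_measurable borel" "0 < T"
  shows "(LINT x|lborel. f (T *\<^sub>R x)) = (LINT x|lborel. f x) / T ^ DIM('a)"
proof -
  have "(LINT x|lborel. f x) = (LINT x|density (distr lborel borel (\<lambda>x. 0 + T *\<^sub>R x)) (\<lambda>_::'a. ennreal (\<bar>T\<bar> ^ DIM('a))). f x)"
    using lborel_affine[of T "0::'a"] assms(2) by simp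
  also have "\<dots> = (LINT x|distr lborel borel (\<lambda>x. 0 + T *\<^sub>R x). \<bar>T\<bar> ^ DIM('a) *\<^sub>R f x)"
    using assms by (intro integral_density) auto
  also have "\<dots> = (LINT x|lborel. \<bar>T\<bar> ^ DIM('a) *\<^sub>R f (0 + T *\<^sub>R x))"
    using assms by (intro integral_distr) auto
  finally show ?thesis using assms(2) by simp
qed

lemma LINT_ball_eq_lborel:
  fixes f :: "real^'n \<Rightarrow> real"
  assumes "f \<in> borel_measurable borel" "\<And>x. x \<notin> ball 0 1 \<Longrightarrow> f x = 0"
  shows "(LINT x|lebesgue_on (ball 0 1). f x) = (LINT x|lborel. f x)"
proof -
  have "(LINT x|lebesgue_on (ball 0 1). f x) = (LINT x|lebesgue. indicator (ball 0 1) x *\<^sub>R f x)"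
    by (simp add: integral_restrict_space)
  also have "(\<lambda>x. indicator (ball 0 1) x *\<^sub>R f x) = f"
    using assms(2) by (auto simp: indicator_def fun_eq_iff)
  also have "(LINT x|lebesgue. f x) = (LINT x|lborel. f x)"
    using assms(1) by (intro integral_completion) auto
  finally show ?thesis .
qed

text \<open>
  The integrand is the divergence of \<open>\<zeta> x\<close>. By scaling, \<open>T\<^sup>n \<integral> \<zeta>(T x) dx\<close> does not depend on \<open>T\<close>,
  and the integral is its derivative at \<open>T = 1\<close>.
\<close>

lemma integral_radial_divergence_zero:
  fixes \<zeta> :: "real^'n \<Rightarrow> real"
  assumes "test_fun \<zeta>"
  shows "(LINT x|lebesgue_on (ball 0 1). x \<bullet> gradient \<zeta> x + real CARD('n) * \<zeta> x) = 0"
proof -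
  let ?B = "ball 0 1 :: (real^'n) set"
  let ?I = "LINT x|lborel. \<zeta> x"
  have cont: "continuous_on UNIV \<zeta>" by (rule C1_compact_support_D(3)[OF assms])
  obtain a b where ab: "0 < a" "a < b" "b < 1" "\<And>x. norm x < a \<or> b < norm x \<Longrightarrow> \<zeta> x = 0"
    using test_fun_support[OF assms] by metis
  have dil: "(LINT x|lebesgue_on ?B. 1 * \<zeta> (T *\<^sub>R x)) = ?I / T ^ CARD('n)" if "1 \<le> T" for T
  proof -
    have "\<zeta> (T *\<^sub>R x) = 0" if "x \<notin> ?B" for x
    proof -
      have "1 \<le> norm x" using that by simp
      also have "\<dots> \<le> norm (T *\<^sub>R x)" using \<open>1 \<le> T\<close> mult_right_mono[of 1 T "norm x"] by simp
      finally show ?thesis using ab(3) by (intro ab(4)) linarith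
    qed
    then have "(LINT x|lebesgue_on ?B. \<zeta> (T *\<^sub>R x)) = (LINT x|lborel. \<zeta> (T *\<^sub>R x))"
      by (intro LINT_ball_eq_lborel borel_measurable_continuous_onI)
        (auto intro!: continuous_on_compose2[OF cont] continuous_intros)
    also have "\<dots> = ?I / T ^ CARD('n)"
      using LINT_scaleR[of \<zeta> T] that cont by (simp add: borel_measurable_continuous_onI)
    finally show ?thesis by simp
  qed
  have "((\<lambda>T. LINT x|lebesgue_on ?B. 1 * \<zeta> (T *\<^sub>R x)) has_real_derivative (LINT x|lebesgue_on ?B. x \<bullet> gradient \<zeta> x)) (at 1 within {1..})"
    using dilation_derivative[OF loc_integrable_one assms, of 1] by simp
  then have "((\<lambda>T. ?I / T ^ CARD('n)) has_real_derivative (LINT x|lebesgue_on ?B. x \<bullet> gradient \<zeta> x)) (at 1 within {1..})"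
    by (rule has_field_derivative_transform_within[of _ _ _ _ 1]) (use dil in auto)
  moreover have "((\<lambda>T. ?I / T ^ CARD('n)) has_real_derivative (- (real CARD('n) * ?I))) (at 1 within {1..})"
    by (auto intro!: derivative_eq_intros)
  moreover have "at (1::real) within {1..} \<noteq> bot"
  proof -
    have "{1..} - {1} = {1::real<..}" by auto
    then show ?thesis by (simp add: at_within_eq_bot_iff)
  qed
  ultimately have "(LINT x|lebesgue_on ?B. x \<bullet> gradient \<zeta> x) = - (real CARD('n) * ?I)"
    using has_field_derivative_unique by blast
  moreover have "?I = (LINT x|lebesgue_on ?B. \<zeta> x)" using dil[of 1] by simp
  moreover have "integrable (lebesgue_on ?B) \<zeta>" "integrable (lebesgue_on ?B) (\<lambda>x. x \<bullet> gradient \<zeta> x)"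
    using test_fun_pairing[OF loc_integrable_one assms] by auto
  ultimately show ?thesis by simp
qed

lemma C1_on_real_polynomial_function:
  fixes p :: "real^'n \<Rightarrow> real"
  assumes "real_polynomial_function p"
  shows "C1_on UNIV p"
  using assms
proof (induction rule: real_polynomial_function.induct)
  case (linear f)
  then interpret bounded_linear f .
  have "f x = x \<bullet> (\<Sum>b\<in>Basis. f b *\<^sub>R b)" for x
  proof -
    have "f x = f (\<Sum>b\<in>Basis. (x \<bullet> b) *\<^sub>R b)" by (simp only: euclidean_representation)
    also have "\<dots> = (\<Sum>b\<in>Basis. (x \<bullet> b) * f b)" by (simp add: sum scaleR)
    finally show ?thesis by (simp add: inner_sum_right mult.commute)
  qed
  then have "f = (\<lambda>x. x \<bullet> (\<Sum>b\<in>Basis. f b *\<^sub>R b))" by (rule ext)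
  then show ?case using C1_on_inner[of "\<Sum>b\<in>Basis. f b *\<^sub>R b"] by metis
qed (auto intro: C1_on_const C1_on_add C1_on_mult)

lemma test_fun_mult_C1:
  assumes "test_fun \<kappa>" "C1_on UNIV p"
  shows "test_fun (\<lambda>x. \<kappa> x * p x)"
proof (rule C1_compact_supportI[where K = "closure {x. \<kappa> x \<noteq> 0}"])
  show "\<kappa> x * p x = 0" if "x \<notin> closure {x. \<kappa> x \<noteq> 0}" for x
    using that closure_subset[of "{x. \<kappa> x \<noteq> 0}"] by auto
qed (use assms in \<open>auto simp: C1_compact_support_def intro: C1_on_mult\<close>)

lemma has_derivative_pos_part_square: "((\<lambda>t::real. (max 0 t)\<^sup>2) has_real_derivative 2 * max 0 t) (at t)"
proof (cases "t = 0")
  case True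
  have "((\<lambda>t::real. (max 0 t)\<^sup>2) has_real_derivative 0) (at 0)"
    unfolding DERIV_def
  proof (rule tendsto_0_le[where K = 1])
    show "((\<lambda>h::real. h) \<longlongrightarrow> 0) (at 0)" by simp
    show "\<forall>\<^sub>F h in at (0::real). norm (((max 0 (0 + h))\<^sup>2 - (max 0 0)\<^sup>2) / h) \<le> norm h * 1"
      by (intro always_eventually) (auto simp: max_def power2_eq_square)
  qed
  then show ?thesis using True by simp
next
  case False
  show ?thesis
  proof (cases "0 < t")
    case True
    have "((\<lambda>t::real. t\<^sup>2) has_real_derivative 2 * max 0 t) (at t)"
      using True by (auto intro!: derivative_eq_intros)
    then show ?thesis
      by (rule has_field_derivative_transform_within_open[where S = "{0<..}"]) (use True in auto)
  next
    case f: False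
    have "((\<lambda>t::real. 0) has_real_derivative 2 * max 0 t) (at t)"
      using f by (simp add: max_def)
    then show ?thesis
      by (rule has_field_derivative_transform_within_open[where S = "{..<0}"]) (use f False in \<open>auto simp: max_def\<close>)
  qed
qed

lemma test_fun_bump:
  assumes "0 < a" "a < b" "b < 1"
  obtains \<kappa> :: "real^'n \<Rightarrow> real" where "test_fun \<kappa>" "\<And>x. 0 \<le> \<kappa> x"
    "\<And>x. 0 < \<kappa> x \<longleftrightarrow> a < norm x \<and> norm x < b"
proof -
  define \<Phi> where "\<Phi> = (\<lambda>r::real. (max 0 ((r - a) * (b - r)))\<^sup>2)"
  define d where "d = (\<lambda>r::real. 2 * max 0 ((r - a) * (b - r)) * (a + b - 2 * r))"
  have der: "(\<Phi> has_real_derivative d r) (at r)" for r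
  proof -
    have "((\<lambda>r. (r - a) * (b - r)) has_real_derivative (a + b - 2 * r)) (at r)"
      by (auto intro!: derivative_eq_intros)
    from DERIV_chain2[OF has_derivative_pos_part_square this] show ?thesis by (simp add: \<Phi>_def d_def)
  qed
  have "test_fun (\<lambda>x::real^'n. \<Phi> (norm x))"
  proof (rule C1_compact_support_radial[OF assms(1,3) der])
    show "continuous_on UNIV d" unfolding d_def by (intro continuous_intros)
    show "\<Phi> r = 0" if "r \<notin> {a..b}" for r
    proof -
      have "(r - a) * (b - r) \<le> 0" using that assms by (auto simp: mult_le_0_iff)
      then show ?thesis by (simp add: \<Phi>_def max_def)
    qed
  qed
  moreover have "0 < \<Phi> r \<longleftrightarrow> a < r \<and> r < b" for r
  proof -
    have "0 < (r - a) * (b - r) \<longleftrightarrow> a < r \<and> r < b" using assms by (auto simp: zero_less_mult_iff)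
    moreover have "0 < (max 0 t)\<^sup>2 \<longleftrightarrow> 0 < t" for t :: real by (auto simp: max_def)
    ultimately show ?thesis by (simp only: \<Phi>_def)
  qed
  ultimately show ?thesis by (intro that[of "\<lambda>x. \<Phi> (norm x)"]) (auto simp: \<Phi>_def)
qed

text \<open>
  Against the sign of \<open>Z\<close> one would get \<open>\<integral> \<kappa> \<bar>Z\<bar> = 0\<close>. The sign is an almost everywhere limit of
  continuous functions with values in \<open>[-1, 1]\<close>, which are uniformly close to polynomials on compact sets.
\<close>

lemma fundamental_lemma_annulus:
  fixes Z :: "real^'n \<Rightarrow> real"
  assumes "loc_integrable Z" "\<And>\<zeta>. test_fun \<zeta> \<Longrightarrow> (LINT x|lebesgue_on (ball 0 1). Z x * \<zeta> x) = 0"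
    and "0 < a" "a < b" "b < 1"
  shows "AE x in lebesgue_on (ball 0 1). a < norm x \<and> norm x < b \<longrightarrow> Z x = 0"
proof -
  let ?B = "ball 0 1 :: (real^'n) set"
  define K where "K = {x::real^'n. a \<le> norm x \<and> norm x \<le> b}"
  have K: "compact K" "K \<subseteq> ?B - {0}" "K \<subseteq> ?B" "K \<in> sets lebesgue"
    unfolding K_def using compact_annulus[of a b] assms(3,5) by (auto simp: compact_lebesgue)
  obtain \<kappa> :: "real^'n \<Rightarrow> real" where \<kappa>: "test_fun \<kappa>" "\<And>x. 0 \<le> \<kappa> x"
    "\<And>x. 0 < \<kappa> x \<longleftrightarrow> a < norm x \<and> norm x < b"
    using test_fun_bump[OF assms(3-5)] by blast
  have \<kappa>0: "\<kappa> x = 0" if "x \<notin> K" for x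
    using \<kappa>(2)[of x] \<kappa>(3)[of x] that by (auto simp: K_def)
  have ZK: "integrable (lebesgue_on K) Z" using assms(1) K by (auto simp: loc_integrable_def)
  define s where "s = (\<lambda>x. if x \<in> K then sgn (Z x) else 0)"
  have "(\<lambda>x. sgn (Z x)) \<in> borel_measurable (lebesgue_on K)"
    using borel_measurable_integrable[OF ZK] by measurable
  then have "s \<in> borel_measurable lebesgue"
    unfolding s_def using K(4) by (simp add: borel_measurable_if)
  then have "s measurable_on UNIV"
    by (intro lebesgue_measurable_imp_measurable_on_real) auto
  then obtain N g where Ng: "negligible N" "\<And>n. continuous_on UNIV (g n)"
      "\<And>x. x \<notin> N \<Longrightarrow> (\<lambda>n. g n x) \<longlonglongrightarrow> s x"
    unfolding measurable_on_def by auto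
  (* The truncation keeps the limit, because s has values in [-1, 1], and it bounds the polynomials below by 2. *)
  define h where "h = (\<lambda>n x. max (- 1) (min 1 (g n x)) :: real)"
  have "\<exists>p. real_polynomial_function p \<and> (\<forall>x\<in>K. \<bar>h n x - p x\<bar> < 1 / Suc n)" for n
  proof -
    have "continuous_on K (h n)"
      unfolding h_def using Ng(2)[of n] by (intro continuous_intros) (auto intro: continuous_on_subset)
    from Stone_Weierstrass_real_polynomial_function[OF K(1) this, of "1 / Suc n"]
    show ?thesis by (metis zero_less_divide_1_iff of_nat_0_less_iff zero_less_Suc)
  qed
  then obtain p where p: "\<And>n. real_polynomial_function (p n)" "\<And>n x. x \<in> K \<Longrightarrow> \<bar>h n x - p n x\<bar> < 1 / Suc n"
    by metis
  have tp: "test_fun (\<lambda>x. \<kappa> x * p n x)" for n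
    by (intro test_fun_mult_C1 \<kappa>(1) C1_on_real_polynomial_function p(1))
  have Ncompl: "AE x in lebesgue_on ?B. x \<notin> N"
  proof -
    have "AE x in lebesgue. x \<notin> N" using Ng(1) by (simp add: negligible_iff_null_sets AE_not_in)
    then show ?thesis by (subst AE_restrict_space_iff) (auto elim: eventually_mono)
  qed
  have Z\<kappa>: "integrable (lebesgue_on ?B) (\<lambda>x. Z x * \<kappa> x)" by (rule test_fun_pairing(1)[OF assms(1) \<kappa>(1)])
  have "(\<lambda>n. LINT x|lebesgue_on ?B. Z x * (\<kappa> x * p n x)) \<longlonglongrightarrow> (LINT x|lebesgue_on ?B. \<kappa> x * \<bar>Z x\<bar>)"
  proof (rule integral_dominated_convergence[where w = "\<lambda>x. 2 * \<bar>Z x * \<kappa> x\<bar>"])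
    have "integrable (lebesgue_on ?B) (\<lambda>x. \<bar>Z x * \<kappa> x\<bar>)" using Z\<kappa> by (rule integrable_abs)
    then show "integrable (lebesgue_on ?B) (\<lambda>x. 2 * \<bar>Z x * \<kappa> x\<bar>)" by (rule integrable_mult_right)
    have "(\<lambda>x. \<bar>Z x * \<kappa> x\<bar>) = (\<lambda>x. \<kappa> x * \<bar>Z x\<bar>)"
      using \<kappa>(2) by (auto simp: abs_mult fun_eq_iff)
    then show "(\<lambda>x. \<kappa> x * \<bar>Z x\<bar>) \<in> borel_measurable (lebesgue_on ?B)"
      using borel_measurable_integrable[OF integrable_abs[OF Z\<kappa>]] by simp
    show "(\<lambda>x. Z x * (\<kappa> x * p n x)) \<in> borel_measurable (lebesgue_on ?B)" for n
      by (rule borel_measurable_integrable[OF test_fun_pairing(1)[OF assms(1) tp]])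
    show "AE x in lebesgue_on ?B. (\<lambda>n. Z x * (\<kappa> x * p n x)) \<longlonglongrightarrow> \<kappa> x * \<bar>Z x\<bar>"
      using Ncompl
    proof eventually_elim
      case (elim x)
      show ?case
      proof (cases "x \<in> K")
        case True
        have "(\<lambda>n. h n x) \<longlonglongrightarrow> max (- 1) (min 1 (s x))"
          unfolding h_def by (intro tendsto_intros Ng(3) elim)
        also have "max (- 1) (min 1 (s x)) = s x" by (auto simp: s_def sgn_if)
        finally have 1: "(\<lambda>n. h n x) \<longlonglongrightarrow> s x" .
        have "(\<lambda>n. h n x - p n x) \<longlonglongrightarrow> 0"
        proof (rule tendsto_0_le[where K = 1])
          show "(\<lambda>n. 1 / Suc n) \<longlonglongrightarrow> (0::real)" by (rule LIMSEQ_inverse_real_of_nat[unfolded inverse_eq_divide])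
          show "\<forall>\<^sub>F n in sequentially. norm (h n x - p n x) \<le> norm (1 / Suc n) * 1"
            using p(2)[OF True] by (auto intro!: always_eventually less_imp_le)
        qed
        from tendsto_diff[OF 1 this] have "(\<lambda>n. p n x) \<longlonglongrightarrow> s x" by simp
        then have "(\<lambda>n. Z x * (\<kappa> x * p n x)) \<longlonglongrightarrow> Z x * (\<kappa> x * s x)" by (intro tendsto_intros)
        also have "Z x * (\<kappa> x * s x) = \<kappa> x * \<bar>Z x\<bar>" using True by (simp add: s_def abs_sgn mult.left_commute)
        finally show ?thesis .
      qed (simp add: \<kappa>0)
    qed
    show "AE x in lebesgue_on ?B. norm (Z x * (\<kappa> x * p n x)) \<le> 2 * \<bar>Z x * \<kappa> x\<bar>" for n
    proof (rule AE_I2)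
      fix x
      show "norm (Z x * (\<kappa> x * p n x)) \<le> 2 * \<bar>Z x * \<kappa> x\<bar>"
      proof (cases "x \<in> K")
        case True
        have "\<bar>h n x\<bar> \<le> 1" by (auto simp: h_def)
        moreover have "1 / real (Suc n) \<le> 1" by simp
        ultimately have "\<bar>p n x\<bar> \<le> 2" using p(2)[OF True, of n] by linarith
        then have "\<bar>Z x * \<kappa> x\<bar> * \<bar>p n x\<bar> \<le> \<bar>Z x * \<kappa> x\<bar> * 2" by (intro mult_left_mono) auto
        then show ?thesis by (simp add: abs_mult ac_simps)
      qed (simp add: \<kappa>0)
    qed
  qed
  moreover have "(LINT x|lebesgue_on ?B. Z x * (\<kappa> x * p n x)) = 0" for n using assms(2)[OF tp] .
  ultimately have "(LINT x|lebesgue_on ?B. \<kappa> x * \<bar>Z x\<bar>) = 0" by (simp add: LIMSEQ_const_iff)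
  moreover have "(\<lambda>x. \<bar>Z x * \<kappa> x\<bar>) = (\<lambda>x. \<kappa> x * \<bar>Z x\<bar>)"
    using \<kappa>(2) by (auto simp: abs_mult fun_eq_iff)
  then have "integrable (lebesgue_on ?B) (\<lambda>x. \<kappa> x * \<bar>Z x\<bar>)" using integrable_abs[OF Z\<kappa>] by simp
  ultimately have "AE x in lebesgue_on ?B. \<kappa> x * \<bar>Z x\<bar> = 0"
    using \<kappa>(2) by (subst (asm) integral_nonneg_eq_0_iff_AE) auto
  then show ?thesis by eventually_elim (use \<kappa>(3) in force)
qed

lemma fundamental_lemma:
  fixes Z :: "real^'n \<Rightarrow> real"
  assumes "loc_integrable Z" "\<And>\<zeta>. test_fun \<zeta> \<Longrightarrow> (LINT x|lebesgue_on (ball 0 1). Z x * \<zeta> x) = 0"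
  shows "AE x in lebesgue_on (ball 0 1). Z x = 0"
proof -
  let ?B = "ball 0 1 :: (real^'n) set"
  have "AE x in lebesgue_on ?B. \<forall>m::nat. 1 / (real m + 3) < norm x \<and> norm x < 1 - 1 / (real m + 3) \<longrightarrow> Z x = 0"
    unfolding AE_all_countable
  proof
    fix m :: nat
    have "2 / (real m + 3) < 1" by simp
    then show "AE x in lebesgue_on ?B. 1 / (real m + 3) < norm x \<and> norm x < 1 - 1 / (real m + 3) \<longrightarrow> Z x = 0"
      by (intro fundamental_lemma_annulus[OF assms]) auto
  qed
  moreover have "AE x in lebesgue_on ?B. x \<noteq> 0"
  proof -
    have "AE x in lborel. x \<noteq> (0::real^'n)" by (rule AE_lborel_singleton)
    then have "AE x in lebesgue. x \<noteq> (0::real^'n)" by (rule AE_completion)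
    then show ?thesis by (subst AE_restrict_space_iff) (auto elim: eventually_mono)
  qed
  moreover have "AE x in lebesgue_on ?B. x \<in> ?B" by (rule AE_I2) (simp add: space_restrict_space)
  ultimately show ?thesis
  proof eventually_elim
    case (elim x)
    define \<epsilon> where "\<epsilon> = min (norm x) (1 - norm x)"
    have "0 < \<epsilon>" using elim by (simp add: \<epsilon>_def)
    then obtain m :: nat where "1 / \<epsilon> < real m" using reals_Archimedean2 by blast
    then have "1 / \<epsilon> < real m + 3" by simp
    then have "1 / (real m + 3) < \<epsilon>" using \<open>0 < \<epsilon>\<close> by (simp add: field_simps)
    then show ?case using elim(1)[rule_format, of m] by (auto simp: \<epsilon>_def)
  qed
qed

section \<open>Profiles and weak gradients\<close>

text \<open>
  The equation \<open>S\<^sub>k(D\<^sup>2u) = g(u)\<close> for \<open>u(x) = v \<bar>x\<bar>\<close> with \<open>z = v'\<close>, in divergence form up to the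
  boundary. The last clause states that the flux through small spheres vanishes, so that there is no
  point source at the origin.
\<close>

definition regular_profile :: "nat \<Rightarrow> nat \<Rightarrow> (real \<Rightarrow> real) \<Rightarrow> (real \<Rightarrow> real) \<Rightarrow> (real \<Rightarrow> real) \<Rightarrow> bool" where
  "regular_profile n k g v z \<longleftrightarrow>
     (\<forall>r\<in>{0<..1}. (v has_real_derivative z r) (at r within {0<..1})) \<and>
     (\<forall>r\<in>{0<..1}. 0 \<le> z r) \<and> continuous_on {0<..1} z \<and>
     (\<forall>r\<in>{0<..1}. ((\<lambda>r. r ^ (n - k) * z r ^ k) has_real_derivative r ^ (n - 1) * g (v r) / c_const n k)
        (at r within {0<..1})) \<and>
     ((\<lambda>r. r ^ (n - k) * z r ^ k) \<longlongrightarrow> 0) (at_right 0)"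

lemma c_const_pos: "1 \<le> k \<Longrightarrow> k \<le> n \<Longrightarrow> 0 < c_const n k"
  by (simp add: c_const_def)

lemma at_within_Ioc: "0 < r \<Longrightarrow> r < 1 \<Longrightarrow> at r within {0<..1::real} = at r"
  by (rule at_within_open_subset[of _ "{0<..<1}"]) auto

text \<open>It suffices that \<open>a\<close> is \<open>C\<^sup>1\<close> where \<open>\<zeta>\<close> lives, for instance a function of \<open>\<bar>x\<bar>\<close>.\<close>

lemma test_fun_mult_local:
  fixes \<zeta> a :: "real^'n \<Rightarrow> real"
  assumes "test_fun \<zeta>" "C1_on (ball 0 1 - {0}) a"
  shows "test_fun (\<lambda>x. \<zeta> x * a x)"
    and "\<And>x. x \<in> ball 0 1 - {0} \<Longrightarrow> gradient (\<lambda>x. \<zeta> x * a x) x = \<zeta> x *\<^sub>R gradient a x + a x *\<^sub>R gradient \<zeta> x"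
proof -
  let ?P = "ball 0 1 - {0} :: (real^'n) set"
  have oP: "open ?P" by (simp add: open_delete)
  obtain \<alpha> \<beta> where ab: "0 < \<alpha>" "\<alpha> < \<beta>" "\<beta> < 1" "\<And>x. norm x < \<alpha> \<or> \<beta> < norm x \<Longrightarrow> \<zeta> x = 0"
    "\<And>x. norm x < \<alpha> \<or> \<beta> < norm x \<Longrightarrow> gradient \<zeta> x = 0"
    using test_fun_support[OF assms(1)] by blast
  let ?K = "{x::real^'n. \<alpha> \<le> norm x \<and> norm x \<le> \<beta>}"
  have K: "compact ?K" by (rule compact_annulus)
  have KP: "?K \<subseteq> ?P" using ab(1,3) by auto
  let ?F = "\<lambda>x. if x \<in> ?P then \<zeta> x *\<^sub>R gradient a x + a x *\<^sub>R gradient \<zeta> x else 0"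
  have derP: "((\<lambda>x. \<zeta> x * a x) has_derivative (\<lambda>h. ?F x \<bullet> h)) (at x)" if "x \<in> ?P" for x
    using has_gradient_mult[OF C1_compact_support_D(1)[OF assms(1)] C1_on_has_derivative[OF assms(2) oP that]] that
    by auto
  have zero: "\<zeta> x * a x = 0" "?F x = 0" if "x \<in> - ?K" for x using that ab(4,5)[of x] by auto
  have oK: "open (- ?K)" using K by (simp add: open_Compl compact_imp_closed)
  have der: "((\<lambda>x. \<zeta> x * a x) has_derivative (\<lambda>h. ?F x \<bullet> h)) (at x)" for x
  proof (cases "x \<in> ?P")
    case False
    then have x: "x \<in> - ?K" using KP by auto
    have "((\<lambda>_. 0) has_derivative (\<lambda>h. ?F x \<bullet> h)) (at x)" using zero(2)[OF x] by simp
    then show ?thesis by (rule has_derivative_transform_within_open[OF _ oK x]) (simp add: zero(1))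
  qed (rule derP)
  have cP: "continuous_on ?P ?F"
  proof (rule continuous_on_eq)
    have "continuous_on ?P a" using assms(2) by (auto simp: C1_on_def differentiable_imp_continuous_on)
    then show "continuous_on ?P (\<lambda>x. \<zeta> x *\<^sub>R gradient a x + a x *\<^sub>R gradient \<zeta> x)"
      using C1_on_continuous_gradient[OF assms(2)] C1_compact_support_D(2,3)[OF assms(1)]
      by (intro continuous_intros) (auto intro: continuous_on_subset)
  qed auto
  have cK: "continuous_on (- ?K) ?F"
    by (rule continuous_on_eq[where f = "\<lambda>_. 0"]) (use zero(2) in auto)
  have "?P \<union> - ?K = UNIV" using KP by blast
  then have cU: "continuous_on UNIV ?F"
    using continuous_on_open_Un[OF oP oK cP cK] by simp
  show "test_fun (\<lambda>x. \<zeta> x * a x)"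
    by (rule C1_compact_supportI[OF C1_onI[OF der cU] K KP]) (use zero(1) in auto)
  show "gradient (\<lambda>x. \<zeta> x * a x) x = \<zeta> x *\<^sub>R gradient a x + a x *\<^sub>R gradient \<zeta> x" if "x \<in> ?P" for x
    using gradient_eqI[OF der, of x] that by simp
qed

lemma test_fun_0: "test_fun \<zeta> \<Longrightarrow> \<zeta> 0 = 0"
  by (metis norm_zero test_fun_support)

lemma test_fun_radial_factor:
  fixes \<zeta> :: "real^'n \<Rightarrow> real"
  assumes "test_fun \<zeta>" "\<And>r. 0 < r \<Longrightarrow> r < 1 \<Longrightarrow> (V has_real_derivative z r) (at r)" "continuous_on {0<..<1} z"
  shows "test_fun (\<lambda>x. \<zeta> x * V (norm x))"
    and "x \<in> ball 0 1 \<Longrightarrow> x \<bullet> gradient (\<lambda>x. \<zeta> x * V (norm x)) x = \<zeta> x * (norm x * z (norm x)) + V (norm x) * (x \<bullet> gradient \<zeta> x)"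
proof -
  have C1: "C1_on (ball 0 1 - {0::real^'n}) (\<lambda>x. V (norm x))"
    by (rule C1_on_radial[where d = z]) (use assms in \<open>auto intro: continuous_on_subset[OF assms(3)]\<close>)
  show "test_fun (\<lambda>x. \<zeta> x * V (norm x))" by (rule test_fun_mult_local(1)[OF assms(1) C1])
  assume x: "x \<in> ball 0 1"
  show "x \<bullet> gradient (\<lambda>x. \<zeta> x * V (norm x)) x = \<zeta> x * (norm x * z (norm x)) + V (norm x) * (x \<bullet> gradient \<zeta> x)"
  proof (cases "x = 0")
    case False
    have "gradient (\<lambda>x. V (norm x)) x = (z (norm x) / norm x) *\<^sub>R x"
      by (rule gradient_eqI[OF has_derivative_radial]) (use False x assms(2) in auto)
    then show ?thesis using test_fun_mult_local(2)[OF assms(1) C1, of x] x False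
      by (simp add: inner_add_right dot_square_norm power2_eq_square)
  qed (simp add: test_fun_0[OF assms(1)])
qed

lemma continuous_on_norm_compose:
  assumes "continuous_on {0<..<1} V"
  shows "continuous_on (ball 0 1 - {0::'a::real_normed_vector}) (\<lambda>x. V (norm x))"
  by (rule continuous_on_compose2[OF assms]) (auto intro: continuous_intros)

text \<open>The divergence identity above, applied to the test function \<open>\<zeta> V \<bar>x\<bar>\<close>.\<close>

lemma radial_integration_by_parts:
  fixes \<zeta> :: "real^'n \<Rightarrow> real"
  assumes "test_fun \<zeta>" "\<And>r. 0 < r \<Longrightarrow> r < 1 \<Longrightarrow> (V has_real_derivative z r) (at r)" "continuous_on {0<..<1} z"
  shows "(LINT x|lebesgue_on (ball 0 1). V (norm x) * (x \<bullet> gradient \<zeta> x + real CARD('n) * \<zeta> x))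
       = - (LINT x|lebesgue_on (ball 0 1). (norm x * z (norm x)) * \<zeta> x)"
proof -
  let ?B = "ball 0 1 :: (real^'n) set"
  have V: "continuous_on {0<..<1} V" using assms(2) by (intro continuous_at_imp_continuous_on ballI) (auto intro: DERIV_isCont)
  have i1: "integrable (lebesgue_on ?B) (\<lambda>x. (norm x * z (norm x)) * \<zeta> x)"
    by (intro test_fun_pairing(1)[OF _ assms(1)] loc_integrable_continuous continuous_intros continuous_on_norm_compose assms(3))
  have lV: "loc_integrable (\<lambda>x::real^'n. V (norm x))"
    by (intro loc_integrable_continuous continuous_on_norm_compose V)
  have i2: "integrable (lebesgue_on ?B) (\<lambda>x. V (norm x) * (x \<bullet> gradient \<zeta> x + real CARD('n) * \<zeta> x))"
  proof -
    have "integrable (lebesgue_on ?B) (\<lambda>x. V (norm x) * (x \<bullet> gradient \<zeta> x) + real CARD('n) * (V (norm x) * \<zeta> x))"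
      using test_fun_pairing[OF lV assms(1)] by auto
    then show ?thesis by (simp add: algebra_simps)
  qed
  have "0 = (LINT x|lebesgue_on ?B. x \<bullet> gradient (\<lambda>x. \<zeta> x * V (norm x)) x + real CARD('n) * (\<zeta> x * V (norm x)))"
    by (rule integral_radial_divergence_zero[OF test_fun_radial_factor(1)[OF assms], symmetric])
  also have "\<dots> = (LINT x|lebesgue_on ?B. V (norm x) * (x \<bullet> gradient \<zeta> x + real CARD('n) * \<zeta> x) + (norm x * z (norm x)) * \<zeta> x)"
    by (rule Bochner_Integration.integral_cong[OF refl])
      (simp add: test_fun_radial_factor(2)[OF assms] space_restrict_space algebra_simps)
  also have "\<dots> = (LINT x|lebesgue_on ?B. V (norm x) * (x \<bullet> gradient \<zeta> x + real CARD('n) * \<zeta> x))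
      + (LINT x|lebesgue_on ?B. (norm x * z (norm x)) * \<zeta> x)"
    by (rule Bochner_Integration.integral_add[OF i2 i1])
  finally show ?thesis by simp
qed

text \<open>The \<open>i\<close>-th component of the weak gradient is tested with \<open>x\<^sub>i \<zeta>\<close>, and the results are added.\<close>

lemma weak_gradient_radial_part:
  fixes u :: "real^'n \<Rightarrow> real"
  assumes "weak_gradient_on (ball 0 1) u G"
  shows "loc_integrable u" "loc_integrable (\<lambda>x. G x \<bullet> x)"
    and "test_fun \<zeta> \<Longrightarrow> (LINT x|lebesgue_on (ball 0 1). u x * (x \<bullet> gradient \<zeta> x + real CARD('n) * \<zeta> x))
       = - (LINT x|lebesgue_on (ball 0 1). (G x \<bullet> x) * \<zeta> x)"
proof -
  let ?B = "ball 0 1 :: (real^'n) set"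
  show lu: "loc_integrable u" using assms by (auto simp: weak_gradient_on_def loc_integrable_def)
  have lGi: "loc_integrable (\<lambda>x. G x $ i)" for i
    unfolding loc_integrable_def
  proof (intro allI impI)
    fix K :: "(real^'n) set" assume "compact K \<and> K \<subseteq> ball 0 1 - {0}"
    then have "integrable (lebesgue_on K) G" using assms by (auto simp: weak_gradient_on_def)
    then have "integrable (lebesgue_on K) (\<lambda>x. G x \<bullet> axis i 1)" by (rule integrable_inner_left)
    then show "integrable (lebesgue_on K) (\<lambda>x. G x $ i)" by (simp add: inner_axis)
  qed
  have "loc_integrable (\<lambda>x. x $ i * G x $ i)" for i
    by (intro loc_integrable_continuous_mult[OF lGi] continuous_intros)
  then have "loc_integrable (\<lambda>x. \<Sum>i\<in>UNIV. x $ i * G x $ i)" by (auto simp: loc_integrable_def)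
  then show "loc_integrable (\<lambda>x. G x \<bullet> x)" by (simp add: inner_vec_def mult.commute)
  assume \<zeta>: "test_fun \<zeta>"
  let ?\<eta> = "\<lambda>i x. \<zeta> x * (x \<bullet> axis i 1)"
  have t\<eta>: "test_fun (?\<eta> i)" for i by (rule test_fun_mult_C1[OF \<zeta> C1_on_inner])
  have pd: "pdiff i (?\<eta> i) x = \<zeta> x + x $ i * gradient \<zeta> x $ i" for i x
  proof -
    have "((\<lambda>x. x \<bullet> axis i 1) has_derivative (\<lambda>h. axis i 1 \<bullet> h)) (at x)"
      by (auto intro!: derivative_eq_intros simp: inner_commute)
    from pdiff_eq_has_derivative[OF has_gradient_mult[OF C1_compact_support_D(1)[OF \<zeta>] this], of i] show ?thesis
      by (simp add: inner_axis inner_add_left)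
  qed
  have i1: "integrable (lebesgue_on ?B) (\<lambda>x. u x * pdiff i (?\<eta> i) x)" for i
  proof -
    obtain \<alpha> \<beta> where ab: "0 < \<alpha>" "\<alpha> < \<beta>" "\<beta> < 1" "\<And>x. norm x < \<alpha> \<or> \<beta> < norm x \<Longrightarrow> \<zeta> x = 0"
      "\<And>x. norm x < \<alpha> \<or> \<beta> < norm x \<Longrightarrow> gradient \<zeta> x = 0"
      using test_fun_support[OF \<zeta>] by blast
    show ?thesis unfolding pd
    proof (rule loc_integrable_pairing[OF lu _ compact_annulus[of \<alpha> \<beta>]])
      show "continuous_on UNIV (\<lambda>x. \<zeta> x + x $ i * gradient \<zeta> x $ i)"
        using C1_compact_support_D(2,3)[OF \<zeta>] by (intro continuous_intros)
    qed (use ab in auto)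
  qed
  have i2: "integrable (lebesgue_on ?B) (\<lambda>x. G x $ i * ?\<eta> i x)" for i
    by (rule test_fun_pairing(1)[OF lGi t\<eta>])
  have weak: "(LINT x|lebesgue_on ?B. u x * pdiff i (?\<eta> i) x) = - (LINT x|lebesgue_on ?B. G x $ i * ?\<eta> i x)" for i
  proof -
    have "C1_compact_support ?B (?\<eta> i)" using t\<eta>[of i] by (auto simp: C1_compact_support_def)
    then show ?thesis using assms unfolding weak_gradient_on_def by blast
  qed
  have "(LINT x|lebesgue_on ?B. u x * (x \<bullet> gradient \<zeta> x + real CARD('n) * \<zeta> x))
     = (LINT x|lebesgue_on ?B. (\<Sum>i\<in>UNIV. u x * pdiff i (?\<eta> i) x))"
    by (simp only: pd) (simp add: sum_distrib_left[symmetric] sum.distrib inner_vec_def add.commute)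
  also have "\<dots> = (\<Sum>i\<in>UNIV. (LINT x|lebesgue_on ?B. u x * pdiff i (?\<eta> i) x))"
    by (rule Bochner_Integration.integral_sum) (rule i1)
  also have "\<dots> = - (\<Sum>i\<in>UNIV. (LINT x|lebesgue_on ?B. G x $ i * ?\<eta> i x))"
    by (simp add: weak sum_negf)
  also have "\<dots> = - (LINT x|lebesgue_on ?B. (\<Sum>i\<in>UNIV. G x $ i * ?\<eta> i x))"
    by (subst Bochner_Integration.integral_sum) (use i2 in auto)
  also have "(\<lambda>x. \<Sum>i\<in>UNIV. G x $ i * ?\<eta> i x) = (\<lambda>x. (G x \<bullet> x) * \<zeta> x)"
  proof -
    have "x \<bullet> axis i (1::real) = x $ i" for x :: "real^'n" and i by (simp add: inner_axis)
    then show ?thesis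
      by (simp only:) (simp add: inner_vec_def sum_distrib_left sum_distrib_right fun_eq_iff ac_simps)
  qed
  finally show "(LINT x|lebesgue_on ?B. u x * (x \<bullet> gradient \<zeta> x + real CARD('n) * \<zeta> x))
       = - (LINT x|lebesgue_on ?B. (G x \<bullet> x) * \<zeta> x)" .
qed

lemma weak_gradient_of_C1_radial:
  fixes u :: "real^'n \<Rightarrow> real"
  assumes "weak_gradient_on (ball 0 1) u G" "\<And>x. x \<in> ball 0 1 \<Longrightarrow> u x = v (norm x)"
    and "\<And>r. 0 < r \<Longrightarrow> r < 1 \<Longrightarrow> (v has_real_derivative z r) (at r)" "continuous_on {0<..<1} z"
  shows "AE x in lebesgue_on (ball 0 1). G x \<bullet> x = norm x * z (norm x)"
proof -
  let ?B = "ball 0 1 :: (real^'n) set"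
  have lz: "loc_integrable (\<lambda>x::real^'n. norm x * z (norm x))"
    by (intro loc_integrable_continuous continuous_intros continuous_on_norm_compose assms(4))
  note lG = weak_gradient_radial_part(2)[OF assms(1)]
  have "AE x in lebesgue_on ?B. G x \<bullet> x - norm x * z (norm x) = 0"
  proof (rule fundamental_lemma)
    show "loc_integrable (\<lambda>x. G x \<bullet> x - norm x * z (norm x))" by (rule loc_integrable_diff[OF lG lz])
    fix \<zeta> :: "real^'n \<Rightarrow> real" assume \<zeta>: "test_fun \<zeta>"
    have "(LINT x|lebesgue_on ?B. u x * (x \<bullet> gradient \<zeta> x + real CARD('n) * \<zeta> x))
      = (LINT x|lebesgue_on ?B. v (norm x) * (x \<bullet> gradient \<zeta> x + real CARD('n) * \<zeta> x))"
      by (rule Bochner_Integration.integral_cong[OF refl]) (simp add: assms(2) space_restrict_space)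
    then have "(LINT x|lebesgue_on ?B. (G x \<bullet> x) * \<zeta> x) = (LINT x|lebesgue_on ?B. (norm x * z (norm x)) * \<zeta> x)"
      using weak_gradient_radial_part(3)[OF assms(1) \<zeta>] radial_integration_by_parts[OF \<zeta> assms(3,4)] by simp
    then show "(LINT x|lebesgue_on ?B. (G x \<bullet> x - norm x * z (norm x)) * \<zeta> x) = 0"
      using test_fun_pairing(1)[OF lG \<zeta>] test_fun_pairing(1)[OF lz \<zeta>] by (simp add: left_diff_distrib)
  qed
  then show ?thesis by eventually_elim simp
qed

lemma antiderivative_Ioc:
  fixes z :: "real \<Rightarrow> real"
  assumes "continuous_on {0<..1} z"
  obtains V where "\<And>r. r \<in> {0<..1} \<Longrightarrow> (V has_real_derivative z r) (at r within {0<..1})"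
proof
  fix r :: real assume r: "r \<in> {0<..1}"
  have "((\<lambda>r. integral {r..1} z) has_real_derivative (- z r)) (at r within {r/2..1})"
    unfolding has_real_derivative_iff_has_vector_derivative
    by (rule integral_has_vector_derivative') (use r in \<open>auto intro: continuous_on_subset[OF assms]\<close>)
  then have "((\<lambda>r. - integral {r..1} z) has_real_derivative z r) (at r within {r/2..1})"
    by (auto intro!: derivative_eq_intros)
  moreover have "at r within {r/2..1} = at r within {0<..1}"
    by (rule at_within_nhd[where S = "{r/2<..}"]) (use r in auto)
  ultimately show "((\<lambda>r. - integral {r..1} z) has_real_derivative z r) (at r within {0<..1})" by simp
qed

lemma continuous_on_Ioc_of_derivative:
  "(\<And>r. r \<in> {0<..1} \<Longrightarrow> (V has_real_derivative z r) (at r within {0<..1})) \<Longrightarrow> continuous_on {0<..1::real} V"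
  by (rule DERIV_continuous_on)

text \<open>
  If the radial part of the weak gradient is a continuous function \<open>z\<close> of \<open>r\<close>, then the profile is a
  primitive of \<open>z\<close>: for a primitive \<open>V\<close> the function \<open>(v - V) / r\<^sup>n\<close> is homogeneous of degree \<open>- n\<close> by
  the dilation argument, so \<open>v - V\<close> is constant.
\<close>

lemma profile_derivative:
  fixes u :: "real^'n \<Rightarrow> real"
  assumes wg: "weak_gradient_on (ball 0 1) u G" and uv: "\<And>x. x \<in> ball 0 1 \<Longrightarrow> u x = v (norm x)"
    and v: "continuous_on {0<..1} v" and z: "continuous_on {0<..1} z"
    and Gz: "AE x in lebesgue_on (ball 0 1). G x \<bullet> x = norm x * z (norm x)"
    and r: "r \<in> {0<..1}"
  shows "(v has_real_derivative z r) (at r within {0<..1})"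
proof -
  let ?B = "ball 0 1 :: (real^'n) set"
  let ?n = "CARD('n)"
  obtain V where V: "\<And>r. r \<in> {0<..1} \<Longrightarrow> (V has_real_derivative z r) (at r within {0<..1})"
    using antiderivative_Ioc[OF z] by blast
  have V': "(V has_real_derivative z r) (at r)" if "0 < r" "r < 1" for r
    using V[of r] that by (simp add: at_within_Ioc)
  have cV: "continuous_on {0<..1} V" by (rule continuous_on_Ioc_of_derivative[OF V])
  define D where "D = (\<lambda>r. v r - V r)"
  have cD: "continuous_on {0<..1} D" unfolding D_def by (intro continuous_intros v cV)
  then have cD': "continuous_on {0<..<1} D" and z': "continuous_on {0<..<1} z"
    using z by (auto intro: continuous_on_subset)
  (* Z is homogeneous of degree -n if and only if D is constant. *)
  define Z where "Z = (\<lambda>x::real^'n. D (norm x) * (1 / norm x ^ ?n))"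
  have cZ: "continuous_on (ball 0 1 - {0}) Z"
    unfolding Z_def by (intro continuous_intros continuous_on_norm_compose cD') auto
  then have lZ: "loc_integrable Z" by (rule loc_integrable_continuous)
  have cW: "continuous_on {0<..<1} (\<lambda>r::real. - real ?n / r ^ (?n + 1))" by (intro continuous_intros) auto
  have dW: "((\<lambda>r. 1 / r ^ ?n) has_real_derivative - real ?n / r ^ (?n + 1)) (at r)" if "0 < r" for r :: real
  proof -
    obtain m where m: "?n = Suc m" by (metis not0_implies_Suc zero_less_card_finite less_numeral_extra(3))
    have "((\<lambda>r. r ^ Suc m) has_real_derivative real (Suc m) * r ^ m) (at r)"
      using DERIV_pow[of "Suc m" r] by simp
    then show ?thesis
      unfolding m by (rule DERIV_cong[OF DERIV_divide[OF DERIV_const]]) (use that in \<open>auto simp: field_simps\<close>)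
  qed
  have Z0: "(LINT x|lebesgue_on ?B. Z x * (x \<bullet> gradient \<eta> x)) = 0" if \<eta>: "test_fun \<eta>" for \<eta>
  proof -
    define \<zeta> where "\<zeta> = (\<lambda>x. \<eta> x * (1 / norm x ^ ?n))"
    have \<zeta>: "test_fun \<zeta>" unfolding \<zeta>_def by (rule test_fun_radial_factor(1)[OF \<eta> dW cW])
    have eq: "x \<bullet> gradient \<zeta> x + real ?n * \<zeta> x = (1 / norm x ^ ?n) * (x \<bullet> gradient \<eta> x)" if "x \<in> ?B" for x
    proof (cases "x = 0")
      case False
      then show ?thesis
        using test_fun_radial_factor(2)[OF \<eta> dW cW that] by (simp add: \<zeta>_def field_simps)
    qed (simp add: test_fun_0[OF \<zeta>])
    have "(LINT x|lebesgue_on ?B. u x * (x \<bullet> gradient \<zeta> x + real ?n * \<zeta> x)) = - (LINT x|lebesgue_on ?B. (G x \<bullet> x) * \<zeta> x)"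
      by (rule weak_gradient_radial_part(3)[OF wg \<zeta>])
    also have "(LINT x|lebesgue_on ?B. (G x \<bullet> x) * \<zeta> x) = (LINT x|lebesgue_on ?B. (norm x * z (norm x)) * \<zeta> x)"
    proof (rule integral_cong_AE)
      show "(\<lambda>x. (G x \<bullet> x) * \<zeta> x) \<in> borel_measurable (lebesgue_on ?B)"
        by (rule borel_measurable_integrable[OF test_fun_pairing(1)[OF weak_gradient_radial_part(2)[OF wg] \<zeta>]])
      show "(\<lambda>x. (norm x * z (norm x)) * \<zeta> x) \<in> borel_measurable (lebesgue_on ?B)"
        by (rule borel_measurable_integrable[OF test_fun_pairing(1)[OF _ \<zeta>]])
          (intro loc_integrable_continuous continuous_intros continuous_on_norm_compose z')
    qed (use Gz in \<open>auto elim: eventually_mono\<close>)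
    also have "- \<dots> = (LINT x|lebesgue_on ?B. V (norm x) * (x \<bullet> gradient \<zeta> x + real ?n * \<zeta> x))"
      using radial_integration_by_parts[OF \<zeta> V' z'] by simp
    finally have e: "(LINT x|lebesgue_on ?B. u x * (x \<bullet> gradient \<zeta> x + real ?n * \<zeta> x))
       = (LINT x|lebesgue_on ?B. V (norm x) * (x \<bullet> gradient \<zeta> x + real ?n * \<zeta> x))" .
    have int: "integrable (lebesgue_on ?B) (\<lambda>x. Y x * (x \<bullet> gradient \<zeta> x + real ?n * \<zeta> x))" if "loc_integrable Y" for Y
    proof -
      have "integrable (lebesgue_on ?B) (\<lambda>x. Y x * (x \<bullet> gradient \<zeta> x) + real ?n * (Y x * \<zeta> x))"
        using test_fun_pairing[OF that \<zeta>] by auto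
      then show ?thesis by (simp add: algebra_simps)
    qed
    have lV: "loc_integrable (\<lambda>x::real^'n. V (norm x))"
      by (intro loc_integrable_continuous continuous_on_norm_compose continuous_on_subset[OF cV]) auto
    have "(LINT x|lebesgue_on ?B. Z x * (x \<bullet> gradient \<eta> x))
       = (LINT x|lebesgue_on ?B. u x * (x \<bullet> gradient \<zeta> x + real ?n * \<zeta> x) - V (norm x) * (x \<bullet> gradient \<zeta> x + real ?n * \<zeta> x))"
      by (rule Bochner_Integration.integral_cong[OF refl])
        (simp add: eq space_restrict_space uv Z_def D_def left_diff_distrib diff_divide_distrib)
    also have "\<dots> = 0"
      using e by (subst Bochner_Integration.integral_diff) (auto intro: int weak_gradient_radial_part(1)[OF wg] lV)
    finally show ?thesis .
  qed
  have D_dil: "D (norm x / T) = D (norm x)" if T: "1 \<le> T" and x: "x \<in> ?B - {0}" for T and x :: "real^'n"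
  proof -
    define E where "E = (\<lambda>x::real^'n. D (norm x / T) - D (norm x))"
    have cDT: "continuous_on {0<..<1} (\<lambda>r. D (r / T))"
      by (rule continuous_on_compose2[OF cD']) (use T in \<open>auto intro!: continuous_intros simp: divide_less_eq\<close>)
    have cE: "continuous_on (ball 0 1 - {0}) E"
      unfolding E_def by (intro continuous_intros continuous_on_norm_compose cDT cD')
    define Y where "Y = (\<lambda>x::real^'n. E x * (1 / norm x ^ ?n))"
    have "AE x in lebesgue_on ?B. Y x = 0"
    proof (rule fundamental_lemma)
      have l1: "loc_integrable (\<lambda>x::real^'n. D (norm x / T) * (1 / norm x ^ ?n))"
        by (intro loc_integrable_continuous continuous_intros continuous_on_norm_compose cDT) auto
      have Yeq: "Y = (\<lambda>x. D (norm x / T) * (1 / norm x ^ ?n) - Z x)"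
        by (simp add: Y_def E_def Z_def diff_divide_distrib fun_eq_iff)
      show "loc_integrable Y" unfolding Yeq by (rule loc_integrable_diff[OF l1 lZ])
      fix \<zeta> :: "real^'n \<Rightarrow> real" assume \<zeta>: "test_fun \<zeta>"
      obtain a b where ab: "0 < a" "a < b" "b < 1" "\<And>x. norm x < a \<or> b < norm x \<Longrightarrow> \<zeta> x = 0"
        using test_fun_support[OF \<zeta>] by metis
      define f where "f = (\<lambda>y. D (norm y / T) * (1 / norm y ^ ?n) * \<zeta> y)"
      have fm: "f \<in> borel_measurable borel"
      proof -
        have "f = (\<lambda>y. indicator {y. a \<le> norm y \<and> norm y \<le> b} y *\<^sub>R f y)"
        proof
          fix y show "f y = indicator {y. a \<le> norm y \<and> norm y \<le> b} y *\<^sub>R f y"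
            using ab(4)[of y] by (cases "a \<le> norm y \<and> norm y \<le> b") (auto simp: f_def)
        qed
        moreover have "(\<lambda>y. indicator {y. a \<le> norm y \<and> norm y \<le> b} y *\<^sub>R f y) \<in> borel_measurable borel"
        proof (rule borel_measurable_continuous_on_indicator)
          show "{y::real^'n. a \<le> norm y \<and> norm y \<le> b} \<in> sets borel"
            by (rule borel_compact[OF compact_annulus])
          show "continuous_on {y::real^'n. a \<le> norm y \<and> norm y \<le> b} f"
            unfolding f_def
          proof (intro continuous_intros)
            show "continuous_on {y::real^'n. a \<le> norm y \<and> norm y \<le> b} (\<lambda>y. D (norm y / T))"
              by (rule continuous_on_subset[OF continuous_on_norm_compose[OF cDT]]) (use ab in auto)
            show "continuous_on {y::real^'n. a \<le> norm y \<and> norm y \<le> b} \<zeta>"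
              by (rule continuous_on_subset[OF C1_compact_support_D(3)[OF \<zeta>]]) auto
          qed (use ab in auto)
        qed
        ultimately show ?thesis by simp
      qed
      have f0: "f x = 0" if "x \<notin> ?B" for x using that ab by (auto simp: f_def)
      have f0': "f (T *\<^sub>R x) = 0" if "x \<notin> ?B" for x
      proof -
        have "1 \<le> norm x" using that by simp
        also have "\<dots> \<le> norm (T *\<^sub>R x)" using T mult_right_mono[of 1 T "norm x"] by simp
        finally show ?thesis by (intro f0) simp
      qed
      have fT: "f (T *\<^sub>R x) = (Z x * \<zeta> (T *\<^sub>R x)) / T ^ ?n" for x
        using T by (simp add: f_def Z_def power_mult_distrib)
      have "(LINT x|lebesgue_on ?B. Z x * \<zeta> x) = (LINT x|lebesgue_on ?B. Z x * \<zeta> (T *\<^sub>R x))"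
        by (rule dilation_constant[OF lZ \<zeta> T Z0, symmetric])
      also have "\<dots> = T ^ ?n * (LINT x|lebesgue_on ?B. f (T *\<^sub>R x))"
        using T by (simp add: fT)
      also have "(LINT x|lebesgue_on ?B. f (T *\<^sub>R x)) = (LINT x|lborel. f (T *\<^sub>R x))"
        by (rule LINT_ball_eq_lborel) (use fm f0' in \<open>auto intro: measurable_compose[OF _ fm]\<close>)
      also have "\<dots> = (LINT x|lborel. f x) / T ^ ?n" using LINT_scaleR[OF fm, of T] T by simp
      also have "(LINT x|lborel. f x) = (LINT x|lebesgue_on ?B. f x)"
        by (rule LINT_ball_eq_lborel[OF fm f0, symmetric])
      finally have "(LINT x|lebesgue_on ?B. Z x * \<zeta> x) = (LINT x|lebesgue_on ?B. f x)" using T by simp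
      then show "(LINT x|lebesgue_on ?B. Y x * \<zeta> x) = 0"
        using test_fun_pairing(1)[OF l1 \<zeta>] test_fun_pairing(1)[OF lZ \<zeta>]
        by (simp add: Yeq left_diff_distrib f_def)
    qed
    then have "AE x in lebesgue_on ?B. x \<noteq> 0 \<longrightarrow> E x = 0" by eventually_elim (auto simp: Y_def)
    then have ae: "AE x in lebesgue. x \<in> ?B \<longrightarrow> x \<noteq> 0 \<longrightarrow> E x = 0" by (subst (asm) AE_restrict_space_iff) auto
    have oP: "open (?B - {0})" by (simp add: open_delete)
    let ?O = "{x \<in> ?B - {0}. E x \<noteq> 0}"
    have "open ((?B - {0}) \<inter> E -` (- {0}))" using continuous_open_preimage[OF cE oP] by auto
    moreover have "(?B - {0}) \<inter> E -` (- {0}) = ?O" by auto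
    ultimately have "open ?O" by simp
    moreover have "negligible ?O"
    proof -
      obtain N where "N \<in> null_sets lebesgue" "{x. \<not> (x \<in> ?B \<longrightarrow> x \<noteq> 0 \<longrightarrow> E x = 0)} \<subseteq> N"
        using ae unfolding eventually_ae_filter by auto
      then have "negligible N" "?O \<subseteq> N" by (auto simp only: negligible_iff_null_sets)
      then show ?thesis by (rule negligible_subset)
    qed
    ultimately have "?O = {}" using open_not_negligible by blast
    then show ?thesis using x by (auto simp: E_def)
  qed
  have D_const: "D r = D s" if "0 < r" "r \<le> s" "s < 1" for r s
  proof -
    obtain e :: "real^'n" where e: "norm e = 1" using vector_choose_size[of 1] by auto
    have "D (norm (s *\<^sub>R e) / (s / r)) = D (norm (s *\<^sub>R e))"
      by (rule D_dil) (use that e in \<open>auto simp: field_simps\<close>)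
    then show ?thesis using that e by simp
  qed
  define c where "c = D (1/2)"
  have Dc: "D r = c" if "0 < r" "r < 1" for r
    using that D_const[of r "1/2"] D_const[of "1/2" r] by (cases "r \<le> 1/2") (auto simp: c_def)
  have "D 1 = c"
  proof -
    have "(D \<longlongrightarrow> D 1) (at 1 within {0<..1})" using cD by (auto simp: continuous_on_def)
    then have 1: "(D \<longlongrightarrow> D 1) (at 1 within {0<..<1})" by (rule tendsto_within_subset) auto
    have "(D \<longlongrightarrow> c) (at 1 within {0<..<1})"
      by (rule tendsto_eventually) (auto simp: eventually_at_filter Dc)
    moreover have "at 1 within {0<..<1::real} \<noteq> bot" by (simp add: at_within_eq_bot_iff)
    ultimately show ?thesis using 1 tendsto_unique by blast
  qed
  then have vV: "v s = V s + c" if "s \<in> {0<..1}" for s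
    using Dc[of s] that by (cases "s = 1") (auto simp: D_def)
  have "((\<lambda>r. V r + c) has_real_derivative z r) (at r within {0<..1})"
    using V[OF r] by (auto intro!: derivative_eq_intros)
  then show ?thesis
    by (rule has_field_derivative_transform_within[of _ _ _ _ 1]) (use vV r in auto)
qed

section \<open>The radial equation\<close>

text \<open>
  In polar coordinates \<open>g(u) \<in> L\<^sup>1\<close> says that \<open>r\<^sup>n\<^sup>-\<^sup>1 g(v)\<close> is integrable up to \<open>0\<close>; its primitive
  \<open>H\<close> is the only candidate for the flux times \<open>c\<close>.
\<close>

lemma weak_solution_integral_equation:
  fixes u :: "real^'n \<Rightarrow> real"
  assumes k: "1 \<le> k" "2 * k < CARD('n)" and g: "continuous_on UNIV g" "\<And>t. 0 \<le> g t"
    and v: "continuous_on {0<..1} v" and uv: "\<And>x. x \<in> ball 0 1 \<Longrightarrow> u x = v (norm x)"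
    and gu: "integrable (lebesgue_on (ball 0 1)) (\<lambda>x. g (u x))"
  obtains H where "continuous_on {0..1} H" "H 0 = 0" "\<And>r s. 0 \<le> r \<Longrightarrow> r \<le> s \<Longrightarrow> s \<le> 1 \<Longrightarrow> H r \<le> H s"
    "\<And>r. r \<in> {0<..1} \<Longrightarrow> (H has_real_derivative r ^ (CARD('n) - 1) * g (v r)) (at r within {0<..1})"
proof -
  let ?n = "CARD('n)"
  define h where "h = (\<lambda>r. r ^ (?n - 1) * g (v r))"
  define f where "f = (\<lambda>r. indicator {0<..<1} r *\<^sub>R g (v r) + indicator {0} r *\<^sub>R g (v 0))"
  have cgv: "continuous_on {0<..1} (\<lambda>r. g (v r))"
    by (rule continuous_on_compose2[OF g(1) v]) auto
  have fm: "f \<in> borel_measurable borel"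
    unfolding f_def
    by (intro borel_measurable_add borel_measurable_continuous_on_indicator) (auto intro: continuous_on_subset[OF cgv])
  have "integrable (lebesgue_on (ball 0 1)) (\<lambda>x::real^'n. f (norm x))"
    by (rule Bochner_Integration.integrable_cong[THEN iffD1, OF refl _ gu])
      (auto simp: space_restrict_space uv f_def indicator_def)
  then have "set_integrable lborel {0<..<1} (\<lambda>r. r ^ (?n - 1) * f r)"
    using polar_integral(1)[OF fm, where 'a="real^'n"] by simp
  then have "(\<lambda>r. r ^ (?n - 1) * f r) integrable_on {0<..<1}" by (rule set_borel_integral_eq_integral(1))
  then have "h integrable_on {0<..<1}"
    by (rule integrable_eq) (auto simp: h_def f_def)
  then have hi: "h integrable_on {0..1}" using integrable_on_Icc_iff_Ioo[of h 0 1] by simp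
  define H where "H = (\<lambda>r. integral {0..r} h)"
  show ?thesis
  proof (rule that[of H])
    show "continuous_on {0..1} H" unfolding H_def by (rule indefinite_integral_continuous_1[OF hi])
    show "H 0 = 0" by (simp add: H_def)
    show "H r \<le> H s" if "0 \<le> r" "r \<le> s" "s \<le> 1" for r s
    proof -
      have "h integrable_on {0..t}" if "t \<le> 1" for t
        by (rule integrable_on_subinterval[OF hi]) (use that in auto)
      then show ?thesis
        unfolding H_def using that by (intro integral_subset_le) (auto simp: h_def g(2))
    qed
    fix r :: real assume r: "r \<in> {0<..1}"
    have "continuous (at r within {0..1} - {0}) h"
    proof -
      have "continuous_on {0<..1} h" unfolding h_def by (intro continuous_intros cgv)
      moreover have "{0..1} - {0} = {0<..1::real}" by auto
      ultimately show ?thesis using r by (simp add: continuous_on_eq_continuous_within)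
    qed
    then have "((\<lambda>u. integral {0..u} h) has_vector_derivative h r) (at r within {0..1} - {0})"
      using r by (intro integral_has_vector_derivative_continuous_at[OF hi]) auto
    moreover have "{0..1} - {0} = {0<..1::real}" by auto
    ultimately show "(H has_real_derivative r ^ (?n - 1) * g (v r)) (at r within {0<..1})"
      by (simp add: has_real_derivative_iff_has_vector_derivative H_def h_def)
  qed
qed

text \<open>
  Both \<open>W\<^sup>k\<close> and its radial candidate \<open>F\<close> solve \<open>div (x W) = g(u) / c\<close> away from the origin, so their
  difference is homogeneous of degree \<open>- n\<close>. Testing with \<open>\<zeta> (m x)\<close> for \<open>m \<rightarrow> \<infinity>\<close> shows that it vanishes:
  the energy bound makes \<open>W\<^sup>k\<close> integrable near the origin because \<open>2 k < n\<close>, and \<open>\<bar>x\<bar>\<^sup>n F\<close> tends to \<open>0\<close> there.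
\<close>

lemma weak_solution_flux:
  fixes u :: "real^'n \<Rightarrow> real" and G :: "real^'n \<Rightarrow> real^'n"
  assumes k: "1 \<le> k" "2 * k < CARD('n)" and g: "continuous_on UNIV g"
    and v: "continuous_on {0<..1} v" and uv: "\<And>x. x \<in> ball 0 1 \<Longrightarrow> u x = v (norm x)"
    and weak: "weak_radial_solution k g u G"
    and H: "continuous_on {0..1} H" "H 0 = 0" "\<And>r s. 0 \<le> r \<Longrightarrow> r \<le> s \<Longrightarrow> s \<le> 1 \<Longrightarrow> H r \<le> H s"
    "\<And>r. r \<in> {0<..1} \<Longrightarrow> (H has_real_derivative r ^ (CARD('n) - 1) * g (v r)) (at r within {0<..1})"
  shows "AE x in lebesgue_on (ball 0 1). ((G x \<bullet> x) / (norm x)\<^sup>2) ^ k = H (norm x) / (c_const CARD('n) k * norm x ^ CARD('n))"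
proof -
  let ?n = "CARD('n)" let ?B = "ball 0 1 :: (real^'n) set" let ?L = "lebesgue_on ?B"
  define c where "c = c_const ?n k"
  have c: "0 < c" unfolding c_def using k by (intro c_const_pos) auto
  define W where "W = (\<lambda>x. (G x \<bullet> x) / (norm x)\<^sup>2)"
  define E where "E = (\<lambda>x. W x ^ (k - 1) * ((G x \<bullet> x) / norm x)\<^sup>2)"
  define F where "F = (\<lambda>r. H r / (c * r ^ ?n))"
  have wg: "weak_gradient_on ?B u G" using weak by (simp add: weak_radial_solution_def)
  have gu: "integrable ?L (\<lambda>x. g (u x))" using weak by (simp add: weak_radial_solution_def)
  have Ei: "integrable ?L E"
  proof -
    have "integrable ?L (\<lambda>x. real k * c * W x ^ (k - 1) * ((G x \<bullet> x) / norm x)\<^sup>2)"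
      using weak by (simp add: weak_radial_solution_def W_def c_def)
    then have "integrable ?L (\<lambda>x. (real k * c) * E x)" by (simp add: E_def mult.assoc)
    then show ?thesis using k(1) c by (subst (asm) integrable_mult_left_iff) auto
  qed
  (* Where W |x|^2 is small the first term dominates, elsewhere the energy density E does. *)
  have Wbound: "\<bar>W x\<bar> ^ k \<le> 1 / norm x ^ (2 * k) + \<bar>E x\<bar>" if "x \<noteq> 0" for x
  proof -
    have n: "0 < (norm x)\<^sup>2" using that by simp
    have "E x = W x ^ (k - 1) * ((W x)\<^sup>2 * (norm x)\<^sup>2)"
      using that by (simp add: E_def W_def power2_eq_square field_simps)
    then have Ex: "\<bar>E x\<bar> = \<bar>W x\<bar> ^ k * (\<bar>W x\<bar> * (norm x)\<^sup>2)"
      using k(1) by (cases k) (auto simp: abs_mult power_abs power2_eq_square)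
    show ?thesis
    proof (cases "\<bar>W x\<bar> * (norm x)\<^sup>2 \<le> 1")
      case True
      then have "\<bar>W x\<bar> ^ k \<le> (1 / (norm x)\<^sup>2) ^ k" using n by (intro power_mono) (auto simp: field_simps)
      then show ?thesis by (simp add: power_one_over power_mult[symmetric] add_increasing2)
    next
      case False
      then have "\<bar>W x\<bar> ^ k * 1 \<le> \<bar>W x\<bar> ^ k * (\<bar>W x\<bar> * (norm x)\<^sup>2)" by (intro mult_left_mono) auto
      then show ?thesis by (simp add: Ex add_increasing)
    qed
  qed
  (* This is where 2 k < n is used. *)
  have inv_i: "integrable ?L (\<lambda>x::real^'n. 1 / norm x ^ (2 * k))"
  proof -
    have "set_integrable lborel {0<..<1} (\<lambda>r::real. r ^ (?n - 1 - 2 * k))"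
      by (rule set_integrable_subset[OF borel_integrable_atLeastAtMost'[of 0 1]]) (auto intro: continuous_intros)
    moreover have "r ^ (?n - 1) * (1 / r ^ (2 * k)) = r ^ (?n - 1 - 2 * k)" if "0 < r" for r :: real
      using that k(2) by (simp add: power_diff)
    ultimately have "set_integrable lborel {0<..<1} (\<lambda>r::real. r ^ (?n - 1) * (1 / r ^ (2 * k)))"
      by (subst set_integrable_cong[OF refl refl, of _ _ "\<lambda>r::real. r ^ (?n - 1 - 2 * k)"]) auto
    then show ?thesis
      using polar_integral(1)[of "\<lambda>r. 1 / r ^ (2 * k)", where 'a="real^'n"] by simp
  qed
  have wi: "integrable ?L (\<lambda>x. 1 / norm x ^ (2 * k) + \<bar>E x\<bar>)" using inv_i Ei by auto
  have lW: "loc_integrable (\<lambda>x. W x ^ k)"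
    unfolding loc_integrable_def
  proof (intro allI impI)
    fix K :: "(real^'n) set" assume K: "compact K \<and> K \<subseteq> ball 0 1 - {0}"
    show "integrable (lebesgue_on K) (\<lambda>x. W x ^ k)"
    proof (rule Bochner_Integration.integrable_bound)
      show "integrable (lebesgue_on K) (\<lambda>x. 1 / norm x ^ (2 * k) + \<bar>E x\<bar>)"
        using loc_integrable_of_integrable[OF wi] K by (auto simp: loc_integrable_def)
      have "integrable (lebesgue_on K) (\<lambda>x. (1 / (norm x)\<^sup>2) * (G x \<bullet> x))"
        using K weak_gradient_radial_part(2)[OF wg]
        by (intro integrable_mult_continuous_compact continuous_intros) (auto simp: loc_integrable_def)
      then have "integrable (lebesgue_on K) W" by (simp add: W_def)
      from borel_measurable_integrable[OF this]
      show "(\<lambda>x. W x ^ k) \<in> borel_measurable (lebesgue_on K)" by measurable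
      show "AE x in lebesgue_on K. norm (W x ^ k) \<le> norm (1 / norm x ^ (2 * k) + \<bar>E x\<bar>)"
      proof (rule AE_I2)
        fix x assume "x \<in> space (lebesgue_on K)"
        then have "x \<noteq> 0" using K by (auto simp: space_restrict_space)
        from Wbound[OF this] show "norm (W x ^ k) \<le> norm (1 / norm x ^ (2 * k) + \<bar>E x\<bar>)"
          by (simp add: power_abs)
      qed
    qed
  qed
  have H': "(H has_real_derivative r ^ (?n - 1) * g (v r)) (at r)" if "0 < r" "r < 1" for r
    using H(4)[of r] that by (simp add: at_within_Ioc)
  have cgv: "continuous_on {0<..<1} (\<lambda>r. g (v r))"
    by (rule continuous_on_compose2[OF g continuous_on_subset[OF v]]) auto
  have cH: "continuous_on {0<..<1} H" by (rule continuous_on_subset[OF H(1)]) auto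
  have cF: "continuous_on {0<..<1} F"
    unfolding F_def using c by (intro continuous_intros cH) auto
  define F' where "F' = (\<lambda>r. (g (v r) / c - real ?n * F r) / r)"
  have F': "(F has_real_derivative F' r) (at r)" if r: "0 < r" "r < 1" for r
  proof -
    obtain m where m: "?n = Suc m" by (metis not0_implies_Suc zero_less_card_finite less_numeral_extra(3))
    have "((\<lambda>r. c * r ^ Suc m) has_real_derivative c * (real (Suc m) * r ^ m)) (at r)"
      using DERIV_cmult[OF DERIV_pow[of "Suc m" r], of c] by simp
    then show ?thesis
      unfolding F_def
      by (subst m, intro DERIV_cong[OF DERIV_divide[OF H'[OF r]]])
        (use c r in \<open>auto simp: F'_def F_def m field_simps\<close>)
  qed
  have cF': "continuous_on {0<..<1} F'"
    unfolding F'_def using c by (intro continuous_intros cgv cF) auto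
  have lF: "loc_integrable (\<lambda>x::real^'n. F (norm x))"
    by (intro loc_integrable_continuous continuous_on_norm_compose cF)
  have lgu: "loc_integrable (\<lambda>x. g (u x))" by (rule loc_integrable_of_integrable[OF gu])
  have eqF: "c * (LINT x|?L. F (norm x) * (x \<bullet> gradient \<zeta> x)) = - (LINT x|?L. g (u x) * \<zeta> x)" if \<zeta>: "test_fun \<zeta>" for \<zeta>
  proof -
    have i1: "integrable ?L (\<lambda>x. F (norm x) * (x \<bullet> gradient \<zeta> x))" "integrable ?L (\<lambda>x. F (norm x) * \<zeta> x)"
      and i3: "integrable ?L (\<lambda>x. g (u x) * \<zeta> x)"
      using test_fun_pairing[OF lF \<zeta>] test_fun_pairing[OF lgu \<zeta>] by auto
    have "(LINT x|?L. F (norm x) * (x \<bullet> gradient \<zeta> x + real ?n * \<zeta> x)) = - (LINT x|?L. (norm x * F' (norm x)) * \<zeta> x)"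
      by (rule radial_integration_by_parts[OF \<zeta> F' cF'])
    also have "(LINT x|?L. (norm x * F' (norm x)) * \<zeta> x) = (LINT x|?L. g (u x) * \<zeta> x / c - real ?n * (F (norm x) * \<zeta> x))"
    proof (rule Bochner_Integration.integral_cong[OF refl])
      fix x assume "x \<in> space ?L"
      then have "x \<in> ?B" by (simp add: space_restrict_space)
      then show "(norm x * F' (norm x)) * \<zeta> x = g (u x) * \<zeta> x / c - real ?n * (F (norm x) * \<zeta> x)"
        using uv[of x] c by (cases "x = 0") (auto simp: F'_def test_fun_0[OF \<zeta>] field_simps)
    qed
    also have "\<dots> = (LINT x|?L. g (u x) * \<zeta> x) / c - real ?n * (LINT x|?L. F (norm x) * \<zeta> x)"
      using i1 i3 by simp
    finally have "(LINT x|?L. F (norm x) * (x \<bullet> gradient \<zeta> x + real ?n * \<zeta> x))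
       = real ?n * (LINT x|?L. F (norm x) * \<zeta> x) - (LINT x|?L. g (u x) * \<zeta> x) / c" by simp
    moreover have "(LINT x|?L. F (norm x) * (x \<bullet> gradient \<zeta> x + real ?n * \<zeta> x))
       = (LINT x|?L. F (norm x) * (x \<bullet> gradient \<zeta> x)) + real ?n * (LINT x|?L. F (norm x) * \<zeta> x)"
    proof -
      have "(LINT x|?L. F (norm x) * (x \<bullet> gradient \<zeta> x + real ?n * \<zeta> x))
        = (LINT x|?L. F (norm x) * (x \<bullet> gradient \<zeta> x) + real ?n * (F (norm x) * \<zeta> x))"
        by (simp add: algebra_simps)
      then show ?thesis using i1 by simp
    qed
    ultimately show ?thesis using c by (simp add: field_simps)
  qed
  have eqW: "c * (LINT x|?L. W x ^ k * (x \<bullet> gradient \<zeta> x)) = - (LINT x|?L. g (u x) * \<zeta> x)" if \<zeta>: "test_fun \<zeta>" for \<zeta>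
  proof -
    have "C1_compact_support ?B \<zeta>" using \<zeta> by (auto simp: C1_compact_support_def)
    then have "(LINT x|?L. 1 / real k * (real k * c * W x ^ k * (x \<bullet> gradient \<zeta> x)) + g (u x) * \<zeta> x) = 0"
      using weak unfolding weak_radial_solution_def W_def c_def by blast
    moreover have "1 / real k * (real k * c * W x ^ k * (x \<bullet> gradient \<zeta> x)) = c * (W x ^ k * (x \<bullet> gradient \<zeta> x))" for x
      using k(1) by simp
    ultimately have "(LINT x|?L. c * (W x ^ k * (x \<bullet> gradient \<zeta> x)) + g (u x) * \<zeta> x) = 0" by simp
    then show ?thesis
      using test_fun_pairing(2)[OF lW \<zeta>] test_fun_pairing(1)[OF lgu \<zeta>] by simp
  qed
  define Z where "Z = (\<lambda>x. W x ^ k - F (norm x))"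
  have lZ: "loc_integrable Z" unfolding Z_def by (rule loc_integrable_diff[OF lW lF])
  have Z0: "(LINT x|?L. Z x * (x \<bullet> gradient \<zeta> x)) = 0" if "test_fun \<zeta>" for \<zeta>
  proof -
    have "c * (LINT x|?L. W x ^ k * (x \<bullet> gradient \<zeta> x)) = c * (LINT x|?L. F (norm x) * (x \<bullet> gradient \<zeta> x))"
      using eqF[OF that] eqW[OF that] by simp
    then have "(LINT x|?L. W x ^ k * (x \<bullet> gradient \<zeta> x)) = (LINT x|?L. F (norm x) * (x \<bullet> gradient \<zeta> x))"
      using c by simp
    then show ?thesis using test_fun_pairing(2)[OF lW that] test_fun_pairing(2)[OF lF that]
      by (simp add: Z_def left_diff_distrib)
  qed
  have "AE x in ?L. Z x = 0"
  proof (rule fundamental_lemma[OF lZ])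
    fix \<zeta> :: "real^'n \<Rightarrow> real" assume \<zeta>: "test_fun \<zeta>"
    obtain a b where ab: "0 < a" "a < b" "b < 1" "\<And>x. norm x < a \<or> b < norm x \<Longrightarrow> \<zeta> x = 0"
      using test_fun_support[OF \<zeta>] by metis
    obtain C where C: "0 \<le> C" "\<And>x. \<bar>\<zeta> x\<bar> \<le> C" using test_fun_lipschitz[OF \<zeta>] by metis
    let ?m = "\<lambda>i. real (Suc i)"
    have t: "test_fun (\<lambda>x. \<zeta> (?m i *\<^sub>R x))" for i by (rule test_fun_scale(1)[OF \<zeta>]) simp
    have split: "(LINT x|?L. Z x * \<zeta> x) = (LINT x|?L. W x ^ k * \<zeta> (?m i *\<^sub>R x)) - (LINT x|?L. F (norm x) * \<zeta> (?m i *\<^sub>R x))" for i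
    proof -
      have "(LINT x|?L. Z x * \<zeta> x) = (LINT x|?L. Z x * \<zeta> (?m i *\<^sub>R x))"
        by (rule dilation_constant[OF lZ \<zeta> _ Z0, symmetric]) simp
      then show ?thesis using test_fun_pairing(1)[OF lW t] test_fun_pairing(1)[OF lF t]
        by (simp add: Z_def left_diff_distrib)
    qed
    (* The dilated test function lives in an annulus that shrinks to the origin. *)
    have outer: "\<zeta> (?m i *\<^sub>R x) = 0" if "1 / ?m i < norm x \<or> ?m i * norm x < a" for i x
    proof (rule ab(4))
      show "norm (?m i *\<^sub>R x) < a \<or> b < norm (?m i *\<^sub>R x)"
      proof -
        have n: "norm (?m i *\<^sub>R x) = ?m i * norm x" by (simp only: norm_scaleR abs_of_nat)
        have "1 < ?m i * norm x" if "1 / ?m i < norm x"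
          using that by (simp only: pos_divide_less_eq of_nat_0_less_iff zero_less_Suc mult.commute)
        then show ?thesis using that ab(3) unfolding n by linarith
      qed
    qed
    have lim1: "(\<lambda>i. LINT x|?L. W x ^ k * \<zeta> (?m i *\<^sub>R x)) \<longlonglongrightarrow> (LINT x|?L. 0)"
    proof (rule integral_dominated_convergence[where w = "\<lambda>x. C * (1 / norm x ^ (2 * k) + \<bar>E x\<bar>)"])
      show "integrable ?L (\<lambda>x. C * (1 / norm x ^ (2 * k) + \<bar>E x\<bar>))" using wi by (rule integrable_mult_right)
      show "(\<lambda>x. W x ^ k * \<zeta> (?m i *\<^sub>R x)) \<in> borel_measurable ?L" for i
        by (rule borel_measurable_integrable[OF test_fun_pairing(1)[OF lW t]])
      show "AE x in ?L. (\<lambda>i. W x ^ k * \<zeta> (?m i *\<^sub>R x)) \<longlonglongrightarrow> 0"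
      proof (rule AE_I2, rule tendsto_eventually)
        fix x :: "real^'n"
        show "\<forall>\<^sub>F i in sequentially. W x ^ k * \<zeta> (?m i *\<^sub>R x) = 0"
        proof (cases "x = 0")
          case False
          then obtain i0 where "1 / norm x < real i0" using reals_Archimedean2 by blast
          then have "1 / ?m i < norm x" if "i0 \<le> i" for i
          proof -
            have "1 / norm x < ?m i" using \<open>1 / norm x < real i0\<close> that by linarith
            then show ?thesis using False by (simp add: field_simps)
          qed
          then show ?thesis using outer by (auto intro!: eventually_sequentiallyI[of i0])
        qed (simp add: test_fun_0[OF \<zeta>])
      qed
      show "AE x in ?L. norm (W x ^ k * \<zeta> (?m i *\<^sub>R x)) \<le> C * (1 / norm x ^ (2 * k) + \<bar>E x\<bar>)" for i
      proof (rule AE_I2)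
        fix x :: "real^'n"
        show "norm (W x ^ k * \<zeta> (?m i *\<^sub>R x)) \<le> C * (1 / norm x ^ (2 * k) + \<bar>E x\<bar>)"
        proof (cases "x = 0")
          case False
          have "\<bar>W x\<bar> ^ k * \<bar>\<zeta> (?m i *\<^sub>R x)\<bar> \<le> (1 / norm x ^ (2 * k) + \<bar>E x\<bar>) * C"
            by (intro mult_mono Wbound[OF False] C(2)) auto
          then show ?thesis by (simp add: abs_mult power_abs mult.commute)
        qed (use C(1) in \<open>simp add: test_fun_0[OF \<zeta>]\<close>)
      qed
    qed simp
    define \<omega> where "\<omega> = measure lborel ?B"
    have lim2: "(\<lambda>i. LINT x|?L. F (norm x) * \<zeta> (?m i *\<^sub>R x)) \<longlonglongrightarrow> 0"
    proof (rule Lim_null_comparison)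
      define A where "A = (\<lambda>i. C * (H (1 / ?m i) * ?m i ^ ?n / (c * a ^ ?n)))"
      have H0: "0 \<le> H r" if "0 \<le> r" "r \<le> 1" for r using H(3)[of 0 r] H(2) that by simp
      have b: "\<bar>F (norm x) * \<zeta> (?m i *\<^sub>R x)\<bar> \<le> A i * indicator (cball 0 (1 / ?m i)) x" if "x \<in> ?B" for i x
      proof (cases "1 / ?m i < norm x \<or> ?m i * norm x < a")
        case True
        have "0 \<le> A i" using C(1) c ab(1) H0[of "1 / ?m i"] by (simp add: A_def)
        then show ?thesis using outer[OF True] by simp
      next
        case False
        then have x: "a / ?m i \<le> norm x" "norm x \<le> 1 / ?m i" by (auto simp: field_simps)
        have mpos: "0 < ?m i" by simp
        have "(a / ?m i) ^ ?n \<le> norm x ^ ?n" using x ab(1) by (intro power_mono) auto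
        then have den: "c * (a / ?m i) ^ ?n \<le> c * norm x ^ ?n" using c by simp
        have dpos: "0 < c * (a / ?m i) ^ ?n" using c ab(1) mpos by (intro mult_pos_pos zero_less_power divide_pos_pos)
        have "H (norm x) \<le> H (1 / ?m i)" using x by (intro H(3)) auto
        moreover have "0 \<le> H (norm x)" using that by (intro H0) auto
        ultimately have "F (norm x) \<le> H (1 / ?m i) / (c * (a / ?m i) ^ ?n)"
          unfolding F_def using den dpos by (intro frac_le) auto
        moreover have "0 \<le> F (norm x)" unfolding F_def using \<open>0 \<le> H (norm x)\<close> c by simp
        ultimately have "\<bar>F (norm x)\<bar> * \<bar>\<zeta> (?m i *\<^sub>R x)\<bar> \<le> H (1 / ?m i) / (c * (a / ?m i) ^ ?n) * C"
          by (intro mult_mono C(2)) auto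
        also have "\<dots> = A i" by (simp add: A_def power_divide)
        finally show ?thesis using x(2) by (simp add: abs_mult indicator_def)
      qed
      have cb: "cball 0 (1 / ?m i) \<inter> ?B \<in> sets lebesgue" for i by auto
      have mi: "measure ?L (cball 0 (1 / ?m i) \<inter> ?B) \<le> \<omega> / ?m i ^ ?n" for i
      proof -
        have "measure ?L (cball 0 (1 / ?m i) \<inter> ?B) = measure lebesgue (cball 0 (1 / ?m i) \<inter> ?B)"
          by (rule measure_restrict_space) auto
        also have "\<dots> \<le> measure lebesgue (cball (0::real^'n) (1 / ?m i))"
          by (rule measure_mono_fmeasurable) auto
        also have "\<dots> = measure lborel (cball (0::real^'n) (1 / ?m i))" by simp
        also have "\<dots> = \<omega> * (1 / ?m i) ^ ?n"
          using emeasure_ball_scale(2)[of "1 / ?m i", where 'a="real^'n"] by (simp add: measure_def[of _ "cball _ _"] \<omega>_def)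
        finally show ?thesis by (simp add: power_one_over field_simps)
      qed
      have fin: "emeasure ?L (cball 0 (1 / ?m i) \<inter> ?B) < \<infinity>" for i
      proof -
        have "emeasure ?L (cball 0 (1 / ?m i) \<inter> ?B) = emeasure lebesgue (cball (0::real^'n) (1 / ?m i) \<inter> ?B)"
          by (rule emeasure_restrict_space) auto
        also have "\<dots> < \<infinity>" using emeasure_bounded_finite[of "cball (0::real^'n) (1 / ?m i) \<inter> ?B"] by auto
        finally show ?thesis .
      qed
      have Ii: "integrable ?L (\<lambda>x. A i * indicator (cball 0 (1 / ?m i) \<inter> ?B) x)" for i
        by (rule integrable_mult_right, rule integrable_real_indicator) (use fin cb in \<open>auto simp: sets_restrict_space_iff\<close>)
      show "\<forall>\<^sub>F i in sequentially. norm (LINT x|?L. F (norm x) * \<zeta> (?m i *\<^sub>R x)) \<le> (C * \<omega> / (c * a ^ ?n)) * H (1 / ?m i)"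
      proof (intro always_eventually allI)
        fix i
        have "norm (LINT x|?L. F (norm x) * \<zeta> (?m i *\<^sub>R x)) \<le> (LINT x|?L. norm (F (norm x) * \<zeta> (?m i *\<^sub>R x)))"
          by (rule integral_norm_bound)
        also have "\<dots> \<le> (LINT x|?L. A i * indicator (cball 0 (1 / ?m i) \<inter> ?B) x)"
        proof (rule integral_mono)
          show "integrable ?L (\<lambda>x. norm (F (norm x) * \<zeta> (?m i *\<^sub>R x)))"
            by (rule integrable_norm[OF test_fun_pairing(1)[OF lF t]])
          show "norm (F (norm x) * \<zeta> (?m i *\<^sub>R x)) \<le> A i * indicator (cball 0 (1 / ?m i) \<inter> ?B) x" if "x \<in> space ?L" for x
            using b[of x i] that by (simp add: space_restrict_space indicator_def)
        qed (rule Ii)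
        also have "\<dots> = A i * measure ?L (cball 0 (1 / ?m i) \<inter> ?B)"
          using cb[of i] by (simp add: space_restrict_space)
        also have "\<dots> \<le> A i * (\<omega> / ?m i ^ ?n)"
          using C(1) c ab(1) H0[of "1 / ?m i"] by (intro mult_left_mono mi) (auto simp: A_def)
        also have "\<dots> = (C * \<omega> / (c * a ^ ?n)) * H (1 / ?m i)" by (simp add: A_def)
        finally show "norm (LINT x|?L. F (norm x) * \<zeta> (?m i *\<^sub>R x)) \<le> (C * \<omega> / (c * a ^ ?n)) * H (1 / ?m i)" .
      qed
      have "(\<lambda>i. H (1 / ?m i)) \<longlonglongrightarrow> H 0"
      proof (rule continuous_on_tendsto_compose[OF H(1)])
        show "(\<lambda>i. 1 / ?m i) \<longlonglongrightarrow> 0" by (rule LIMSEQ_inverse_real_of_nat[unfolded inverse_eq_divide])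
      qed auto
      from tendsto_mult_left[OF this, of "C * \<omega> / (c * a ^ ?n)"]
      show "(\<lambda>i. (C * \<omega> / (c * a ^ ?n)) * H (1 / ?m i)) \<longlonglongrightarrow> 0" by (simp add: H(2))
    qed
    have "(\<lambda>i. LINT x|?L. Z x * \<zeta> x) \<longlonglongrightarrow> 0"
      using tendsto_diff[OF lim1 lim2] by (simp only: split[symmetric]) simp
    then show "(LINT x|?L. Z x * \<zeta> x) = 0" by (simp add: LIMSEQ_const_iff)
  qed
  then show ?thesis by eventually_elim (simp add: Z_def W_def F_def c_def)
qed

text \<open>
  As the radial part of the gradient is nonnegative almost everywhere, it can be recovered from its
  \<open>k\<close>-th power, which has a continuous representative by the previous lemma.
\<close>

lemma weak_solution_profile:
  fixes u :: "real^'n \<Rightarrow> real" and G :: "real^'n \<Rightarrow> real^'n"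
  assumes k: "1 \<le> k" "2 * k < CARD('n)" and g: "continuous_on UNIV g" "\<And>t. 0 \<le> g t"
    and v: "continuous_on {0<..1} v" and uv: "\<And>x. x \<in> ball 0 1 \<Longrightarrow> u x = v (norm x)"
    and weak: "weak_radial_solution k g u G"
    and Gpos: "AE x in lebesgue_on (ball 0 1). G x \<bullet> x \<ge> 0"
  obtains z where "regular_profile CARD('n) k g v z" "AE x in lebesgue_on (ball 0 1). G x \<bullet> x = norm x * z (norm x)"
proof -
  let ?n = "CARD('n)" let ?B = "ball 0 1 :: (real^'n) set" let ?L = "lebesgue_on ?B"
  define c where "c = c_const ?n k"
  have c: "0 < c" unfolding c_def using k by (intro c_const_pos) auto
  have wg: "weak_gradient_on ?B u G" and gu: "integrable ?L (\<lambda>x. g (u x))"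
    using weak by (auto simp: weak_radial_solution_def)
  obtain H where H: "continuous_on {0..1} H" "H 0 = 0" "\<And>r s. 0 \<le> r \<Longrightarrow> r \<le> s \<Longrightarrow> s \<le> 1 \<Longrightarrow> H r \<le> H s"
    "\<And>r. r \<in> {0<..1} \<Longrightarrow> (H has_real_derivative r ^ (?n - 1) * g (v r)) (at r within {0<..1})"
    using weak_solution_integral_equation[OF k g v uv gu] by blast
  have flux: "AE x in ?L. ((G x \<bullet> x) / (norm x)\<^sup>2) ^ k = H (norm x) / (c * norm x ^ ?n)"
    unfolding c_def by (rule weak_solution_flux[OF k g(1) v uv weak H])
  define F where "F = (\<lambda>r. H r / (c * r ^ ?n))"
  have F0: "0 \<le> F r" if "0 \<le> r" "r \<le> 1" for r using H(3)[of 0 r] H(2) that c by (simp add: F_def)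
  define z where "z = (\<lambda>r. r * root k (F r))"
  have z0: "0 \<le> z r" if "r \<in> {0<..1}" for r
    using F0[of r] that k(1) by (simp add: z_def real_root_ge_zero)
  have cz: "continuous_on {0<..1} z"
    unfolding z_def F_def using c by (intro continuous_intros continuous_on_subset[OF H(1)]) auto
  have zk: "r ^ (?n - k) * z r ^ k = H r / c" if "r \<in> {0<..1}" for r
  proof -
    have "z r ^ k = r ^ k * F r"
      using F0[of r] that k(1) by (simp add: z_def power_mult_distrib real_root_pow_pos2)
    moreover have "r ^ (?n - k) * r ^ k = r ^ ?n" using k(2) by (simp add: power_add[symmetric])
    ultimately have "r ^ (?n - k) * z r ^ k = r ^ ?n * F r" by (simp add: mult.assoc[symmetric])
    then show ?thesis using that c by (simp add: F_def)
  qed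
  have Gz: "AE x in ?L. G x \<bullet> x = norm x * z (norm x)"
    using flux Gpos
  proof eventually_elim
    case (elim x)
    show ?case
    proof (cases "x = 0")
      case False
      let ?W = "(G x \<bullet> x) / (norm x)\<^sup>2"
      have "0 \<le> ?W" using elim by simp
      then have "?W = root k (?W ^ k)" using k(1) by (simp add: real_root_power_cancel)
      also have "\<dots> = root k (F (norm x))" using elim(1) by (simp add: F_def)
      finally have "G x \<bullet> x = (norm x)\<^sup>2 * root k (F (norm x))" using False by (simp add: field_simps)
      then show ?thesis by (simp add: z_def power2_eq_square)
    qed simp
  qed
  have "regular_profile ?n k g v z"
    unfolding regular_profile_def
  proof (intro conjI ballI)
    show "(v has_real_derivative z r) (at r within {0<..1})" if "r \<in> {0<..1}" for r
      by (rule profile_derivative[OF wg uv v cz Gz that])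
    show "((\<lambda>r. r ^ (?n - k) * z r ^ k) has_real_derivative r ^ (?n - 1) * g (v r) / c_const ?n k) (at r within {0<..1})"
      if r: "r \<in> {0<..1}" for r
    proof -
      have "((\<lambda>r. H r / c) has_real_derivative r ^ (?n - 1) * g (v r) / c) (at r within {0<..1})"
        by (rule DERIV_cdivide[OF H(4)[OF r]])
      then show ?thesis unfolding c_def[symmetric]
        by (rule has_field_derivative_transform_within[of _ _ _ _ 1]) (use zk r in auto)
    qed
    show "((\<lambda>r. r ^ (?n - k) * z r ^ k) \<longlongrightarrow> 0) (at_right 0)"
    proof -
      have "(H \<longlongrightarrow> H 0) (at 0 within {0..1})" using H(1) by (auto simp: continuous_on_def)
      then have "(H \<longlongrightarrow> H 0) (at 0 within {0<..1})" by (rule tendsto_within_subset) auto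
      moreover have "at 0 within {0<..1::real} = at_right 0"
        by (rule at_within_nhd[where S = "{..<1}"]) auto
      ultimately have "((\<lambda>r. H r / c) \<longlongrightarrow> 0) (at_right 0)" by (simp add: H(2) tendsto_divide_zero)
      moreover have "\<forall>\<^sub>F r in at_right 0. r \<in> {0<..1::real}"
        unfolding eventually_at_right_field by (intro exI[of _ 1]) auto
      then have "\<forall>\<^sub>F r in at_right 0. H r / c = r ^ (?n - k) * z r ^ k"
        by eventually_elim (simp add: zk)
      ultimately show ?thesis by (rule Lim_transform_eventually)
    qed
  qed (use z0 cz in auto)
  then show ?thesis using Gz by (rule that)
qed

lemma tendsto_power_mult_bounded:
  fixes f :: "real \<Rightarrow> real"
  assumes "0 < m" "\<And>r. 0 < r \<Longrightarrow> r < 1/2 \<Longrightarrow> \<bar>f r\<bar> \<le> C"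
  shows "((\<lambda>r. r ^ m * f r) \<longlongrightarrow> 0) (at_right 0)"
proof (rule Lim_null_comparison)
  have "((\<lambda>r::real. r ^ m * C) \<longlongrightarrow> 0 ^ m * C) (at_right 0)" by (intro tendsto_intros)
  then show "((\<lambda>r::real. r ^ m * C) \<longlongrightarrow> 0) (at_right 0)" using assms(1) by (simp add: zero_power)
  have "\<forall>\<^sub>F r in at_right 0. 0 < r \<and> r < (1/2::real)"
    unfolding eventually_at_right_field by (intro exI[of _ "1/2"]) auto
  then show "\<forall>\<^sub>F r in at_right 0. norm (r ^ m * f r) \<le> r ^ m * C"
    by eventually_elim (use assms(2) in \<open>auto simp: abs_mult intro!: mult_left_mono\<close>)
qed

text \<open>
  The condition \<open>\<sigma>\<^sub>1 > 0\<close> forces \<open>z \<ge> 0\<close>: it says that \<open>r\<^sup>n\<^sup>-\<^sup>1 z\<close>, which tends to \<open>0\<close> at the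
  origin, is increasing.
\<close>

lemma classical_solution_ode:
  fixes u :: "real^'n \<Rightarrow> real"
  assumes k: "1 \<le> k" "k < CARD('n)"
    and uv: "\<And>x. x \<in> ball 0 1 \<Longrightarrow> u x = v (norm x)" and sol: "classical_solution k g u"
  obtains z C where "\<And>r. 0 < r \<Longrightarrow> r < 1 \<Longrightarrow> (v has_real_derivative z r) (at r)"
    "\<And>r. 0 < r \<Longrightarrow> r < 1 \<Longrightarrow> 0 \<le> z r" "\<And>r. 0 < r \<Longrightarrow> r < 1/2 \<Longrightarrow> \<bar>z r\<bar> \<le> C" "continuous_on {0<..<1} z"
    "\<And>r. 0 < r \<Longrightarrow> r < 1 \<Longrightarrow> ((\<lambda>r. r ^ (CARD('n) - k) * z r ^ k) has_real_derivative r ^ (CARD('n) - 1) * g (v r) / c_const CARD('n) k) (at r)"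
proof -
  let ?n = "CARD('n)" let ?B = "ball 0 1 :: (real^'n) set"
  have C1: "C1_on ?B u" and C2: "\<And>i. C1_on ?B (pdiff i u)"
    using sol by (auto simp: classical_solution_def C2_on_def)
  obtain e :: "real^'n" where e: "norm e = 1" using vector_choose_size[of 1] by auto
  define z where "z = (\<lambda>r. \<Sum>i\<in>UNIV. pdiff i u (r *\<^sub>R e) * e $ i)"
  define z1 where "z1 = (\<lambda>r. \<Sum>i\<in>UNIV. (gradient (pdiff i u) (r *\<^sub>R e) \<bullet> e) * e $ i)"
  have inB: "r *\<^sub>R e \<in> ?B" if "0 < r" "r < 1" for r using that e by simp
  have line: "((\<lambda>r. f (r *\<^sub>R e)) has_real_derivative gradient f (r *\<^sub>R e) \<bullet> e) (at r)"
    if "C1_on ?B f" "0 < r" "r < 1" for f r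
  proof -
    have "((\<lambda>r. r *\<^sub>R e) has_derivative (\<lambda>h. h *\<^sub>R e)) (at r)" by (auto intro!: derivative_eq_intros)
    from has_derivative_compose[OF this C1_on_has_derivative[OF that(1) open_ball inB[OF that(2,3)]]]
    show ?thesis unfolding has_field_derivative_def by (rule has_derivative_eq_rhs) (auto simp: mult.commute)
  qed
  have vz: "(v has_real_derivative z r) (at r)" if r: "0 < r" "r < 1" for r
  proof -
    have "gradient u (r *\<^sub>R e) \<bullet> e = z r" by (simp add: z_def inner_vec_def gradient_def)
    then have "((\<lambda>r. u (r *\<^sub>R e)) has_real_derivative z r) (at r)" using line[OF C1 r] by simp
    then show ?thesis
      by (rule has_field_derivative_transform_within_open[where S = "{0<..<1}"]) (use r e uv inB in auto)
  qed
  have zz: "(z has_real_derivative z1 r) (at r)" if r: "0 < r" "r < 1" for r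
    unfolding z_def z1_def by (intro DERIV_sum DERIV_cmult_right line C2 r)
  have cz: "continuous_on {0<..<1} z"
    by (intro continuous_at_imp_continuous_on ballI) (auto intro!: DERIV_isCont zz)
  have Hess: "hess_op j (hessian u (r *\<^sub>R e))
      = c_const ?n j * (real j * (z r / r) ^ (j - 1) * z1 r + (real ?n - real j) * (z r / r) ^ j)"
    if r: "0 < r" "r < 1" and j: "1 \<le> j" "j \<le> ?n" for r j
  proof -
    let ?x = "r *\<^sub>R e"
    have x: "norm ?x = r" "?x \<noteq> 0" using r e by auto
    have "hessian u ?x = (\<chi> i j. (if i = j then z (norm ?x) / norm ?x else 0)
            + (z1 r - z (norm ?x) / norm ?x) * (?x $ i * ?x $ j) / (norm ?x)\<^sup>2)"
      by (rule hessian_radial[where T = "{0<..<1}" and S = ?B]) (use x r uv vz zz inB in \<open>auto simp del: norm_scaleR\<close>)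
    then show ?thesis using hess_op_radial[OF x(2) j] by (simp only: x(1))
  qed
  have "bounded (gradient u ` cball 0 (1/2))"
    by (intro compact_imp_bounded compact_continuous_image continuous_on_subset[OF C1_on_continuous_gradient[OF C1]]) auto
  then obtain C where C: "\<And>x. x \<in> cball 0 (1/2) \<Longrightarrow> norm (gradient u x) \<le> C" unfolding bounded_iff by blast
  have zC: "\<bar>z r\<bar> \<le> C" if "0 < r" "r < 1/2" for r
  proof -
    have "z r = gradient u (r *\<^sub>R e) \<bullet> e" by (simp add: z_def inner_vec_def gradient_def)
    also have "\<bar>\<dots>\<bar> \<le> norm (gradient u (r *\<^sub>R e)) * norm e" by (rule Cauchy_Schwarz_ineq2)
    finally show ?thesis using C[of "r *\<^sub>R e"] that e by simp
  qed
  have n2: "2 \<le> ?n" using k by simp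
  define N where "N = (\<lambda>r. r ^ (?n - 1) * z r)"
  have dN: "\<exists>y>0. (N has_real_derivative y) (at r)" if r: "0 < r" "r < 1" for r
  proof -
    obtain m where m: "?n = Suc (Suc m)" using n2 by (metis Suc_le_D numeral_2_eq_2 Suc_le_mono)
    have "0 < hess_op 1 (hessian u (r *\<^sub>R e))"
      using sol inB[OF r] k by (auto simp: classical_solution_def)
    then have "0 < c_const ?n 1 * (z1 r + (real ?n - 1) * (z r / r))" using Hess[OF r, of 1] n2 by simp
    then have "0 < z1 r + (real ?n - 1) * (z r / r)" using c_const_pos[of 1 ?n] n2 by (simp add: zero_less_mult_iff)
    then have "0 < r ^ (?n - 1) * (z1 r + (real ?n - 1) * (z r / r))" using r by simp
    moreover have "(N has_real_derivative r ^ (?n - 1) * (z1 r + (real ?n - 1) * (z r / r))) (at r)"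
      unfolding N_def m diff_Suc_1
      by (rule DERIV_cong[OF DERIV_mult[OF DERIV_pow[of "Suc m" r] zz[OF r]]]) (use r in \<open>simp add: field_simps\<close>)
    ultimately show ?thesis by blast
  qed
  have N0: "(N \<longlongrightarrow> 0) (at_right 0)"
    unfolding N_def by (rule tendsto_power_mult_bounded[of _ _ C]) (use n2 zC in auto)
  have zpos: "0 \<le> z r" if r: "0 < r" "r < 1" for r
  proof -
    have mono: "N s \<le> N r" if "0 < s" "s < r" for s
    proof (rule less_imp_le[OF DERIV_pos_imp_increasing[OF that(2)]])
      fix x assume "s \<le> x" "x \<le> r"
      then have "0 < x" "x < 1" using that r by auto
      from dN[OF this] show "\<exists>y. (N has_real_derivative y) (at x) \<and> 0 < y" by blast
    qed
    have "\<forall>\<^sub>F s in at_right 0. N s \<le> N r"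
      unfolding eventually_at_right_field using mono r by (intro exI[of _ r]) auto
    then have "0 \<le> N r" using tendsto_upperbound[OF N0, of "N r"] by simp
    moreover have "0 < r ^ (?n - 1)" using r by simp
    ultimately show ?thesis unfolding N_def by (simp only: zero_le_mult_iff not_le) linarith
  qed
  have dM: "((\<lambda>r. r ^ (?n - k) * z r ^ k) has_real_derivative r ^ (?n - 1) * g (v r) / c_const ?n k) (at r)"
    if r: "0 < r" "r < 1" for r
  proof -
    obtain m where m: "?n - k = Suc m" using k by (metis Suc_diff_Suc)
    obtain j where j: "k = Suc j" using k by (cases k) auto
    have nn: "?n - 1 = m + k" "real ?n - real k = real (Suc m)" using m k by auto
    have "hess_op k (hessian u (r *\<^sub>R e)) = g (v r)"
      using sol inB[OF r] uv[OF inB[OF r]] e r by (auto simp: classical_solution_def)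
    then have "g (v r) = c_const ?n k * (real k * (z r / r) ^ (k - 1) * z1 r + (real ?n - real k) * (z r / r) ^ k)"
      using Hess[OF r k(1)] k(2) by simp
    then have "g (v r) / c_const ?n k = real k * (z r / r) ^ (k - 1) * z1 r + (real ?n - real k) * (z r / r) ^ k"
      using c_const_pos[OF k(1), of ?n] k(2) by simp
    then have eq: "g (v r) / c_const ?n k = real k * (z r / r) ^ j * z1 r + real (Suc m) * (z r / r) ^ k"
      by (simp only: nn(2)) (simp only: j diff_Suc_1)
    have d1: "((\<lambda>r. r ^ Suc m) has_real_derivative real (Suc m) * r ^ m) (at r)"
      using DERIV_pow[of "Suc m" r] by simp
    have d2: "((\<lambda>r. z r ^ k) has_real_derivative real k * z r ^ j * z1 r) (at r)"
      using DERIV_power[OF zz[OF r], of k] by (simp add: j mult.commute mult.left_commute)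
    have "real (Suc m) * r ^ m * z r ^ k + real k * z r ^ j * z1 r * r ^ Suc m = r ^ (m + k) * (g (v r) / c_const ?n k)"
      unfolding eq using r by (simp add: j power_add power_divide field_simps)
    then show ?thesis unfolding m nn(1) using DERIV_mult[OF d1 d2] by (simp add: mult.assoc)
  qed
  show ?thesis by (rule that[OF vz zpos zC cz dM])
qed

text \<open>
  A classical solution is \<open>C\<^sup>2\<close> in the open ball only. Regularity up to \<open>r = 1\<close> comes from the
  equation, since its right-hand side is continuous on \<open>{0<..1}\<close> and has a primitive there.
\<close>

lemma classical_solution_profile:
  fixes u :: "real^'n \<Rightarrow> real" and G :: "real^'n \<Rightarrow> real^'n"
  assumes k: "1 \<le> k" "k < CARD('n)" and g: "continuous_on UNIV g"
    and v: "continuous_on {0<..1} v" and uv: "\<And>x. x \<in> ball 0 1 \<Longrightarrow> u x = v (norm x)"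
    and sol: "classical_solution k g u" and wg: "weak_gradient_on (ball 0 1) u G"
  obtains z where "regular_profile CARD('n) k g v z" "AE x in lebesgue_on (ball 0 1). G x \<bullet> x = norm x * z (norm x)"
proof -
  let ?n = "CARD('n)"
  define c where "c = c_const ?n k"
  have c: "0 < c" unfolding c_def using k by (intro c_const_pos) auto
  obtain w C where w: "\<And>r. 0 < r \<Longrightarrow> r < 1 \<Longrightarrow> (v has_real_derivative w r) (at r)"
    "\<And>r. 0 < r \<Longrightarrow> r < 1 \<Longrightarrow> 0 \<le> w r" "\<And>r. 0 < r \<Longrightarrow> r < 1/2 \<Longrightarrow> \<bar>w r\<bar> \<le> C" "continuous_on {0<..<1} w"
    "\<And>r. 0 < r \<Longrightarrow> r < 1 \<Longrightarrow> ((\<lambda>r. r ^ (?n - k) * w r ^ k) has_real_derivative r ^ (?n - 1) * g (v r) / c) (at r)"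
    unfolding c_def using classical_solution_ode[OF k uv sol] by blast
  have "continuous_on {0<..1} (\<lambda>r. r ^ (?n - 1) * g (v r) / c)"
    using c by (intro continuous_intros continuous_on_compose2[OF g v]) auto
  then obtain A where A: "\<And>r. r \<in> {0<..1} \<Longrightarrow> (A has_real_derivative r ^ (?n - 1) * g (v r) / c) (at r within {0<..1})"
    using antiderivative_Ioc by blast
  have "\<exists>\<kappa>. \<forall>r\<in>{0<..<1}. r ^ (?n - k) * w r ^ k - A r = \<kappa>"
  proof (rule has_field_derivative_zero_constant)
    fix r :: real assume r: "r \<in> {0<..<1}"
    then have "(A has_real_derivative r ^ (?n - 1) * g (v r) / c) (at r)"
      using A[of r] by (simp add: at_within_Ioc)
    from DERIV_diff[OF w(5) this] r show "((\<lambda>r. r ^ (?n - k) * w r ^ k - A r) has_real_derivative 0) (at r within {0<..<1})"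
      by (auto intro: has_field_derivative_at_within)
  qed auto
  then obtain \<kappa> where \<kappa>: "\<And>r. 0 < r \<Longrightarrow> r < 1 \<Longrightarrow> r ^ (?n - k) * w r ^ k - A r = \<kappa>" by auto
  define M where "M = (\<lambda>r. A r + \<kappa>)"
  have Mw: "M r = r ^ (?n - k) * w r ^ k" if "0 < r" "r < 1" for r using \<kappa>[OF that] by (simp add: M_def)
  have dM: "(M has_real_derivative r ^ (?n - 1) * g (v r) / c) (at r within {0<..1})" if "r \<in> {0<..1}" for r
    unfolding M_def using A[OF that] by (auto intro!: derivative_eq_intros)
  have cM: "continuous_on {0<..1} M" by (rule continuous_on_Ioc_of_derivative[OF dM])
  have M0: "0 \<le> M r" if "r \<in> {0<..1}" for r
  proof (cases "r = 1")
    case True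
    have "(M \<longlongrightarrow> M 1) (at 1 within {0<..1})" using cM by (auto simp: continuous_on_def)
    then have l: "(M \<longlongrightarrow> M 1) (at 1 within {0<..<1})" by (rule tendsto_within_subset) auto
    have "\<forall>\<^sub>F s in at 1 within {0<..<1}. 0 \<le> M s"
      using Mw w(2) by (auto simp: eventually_at_filter)
    moreover have "at 1 within {0<..<1::real} \<noteq> bot" by (simp add: at_within_eq_bot_iff)
    ultimately show ?thesis using tendsto_lowerbound[OF l] True by blast
  next
    case False then show ?thesis using Mw[of r] w(2)[of r] that by simp
  qed
  define z where "z = (\<lambda>r. root k (M r / r ^ (?n - k)))"
  have zw: "z r = w r" if "0 < r" "r < 1" for r
    using Mw[OF that] w(2)[OF that] that k(1) by (simp add: z_def real_root_power_cancel)
  have z0: "0 \<le> z r" if "r \<in> {0<..1}" for r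
    using M0[OF that] that k(1) by (simp add: z_def real_root_ge_zero)
  have cz: "continuous_on {0<..1} z" unfolding z_def by (intro continuous_intros cM) auto
  have zk: "r ^ (?n - k) * z r ^ k = M r" if "r \<in> {0<..1}" for r
    using M0[OF that] that k(1) by (simp add: z_def real_root_pow_pos2)
  have vz: "(v has_real_derivative z r) (at r)" if "0 < r" "r < 1" for r using w(1)[OF that] zw[OF that] by simp
  have Gz: "AE x in lebesgue_on (ball 0 1). G x \<bullet> x = norm x * z (norm x)"
    by (rule weak_gradient_of_C1_radial[OF wg uv vz continuous_on_subset[OF cz]]) auto
  have "regular_profile ?n k g v z"
    unfolding regular_profile_def
  proof (intro conjI ballI)
    show "(v has_real_derivative z r) (at r within {0<..1})" if "r \<in> {0<..1}" for r
      by (rule profile_derivative[OF wg uv v cz Gz that])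
    show "((\<lambda>r. r ^ (?n - k) * z r ^ k) has_real_derivative r ^ (?n - 1) * g (v r) / c_const ?n k) (at r within {0<..1})"
      if r: "r \<in> {0<..1}" for r
      using dM[OF r] unfolding c_def[symmetric]
      by (rule has_field_derivative_transform_within[of _ _ _ _ 1]) (use zk r in auto)
    show "((\<lambda>r. r ^ (?n - k) * z r ^ k) \<longlongrightarrow> 0) (at_right 0)"
    proof (rule tendsto_power_mult_bounded[of _ _ "C ^ k"])
      show "\<bar>z r ^ k\<bar> \<le> C ^ k" if "0 < r" "r < 1/2" for r
        using w(3)[OF that] that zw[of r] by (simp add: power_abs power_mono)
    qed (use k in simp)
  qed (use z0 cz in auto)
  then show ?thesis using Gz by (rule that)
qed

section \<open>Lipschitz functions of one real variable\<close>

text \<open>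
  A Vitali covering of \<open>E\<close> by short intervals on which \<open>h\<close> has slope at most \<open>p\<close> is mapped to intervals
  that cover \<open>h ` E\<close> up to a null set and are shorter by the factor \<open>p\<close>.
\<close>

lemma measure_image_le_slope:
  fixes h :: "real \<Rightarrow> real"
  assumes h: "strict_mono h" "L-lipschitz_on UNIV h" and E: "E \<in> lmeasurable" "h ` E \<in> lmeasurable" and p: "0 \<le> p"
    and slope: "\<And>x \<delta>. x \<in> E \<Longrightarrow> 0 < \<delta> \<Longrightarrow> \<exists>c d. c < d \<and> c \<le> x \<and> x \<le> d \<and> d - c < \<delta> \<and> h d - h c \<le> p * (d - c)"
  shows "measure lebesgue (h ` E) \<le> p * measure lebesgue E"
proof (rule field_le_epsilon)
  fix \<epsilon> :: real assume \<epsilon>: "0 < \<epsilon>"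
  (* Dividing by p + 1 instead of p covers the case p = 0. *)
  obtain U where U: "open U" "E \<subseteq> U" "U \<in> lmeasurable" "measure lebesgue U < measure lebesgue E + \<epsilon> / (p + 1)"
  proof -
    have "0 < \<epsilon> / (p + 1)" using \<epsilon> p by simp
    then obtain U where "open U" "E \<subseteq> U" "(U - E) \<in> lmeasurable" "emeasure lebesgue (U - E) < ennreal (\<epsilon> / (p + 1))"
      using sets_lebesgue_outer_open[of E "\<epsilon> / (p + 1)"] E(1) by (auto simp: fmeasurableD)
    moreover from this have "U \<in> lmeasurable"
      using E(1) fmeasurable.Un[of E lebesgue "U - E"] by (simp add: Un_absorb1)
    moreover from calculation have "measure lebesgue U = measure lebesgue E + measure lebesgue (U - E)"
      using E(1) measure_Un2[of E lebesgue "U - E"] by (simp add: Un_absorb1 Diff_idemp)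
    moreover have "measure lebesgue (U - E) < \<epsilon> / (p + 1)"
      using \<open>emeasure lebesgue (U - E) < ennreal (\<epsilon> / (p + 1))\<close> \<open>(U - E) \<in> lmeasurable\<close>
      by (simp add: emeasure_eq_measure2 ennreal_less_iff)
    ultimately show ?thesis by (intro that[of U]) auto
  qed
  define K where "K = {(c, d). c < d \<and> {c..d} \<subseteq> U \<and> h d - h c \<le> p * (d - c)}"
  define m where "m = (\<lambda>(c, d). (c + d) / 2 :: real)"
  define r where "r = (\<lambda>(c, d). (d - c) / 2 :: real)"
  have cb: "cball (m (c, d)) (r (c, d)) = {c..d}" for c d
    by (auto simp: m_def r_def cball_def dist_real_def abs_le_iff field_simps)
  obtain C where C: "countable C" "C \<subseteq> K" "pairwise (\<lambda>i j. disjnt (cball (m i) (r i)) (cball (m j) (r j))) C"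
    "negligible (E - (\<Union>i\<in>C. cball (m i) (r i)))"
  proof (rule Vitali_covering_theorem_cballs[of K r E m])
    show "0 < r i" if "i \<in> K" for i using that by (auto simp: K_def r_def)
    show "\<exists>i. i \<in> K \<and> x \<in> cball (m i) (r i) \<and> r i < d" if x: "x \<in> E" and d: "0 < d" for x d
    proof -
      obtain \<eta> where \<eta>: "0 < \<eta>" "ball x \<eta> \<subseteq> U" using U(1,2) x openE by blast
      obtain c e where ce: "c < e" "c \<le> x" "x \<le> e" "e - c < min \<eta> d" "h e - h c \<le> p * (e - c)"
        using slope[OF x, of "min \<eta> d"] \<eta> d by auto
      have "{c..e} \<subseteq> ball x \<eta>" using ce by (auto simp: dist_real_def)
      then have "(c, e) \<in> K" using ce \<eta> by (auto simp: K_def)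
      moreover have "r (c, e) < d" using ce by (simp add: r_def)
      ultimately show ?thesis using cb[of c e] ce by (intro exI[of _ "(c, e)"]) auto
    qed
  qed
  define I where "I = (\<lambda>i::real \<times> real. {fst i..snd i})"
  define J where "J = (\<lambda>i::real \<times> real. {h (fst i)..h (snd i)})"
  have cbI: "cball (m i) (r i) = I i" for i using cb[of "fst i" "snd i"] by (simp add: I_def)
  have CK: "fst i < snd i" "I i \<subseteq> U" "h (snd i) - h (fst i) \<le> p * (snd i - fst i)" if "i \<in> C" for i
  proof -
    have "i \<in> K" using that C(2) by blast
    then show "fst i < snd i" "I i \<subseteq> U" "h (snd i) - h (fst i) \<le> p * (snd i - fst i)"
      by (cases i; auto simp: K_def I_def)+
  qed
  have disI: "disjoint_family_on I C"
    using C(3) by (auto simp: disjoint_family_on_def pairwise_def disjnt_def cbI)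
  have disJ: "disjoint_family_on J C"
    unfolding disjoint_family_on_def
  proof (intro ballI impI)
    fix i j assume ij: "i \<in> C" "j \<in> C" "i \<noteq> j"
    then have "I i \<inter> I j = {}" using disI by (auto simp: disjoint_family_on_def)
    then have "snd i < fst j \<or> snd j < fst i" using CK(1)[OF ij(1)] CK(1)[OF ij(2)]
      by (auto simp: I_def not_less[symmetric])
    then have "h (snd i) < h (fst j) \<or> h (snd j) < h (fst i)" using h(1) by (auto simp: strict_mono_less)
    then show "J i \<inter> J j = {}" by (auto simp: J_def)
  qed
  let ?N = "E - (\<Union>i\<in>C. I i)"
  have "negligible (h ` ?N)"
  proof (rule negligible_locally_Lipschitz_image)
    show "negligible ?N" using C(4) by (simp add: cbI)
    show "\<exists>T B. open T \<and> x \<in> T \<and> (\<forall>y\<in>?N \<inter> T. norm (h y - h x) \<le> B * norm (y - x))" for x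
      using lipschitz_onD[OF h(2)] by (intro exI[of _ UNIV] exI[of _ L]) (auto simp: dist_norm)
  qed simp
  then have N0: "h ` ?N \<in> null_sets lebesgue" by (simp only: negligible_iff_null_sets)
  have msets: "(\<Union>i\<in>C. J i) \<in> sets lebesgue" "(\<Union>i\<in>C. I i) \<in> sets lebesgue"
    using C(1) by (auto intro!: sets.countable_UN' simp: I_def J_def)
  have sub: "h ` E \<subseteq> h ` ?N \<union> (\<Union>i\<in>C. J i)"
  proof
    fix y assume "y \<in> h ` E"
    then obtain x where x: "x \<in> E" "y = h x" by auto
    show "y \<in> h ` ?N \<union> (\<Union>i\<in>C. J i)"
    proof (cases "x \<in> (\<Union>i\<in>C. I i)")
      case True
      then obtain i where "i \<in> C" "fst i \<le> x" "x \<le> snd i" by (auto simp: I_def)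
      then have "y \<in> J i" using h(1) x(2) by (auto simp: J_def strict_mono_less_eq)
      then show ?thesis using \<open>i \<in> C\<close> by auto
    qed (use x in auto)
  qed
  have "emeasure lebesgue (h ` E) \<le> emeasure lebesgue (h ` ?N \<union> (\<Union>i\<in>C. J i))"
    using sub msets N0 by (intro emeasure_mono) auto
  also have "\<dots> \<le> emeasure lebesgue (\<Union>i\<in>C. J i)"
    using emeasure_Un_null_set[OF msets(1) N0] by (simp add: Un_commute)
  also have "\<dots> = (\<integral>\<^sup>+i. emeasure lebesgue (J i) \<partial>count_space C)"
    by (rule emeasure_UN_countable[OF _ C(1) disJ]) (simp add: J_def)
  also have "\<dots> \<le> (\<integral>\<^sup>+i. ennreal p * emeasure lebesgue (I i) \<partial>count_space C)"
  proof (rule nn_integral_mono)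
    fix i assume "i \<in> space (count_space C)"
    then have i: "i \<in> C" by simp
    then have "h (fst i) \<le> h (snd i)" using CK(1) h(1) by (simp add: strict_mono_less_eq less_imp_le)
    then show "emeasure lebesgue (J i) \<le> ennreal p * emeasure lebesgue (I i)"
      using CK(1,3)[OF i] p by (simp add: I_def J_def ennreal_mult[symmetric] ennreal_leI)
  qed
  also have "\<dots> = ennreal p * (\<integral>\<^sup>+i. emeasure lebesgue (I i) \<partial>count_space C)" by (rule nn_integral_cmult) simp
  also have "(\<integral>\<^sup>+i. emeasure lebesgue (I i) \<partial>count_space C) = emeasure lebesgue (\<Union>i\<in>C. I i)"
    by (rule emeasure_UN_countable[OF _ C(1) disI, symmetric]) (simp add: I_def)
  also have "ennreal p * emeasure lebesgue (\<Union>i\<in>C. I i) \<le> ennreal p * emeasure lebesgue U"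
    using CK(2) U(3) by (intro mult_left_mono emeasure_mono) auto
  also have "\<dots> = ennreal (p * measure lebesgue U)"
    using U(3) p by (simp add: emeasure_eq_measure2 ennreal_mult)
  finally have "measure lebesgue (h ` E) \<le> p * measure lebesgue U"
    using E(2) p by (simp add: emeasure_eq_measure2)
  also have "\<dots> \<le> p * (measure lebesgue E + \<epsilon> / (p + 1))" using U(4) p by (intro mult_left_mono) auto
  also have "\<dots> \<le> p * measure lebesgue E + \<epsilon>" using p \<epsilon> by (simp add: field_simps)
  finally show "measure lebesgue (h ` E) \<le> p * measure lebesgue E + \<epsilon>" .
qed

text \<open>A bounded function has a limit as soon as no two rational levels are both crossed frequently.\<close>

lemma bounded_limit_exists:
  fixes f :: "real \<Rightarrow> real"
  assumes F: "F \<noteq> bot" and b: "\<forall>\<^sub>F h in F. a \<le> f h \<and> f h \<le> b"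
    and cross: "\<And>p q::rat. p < q \<Longrightarrow> \<not> ((\<exists>\<^sub>F h in F. f h < of_rat p) \<and> (\<exists>\<^sub>F h in F. of_rat q < f h))"
  shows "\<exists>D. (f \<longlongrightarrow> D) F"
proof -
  define S where "S = {p. \<forall>\<^sub>F h in F. p \<le> f h}"
  have aS: "a \<in> S" using b by (auto simp: S_def elim: eventually_mono)
  have Sb: "p \<le> b" if "p \<in> S" for p
  proof -
    have "\<forall>\<^sub>F h in F. p \<le> f h" using that by (simp add: S_def)
    then have "\<forall>\<^sub>F h in F. p \<le> b" using b by eventually_elim auto
    then show ?thesis using F by simp
  qed
  define D where "D = Sup S"
  have bdd: "bdd_above S" using Sb by (auto simp: bdd_above_def)
  have "(f \<longlongrightarrow> D) F"
  proof (rule order_tendstoI)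
    fix y assume "y < D"
    then obtain p where p: "p \<in> S" "y < p" unfolding D_def using less_cSup_iff[of S y] aS bdd by auto
    then have "\<forall>\<^sub>F h in F. p \<le> f h" by (simp add: S_def)
    then show "\<forall>\<^sub>F h in F. y < f h" by eventually_elim (use p in auto)
  next
    fix y assume "D < y"
    then obtain q :: rat where q: "D < of_rat q" "of_rat q < y" using of_rat_dense by blast
    then obtain p :: rat where p: "D < of_rat p" "of_rat p < (of_rat q :: real)" using of_rat_dense by blast
    have "of_rat p \<notin> S" using p(1) cSup_upper[OF _ bdd] unfolding D_def by force
    then have "\<exists>\<^sub>F h in F. f h < of_rat p" by (simp add: S_def frequently_def not_less)
    then have "\<not> (\<exists>\<^sub>F h in F. of_rat q < f h)" using cross[of p q] p(2) by (simp add: of_rat_less)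
    then have "\<forall>\<^sub>F h in F. f h \<le> of_rat q" by (simp add: frequently_def not_less)
    then show "\<forall>\<^sub>F h in F. f h < y" by eventually_elim (use q in auto)
  qed
  then show ?thesis by blast
qed

lemma open_exists_quotient:
  fixes \<phi> :: "real \<Rightarrow> real"
  assumes "continuous_on UNIV \<phi>" "open T"
  shows "open {x. \<exists>h. P h \<and> (\<phi> (x + h) - \<phi> x) / h \<in> T}"
proof -
  have "{x. \<exists>h. P h \<and> (\<phi> (x + h) - \<phi> x) / h \<in> T} = (\<Union>h\<in>{h. P h}. (\<lambda>x. (\<phi> (x + h) - \<phi> x) / h) -` T)" by auto
  moreover have "open ((\<lambda>x. (\<phi> (x + h) - \<phi> x) / h) -` T)" for h
    by (rule open_vimage[OF assms(2)]) (unfold divide_inverse, intro continuous_intros continuous_on_compose2[OF assms(1)], auto)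
  ultimately show ?thesis by auto
qed

text \<open>
  The condition holds at \<open>x\<close> if it is met for some \<open>h\<close> with \<open>0 < \<bar>h\<bar> < 1/i\<close>, for every \<open>i\<close>; each of
  these sets is open.
\<close>

lemma borel_frequent_quotient:
  fixes \<phi> :: "real \<Rightarrow> real"
  assumes "continuous_on UNIV \<phi>" "open T"
  shows "{x. \<exists>\<^sub>F h in at 0. (\<phi> (x + h) - \<phi> x) / h \<in> T} \<in> sets borel"
proof -
  have eq: "(\<exists>\<^sub>F h in at 0. Q h) \<longleftrightarrow> (\<forall>m. \<exists>h. (h \<noteq> 0 \<and> \<bar>h\<bar> < 1 / real (Suc m)) \<and> Q h)" for Q :: "real \<Rightarrow> bool"
  proof
    assume "\<exists>\<^sub>F h in at 0. Q h"
    then show "\<forall>m. \<exists>h. (h \<noteq> 0 \<and> \<bar>h\<bar> < 1 / real (Suc m)) \<and> Q h"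
      unfolding frequently_at by (metis UNIV_I dist_real_def diff_zero zero_less_divide_1_iff of_nat_0_less_iff zero_less_Suc)
  next
    assume *: "\<forall>m. \<exists>h. (h \<noteq> 0 \<and> \<bar>h\<bar> < 1 / real (Suc m)) \<and> Q h"
    show "\<exists>\<^sub>F h in at 0. Q h"
      unfolding frequently_at
    proof (intro allI impI)
      fix d :: real assume "0 < d"
      then obtain m where "1 / real (Suc m) < d" using reals_Archimedean by (auto simp: inverse_eq_divide)
      moreover obtain h where "h \<noteq> 0" "\<bar>h\<bar> < 1 / real (Suc m)" "Q h" using * by blast
      ultimately show "\<exists>x\<in>UNIV. x \<noteq> 0 \<and> dist x 0 < d \<and> Q x" by (intro bexI[of _ h]) auto
    qed
  qed
  have "{x. \<exists>\<^sub>F h in at 0. (\<phi> (x + h) - \<phi> x) / h \<in> T}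
      = (\<Inter>m. {x. \<exists>h. (h \<noteq> 0 \<and> \<bar>h\<bar> < 1 / real (Suc m)) \<and> (\<phi> (x + h) - \<phi> x) / h \<in> T})"
    unfolding eq by auto
  also have "\<dots> \<in> sets borel"
  proof -
    define S where "S = (\<lambda>m. {x. \<exists>h. (h \<noteq> 0 \<and> \<bar>h\<bar> < 1 / real (Suc m)) \<and> (\<phi> (x + h) - \<phi> x) / h \<in> T})"
    have "S m \<in> sets borel" for m
      unfolding S_def by (rule borel_open[OF open_exists_quotient[OF assms]])
    then have "(\<Inter>m. S m) \<in> sets borel" by (intro sets.countable_INT) auto
    then show ?thesis by (simp only: S_def)
  qed
  finally show ?thesis .
qed

lemma frequently_quotient_interval:
  fixes \<phi> :: "real \<Rightarrow> real"
  assumes "\<exists>\<^sub>F h in at 0. Q ((\<phi> (x + h) - \<phi> x) / h)" "0 < \<delta>"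
  obtains c d where "c < d" "c \<le> x" "x \<le> d" "d - c < \<delta>" "Q ((\<phi> d - \<phi> c) / (d - c))"
proof -
  obtain h where h: "h \<noteq> 0" "\<bar>h\<bar> < \<delta>" "Q ((\<phi> (x + h) - \<phi> x) / h)"
    using assms unfolding frequently_at by (auto simp: dist_real_def)
  show ?thesis
  proof (cases "0 < h")
    case True then show ?thesis using h that[of x "x + h"] by simp
  next
    case False
    moreover have "(\<phi> (x + h) - \<phi> x) / h = (\<phi> x - \<phi> (x + h)) / (x - (x + h))"
      using h(1) by (simp add: field_simps)
    ultimately show ?thesis using h that[of "x + h" x] by simp
  qed
qed

text \<open>
  On the set where difference quotients both below \<open>p\<close> and above \<open>q > p\<close> occur at all scales, the
  covering estimate applies to \<open>\<phi>\<close> with slope \<open>p\<close> and to its inverse with slope \<open>1/q\<close>, which gives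
  \<open>q \<mu>(E) \<le> \<mu>(\<phi> ` E) \<le> p \<mu>(E)\<close>.
\<close>

lemma bilipschitz_crossing_negligible:
  fixes \<phi> :: "real \<Rightarrow> real"
  assumes lip: "\<And>x y. x \<le> y \<Longrightarrow> y - x \<le> \<phi> y - \<phi> x \<and> \<phi> y - \<phi> x \<le> L * (y - x)" and pq: "p < q" "0 \<le> p"
  shows "negligible {x. \<bar>x\<bar> \<le> R \<and> (\<exists>\<^sub>F h in at 0. (\<phi> (x + h) - \<phi> x) / h < p) \<and> (\<exists>\<^sub>F h in at 0. q < (\<phi> (x + h) - \<phi> x) / h)}"
    (is "negligible ?E")
proof -
  have L: "1 \<le> L" using lip[of 0 1] by simp
  have mono: "strict_mono \<phi>" by (rule strict_monoI) (use lip in \<open>smt (verit)\<close>)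
  have absl: "\<bar>\<phi> x - \<phi> y\<bar> \<le> L * \<bar>x - y\<bar>" "\<bar>x - y\<bar> \<le> \<bar>\<phi> x - \<phi> y\<bar>" for x y
    using lip[of x y] lip[of y x] by (cases "x \<le> y"; simp add: abs_if)+
  have lip\<phi>: "L-lipschitz_on UNIV \<phi>" using absl L by (intro lipschitz_onI) (auto simp: dist_real_def)
  then have cont: "continuous_on UNIV \<phi>" by (rule lipschitz_on_continuous_on)
  have inj: "inj \<phi>" using mono by (rule strict_mono_imp_inj_on)
  have surj: "surj \<phi>"
  proof -
    have "\<exists>x. \<phi> x = y" for y
    proof -
      define a where "a = - \<bar>y - \<phi> 0\<bar>" define b where "b = \<bar>y - \<phi> 0\<bar>"
      have "\<phi> a \<le> y" using lip[of a 0] by (auto simp: a_def)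
      moreover have "y \<le> \<phi> b" using lip[of 0 b] by (auto simp: b_def)
      moreover have "a \<le> b" by (simp add: a_def b_def)
      ultimately show ?thesis using IVT'[of \<phi> a y b] cont by (auto intro: continuous_on_subset)
    qed
    then show ?thesis by (metis surjI)
  qed
  define \<psi> where "\<psi> = inv \<phi>"
  have \<psi>: "\<psi> (\<phi> x) = x" "\<phi> (\<psi> y) = y" for x y
    using inj surj by (auto simp: \<psi>_def surj_f_inv_f)
  have lip\<psi>: "1-lipschitz_on UNIV \<psi>"
    using absl(2)[of "\<psi> _" "\<psi> _"] by (intro lipschitz_onI) (auto simp: dist_real_def \<psi>)
  have mono\<psi>: "strict_mono \<psi>" by (rule strict_monoI) (metis \<psi>(2) mono strict_mono_less)
  have Eb: "?E \<in> sets borel"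
  proof -
    have 1: "{x. \<exists>\<^sub>F h in at 0. (\<phi> (x + h) - \<phi> x) / h < p} \<in> sets borel"
      using borel_frequent_quotient[OF cont, of "{..<p}"] by simp
    have 2: "{x. \<exists>\<^sub>F h in at 0. q < (\<phi> (x + h) - \<phi> x) / h} \<in> sets borel"
      using borel_frequent_quotient[OF cont, of "{q<..}"] by simp
    have "?E = {-R..R} \<inter> ({x. \<exists>\<^sub>F h in at 0. (\<phi> (x + h) - \<phi> x) / h < p} \<inter> {x. \<exists>\<^sub>F h in at 0. q < (\<phi> (x + h) - \<phi> x) / h})"
      by (auto simp: abs_le_iff)
    then show ?thesis by (simp only:) (intro sets.Int 1 2 atLeastAtMost_borel)
  qed
  have bE: "bounded ?E" by (rule boundedI[of _ R]) auto
  have Em: "?E \<in> lmeasurable" using Eb bE by (intro bounded_set_imp_lmeasurable) auto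
  have img: "\<phi> ` S = \<psi> -` S" for S
  proof (intro equalityI subsetI)
    fix y assume "y \<in> \<psi> -` S"
    then show "y \<in> \<phi> ` S" using \<psi>(2)[of y] by (intro image_eqI[of y \<phi> "\<psi> y"]) auto
  qed (use \<psi> in auto)
  have "\<phi> ` ?E = \<psi> -` ?E" by (rule img)
  moreover have "\<psi> -` ?E \<in> sets borel"
    using measurable_sets[OF borel_measurable_continuous_onI[OF lipschitz_on_continuous_on[OF lip\<psi>]] Eb] by simp
  ultimately have \<phi>Eb: "\<phi> ` ?E \<in> sets borel" by simp
  have b\<phi>E: "bounded (\<phi> ` ?E)"
    using lipschitz_on_subset[OF lip\<phi>, of ?E] bE by (intro bounded_uniformly_continuous_image lipschitz_on_uniformly_continuous) auto
  have \<phi>Em: "\<phi> ` ?E \<in> lmeasurable" using \<phi>Eb b\<phi>E by (intro bounded_set_imp_lmeasurable) auto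
  have 1: "measure lebesgue (\<phi> ` ?E) \<le> p * measure lebesgue ?E"
  proof (rule measure_image_le_slope[OF mono lip\<phi> Em \<phi>Em pq(2)])
    fix x \<delta> :: real assume x: "x \<in> ?E" and \<delta>: "0 < \<delta>"
    obtain c d where "c < d" "c \<le> x" "x \<le> d" "d - c < \<delta>" "(\<phi> d - \<phi> c) / (d - c) < p"
      using frequently_quotient_interval[of "\<lambda>s. s < p" \<phi> x \<delta>] x \<delta> by auto
    then show "\<exists>c d. c < d \<and> c \<le> x \<and> x \<le> d \<and> d - c < \<delta> \<and> \<phi> d - \<phi> c \<le> p * (d - c)"
      by (intro exI[of _ c] exI[of _ d]) (auto simp: divide_less_eq)
  qed
  have \<psi>\<phi>E: "\<psi> ` (\<phi> ` ?E) = ?E" using \<psi>(1) by (auto simp: image_image)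
  have 2: "measure lebesgue (\<psi> ` (\<phi> ` ?E)) \<le> (1 / q) * measure lebesgue (\<phi> ` ?E)"
  proof (rule measure_image_le_slope[OF mono\<psi> lip\<psi> \<phi>Em])
    show "\<psi> ` (\<phi> ` ?E) \<in> lmeasurable" unfolding \<psi>\<phi>E by (rule Em)
    show "0 \<le> 1 / q" using pq by simp
    fix y \<delta> :: real assume y: "y \<in> \<phi> ` ?E" and \<delta>: "0 < \<delta>"
    then obtain x where x: "x \<in> ?E" "y = \<phi> x" by auto
    (* The map stretches intervals by at most L. *)
    have "0 < \<delta> / L" using \<delta> L by simp
    then obtain c d where cd: "c < d" "c \<le> x" "x \<le> d" "d - c < \<delta> / L" "q < (\<phi> d - \<phi> c) / (d - c)"
      using frequently_quotient_interval[of "\<lambda>s. q < s" \<phi> x "\<delta> / L"] x by auto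
    have "\<phi> d - \<phi> c \<le> L * (d - c)" using lip[of c d] cd by simp
    also have "\<dots> < \<delta>" using cd(4) L by (simp add: field_simps)
    finally have "\<phi> d - \<phi> c < \<delta>" .
    moreover have "\<psi> (\<phi> d) - \<psi> (\<phi> c) \<le> 1 / q * (\<phi> d - \<phi> c)"
      using cd(1,5) pq by (simp add: \<psi> field_simps)
    ultimately show "\<exists>c d. c < d \<and> c \<le> y \<and> y \<le> d \<and> d - c < \<delta> \<and> \<psi> d - \<psi> c \<le> 1 / q * (d - c)"
      using cd mono x(2) by (intro exI[of _ "\<phi> c"] exI[of _ "\<phi> d"]) (auto simp: strict_mono_less strict_mono_less_eq)
  qed
  have "q * measure lebesgue ?E \<le> p * measure lebesgue ?E"
    using 1 2 pq unfolding \<psi>\<phi>E by (simp add: field_simps)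
  then have "(q - p) * measure lebesgue ?E \<le> 0" by (simp add: algebra_simps)
  then have "measure lebesgue ?E \<le> 0" using pq by (simp add: mult_le_0_iff)
  then have "measure lebesgue ?E = 0" by (simp add: measure_le_0_iff)
  then show ?thesis using Em by (simp add: negligible_iff_measure)
qed

text \<open>
  Adding \<open>(L + 1) x\<close> turns \<open>f\<close> into an increasing bilipschitz function. At a point without
  derivative its difference quotients cross two rational levels frequently, and the exceptional sets
  for the countably many pairs of levels are negligible.
\<close>

lemma lipschitz_AE_differentiable:
  fixes f :: "real \<Rightarrow> real"
  assumes "L-lipschitz_on UNIV f"
  shows "AE x in lebesgue. \<exists>D. (f has_real_derivative D) (at x)"
proof -
  have L: "0 \<le> L" using assms by (rule lipschitz_on_nonneg)
  have lf: "\<bar>f x - f y\<bar> \<le> L * \<bar>x - y\<bar>" for x y using lipschitz_onD[OF assms, of x y] by (simp add: dist_real_def)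
  define \<phi> where "\<phi> = (\<lambda>x. f x + (L + 1) * x)"
  have lip: "y - x \<le> \<phi> y - \<phi> x \<and> \<phi> y - \<phi> x \<le> (2 * L + 1) * (y - x)" if "x \<le> y" for x y
    using lf[of y x] that by (auto simp: \<phi>_def algebra_simps abs_le_iff)
  let ?E = "\<lambda>p q R. {x. \<bar>x\<bar> \<le> R \<and> (\<exists>\<^sub>F h in at 0. (\<phi> (x + h) - \<phi> x) / h < p) \<and> (\<exists>\<^sub>F h in at 0. q < (\<phi> (x + h) - \<phi> x) / h)}"
  define I where "I = {(p, q, m). p < q \<and> (0::rat) \<le> p \<and> (m::nat) \<in> UNIV}"
  have "negligible (\<Union>(p, q, m)\<in>I. ?E (of_rat p) (of_rat q) (real m))"
  proof (rule negligible_countable_Union)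
    show "countable ((\<lambda>(p, q, m). ?E (of_rat p) (of_rat q) (real m)) ` I)" by (rule countable_image) simp
    fix S assume "S \<in> (\<lambda>(p, q, m). ?E (of_rat p) (of_rat q) (real m)) ` I"
    then obtain p q m where "p < q" "0 \<le> p" and S: "S = ?E (of_rat p) (of_rat q) (real m)" by (auto simp: I_def)
    then show "negligible S" unfolding S by (intro bilipschitz_crossing_negligible[OF lip]) (auto simp: of_rat_less zero_le_of_rat_iff)
  qed
  then have "AE x in lebesgue. x \<notin> (\<Union>(p, q, m)\<in>I. ?E (of_rat p) (of_rat q) (real m))"
    by (intro AE_not_in) (simp only: negligible_iff_null_sets)
  then show ?thesis
  proof eventually_elim
    case (elim x)
    let ?Q = "\<lambda>h. (\<phi> (x + h) - \<phi> x) / h"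
    have Qb: "1 \<le> ?Q h \<and> ?Q h \<le> 2 * L + 1" if "h \<noteq> 0" for h
    proof (cases "0 < h")
      case True then show ?thesis using lip[of x "x + h"] by (simp add: field_simps)
    next
      case False then show ?thesis using lip[of "x + h" x] that by (simp add: field_simps)
    qed
    then have ev: "\<forall>\<^sub>F h in at 0. 1 \<le> ?Q h \<and> ?Q h \<le> 2 * L + 1"
      by (auto simp: eventually_at_filter)
    have "\<exists>D. (?Q \<longlongrightarrow> D) (at 0)"
    proof (rule bounded_limit_exists[OF _ ev])
      fix p q :: rat assume pq: "p < q"
      show "\<not> ((\<exists>\<^sub>F h in at 0. ?Q h < of_rat p) \<and> (\<exists>\<^sub>F h in at 0. of_rat q < ?Q h))"
      proof
        assume *: "(\<exists>\<^sub>F h in at 0. ?Q h < of_rat p) \<and> (\<exists>\<^sub>F h in at 0. of_rat q < ?Q h)"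
        then have "\<exists>\<^sub>F h in at 0. ?Q h < of_rat p" by blast
        then obtain h where "?Q h < of_rat p" "1 \<le> ?Q h"
          using frequently_ex[OF frequently_eventually_frequently[OF _ ev]] by blast
        then have "(0::real) \<le> of_rat p" by linarith
        then have "0 \<le> p" by (simp add: zero_le_of_rat_iff)
        moreover obtain m :: nat where "\<bar>x\<bar> \<le> real m" using real_arch_simple by blast
        ultimately have "(p, q, m) \<in> I" "x \<in> ?E (of_rat p) (of_rat q) (real m)"
          using pq * by (auto simp: I_def)
        then show False using elim by blast
      qed
    qed simp
    then obtain D where "(\<phi> has_real_derivative D) (at x)" by (auto simp: DERIV_def)
    then have "((\<lambda>x. \<phi> x - (L + 1) * x) has_real_derivative D - (L + 1)) (at x)"
      by (auto intro!: derivative_eq_intros)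
    then show ?case by (auto simp: \<phi>_def)
  qed
qed

text \<open>A Borel function on the whole line that agrees with the derivative wherever there is one.\<close>

definition right_quotient_limit :: "(real \<Rightarrow> real) \<Rightarrow> real \<Rightarrow> real" where
  "right_quotient_limit f x = lim (\<lambda>i. real (Suc i) * (f (x + 1 / real (Suc i)) - f x))"

lemma right_quotient_limit_eq:
  assumes "(f has_real_derivative D) (at x)"
  shows "(\<lambda>i. real (Suc i) * (f (x + 1 / real (Suc i)) - f x)) \<longlonglongrightarrow> D" "right_quotient_limit f x = D"
proof -
  have h: "filterlim (\<lambda>i. 1 / real (Suc i)) (at 0) sequentially"
    unfolding filterlim_at
    by (auto intro!: always_eventually LIMSEQ_inverse_real_of_nat[unfolded inverse_eq_divide] simp del: of_nat_Suc)
  have "((\<lambda>h. (f (x + h) - f x) / h) \<longlongrightarrow> D) (at 0)" using assms by (simp add: DERIV_def)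
  from filterlim_compose[OF this h]
  show *: "(\<lambda>i. real (Suc i) * (f (x + 1 / real (Suc i)) - f x)) \<longlonglongrightarrow> D" by (simp add: mult.commute)
  then show "right_quotient_limit f x = D" unfolding right_quotient_limit_def by (rule limI)
qed

lemma right_quotient_limit_borel:
  assumes "continuous_on UNIV f"
  shows "right_quotient_limit f \<in> borel_measurable borel"
proof -
  have "(\<lambda>x. real (Suc i) * (f (x + 1 / real (Suc i)) - f x)) \<in> borel_measurable borel" for i
    by (intro borel_measurable_continuous_onI continuous_intros continuous_on_compose2[OF assms]) auto
  then show ?thesis unfolding right_quotient_limit_def[abs_def] by (rule borel_measurable_lim_metric)
qed

text \<open>
  The difference quotients are bounded by the Lipschitz constant, and the integral of a difference
  quotient is a difference of difference quotients of a primitive, which converges to \<open>f b - f a\<close>.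
\<close>

lemma lipschitz_fundamental_theorem:
  fixes f :: "real \<Rightarrow> real"
  assumes f: "L-lipschitz_on UNIV f" and ab: "a \<le> b"
  shows "set_integrable lborel {a..b} (right_quotient_limit f)"
    and "(LBINT x:{a..b}. right_quotient_limit f x) = f b - f a"
    and "AE x in lborel. (f has_real_derivative right_quotient_limit f x) (at x)"
proof -
  have L: "0 \<le> L" using f by (rule lipschitz_on_nonneg)
  have cont: "continuous_on UNIV f" using f by (rule lipschitz_on_continuous_on)
  show ae: "AE x in lborel. (f has_real_derivative right_quotient_limit f x) (at x)"
  proof -
    have "AE x in lebesgue. (f has_real_derivative right_quotient_limit f x) (at x)"
      using lipschitz_AE_differentiable[OF f] by eventually_elim (use right_quotient_limit_eq in metis)
    then show ?thesis by (simp only: AE_completion_iff)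
  qed
  define A where "A = (\<lambda>x. integral {a - 1..x} f)"
  have A: "(A has_real_derivative f x) (at x)" if "a - 1 < x" "x < b + 2" for x
  proof -
    have "((\<lambda>x. integral {a - 1..x} f) has_real_derivative f x) (at x within {a - 1..b + 2})"
      by (rule integral_has_real_derivative) (use that cont in \<open>auto intro: continuous_on_subset\<close>)
    then show ?thesis unfolding A_def using that by (simp add: at_within_Icc_at)
  qed
  let ?q = "\<lambda>i x. real (Suc i) * (f (x + 1 / real (Suc i)) - f x)"
  let ?Q = "\<lambda>i x. real (Suc i) * (A (x + 1 / real (Suc i)) - A x)"
  have qc: "continuous_on S (?q i)" for i S
    by (intro continuous_intros continuous_on_compose2[OF cont]) auto
  have Iq: "(LBINT x:{a..b}. ?q i x) = ?Q i b - ?Q i a" for i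
    unfolding set_lebesgue_integral_def
  proof (rule integral_FTC_atLeastAtMost[OF ab _ qc])
    fix x assume x: "a \<le> x" "x \<le> b"
    have "(0::real) < 1 / real (Suc i)" "1 / real (Suc i) \<le> 1" by auto
    then have x': "a - 1 < x + 1 / real (Suc i)" "x + 1 / real (Suc i) < b + 2" "a - 1 < x" "x < b + 2"
      using x by linarith+
    have "((\<lambda>x. A (x + 1 / real (Suc i))) has_real_derivative f (x + 1 / real (Suc i))) (at x)"
      using A[OF x'(1,2)] by (simp add: DERIV_shift)
    from DERIV_cmult[OF DERIV_diff[OF this A[OF x'(3,4)]], of "real (Suc i)"]
    show "(?Q i has_vector_derivative ?q i x) (at x within {a..b})"
      by (simp add: has_real_derivative_iff_has_vector_derivative has_vector_derivative_at_within)
  qed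
  have qL: "\<bar>?q i x\<bar> \<le> L" for i x
  proof -
    have "\<bar>f (x + 1 / real (Suc i)) - f x\<bar> \<le> L * \<bar>1 / real (Suc i)\<bar>"
      using lipschitz_onD[OF f, of "x + 1 / real (Suc i)" x] by (simp add: dist_real_def)
    then have "real (Suc i) * \<bar>f (x + 1 / real (Suc i)) - f x\<bar> \<le> real (Suc i) * (L * \<bar>1 / real (Suc i)\<bar>)"
      by (intro mult_left_mono) auto
    then show ?thesis by (simp add: abs_mult)
  qed
  have wint: "integrable lborel (\<lambda>x. indicator {a..b} x *\<^sub>R L)"
    using borel_integrable_atLeastAtMost'[of a b "\<lambda>_. L"] by (simp add: set_integrable_def)
  have m1: "(\<lambda>x. indicator {a..b} x *\<^sub>R right_quotient_limit f x) \<in> borel_measurable lborel"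
    using right_quotient_limit_borel[OF cont] by measurable
  have m2: "(\<lambda>x. indicator {a..b} x *\<^sub>R ?q i x) \<in> borel_measurable lborel" for i
    using borel_measurable_continuous_onI[OF qc, of i] by measurable
  have ae2: "AE x in lborel. (\<lambda>i. indicator {a..b} x *\<^sub>R ?q i x) \<longlonglongrightarrow> indicator {a..b} x *\<^sub>R right_quotient_limit f x"
    using ae by eventually_elim (intro tendsto_intros right_quotient_limit_eq(1))
  have bd: "AE x in lborel. norm (indicator {a..b} x *\<^sub>R ?q i x) \<le> indicator {a..b} x *\<^sub>R L" for i
    using qL[of i] L by (intro AE_I2) (auto simp: indicator_def)
  show "set_integrable lborel {a..b} (right_quotient_limit f)"
    unfolding set_integrable_def by (rule integrable_dominated_convergence[OF m1 m2 wint ae2 bd])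
  have "(\<lambda>i. LBINT x:{a..b}. ?q i x) \<longlonglongrightarrow> (LBINT x:{a..b}. right_quotient_limit f x)"
    unfolding set_lebesgue_integral_def by (rule integral_dominated_convergence[OF m1 m2 wint ae2 bd])
  moreover have "(\<lambda>i. LBINT x:{a..b}. ?q i x) \<longlonglongrightarrow> f b - f a"
    unfolding Iq by (intro tendsto_diff right_quotient_limit_eq(1) A) (use ab in auto)
  ultimately show "(LBINT x:{a..b}. right_quotient_limit f x) = f b - f a" by (rule LIMSEQ_unique)
qed

section \<open>The stability inequality in radial form\<close>

lemma locally_lipschitz_continuous:
  assumes "locally_lipschitz g"
  shows "continuous_on UNIV g"
proof (intro continuous_at_imp_continuous_on ballI)
  fix x :: real
  obtain e L where e: "e > 0" "L-lipschitz_on (ball x e) g" using assms unfolding locally_lipschitz_def by blast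
  then have "continuous_on (ball x e) g" by (auto intro: lipschitz_on_continuous_on)
  then show "isCont g x" using e(1) by (auto simp: continuous_on_eq_continuous_at)
qed

lemma locally_lipschitz_compact:
  assumes "locally_lipschitz g"
  obtains L where "L-lipschitz_on {a..b} g"
proof -
  have "local_lipschitz {0::real} {a..b} (\<lambda>_. g)"
  proof (rule local_lipschitzI)
    fix t x :: real
    obtain e L where e: "e > 0" "L-lipschitz_on (ball x e) g" using assms unfolding locally_lipschitz_def by blast
    have "L-lipschitz_on (cball x (e/2) \<inter> {a..b}) g"
      by (rule lipschitz_on_subset[OF e(2)]) (use e(1) in auto)
    then show "\<exists>u>0. \<exists>L. \<forall>t\<in>cball t u \<inter> {0}. L-lipschitz_on (cball x u \<inter> {a..b}) g"
      using e(1) by (intro exI[of _ "e/2"]) auto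
  qed
  then obtain L where "\<And>t. t \<in> {0::real} \<Longrightarrow> L-lipschitz_on {a..b} g"
    using local_lipschitz_compact_implies_lipschitz[of "{0::real}" "{a..b}" "\<lambda>_. g"] by auto
  then show ?thesis using that by blast
qed

lemma lipschitz_clamp:
  fixes f :: "real \<Rightarrow> real"
  assumes "L-lipschitz_on {a..b} f" "a \<le> b"
  shows "L-lipschitz_on UNIV (\<lambda>x. f (max a (min b x)))"
proof (rule lipschitz_onI)
  show L: "0 \<le> L" using assms(1) by (rule lipschitz_on_nonneg)
  fix x y
  have "dist (f (max a (min b x))) (f (max a (min b y))) \<le> L * dist (max a (min b x)) (max a (min b y))"
    using assms by (intro lipschitz_onD[OF assms(1)]) auto
  also have "\<dots> \<le> L * dist x y" using L by (intro mult_left_mono) (auto simp: dist_real_def max_def min_def abs_if)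
  finally show "dist (f (max a (min b x))) (f (max a (min b y))) \<le> L * dist x y" .
qed

lemma C1_lipschitz_Icc:
  fixes f f' :: "real \<Rightarrow> real"
  assumes "\<And>x. x \<in> {a..b} \<Longrightarrow> (f has_real_derivative f' x) (at x)" "continuous_on {a..b} f'"
  obtains L where "L-lipschitz_on {a..b} f"
proof -
  have "bounded (f' ` {a..b})" using assms(2) by (intro compact_imp_bounded compact_continuous_image) auto
  then obtain C where C: "\<And>x. x \<in> {a..b} \<Longrightarrow> \<bar>f' x\<bar> \<le> C"
    unfolding bounded_iff ball_simps real_norm_def by blast
  have "\<bar>f x - f y\<bar> \<le> \<bar>C\<bar> * \<bar>x - y\<bar>" if "x \<in> {a..b}" "y \<in> {a..b}" for x y
  proof -
    have "norm (f x - f y) \<le> \<bar>C\<bar> * norm (x - y)"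
    proof (rule field_differentiable_bound[of "{a..b}" f f'])
      show "norm (f' x) \<le> \<bar>C\<bar>" if "x \<in> {a..b}" for x using C[OF that] by simp
    qed (use assms(1) that in \<open>auto intro: has_field_derivative_at_within\<close>)
    then show ?thesis by simp
  qed
  then have "\<bar>C\<bar>-lipschitz_on {a..b} f" by (intro lipschitz_onI) (auto simp: dist_real_def)
  then show ?thesis by (rule that)
qed

text \<open>The value of \<open>z'\<close> that the equation prescribes where \<open>z > 0\<close>.\<close>

definition profile_slope :: "nat \<Rightarrow> nat \<Rightarrow> (real \<Rightarrow> real) \<Rightarrow> (real \<Rightarrow> real) \<Rightarrow> (real \<Rightarrow> real) \<Rightarrow> real \<Rightarrow> real" where
  "profile_slope n k g v z r =
     (r ^ (k - 1) * g (v r) / c_const n k - (real n - real k) * z r ^ k / r) / (real k * z r ^ (k - 1))"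

lemma regular_profile_slope:
  assumes "regular_profile n k g v z" "1 \<le> k" "k < n" "r \<in> {0<..1}" "0 < z r"
  shows "(z has_real_derivative profile_slope n k g v z r) (at r within {0<..1})"
proof -
  define M where "M = (\<lambda>r. r ^ (n - k) * z r ^ k)"
  define P where "P = (\<lambda>r. M r / r ^ (n - k))"
  have M: "(M has_real_derivative r ^ (n - 1) * g (v r) / c_const n k) (at r within {0<..1})"
    using assms unfolding regular_profile_def M_def by blast
  have Pz: "P s = z s ^ k" if "s \<in> {0<..1}" for s using that by (simp add: P_def M_def)
  have z0: "0 \<le> z s" if "s \<in> {0<..1}" for s using assms(1) that by (simp add: regular_profile_def)
  have zP: "z s = root k (P s)" if "s \<in> {0<..1}" for s
    using Pz[OF that] z0[OF that] assms(2) by (simp add: real_root_power_cancel)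
  have r: "0 < r" using assms(4) by simp
  obtain m where m: "n - k = Suc m" using assms(3) by (metis Suc_diff_Suc)
  have nm: "n - 1 = m + k" "real n - real k = real (Suc m)" using m assms(3) by auto
  obtain j where j: "k = Suc j" using assms(2) by (cases k) auto
  have pw: "((\<lambda>r. r ^ Suc m) has_real_derivative real (Suc m) * r ^ m) (at r within {0<..1})"
    using DERIV_pow[of "Suc m" r] by (auto intro: has_field_derivative_at_within)
  have "(P has_real_derivative (r ^ (k - 1) * g (v r) / c_const n k - (real n - real k) * z r ^ k / r)) (at r within {0<..1})"
    unfolding P_def m
  proof (rule DERIV_cong[OF DERIV_divide[OF M pw]])
    show "r ^ Suc m \<noteq> 0" using r by simp
    show "(r ^ (n - 1) * g (v r) / c_const n k * r ^ Suc m - M r * (real (Suc m) * r ^ m)) / (r ^ Suc m * r ^ Suc m)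
      = r ^ (k - 1) * g (v r) / c_const n k - (real n - real k) * z r ^ k / r"
      unfolding nm(1) nm(2) M_def m using r by (simp add: j power_add field_simps)
  qed
  moreover have "0 < P r" using Pz[OF assms(4)] assms(5) by simp
  ultimately have "((\<lambda>s. root k (P s)) has_real_derivative inverse (real k * root k (P r) ^ (k - Suc 0)) *
      (r ^ (k - 1) * g (v r) / c_const n k - (real n - real k) * z r ^ k / r)) (at r within {0<..1})"
    using assms(2) by (intro DERIV_chain2[OF DERIV_real_root]) auto
  moreover have "inverse (real k * root k (P r) ^ (k - Suc 0)) *
      (r ^ (k - 1) * g (v r) / c_const n k - (real n - real k) * z r ^ k / r) = profile_slope n k g v z r"
    by (simp add: profile_slope_def zP[OF assms(4), symmetric] divide_inverse mult.commute)
  ultimately have "((\<lambda>s. root k (P s)) has_real_derivative profile_slope n k g v z r) (at r within {0<..1})" by simp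
  then show ?thesis
    by (rule has_field_derivative_transform_within[of _ _ _ _ 1]) (use zP assms(4) in auto)
qed

lemma continuous_on_profile_slope:
  assumes "regular_profile n k g v z" "1 \<le> k" "k < n" "continuous_on UNIV g" "S \<subseteq> {0<..1}" "\<And>r. r \<in> S \<Longrightarrow> 0 < z r"
  shows "continuous_on S (profile_slope n k g v z)"
proof -
  have v: "continuous_on S v" and z: "continuous_on S z"
    using assms(1,5) continuous_on_Ioc_of_derivative[of v z] by (auto simp: regular_profile_def intro: continuous_on_subset)
  have "c_const n k \<noteq> 0" using c_const_pos[of k n] assms(2,3) by simp
  then show ?thesis unfolding profile_slope_def using assms(2,5,6)
    by (intro continuous_intros continuous_on_compose2[OF assms(4) v] z) (auto simp: less_imp_neq[symmetric])
qed

lemma profile_slope_equation: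
  assumes "1 \<le> k" "k < n" "0 < r" "0 < z r"
  shows "r ^ (n - 1) * g (v r) = c_const n k * ((real n - real k) * r ^ (n - k - 1) * z r ^ k
     + real k * r ^ (n - k) * z r ^ (k - 1) * profile_slope n k g v z r)"
proof -
  obtain m where m: "n - k = Suc m" using assms(2) by (metis Suc_diff_Suc)
  have nm: "n - 1 = m + k" "n - k - 1 = m" using m assms(2) by auto
  obtain j where j: "k = Suc j" using assms(1) by (cases k) auto
  have c: "0 < c_const n k" using assms(1,2) by (intro c_const_pos) auto
  have "real k * z r ^ (k - 1) * profile_slope n k g v z r
     = r ^ (k - 1) * g (v r) / c_const n k - (real n - real k) * z r ^ k / r"
    using assms by (simp add: profile_slope_def)
  then have "g (v r) * r ^ (k - 1) = c_const n k * (real k * z r ^ (k - 1) * profile_slope n k g v z r + (real n - real k) * z r ^ k / r)"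
    using c by (simp add: field_simps)
  then have "r ^ Suc m * (g (v r) * r ^ (k - 1)) = r ^ Suc m * (c_const n k * (real k * z r ^ (k - 1) * profile_slope n k g v z r + (real n - real k) * z r ^ k / r))"
    by simp
  moreover have "r ^ Suc m * (g (v r) * r ^ (k - 1)) = r ^ (n - 1) * g (v r)"
    unfolding nm by (simp add: j power_add)
  moreover have "r ^ Suc m * (c_const n k * (real k * z r ^ (k - 1) * profile_slope n k g v z r + (real n - real k) * z r ^ k / r))
    = c_const n k * ((real n - real k) * r ^ m * z r ^ k + real k * r ^ Suc m * z r ^ (k - 1) * profile_slope n k g v z r)"
    using assms(3) by (simp add: field_simps)
  ultimately show ?thesis unfolding nm(2) unfolding m by (simp only:)
qed

text \<open>
  What remains of the integrand of the stability condition for the test function \<open>z \<xi>\<close> with \<open>d =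
  \<xi>'\<close>, after division by the weight \<open>r\<^bsup>n-k\<^esup> z\<^bsup>k+1\<^esup>\<close>. It does not involve \<open>g\<close>.
\<close>

definition stability_form :: "nat \<Rightarrow> nat \<Rightarrow> real \<Rightarrow> real \<Rightarrow> real \<Rightarrow> real" where
  "stability_form n k r \<xi> d =
     d\<^sup>2 + 2 * ((real k - 1) / (real k + 1)) * (\<xi> * d / r) - (2 * real n - real k - 1) / (real k + 1) * (\<xi>\<^sup>2 / r\<^sup>2)"

text \<open>
  Pointwise in \<open>r\<close>: \<open>a = z\<^bsup>k-1\<^esup>\<close>, \<open>b = z\<close>, \<open>s = z'\<close>, \<open>d = \<zeta>'\<close> and \<open>R = r\<^bsup>n-k-2\<^esup>\<close>. The terms quadratic in \<open>s\<close>
  cancel, and the terms linear in \<open>s\<close> are absorbed by a total derivative.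
\<close>

lemma stability_algebra:
  fixes R r a b s \<zeta> d c :: real
  assumes "r \<noteq> 0"
  shows "real k * c * (R * r\<^sup>2) * a * (s * \<zeta> + b * d)\<^sup>2
     - c * ((real n - real k) * (R * r) * (a * b) + real k * (R * r\<^sup>2) * a * s) * ((real n - 1) * b * \<zeta>\<^sup>2 / r + s * \<zeta>\<^sup>2 + 2 * b * \<zeta> * d)
   = real k * c * ((R * r\<^sup>2) * (a * b\<^sup>2) * stability_form n k r \<zeta> d)
     - c * (((real k + 1) * real n - 2 * real k) / (real k + 1)) *
       ((real n - real k - 1) * R * (a * b\<^sup>2) * \<zeta>\<^sup>2 + (R * r) * ((real k + 1) * (a * b) * s) * \<zeta>\<^sup>2 + (R * r) * (a * b\<^sup>2) * (2 * \<zeta> * d))"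
proof -
  have k1: "real k + 1 \<noteq> 0" by simp
  have "(real k + 1) * (real k * c * (R * r\<^sup>2) * a * (s * \<zeta> + b * d)\<^sup>2
     - c * ((real n - real k) * (R * r) * (a * b) + real k * (R * r\<^sup>2) * a * s) * ((real n - 1) * b * \<zeta>\<^sup>2 / r + s * \<zeta>\<^sup>2 + 2 * b * \<zeta> * d))
   = (real k + 1) * (real k * c * ((R * r\<^sup>2) * (a * b\<^sup>2) * stability_form n k r \<zeta> d)
     - c * (((real k + 1) * real n - 2 * real k) / (real k + 1)) *
       ((real n - real k - 1) * R * (a * b\<^sup>2) * \<zeta>\<^sup>2 + (R * r) * ((real k + 1) * (a * b) * s) * \<zeta>\<^sup>2 + (R * r) * (a * b\<^sup>2) * (2 * \<zeta> * d)))"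
    unfolding stability_form_def using assms k1
    by (simp add: divide_simps) algebra
  then show ?thesis using k1 by (simp only: mult_cancel_left) simp
qed

lemma derivative_zero_outside:
  fixes f :: "real \<Rightarrow> real"
  assumes "\<And>r. (f has_real_derivative f' r) (at r)" "\<And>r. r \<notin> {a..b} \<Longrightarrow> f r = 0" "r \<notin> {a..b}"
  shows "f' r = 0"
proof -
  have "((\<lambda>_. 0) has_real_derivative 0) (at r)" by simp
  then have "(f has_real_derivative 0) (at r)"
    by (rule has_field_derivative_transform_within_open[where S = "- {a..b}"]) (use assms(2,3) in auto)
  then show ?thesis using assms(1) DERIV_unique by blast
qed

text \<open>At a point where \<open>v' \<noteq> 0\<close>, differentiability passes from \<open>g \<circ> v\<close> to \<open>g\<close>, since \<open>v\<close> is locally invertible.\<close>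

lemma derivative_of_composition_factor:
  fixes g v z \<gamma> :: "real \<Rightarrow> real"
  assumes v: "\<And>s. s \<in> {a..b} \<Longrightarrow> (v has_real_derivative z s) (at s)" "\<And>s. s \<in> {a..b} \<Longrightarrow> 0 < z s"
    and \<gamma>: "\<And>s. s \<in> {a..b} \<Longrightarrow> \<gamma> s = g (v s)" and r: "a < r" "r < b" and D: "(\<gamma> has_real_derivative D) (at r)"
  shows "(g has_real_derivative D * inverse (z r)) (at (v r))"
proof -
  have mono: "v x < v y" if "a \<le> x" "x < y" "y \<le> b" for x y
  proof (rule DERIV_pos_imp_increasing[OF that(2)])
    fix s assume "x \<le> s" "s \<le> y"
    then have "s \<in> {a..b}" using that by auto
    then show "\<exists>d. (v has_real_derivative d) (at s) \<and> 0 < d" using v by blast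
  qed
  have inj: "inj_on v {a..b}"
    by (rule inj_onI) (metis atLeastAtMost_iff linorder_cases mono order_less_irrefl)
  have cv: "continuous_on {a..b} v" using v(1) by (intro continuous_at_imp_continuous_on ballI) (auto intro: DERIV_isCont)
  define w where "w = inv_into {a..b} v"
  have wv: "w (v s) = s" if "s \<in> {a..b}" for s using inv_into_f_f[OF inj that] by (simp add: w_def)
  have img: "v ` {a..b} = {v a..v b}"
  proof (intro equalityI subsetI)
    fix y assume "y \<in> v ` {a..b}"
    then obtain s where s: "s \<in> {a..b}" "y = v s" by auto
    have "v a \<le> v s" using mono[of a s] s(1) by (cases "a = s") auto
    moreover have "v s \<le> v b" using mono[of s b] s(1) by (cases "s = b") auto
    ultimately show "y \<in> {v a..v b}" using s(2) by simp
  next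
    fix y assume "y \<in> {v a..v b}"
    then obtain s where "a \<le> s" "s \<le> b" "v s = y" using IVT'[of v a y b] cv r by auto
    then show "y \<in> v ` {a..b}" by auto
  qed
  have vw: "v (w y) = y" if "y \<in> {v a..v b}" for y
    unfolding w_def by (rule f_inv_into_f) (use that img in auto)
  have w_in: "w y \<in> {a..b}" if "y \<in> {v a..v b}" for y
    unfolding w_def by (rule inv_into_into) (use that img in auto)
  have rin: "v a < v r" "v r < v b" using mono r by auto
  have "continuous_on {v a..v b} w"
    unfolding img[symmetric] by (rule continuous_on_inv[OF cv]) (use wv in auto)
  then have "isCont w (v r)" using rin by (auto intro: continuous_on_interior)
  then have "(w has_real_derivative inverse (z r)) (at (v r))"
    using rin r v(1)[of r] v(2)[of r] vw wv[of r] 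
    by (intro DERIV_inverse_function[where f = v and g = w and a = "v a" and b = "v b"]) auto
  moreover have "(\<gamma> has_real_derivative D) (at (w (v r)))" using D wv[of r] r by simp
  ultimately have "((\<lambda>y. \<gamma> (w y)) has_real_derivative D * inverse (z r)) (at (v r))"
    by (rule DERIV_chain2[rotated])
  then show ?thesis
    by (rule has_field_derivative_transform_within_open[where S = "{v a<..<v b}"])
      (use rin \<gamma> w_in vw in auto)
qed

text \<open>
  Testing stability with \<open>\<phi> = z \<zeta>\<close>. The term \<open>g'(v) z\<close> is the derivative of \<open>g \<circ> v\<close>, and \<open>g \<circ> v\<close> is expressed
  through \<open>z\<close> and \<open>z'\<close> by the equation; after integration by parts nothing but \<open>z\<close> remains.
\<close>

lemma semistable_radial_inequality:
  fixes u :: "real^'n \<Rightarrow> real"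
  assumes prof: "regular_profile CARD('n) k g v z" and k: "1 \<le> k" "2 * k < CARD('n)" and g: "locally_lipschitz g"
    and uv: "\<And>x. x \<in> ball 0 1 \<Longrightarrow> u x = v (norm x)" and semi: "semistable k g u"
    and pos: "0 \<le> r0" "\<And>r. r0 < r \<Longrightarrow> r < 1 \<Longrightarrow> 0 < z r" and ab: "r0 < a" "a < b" "b < 1"
    and \<zeta>: "\<And>r. (\<zeta> has_real_derivative \<zeta>' r) (at r)" "continuous_on UNIV \<zeta>'" "\<And>r. r \<notin> {a<..<b} \<Longrightarrow> \<zeta> r = 0"
  shows "0 \<le> (LBINT r:{a..b}. r ^ (CARD('n) - k) * z r ^ (k + 1) * stability_form CARD('n) k r (\<zeta> r) (\<zeta>' r))"
proof -
  let ?n = "CARD('n)" let ?B = "ball 0 1 :: (real^'n) set" let ?L = "lebesgue_on ?B"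
  have kn: "k < ?n" "k \<le> ?n" using k by auto
  define c where "c = c_const ?n k"
  have c: "0 < c" unfolding c_def using k by (intro c_const_pos) auto
  define s where "s = profile_slope ?n k g v z"
  have gc: "continuous_on UNIV g" by (rule locally_lipschitz_continuous[OF g])
  have v': "(v has_real_derivative z r) (at r)" if "0 < r" "r < 1" for r
  proof -
    have "(v has_real_derivative z r) (at r within {0<..1})" using prof that unfolding regular_profile_def by simp
    then show ?thesis using that by (simp add: at_within_Ioc)
  qed
  have z': "(z has_real_derivative s r) (at r)" if "r0 < r" "r < 1" for r
    using regular_profile_slope[OF prof k(1) kn(1), of r] pos that by (simp add: s_def at_within_Ioc)
  have cs: "continuous_on S s" if "S \<subseteq> {r0<..<1}" for S
    unfolding s_def by (rule continuous_on_profile_slope[OF prof k(1) kn(1) gc]) (use that pos in auto)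
  have cz: "continuous_on S z" if "S \<subseteq> {r0<..<1}" for S
    using that by (intro continuous_at_imp_continuous_on ballI) (auto intro!: DERIV_isCont z')
  have cv: "continuous_on S v" if "S \<subseteq> {0<..<1}" for S
    using that by (intro continuous_at_imp_continuous_on ballI) (auto intro!: DERIV_isCont v')
  have c\<zeta>: "continuous_on S \<zeta>" for S
    by (intro continuous_at_imp_continuous_on ballI) (auto intro!: DERIV_isCont \<zeta>(1))
  have c\<zeta>': "continuous_on S \<zeta>'" for S using \<zeta>(2) by (rule continuous_on_subset) auto
  have \<zeta>0: "\<zeta> r = 0" if "r \<notin> {a..b}" for r using that by (intro \<zeta>(3)) auto
  have \<zeta>'0: "\<zeta>' r = 0" if "r \<notin> {a..b}" for r by (rule derivative_zero_outside[OF \<zeta>(1) \<zeta>0 that])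
  have sub: "{a..b} \<subseteq> {r0<..<1}" "{a..b} \<subseteq> {0<..<1}" using ab pos(1) by auto
  note cont = cs[OF sub(1)] cz[OF sub(1)] cv[OF sub(2)] c\<zeta>[of "{a..b}"] c\<zeta>'[of "{a..b}"]
  (* The profile of the test function; z is differentiable where it is positive. *)
  define \<Phi> where "\<Phi> = (\<lambda>r. if r0 < r \<and> r < 1 then z r * \<zeta> r else 0)"
  define \<Phi>' where "\<Phi>' = (\<lambda>r. if r0 < r \<and> r < 1 then s r * \<zeta> r + z r * \<zeta>' r else 0)"
  have \<Phi>0: "\<Phi> r = 0" "\<Phi>' r = 0" if "r \<notin> {a..b}" for r
    using \<zeta>0[OF that] \<zeta>'0[OF that] by (auto simp: \<Phi>_def \<Phi>'_def)
  have d\<Phi>: "(\<Phi> has_real_derivative \<Phi>' r) (at r)" for r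
  proof (cases "r0 < r \<and> r < 1")
    case True
    have "((\<lambda>r. z r * \<zeta> r) has_real_derivative s r * \<zeta> r + \<zeta>' r * z r) (at r)"
      by (rule DERIV_mult[OF z' \<zeta>(1)]) (use True in auto)
    then have "((\<lambda>r. z r * \<zeta> r) has_real_derivative \<Phi>' r) (at r)" using True by (simp add: \<Phi>'_def mult.commute)
    then show ?thesis
      by (rule has_field_derivative_transform_within_open[where S = "{r0<..<1}"]) (use True in \<open>auto simp: \<Phi>_def\<close>)
  next
    case False
    then have r: "r \<notin> {a..b}" using sub(1) by auto
    have "((\<lambda>_. 0) has_real_derivative \<Phi>' r) (at r)" using \<Phi>0(2)[OF r] by simp
    then show ?thesis
      by (rule has_field_derivative_transform_within_open[where S = "- {a..b}"]) (use r \<Phi>0(1) in auto)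
  qed
  have c\<Phi>': "continuous_on UNIV \<Phi>'"
  proof -
    have "continuous_on {r0<..<1} (\<lambda>r. s r * \<zeta> r + z r * \<zeta>' r)" by (intro continuous_intros cs cz c\<zeta> c\<zeta>') auto
    then have "continuous_on {r0<..<1} \<Phi>'" by (rule continuous_on_eq) (auto simp: \<Phi>'_def)
    moreover have "continuous_on (- {a..b}) \<Phi>'" by (rule continuous_on_eq[where f = "\<lambda>_. 0"]) (use \<Phi>0(2) in auto)
    moreover have "{r0<..<1} \<union> - {a..b} = UNIV" using sub(1) by auto
    ultimately show ?thesis using continuous_on_open_Un[of "{r0<..<1}" "- {a..b}" \<Phi>'] by (simp add: open_Compl)
  qed
  define \<phi> where "\<phi> = (\<lambda>x::real^'n. \<Phi> (norm x))"
  have a0: "0 < a" using ab pos(1) by simp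
  have t\<phi>: "test_fun \<phi>" unfolding \<phi>_def by (rule C1_compact_support_radial[OF a0 ab(3) d\<Phi> c\<Phi>' \<Phi>0(1)])
  have pd: "pdiff i \<phi> x = \<Phi>' (norm x) / norm x * x $ i" for i x
  proof -
    have "pdiff i \<phi> x = gradient \<phi> x $ i" by (simp add: gradient_def)
    also have "gradient \<phi> x = (\<Phi>' (norm x) / norm x) *\<^sub>R x"
      unfolding \<phi>_def by (rule C1_on_radial_test(2)[OF a0 d\<Phi> c\<Phi>' \<Phi>0(1)])
    finally show ?thesis by simp
  qed
  (* At the values of v where g has no derivative, g' is arbitrary. By the chain rule these radii form a null set. *)
  obtain g' where g': "\<And>t D. (g has_real_derivative D) (at t) \<Longrightarrow> g' t = D"
    and q: "integrable ?L (\<lambda>x. (\<Sum>i\<in>UNIV. \<Sum>j\<in>UNIV. pdiff i \<phi> x * pdiff j \<phi> x * hess_coeff k (hessian u x) i j) + g' (u x) * (\<phi> x)\<^sup>2)"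
      "0 \<le> (LINT x|?L. (\<Sum>i\<in>UNIV. \<Sum>j\<in>UNIV. pdiff i \<phi> x * pdiff j \<phi> x * hess_coeff k (hessian u x) i j) + g' (u x) * (\<phi> x)\<^sup>2)"
    using semi t\<phi> unfolding semistable_def Let_def by blast
  define q where "q = (\<lambda>x. (\<Sum>i\<in>UNIV. \<Sum>j\<in>UNIV. pdiff i \<phi> x * pdiff j \<phi> x * hess_coeff k (hessian u x) i j) + g' (u x) * (\<phi> x)\<^sup>2)"
  define F where "F = (\<lambda>r. real k * c * (z r / r) ^ (k - 1) * (\<Phi>' r)\<^sup>2 + g' (v r) * (\<Phi> r)\<^sup>2)"
  have qF: "q x = F (norm x)" if x: "x \<in> ?B" for x
  proof (cases "r0 < norm x")
    case True
    let ?r = "norm x"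
    have x0: "x \<noteq> 0" "?r < 1" using True pos(1) x by auto
    have "hessian u x = (\<chi> i j. (if i = j then z ?r / ?r else 0) + (s ?r - z ?r / ?r) * (x $ i * x $ j) / ?r\<^sup>2)"
      by (rule hessian_radial[where T = "{r0<..<1}" and S = ?B]) (use True x x0 uv v' z' pos(1) in auto)
    then have "(\<Sum>i\<in>UNIV. \<Sum>j\<in>UNIV. x $ i * x $ j * hess_coeff k (hessian u x) i j) = real k * c * (z ?r / ?r) ^ (k - 1) * ?r\<^sup>2"
      using sum_hess_coeff_radial[OF x0(1) k(1) kn(2)] by (simp add: c_def)
    moreover have "(\<Sum>i\<in>UNIV. \<Sum>j\<in>UNIV. pdiff i \<phi> x * pdiff j \<phi> x * hess_coeff k (hessian u x) i j)
      = (\<Phi>' ?r / ?r)\<^sup>2 * (\<Sum>i\<in>UNIV. \<Sum>j\<in>UNIV. x $ i * x $ j * hess_coeff k (hessian u x) i j)"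
      unfolding pd sum_distrib_left by (intro sum.cong refl) (simp add: power2_eq_square)
    ultimately show ?thesis using x0 uv[OF x] by (simp add: q_def F_def \<phi>_def power_divide)
  next
    case False
    then have "norm x \<notin> {a..b}" using ab by auto
    note \<Phi>0[OF this]
    moreover from this have "\<phi> x = 0" by (simp add: \<phi>_def)
    ultimately show ?thesis by (simp add: q_def F_def pd)
  qed
  (* The function g o v, extended to the line by its boundary values. *)
  obtain \<gamma> L where \<gamma>: "L-lipschitz_on UNIV \<gamma>" "\<And>r. r \<in> {a..b} \<Longrightarrow> \<gamma> r = g (v r)" "L-lipschitz_on {a..b} \<gamma>"
  proof -
    obtain L1 where L1: "L1-lipschitz_on {a..b} v"
    proof (rule C1_lipschitz_Icc[of a b v z])
      show "(v has_real_derivative z x) (at x)" if "x \<in> {a..b}" for x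
        by (rule v') (use that sub(2) in auto)
    qed (rule cont(2))
    have "bounded (v ` {a..b})" by (intro compact_imp_bounded compact_continuous_image cont(3)) auto
    then obtain C where C: "\<forall>x\<in>{a..b}. \<bar>v x\<bar> \<le> C" unfolding bounded_iff ball_simps real_norm_def by blast
    obtain L2 where "L2-lipschitz_on {- C..C} g" using locally_lipschitz_compact[OF g] by blast
    then have "L2-lipschitz_on (v ` {a..b}) g" by (rule lipschitz_on_subset) (use C in \<open>auto simp: abs_le_iff minus_le_iff\<close>)
    then have "(L2 * L1)-lipschitz_on {a..b} (\<lambda>r. g (v r))" using L1 by (intro lipschitz_on_compose2)
    then have l: "(L2 * L1)-lipschitz_on UNIV (\<lambda>r. g (v (max a (min b r))))" using ab by (intro lipschitz_clamp) auto
    show ?thesis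
      by (rule that[OF l _ lipschitz_on_subset[OF l]]) auto
  qed
  define d\<gamma> where "d\<gamma> = right_quotient_limit \<gamma>"
  have ae\<gamma>: "AE r in lborel. (\<gamma> has_real_derivative d\<gamma> r) (at r)"
    using lipschitz_fundamental_theorem(3)[OF \<gamma>(1), of 0 0] by (simp add: d\<gamma>_def)
  have g'z: "g' (v r) * z r = d\<gamma> r" if "a < r" "r < b" "(\<gamma> has_real_derivative d\<gamma> r) (at r)" for r
  proof -
    have "(g has_real_derivative d\<gamma> r * inverse (z r)) (at (v r))"
    proof (rule derivative_of_composition_factor[where \<gamma> = \<gamma> and v = v and z = z and a = a and b = b])
      fix s assume s: "s \<in> {a..b}"
      show "(v has_real_derivative z s) (at s)" by (rule v') (use s sub(2) in auto)
      show "0 < z s" by (rule pos(2)) (use s sub(1) in auto)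
      show "\<gamma> s = g (v s)" by (rule \<gamma>(2)[OF s])
    qed (rule that)+
    then have "g' (v r) = d\<gamma> r * inverse (z r)" by (rule g')
    moreover have "0 < z r" using that ab by (intro pos(2)) auto
    ultimately show ?thesis by simp
  qed
  (* In polar coordinates the zeroth order term is the derivative of g o v times this weight. *)
  define \<Psi> where "\<Psi> = (\<lambda>r. r ^ (?n - 1) * z r * (\<zeta> r)\<^sup>2)"
  define \<Psi>' where "\<Psi>' = (\<lambda>r. r ^ (?n - 1) * ((real ?n - 1) * z r * (\<zeta> r)\<^sup>2 / r + s r * (\<zeta> r)\<^sup>2 + 2 * z r * \<zeta> r * \<zeta>' r))"
  have d\<Psi>: "(\<Psi> has_real_derivative \<Psi>' r) (at r)" if "r \<in> {a..b}" for r
  proof -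
    have r: "r0 < r" "r < 1" "0 < r" using that ab a0 by auto
    obtain m where m: "?n = Suc (Suc m)" using k by (metis Suc_diff_1 add_lessD1 less_one mult_2 not_less_eq One_nat_def Suc_lessD Suc_less_eq2 linorder_not_le le_less_trans nat_less_le)
    have pw: "((\<lambda>r. r ^ Suc m) has_real_derivative real (Suc m) * r ^ m) (at r)" using DERIV_pow[of "Suc m" r] by simp
    show ?thesis unfolding \<Psi>_def m diff_Suc_1
      by (rule DERIV_cong[OF DERIV_mult[OF DERIV_mult[OF pw z'[OF r(1,2)]] DERIV_power[OF \<zeta>(1), of 2]]])
        (use r in \<open>simp add: \<Psi>'_def m field_simps power2_eq_square\<close>)
  qed
  have c\<Psi>': "continuous_on {a..b} \<Psi>'" unfolding \<Psi>'_def using a0 by (intro continuous_intros cont) auto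
  have c\<Psi>: "continuous_on {a..b} \<Psi>" unfolding \<Psi>_def by (intro continuous_intros cont)
  define A where "A = (\<lambda>r. real k * c * (r ^ (?n - k) * z r ^ (k - 1)) * (\<Phi>' r)\<^sup>2)"
  have A: "r ^ (?n - 1) * (real k * c * (z r / r) ^ (k - 1) * (\<Phi>' r)\<^sup>2) = A r" if "r \<in> {a..b}" for r
  proof -
    have "r ^ (?n - 1) = r ^ (?n - k) * r ^ (k - 1)" using k by (simp add: power_add[symmetric])
    then show ?thesis using that a0 by (simp add: A_def power_divide)
  qed
  have c\<gamma>: "continuous_on {a..b} \<gamma>" using \<gamma>(3) by (rule lipschitz_on_continuous_on)
  have cA: "continuous_on {a..b} A"
    unfolding A_def by (intro continuous_intros cont continuous_on_subset[OF c\<Phi>']) auto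
  obtain f Lf where f: "Lf-lipschitz_on UNIV f" "\<And>r. r \<in> {a..b} \<Longrightarrow> f r = \<gamma> r * \<Psi> r"
  proof -
    obtain L2 where L2: "L2-lipschitz_on {a..b} \<Psi>" using C1_lipschitz_Icc[OF d\<Psi> c\<Psi>'] by blast
    have b1: "bounded (\<gamma> ` {a..b})" "bounded (\<Psi> ` {a..b})"
      using c\<gamma> c\<Psi> by (auto intro!: compact_imp_bounded compact_continuous_image)
    obtain C1 where C1: "\<forall>x\<in>{a..b}. \<bar>\<gamma> x\<bar> \<le> C1" using b1(1) unfolding bounded_iff ball_simps real_norm_def by blast
    obtain C2 where C2: "\<forall>x\<in>{a..b}. \<bar>\<Psi> x\<bar> \<le> C2" using b1(2) unfolding bounded_iff ball_simps real_norm_def by blast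
    have L0: "0 \<le> L" "0 \<le> L2" using \<gamma>(1) L2 by (auto intro: lipschitz_on_nonneg)
    have "(\<bar>C1\<bar> * L2 + \<bar>C2\<bar> * L)-lipschitz_on {a..b} (\<lambda>r. \<gamma> r * \<Psi> r)"
    proof (rule lipschitz_onI)
      fix x y assume xy: "x \<in> {a..b}" "y \<in> {a..b}"
      have "\<gamma> x * \<Psi> x - \<gamma> y * \<Psi> y = \<gamma> x * (\<Psi> x - \<Psi> y) + \<Psi> y * (\<gamma> x - \<gamma> y)" by (simp add: algebra_simps)
      also have "\<bar>\<dots>\<bar> \<le> \<bar>\<gamma> x\<bar> * \<bar>\<Psi> x - \<Psi> y\<bar> + \<bar>\<Psi> y\<bar> * \<bar>\<gamma> x - \<gamma> y\<bar>"
        by (metis abs_mult abs_triangle_ineq)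
      also have "\<dots> \<le> \<bar>C1\<bar> * (L2 * dist x y) + \<bar>C2\<bar> * (L * dist x y)"
        using C1 C2 xy lipschitz_onD[OF L2 xy] lipschitz_onD[OF \<gamma>(3) xy]
        by (intro add_mono mult_mono) (auto simp: dist_real_def intro: order_trans[OF _ abs_ge_self])
      finally show "dist (\<gamma> x * \<Psi> x) (\<gamma> y * \<Psi> y) \<le> (\<bar>C1\<bar> * L2 + \<bar>C2\<bar> * L) * dist x y"
        by (simp add: dist_real_def algebra_simps)
    qed (use L0 in simp)
    from lipschitz_clamp[OF this less_imp_le[OF ab(2)]] show ?thesis
      by (rule that) auto
  qed
  have fab: "f b - f a = 0" using f(2)[of a] f(2)[of b] \<zeta>(3)[of a] \<zeta>(3)[of b] ab by (simp add: \<Psi>_def)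
  note fI = lipschitz_fundamental_theorem[OF f(1) less_imp_le[OF ab(2)]]
  define p where "p = (\<lambda>r. indicator {a..b} r * (real k * c * (z r / r) ^ (k - 1) * (\<Phi>' r)\<^sup>2) + indicator {a..b} r * (z r * (\<zeta> r)\<^sup>2) * d\<gamma> r)"
  have pm: "p \<in> borel_measurable borel"
  proof -
    have "continuous_on {a..b} (\<lambda>r. real k * c * (z r / r) ^ (k - 1) * (\<Phi>' r)\<^sup>2)"
      using a0 by (intro continuous_intros cont continuous_on_subset[OF c\<Phi>']) auto
    then have 1: "(\<lambda>r. indicator {a..b} r *\<^sub>R (real k * c * (z r / r) ^ (k - 1) * (\<Phi>' r)\<^sup>2)) \<in> borel_measurable borel"
      by (intro borel_measurable_continuous_on_indicator) auto
    have 2: "(\<lambda>r. indicator {a..b} r *\<^sub>R (z r * (\<zeta> r)\<^sup>2)) \<in> borel_measurable borel"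
      by (intro borel_measurable_continuous_on_indicator continuous_intros cont) auto
    have 3: "d\<gamma> \<in> borel_measurable borel"
      unfolding d\<gamma>_def by (rule right_quotient_limit_borel[OF lipschitz_on_continuous_on[OF \<gamma>(1)]])
    have "(\<lambda>r. indicator {a..b} r *\<^sub>R (real k * c * (z r / r) ^ (k - 1) * (\<Phi>' r)\<^sup>2) + indicator {a..b} r *\<^sub>R (z r * (\<zeta> r)\<^sup>2) * d\<gamma> r) \<in> borel_measurable borel"
      by (intro borel_measurable_add borel_measurable_times 1 2 3)
    then show ?thesis by (simp add: p_def)
  qed
  have neq: "AE r in lborel. r \<noteq> a" "AE r in lborel. r \<noteq> b" by (rule AE_lborel_singleton)+
  have aeFp: "AE r in lborel. F r = p r"
    using ae\<gamma> neq
  proof eventually_elim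
    case (elim r)
    show ?case
    proof (cases "r \<in> {a..b}")
      case True
      then have r: "a < r" "r < b" "r0 < r" "r < 1" using elim ab by auto
      have "g' (v r) * (\<Phi> r)\<^sup>2 = (g' (v r) * z r) * (z r * (\<zeta> r)\<^sup>2)"
        using r by (simp add: \<Phi>_def power2_eq_square)
      also have "\<dots> = z r * (\<zeta> r)\<^sup>2 * d\<gamma> r" using g'z[OF r(1,2) elim(1)] by simp
      finally show ?thesis using True by (simp add: F_def p_def)
    qed (simp add: F_def p_def \<Phi>0)
  qed
  have "0 \<le> (LINT x|?L. q x)" using q(2) by (simp add: q_def)
  also have "(LINT x|?L. q x) = (LINT x|?L. p (norm x))"
  proof (rule integral_cong_AE)
    show "q \<in> borel_measurable ?L" using borel_measurable_integrable[OF q(1)] by (simp add: q_def[abs_def])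
    show "(\<lambda>x. p (norm x)) \<in> borel_measurable ?L"
    proof (rule measurable_compose[OF _ pm])
      show "norm \<in> borel_measurable ?L"
        by (intro continuous_imp_measurable_on_sets_lebesgue continuous_intros) auto
    qed
    have "AE x in ?L. F (norm x) = p (norm x)" by (rule polar_AE[OF aeFp])
    moreover have "AE x in ?L. x \<in> ?B" by (rule AE_I2) (simp add: space_restrict_space)
    ultimately show "AE x in ?L. q x = p (norm x)" by eventually_elim (simp add: qF)
  qed
  also have "\<dots> = sphere_area TYPE(real^'n) * (LBINT r:{0<..<1}. r ^ (?n - 1) * p r)"
    using polar_integral(2)[OF pm, where 'a="real^'n"] by simp
  finally have "0 \<le> (LBINT r:{0<..<1}. r ^ (?n - 1) * p r)"
    using sphere_area_pos[where 'a="real^'n"] by (simp add: zero_le_mult_iff)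
  also have "\<dots> = (LBINT r:{a..b}. (A r - \<gamma> r * \<Psi>' r) + right_quotient_limit f r)"
    unfolding set_lebesgue_integral_def
  proof (rule integral_cong_AE)
    show "(\<lambda>r. indicator {0<..<1} r *\<^sub>R (r ^ (?n - 1) * p r)) \<in> borel_measurable lborel"
      using pm by measurable
    have 1: "(\<lambda>r. indicator {a..b} r *\<^sub>R (A r - \<gamma> r * \<Psi>' r)) \<in> borel_measurable borel"
      by (intro borel_measurable_continuous_on_indicator continuous_intros cA c\<gamma> c\<Psi>') auto
    have 2: "right_quotient_limit f \<in> borel_measurable borel"
      by (rule right_quotient_limit_borel[OF lipschitz_on_continuous_on[OF f(1)]])
    have "(\<lambda>r. indicator {a..b} r *\<^sub>R (A r - \<gamma> r * \<Psi>' r) + indicator {a..b} r *\<^sub>R right_quotient_limit f r) \<in> borel_measurable lborel"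
      using 1 2 by measurable
    then show "(\<lambda>r. indicator {a..b} r *\<^sub>R (A r - \<gamma> r * \<Psi>' r + right_quotient_limit f r)) \<in> borel_measurable lborel"
      by (simp add: algebra_simps)
    show "AE r in lborel. indicator {0<..<1} r *\<^sub>R (r ^ (?n - 1) * p r) = indicator {a..b} r *\<^sub>R (A r - \<gamma> r * \<Psi>' r + right_quotient_limit f r)"
      using ae\<gamma> neq fI(3)
    proof eventually_elim
      case (elim r)
      show ?case
      proof (cases "r \<in> {a..b}")
        case True
        then have r: "a < r" "r < b" "0 < r" "r < 1" using elim ab a0 by auto
        have "((\<lambda>r. \<gamma> r * \<Psi> r) has_real_derivative d\<gamma> r * \<Psi> r + \<Psi>' r * \<gamma> r) (at r)"
          by (rule DERIV_mult[OF elim(1) d\<Psi>[OF True]])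
        then have "(f has_real_derivative d\<gamma> r * \<Psi> r + \<Psi>' r * \<gamma> r) (at r)"
          by (rule has_field_derivative_transform_within_open[where S = "{a<..<b}"]) (use r f(2) in auto)
        then have "right_quotient_limit f r = d\<gamma> r * \<Psi> r + \<Psi>' r * \<gamma> r" using elim(4) DERIV_unique by blast
        moreover have "r ^ (?n - 1) * p r = A r + d\<gamma> r * \<Psi> r"
          using True A[OF True] by (simp add: p_def \<Psi>_def algebra_simps)
        ultimately show ?thesis using True r by simp
      qed (simp add: p_def)
    qed
  qed
  also have "\<dots> = (LBINT r:{a..b}. A r - \<gamma> r * \<Psi>' r) + (LBINT r:{a..b}. right_quotient_limit f r)"
    by (intro set_integral_add borel_integrable_atLeastAtMost' continuous_intros cA c\<gamma> c\<Psi>' fI(1))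
  also have "(LBINT r:{a..b}. right_quotient_limit f r) = 0" using fI(2) fab by simp
  finally have nonneg: "0 \<le> (LBINT r:{a..b}. A r - \<gamma> r * \<Psi>' r)" by simp
  let ?a0 = "((real k + 1) * real ?n - 2 * real k) / (real k + 1)"
  define Q where "Q = (\<lambda>r. r ^ (?n - k) * z r ^ (k + 1) * stability_form ?n k r (\<zeta> r) (\<zeta>' r))"
  (* The boundary term of the algebraic identity: its derivative collects the terms linear in s. *)
  define U where "U = (\<lambda>r. c * ?a0 * (r ^ (?n - k - 1) * z r ^ (k + 1) * (\<zeta> r)\<^sup>2))"
  define U' where "U' = (\<lambda>r. c * ?a0 * ((real ?n - real k - 1) * r ^ (?n - k - 2) * z r ^ (k + 1) * (\<zeta> r)\<^sup>2
      + r ^ (?n - k - 1) * ((real k + 1) * z r ^ k * s r) * (\<zeta> r)\<^sup>2 + r ^ (?n - k - 1) * z r ^ (k + 1) * (2 * \<zeta> r * \<zeta>' r)))"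
  obtain m where m: "?n - k = Suc (Suc m)"
  proof -
    have "2 \<le> ?n - k" using k by simp
    then show ?thesis using that by (metis Suc_le_D numeral_2_eq_2 Suc_le_mono)
  qed
  have nm: "?n - k - 1 = Suc m" "?n - k - 2 = m" "real ?n - real k - 1 = real (Suc m)" using m k by auto
  obtain j where j: "k = Suc j" using k by (cases k) auto
  have pointwise: "A r - \<gamma> r * \<Psi>' r = real k * c * Q r - U' r" if r: "r \<in> {a..b}" for r
  proof -
    have r': "0 < r" "r0 < r" "r < 1" using r a0 ab by auto
    have pows: "r ^ (?n - k) = r ^ m * r\<^sup>2" "r ^ (?n - k - 1) = r ^ m * r" "r ^ (?n - k - 2) = r ^ m"
      "z r ^ (k + 1) = z r ^ (k - 1) * (z r)\<^sup>2" "z r ^ k = z r ^ (k - 1) * z r"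
      unfolding nm(1,2) unfolding m by (auto simp: power2_eq_square j)
    have eq: "r ^ (?n - 1) * g (v r) = c * ((real ?n - real k) * (r ^ m * r) * (z r ^ (k - 1) * z r)
       + real k * (r ^ m * r\<^sup>2) * z r ^ (k - 1) * s r)"
      using profile_slope_equation[where z = z and g = g and v = v and r = r, OF k(1) kn(1) r'(1) pos(2)[OF r'(2,3)]]
      unfolding c_def s_def pows by (simp only: mult.assoc)
    have "\<gamma> r * \<Psi>' r = (r ^ (?n - 1) * g (v r)) * ((real ?n - 1) * z r * (\<zeta> r)\<^sup>2 / r + s r * (\<zeta> r)\<^sup>2 + 2 * z r * \<zeta> r * \<zeta>' r)"
      unfolding \<Psi>'_def using \<gamma>(2)[OF r] by (simp only: mult.assoc mult.left_commute)
    moreover have "A r = real k * c * (r ^ m * r\<^sup>2) * z r ^ (k - 1) * (s r * \<zeta> r + z r * \<zeta>' r)\<^sup>2"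
      unfolding A_def \<Phi>'_def pows using r' by (simp add: mult.assoc)
    ultimately have "A r - \<gamma> r * \<Psi>' r = real k * c * ((r ^ m * r\<^sup>2) * (z r ^ (k - 1) * (z r)\<^sup>2) * stability_form ?n k r (\<zeta> r) (\<zeta>' r))
      - c * ?a0 * ((real ?n - real k - 1) * r ^ m * (z r ^ (k - 1) * (z r)\<^sup>2) * (\<zeta> r)\<^sup>2
        + (r ^ m * r) * ((real k + 1) * (z r ^ (k - 1) * z r) * s r) * (\<zeta> r)\<^sup>2 + (r ^ m * r) * (z r ^ (k - 1) * (z r)\<^sup>2) * (2 * \<zeta> r * \<zeta>' r))"
      unfolding eq using stability_algebra[of r k c "r ^ m" "z r ^ (k - 1)" "s r" "\<zeta> r" "z r" "\<zeta>' r" ?n] r'(1) by (simp only:)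
    then show ?thesis unfolding Q_def U'_def pows by (simp only: mult.assoc)
  qed
  have cQ: "continuous_on {a..b} Q"
    unfolding Q_def stability_form_def using a0 by (intro continuous_intros cont) auto
  have cU': "continuous_on {a..b} U'"
    unfolding U'_def by (intro continuous_intros cont)
  have dU: "(U has_real_derivative U' r) (at r)" if "r \<in> {a..b}" for r
  proof -
    have r: "r0 < r" "r < 1" using that ab by auto
    have pw: "((\<lambda>r. r ^ Suc m) has_real_derivative real (Suc m) * r ^ m) (at r)" using DERIV_pow[of "Suc m" r] by simp
    have "((\<lambda>r. r ^ Suc m * z r ^ (k + 1) * (\<zeta> r)\<^sup>2) has_real_derivative
      (real (Suc m) * r ^ m * z r ^ (k + 1) * (\<zeta> r)\<^sup>2
      + r ^ Suc m * ((real k + 1) * z r ^ k * s r) * (\<zeta> r)\<^sup>2 + r ^ Suc m * z r ^ (k + 1) * (2 * \<zeta> r * \<zeta>' r))) (at r)"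
      by (rule DERIV_cong[OF DERIV_mult[OF DERIV_mult[OF pw DERIV_power[OF z'[OF r], of "k + 1"]] DERIV_power[OF \<zeta>(1), of 2]]])
        (simp add: algebra_simps power2_eq_square)
    from DERIV_cmult[OF this, of "c * ?a0"] show ?thesis unfolding U_def U'_def nm .
  qed
  have IU: "(LBINT r:{a..b}. U' r) = 0"
  proof -
    have "(LBINT r:{a..b}. U' r) = U b - U a"
      unfolding set_lebesgue_integral_def
      by (rule integral_FTC_atLeastAtMost[OF _ _ cU'])
        (use ab dU in \<open>auto simp: has_real_derivative_iff_has_vector_derivative intro: has_vector_derivative_at_within\<close>)
    then show ?thesis using \<zeta>(3)[of a] \<zeta>(3)[of b] by (simp add: U_def)
  qed
  have "(LBINT r:{a..b}. A r - \<gamma> r * \<Psi>' r) = (LBINT r:{a..b}. real k * c * Q r - U' r)"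
    by (rule set_lebesgue_integral_cong) (use pointwise in auto)
  also have "\<dots> = (LBINT r:{a..b}. real k * c * Q r) - (LBINT r:{a..b}. U' r)"
    by (intro set_integral_diff borel_integrable_atLeastAtMost' continuous_intros cQ cU')
  also have "\<dots> = real k * c * (LBINT r:{a..b}. Q r)" using IU by simp
  finally have "0 \<le> real k * c * (LBINT r:{a..b}. Q r)" using nonneg by simp
  moreover have "0 < real k * c" using c k(1) by simp
  ultimately have "0 \<le> (LBINT r:{a..b}. Q r)" by (simp only: zero_le_mult_iff) linarith
  then show ?thesis unfolding Q_def .
qed

section \<open>Decay of the energy\<close>

text \<open>A \<open>C\<^sup>1\<close> transition from \<open>0\<close> to \<open>1\<close> on the unit interval, made from the squares of positive parts.\<close>

definition smoothstep :: "real \<Rightarrow> real" where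
  "smoothstep t = (max 0 t)\<^sup>2 / ((max 0 t)\<^sup>2 + (max 0 (1 - t))\<^sup>2)"

definition smoothstep' :: "real \<Rightarrow> real" where
  "smoothstep' t = (2 * max 0 t * (max 0 (1 - t))\<^sup>2 + 2 * max 0 (1 - t) * (max 0 t)\<^sup>2)
     / ((max 0 t)\<^sup>2 + (max 0 (1 - t))\<^sup>2)\<^sup>2"

lemma smoothstep_denominator: "0 < (max 0 t)\<^sup>2 + (max 0 (1 - t))\<^sup>2" for t :: real
proof (cases "0 < t")
  case True then show ?thesis by (intro add_pos_nonneg) auto
next
  case False then show ?thesis by (intro add_nonneg_pos) auto
qed

lemma smoothstep_derivative: "(smoothstep has_real_derivative smoothstep' t) (at t)"
proof -
  have 1: "((\<lambda>t. (max 0 (1 - t))\<^sup>2) has_real_derivative - (2 * max 0 (1 - t))) (at t)"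
  proof -
    have "((\<lambda>t::real. 1 - t) has_real_derivative - 1) (at t)" by (auto intro!: derivative_eq_intros)
    from DERIV_chain2[OF has_derivative_pos_part_square this] show ?thesis by simp
  qed
  show ?thesis
    unfolding smoothstep_def[abs_def]
    by (rule DERIV_cong[OF DERIV_divide[OF has_derivative_pos_part_square DERIV_add[OF has_derivative_pos_part_square 1]]])
      (use smoothstep_denominator[of t] in \<open>auto simp: smoothstep'_def power2_eq_square algebra_simps\<close>)
qed

lemma continuous_smoothstep': "continuous_on S smoothstep'"
  unfolding smoothstep'_def[abs_def] using smoothstep_denominator
  by (intro continuous_intros) (auto simp: less_imp_neq[symmetric])

lemma smoothstep_values:
  "t \<le> 0 \<Longrightarrow> smoothstep t = 0" "1 \<le> t \<Longrightarrow> smoothstep t = 1" "0 \<le> smoothstep t" "smoothstep t \<le> 1"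
  "t \<le> 0 \<Longrightarrow> smoothstep' t = 0" "1 \<le> t \<Longrightarrow> smoothstep' t = 0"
  using smoothstep_denominator[of t] by (auto simp: smoothstep_def smoothstep'_def divide_le_eq)

lemma smoothstep'_bound: "\<bar>smoothstep' t\<bar> \<le> 2"
proof (cases "0 \<le> t \<and> t \<le> 1")
  case True
  define w where "w = t * (1 - t)"
  have w: "0 \<le> w" "w \<le> 1 / 4"
  proof -
    show "0 \<le> w" using True by (simp add: w_def)
    have "0 \<le> (2 * t - 1)\<^sup>2" by simp
    then show "w \<le> 1 / 4" by (simp add: w_def power2_eq_square algebra_simps)
  qed
  have den: "t\<^sup>2 + (1 - t)\<^sup>2 = 1 - 2 * w" by (simp add: w_def power2_eq_square algebra_simps)
  have num: "2 * t * (1 - t)\<^sup>2 + 2 * (1 - t) * t\<^sup>2 = 2 * w" by (simp add: w_def power2_eq_square algebra_simps)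
  have eq: "smoothstep' t = 2 * w / (1 - 2 * w)\<^sup>2" using True den num by (simp add: smoothstep'_def)
  have "0 \<le> 2 * ((1 - w) * (1 - 4 * w))" using w by simp
  also have "\<dots> = 2 * (1 - 2 * w)\<^sup>2 - 2 * w" by (simp add: power2_eq_square algebra_simps)
  finally have "2 * w \<le> 2 * (1 - 2 * w)\<^sup>2" by simp
  moreover have "0 < (1 - 2 * w)\<^sup>2" using w by simp
  ultimately show ?thesis unfolding eq using w by (simp add: divide_le_eq)
qed (use smoothstep_values(5,6)[of t] in auto)

text \<open>The absolute value of the negative root of the polynomial below.\<close>

definition stability_exponent :: "nat \<Rightarrow> nat \<Rightarrow> real" where
  "stability_exponent n k = ((real k - 1) + sqrt (2 * (real k + 1) * real n - 4 * real k)) / (real k + 1)"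

text \<open>The form acts on power functions \<open>r\<^sup>p\<close> by this polynomial in \<open>p\<close>, which has the root \<open>- stability_exponent\<close>.\<close>

definition stability_polynomial :: "nat \<Rightarrow> nat \<Rightarrow> real \<Rightarrow> real" where
  "stability_polynomial n k p = p\<^sup>2 + 2 * ((real k - 1) / (real k + 1)) * p - (2 * real n - real k - 1) / (real k + 1)"

lemma stability_radicand:
  assumes "1 \<le> k" "2 * k < n"
  shows "0 \<le> 2 * (real k + 1) * real n - 4 * real k"
proof -
  have "2 * real k \<le> real n" using assms(2) by linarith
  then have "2 * (real k + 1) * (2 * real k) \<le> 2 * (real k + 1) * real n" by (intro mult_left_mono) auto
  moreover have "4 * real k \<le> 2 * (real k + 1) * (2 * real k)" by (simp add: algebra_simps)
  ultimately show ?thesis by linarith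
qed

lemma stability_polynomial_factor:
  assumes "1 \<le> k" "2 * k < n"
  shows "stability_polynomial n k p
    = (p + stability_exponent n k) * (p - (stability_exponent n k - 2 * ((real k - 1) / (real k + 1))))"
proof -
  define K where "K = real k + 1"
  define D where "D = sqrt (2 * K * real n - 4 * (K - 1))"
  have K: "0 < K" by (simp add: K_def)
  have "4 * (K - 1) \<le> 2 * K * real n" using stability_radicand[OF assms] by (simp add: K_def)
  then have D2: "D\<^sup>2 = 2 * K * real n - 4 * (K - 1)" by (simp add: D_def)
  have e: "stability_exponent n k = (K - 2 + D) / K" by (simp add: stability_exponent_def K_def D_def algebra_simps)
  have "K\<^sup>2 * ((p + (K - 2 + D) / K) * (p - ((K - 2 + D) / K - 2 * ((K - 2) / K)))) = (K * p + K - 2 + D) * (K * p - (2 - K + D))"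
    using K by (simp add: field_simps power2_eq_square)
  also have "\<dots> = (K * p + K - 2)\<^sup>2 - D\<^sup>2" by (simp add: power2_eq_square algebra_simps)
  also have "\<dots> = K\<^sup>2 * (p\<^sup>2 + 2 * ((K - 2) / K) * p - (2 * real n - K) / K)"
    unfolding D2 using K by (simp add: field_simps power2_eq_square)
  finally have "(p + (K - 2 + D) / K) * (p - ((K - 2 + D) / K - 2 * ((K - 2) / K))) = p\<^sup>2 + 2 * ((K - 2) / K) * p - (2 * real n - K) / K"
    using K by simp
  then show ?thesis unfolding e by (simp add: stability_polynomial_def K_def algebra_simps)
qed

text \<open>
  The first inequality says that the positive root of the polynomial exceeds \<open>1\<close>, which is where \<open>2
  k < n\<close> enters: the value at \<open>1\<close> is negative.
\<close>

lemma stability_exponent_bounds: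
  assumes "1 \<le> k" "2 * k < n"
  shows "1 + 2 * ((real k - 1) / (real k + 1)) < stability_exponent n k" "1 \<le> stability_exponent n k"
proof -
  have "2 * real k < real n" using assms(2) by linarith
  have "0 \<le> stability_exponent n k"
    using assms(1) stability_radicand[OF assms] unfolding stability_exponent_def
    by (intro divide_nonneg_pos add_nonneg_nonneg real_sqrt_ge_zero) auto
  have "stability_polynomial n k 1 = (4 * real k - 2 * real n) / (real k + 1)"
    by (simp add: stability_polynomial_def divide_simps)
  also have "\<dots> < 0" using \<open>2 * real k < real n\<close> by (intro divide_neg_pos) auto
  finally have "(1 + stability_exponent n k) * (1 - (stability_exponent n k - 2 * ((real k - 1) / (real k + 1)))) < 0"
    by (simp only: stability_polynomial_factor[OF assms])
  then have 1: "1 - (stability_exponent n k - 2 * ((real k - 1) / (real k + 1))) < 0"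
    using \<open>0 \<le> stability_exponent n k\<close> by (simp add: mult_less_0_iff)
  then show "1 + 2 * ((real k - 1) / (real k + 1)) < stability_exponent n k" by simp
  have "0 \<le> (real k - 1) / (real k + 1)" using assms(1) by simp
  then show "1 \<le> stability_exponent n k" using 1 by linarith
qed

text \<open>
  A lower bound for \<open>- stability_polynomial n k p\<close> on the interval from \<open>(1 - s) / 2\<close> to \<open>1\<close>, where
  \<open>s\<close> is the stability exponent: the product of the least values of the two factors.
\<close>

definition stability_gap :: "nat \<Rightarrow> nat \<Rightarrow> real" where
  "stability_gap n k = (1 + stability_exponent n k) / 2 * (stability_exponent n k - 2 * ((real k - 1) / (real k + 1)) - 1)"

lemma stability_gap_pos: "1 \<le> k \<Longrightarrow> 2 * k < n \<Longrightarrow> 0 < stability_gap n k"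
  using stability_exponent_bounds[of k n] by (auto simp: stability_gap_def intro!: mult_pos_pos)

lemma stability_polynomial_nonpos:
  assumes "1 \<le> k" "2 * k < n" "- stability_exponent n k \<le> p" "p \<le> 1"
  shows "stability_polynomial n k p \<le> 0"
  unfolding stability_polynomial_factor[OF assms(1,2)]
  using assms(3,4) stability_exponent_bounds[OF assms(1,2)] by (intro mult_nonneg_nonpos) auto

lemma stability_polynomial_gap:
  assumes "1 \<le> k" "2 * k < n" "(1 - stability_exponent n k) / 2 \<le> p" "p \<le> 1"
  shows "stability_polynomial n k p \<le> - stability_gap n k"
proof -
  let ?s = "stability_exponent n k" let ?t = "?s - 2 * ((real k - 1) / (real k + 1))"
  have "(1 + ?s) / 2 * (?t - 1) \<le> (p + ?s) * (?t - p)"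
    using assms(3,4) stability_exponent_bounds[OF assms(1,2)] by (intro mult_mono) auto
  then show ?thesis unfolding stability_polynomial_factor[OF assms(1,2)] stability_gap_def
    by (simp add: algebra_simps)
qed

text \<open>Here \<open>r y\<close> is a weight with logarithmic slope \<open>p\<close> and \<open>\<kappa>\<close> is a cut-off.\<close>

lemma stability_form_cutoff:
  assumes "r \<noteq> 0"
  shows "stability_form n k r (r * y * \<kappa>) (p * y * \<kappa> + r * y * d)
     = y\<^sup>2 * (\<kappa>\<^sup>2 * stability_polynomial n k p + 2 * r * (p + (real k - 1) / (real k + 1)) * \<kappa> * d + r\<^sup>2 * d\<^sup>2)"
  unfolding stability_form_def stability_polynomial_def using assms
  by (simp add: divide_simps) algebra

lemma stability_form_cutoff_bound:
  assumes k: "1 \<le> k" "2 * k < n" and r: "0 < r" and p: "- stability_exponent n k \<le> p" "p \<le> 1" and \<kappa>: "0 \<le> \<kappa>" "\<kappa> \<le> 1"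
    and d: "\<bar>d\<bar> \<le> \<Delta>" and y: "0 \<le> y" "y \<le> Y"
  shows "stability_form n k r (r * y * \<kappa>) (p * y * \<kappa> + r * y * d) \<le> Y\<^sup>2 * (2 * (stability_exponent n k + 1) * (r * \<Delta>) + (r * \<Delta>)\<^sup>2)"
proof -
  let ?s = "stability_exponent n k" let ?b = "(real k - 1) / (real k + 1)"
  have b: "0 \<le> ?b" "?b \<le> 1" using k(1) by auto
  have s: "1 \<le> ?s" by (rule stability_exponent_bounds(2)[OF k])
  have \<Delta>: "0 \<le> \<Delta>" using d by linarith
  have "\<kappa>\<^sup>2 * stability_polynomial n k p \<le> 0"
    using stability_polynomial_nonpos[OF k p] by (intro mult_nonneg_nonpos) auto
  moreover have "2 * r * (p + ?b) * \<kappa> * d \<le> 2 * (?s + 1) * (r * \<Delta>)"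
  proof -
    have "2 * r * (p + ?b) * \<kappa> * d \<le> \<bar>2 * r * (p + ?b) * \<kappa> * d\<bar>" by (rule abs_ge_self)
    also have "\<dots> = 2 * r * (\<bar>p + ?b\<bar> * \<kappa> * \<bar>d\<bar>)" using r \<kappa> by (simp add: abs_mult)
    also have "\<dots> \<le> 2 * r * ((?s + 1) * 1 * \<Delta>)"
    proof -
      have "\<bar>p + ?b\<bar> \<le> ?s + 1" by (rule abs_leI) (use p b s in linarith)+
      then show ?thesis using r s \<kappa> d by (intro mult_left_mono mult_mono) auto
    qed
    finally show ?thesis by (simp add: ac_simps)
  qed
  moreover have "r\<^sup>2 * d\<^sup>2 \<le> (r * \<Delta>)\<^sup>2"
    using d \<Delta> r by (auto simp: power_mult_distrib abs_le_square_iff[symmetric])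
  ultimately have le: "\<kappa>\<^sup>2 * stability_polynomial n k p + 2 * r * (p + ?b) * \<kappa> * d + r\<^sup>2 * d\<^sup>2 \<le> 2 * (?s + 1) * (r * \<Delta>) + (r * \<Delta>)\<^sup>2"
    by linarith
  have nn: "0 \<le> 2 * (?s + 1) * (r * \<Delta>) + (r * \<Delta>)\<^sup>2" using s r \<Delta> by simp
  have "y\<^sup>2 * (\<kappa>\<^sup>2 * stability_polynomial n k p + 2 * r * (p + ?b) * \<kappa> * d + r\<^sup>2 * d\<^sup>2) \<le> y\<^sup>2 * (2 * (?s + 1) * (r * \<Delta>) + (r * \<Delta>)\<^sup>2)"
    by (rule mult_left_mono[OF le]) simp
  also have "\<dots> \<le> Y\<^sup>2 * (2 * (?s + 1) * (r * \<Delta>) + (r * \<Delta>)\<^sup>2)"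
    using y nn by (intro mult_right_mono power_mono)
  finally show ?thesis using stability_form_cutoff[of r n k y \<kappa> p d] r by simp
qed

text \<open>
  The weight \<open>\<xi>(r) = r / (r\<^sup>s\<^sup>+\<^sup>1 + \<rho>\<^sup>s\<^sup>+\<^sup>1)\<close> interpolates smoothly between \<open>r\<close> and \<open>r\<^sup>-\<^sup>s\<close>; its logarithmic slope stays in
  \<open>[-s, 1]\<close>, where the form is nonpositive, and on \<open>r \<le> \<rho>\<close> it stays away from the root \<open>-s\<close>.
\<close>

lemma interpolating_weight:
  assumes "0 < r" "0 < \<rho>" and s: "1 \<le> s"
  defines "y \<equiv> 1 / (r powr (s + 1) + \<rho> powr (s + 1))" and "p \<equiv> (\<rho> powr (s + 1) - s * r powr (s + 1)) / (r powr (s + 1) + \<rho> powr (s + 1))"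
  shows "((\<lambda>r. r / (r powr (s + 1) + \<rho> powr (s + 1))) has_real_derivative p * y) (at r)"
    and "- s \<le> p" "p \<le> 1" "0 < y" "y \<le> \<rho> powr - (s + 1)" "y \<le> r powr - (s + 1)"
    and "r \<le> \<rho> \<Longrightarrow> (1 - s) / 2 \<le> p" "r \<le> \<rho> \<Longrightarrow> \<rho> powr - (s + 1) / 2 \<le> y"
proof -
  let ?X = "r powr (s + 1)" let ?A = "\<rho> powr (s + 1)"
  have X: "0 < ?X" "0 < ?A" using assms(1,2) by auto
  have "r * r powr s = ?X" using assms(1) by (simp add: powr_add)
  have "((\<lambda>r. r powr (s + 1) + \<rho> powr (s + 1)) has_real_derivative (s + 1) * r powr s) (at r)"
    using assms(1) by (auto intro!: derivative_eq_intros)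
  then have "((\<lambda>r. r / (r powr (s + 1) + \<rho> powr (s + 1))) has_real_derivative
      (1 * (?X + ?A) - r * ((s + 1) * r powr s)) / ((?X + ?A) * (?X + ?A))) (at r)"
    using add_pos_pos[OF X] by (intro DERIV_divide) (auto intro!: derivative_eq_intros)
  moreover have "(1 * (?X + ?A) - r * ((s + 1) * r powr s)) / ((?X + ?A) * (?X + ?A)) = p * y"
  proof -
    have "1 * (?X + ?A) - r * ((s + 1) * r powr s) = ?A - s * ?X"
      using \<open>r * r powr s = ?X\<close> by (simp add: algebra_simps)
    then show ?thesis by (simp add: p_def y_def)
  qed
  ultimately show "((\<lambda>r. r / (r powr (s + 1) + \<rho> powr (s + 1))) has_real_derivative p * y) (at r)" by simp
  have "0 \<le> s * ?A" "0 \<le> s * ?X" using s by auto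
  have den: "0 < ?X + ?A" using add_pos_pos[OF X] .
  have "- s * (?X + ?A) \<le> ?A - s * ?X" "?A - s * ?X \<le> 1 * (?X + ?A)"
  proof -
    have "- s * (?X + ?A) = - (s * ?X) - s * ?A" by (simp add: algebra_simps)
    then show "- s * (?X + ?A) \<le> ?A - s * ?X" using X \<open>0 \<le> s * ?A\<close> by linarith
    show "?A - s * ?X \<le> 1 * (?X + ?A)" unfolding mult_1 using X \<open>0 \<le> s * ?X\<close> by linarith
  qed
  then show "- s \<le> p" "p \<le> 1" unfolding p_def by (simp_all only: pos_le_divide_eq[OF den] pos_divide_le_eq[OF den])
  show "0 < y" unfolding y_def by (simp only: zero_less_divide_1_iff den)
  show "y \<le> \<rho> powr - (s + 1)" "y \<le> r powr - (s + 1)"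
    unfolding y_def powr_minus_divide by (rule frac_le; use X in linarith)+
  assume "r \<le> \<rho>"
  then have XA: "?X \<le> ?A" using assms(1) s by (intro powr_mono2) auto
  then have "0 \<le> (s + 1) * (?A - ?X)" using s by simp
  then have "(1 - s) / 2 * (?X + ?A) \<le> ?A - s * ?X" by (simp add: field_simps)
  then show "(1 - s) / 2 \<le> p" unfolding p_def by (simp only: pos_le_divide_eq[OF den])
  show "\<rho> powr - (s + 1) / 2 \<le> y"
  proof -
    have "1 / ?A / 2 = 1 / (2 * ?A)" by simp
    also have "\<dots> \<le> 1 / (?X + ?A)" by (rule frac_le; use X XA in linarith)
    finally show ?thesis by (simp only: y_def powr_minus_divide)
  qed
qed

lemma LBINT_indicator_subset:
  fixes f :: "real \<Rightarrow> real"
  assumes "A \<subseteq> B"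
  shows "(LBINT r:B. indicator A r * f r) = (LBINT r:A. f r)"
  unfolding set_lebesgue_integral_def
  by (rule Bochner_Integration.integral_cong) (use assms in \<open>auto simp: indicator_def\<close>)

lemma set_integrable_indicator_subset:
  fixes f :: "real \<Rightarrow> real"
  assumes "A \<subseteq> B" "set_integrable lborel A f"
  shows "set_integrable lborel B (\<lambda>r. indicator A r * f r)"
  using assms(2) unfolding set_integrable_def
  by (rule Bochner_Integration.integrable_cong[THEN iffD1, OF refl, rotated]) (use assms(1) in \<open>auto simp: indicator_def\<close>)

text \<open>
  Testing with the interpolating weight, cut off smoothly at \<open>r0 + \<delta>\<close> and between \<open>1/2\<close> and \<open>3/4\<close>. The lower
  cut-off costs nothing in the limit \<open>\<delta> \<rightarrow> 0\<close>, and the upper one a fixed multiple of the energy there.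
\<close>

lemma energy_decay:
  fixes e :: "real \<Rightarrow> real" and n k :: nat
  defines "s \<equiv> stability_exponent n k"
  assumes k: "1 \<le> k" "2 * k < n" and r0: "0 \<le> r0" "r0 < a" "a \<le> \<rho>" "\<rho> \<le> 1/2"
    and e: "continuous_on {0<..1} e" "\<And>r. r \<in> {0<..1} \<Longrightarrow> 0 \<le> e r"
    and stable: "\<And>\<alpha> \<beta> \<zeta> \<zeta>'. r0 < \<alpha> \<Longrightarrow> \<alpha> < \<beta> \<Longrightarrow> \<beta> < 1 \<Longrightarrow> (\<And>r. (\<zeta> has_real_derivative \<zeta>' r) (at r)) \<Longrightarrow>
       continuous_on UNIV \<zeta>' \<Longrightarrow> (\<And>r. r \<notin> {\<alpha><..<\<beta>} \<Longrightarrow> \<zeta> r = 0) \<Longrightarrow>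
       0 \<le> (LBINT r:{\<alpha>..\<beta>}. e r * stability_form n k r (\<zeta> r) (\<zeta>' r))"
    and cutoff: "\<And>\<epsilon>. 0 < \<epsilon> \<Longrightarrow> \<exists>\<delta>0>0. \<forall>\<delta>. 0 < \<delta> \<and> \<delta> < \<delta>0 \<longrightarrow> (LBINT r:{r0+\<delta>..r0+2*\<delta>}. (r / \<delta>)\<^sup>2 * e r) \<le> \<epsilon>"
  shows "stability_gap n k / 4 * (LBINT r:{a..\<rho>}. e r)
     \<le> (2 powr (s + 1))\<^sup>2 * (16 * s + 80) * (\<rho> powr (s + 1))\<^sup>2 * (LBINT r:{1/2..3/4}. e r)"
proof -
  define A where "A = \<rho> powr (s + 1)"
  define \<kappa> where "\<kappa> = stability_gap n k"
  (* K1 (r / delta)^2 and K3 bound the form on the lower and on the upper transition zone. *)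
  define K1 where "K1 = (1 / A)\<^sup>2 * (4 * s + 8)"
  define K3 where "K3 = (2 powr (s + 1))\<^sup>2 * (16 * s + 80)"
  have s1: "1 \<le> s" unfolding s_def by (rule stability_exponent_bounds(2)[OF k])
  have \<rho>: "0 < \<rho>" using r0 by linarith
  have A: "0 < A" using \<rho> by (simp add: A_def)
  have \<kappa>: "0 < \<kappa>" unfolding \<kappa>_def by (rule stability_gap_pos[OF k])
  have K1: "0 < K1" using A s1 by (simp add: K1_def)
  have K3: "0 \<le> K3" using s1 by (simp add: K3_def)
  define y where "y = (\<lambda>r. 1 / (r powr (s + 1) + A))"
  define p where "p = (\<lambda>r. (A - s * r powr (s + 1)) / (r powr (s + 1) + A))"
  have eqA: "\<rho> powr - (s + 1) = 1 / A" unfolding A_def by (rule powr_minus_divide)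
  note weight = interpolating_weight[OF _ \<rho> s1, folded A_def, unfolded eqA]
  have w1: "((\<lambda>r. r * y r) has_real_derivative p r * y r) (at r)" if "0 < r" for r
    using weight(1)[OF that] by (simp add: y_def p_def)
  have w2: "- s \<le> p r" "p r \<le> 1" "0 < y r" "y r \<le> 1 / A" "y r \<le> r powr - (s + 1)" if "0 < r" for r
    using weight(2-6)[OF that] unfolding y_def p_def by blast+
  have w3: "(1 - s) / 2 \<le> p r" "1 / A / 2 \<le> y r" if "0 < r" "r \<le> \<rho>" for r
    using weight(7,8)[OF that(1)] that(2) unfolding y_def p_def by blast+
  have eint: "set_integrable lborel {c..d} (\<lambda>r. h r * e r)" if "0 < c" "d \<le> 1" "continuous_on {c..d} h" for c d h
    using that by (intro borel_integrable_atLeastAtMost' continuous_intros continuous_on_subset[OF e(1)]) auto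
  have main: "\<kappa> / (4 * A\<^sup>2) * (LBINT r:{a..\<rho>}. e r) \<le> K1 * (LBINT r:{r0+\<delta>..r0+2*\<delta>}. (r / \<delta>)\<^sup>2 * e r) + K3 * (LBINT r:{1/2..3/4}. e r)"
    if \<delta>: "0 < \<delta>" "r0 + 2 * \<delta> < a" for \<delta>
  proof -
    define \<kappa>1 where "\<kappa>1 = (\<lambda>r. smoothstep ((r - r0 - \<delta>) / \<delta>))"
    define d1 where "d1 = (\<lambda>r. smoothstep' ((r - r0 - \<delta>) / \<delta>) / \<delta>)"
    define \<kappa>2 where "\<kappa>2 = (\<lambda>r. 1 - smoothstep (4 * r - 2))"
    define d2 where "d2 = (\<lambda>r. - (4 * smoothstep' (4 * r - 2)))"
    have D1: "(\<kappa>1 has_real_derivative d1 r) (at r)" for r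
    proof -
      have "((\<lambda>r. (r - r0 - \<delta>) / \<delta>) has_real_derivative 1 / \<delta>) (at r)"
        using \<delta> by (auto intro!: derivative_eq_intros)
      from DERIV_chain2[OF smoothstep_derivative this] show ?thesis by (simp add: \<kappa>1_def d1_def)
    qed
    have D2: "(\<kappa>2 has_real_derivative d2 r) (at r)" for r
    proof -
      have "((\<lambda>r. 4 * r - 2) has_real_derivative 4) (at r)" by (auto intro!: derivative_eq_intros)
      from DERIV_diff[OF DERIV_const DERIV_chain2[OF smoothstep_derivative this]] show ?thesis by (simp add: \<kappa>2_def d2_def mult.commute)
    qed
    define \<zeta> where "\<zeta> = (\<lambda>r. if r0 < r then r * y r * (\<kappa>1 r * \<kappa>2 r) else 0)"
    define \<zeta>' where "\<zeta>' = (\<lambda>r. if r0 < r then p r * y r * (\<kappa>1 r * \<kappa>2 r) + r * y r * (d1 r * \<kappa>2 r + d2 r * \<kappa>1 r) else 0)"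
    have low: "\<kappa>1 r = 0" "d1 r = 0" if "r \<le> r0 + \<delta>" for r
      using that \<delta> by (auto simp: \<kappa>1_def d1_def smoothstep_values divide_le_0_iff)
    have d\<zeta>: "(\<zeta> has_real_derivative \<zeta>' r) (at r)" for r
    proof (cases "r0 < r")
      case True
      then have "0 < r" using r0 by linarith
      from DERIV_mult[OF w1[OF this] DERIV_mult[OF D1 D2]]
      have "((\<lambda>r. r * y r * (\<kappa>1 r * \<kappa>2 r)) has_real_derivative \<zeta>' r) (at r)"
        using True by (simp add: \<zeta>'_def algebra_simps)
      then show ?thesis
        by (rule has_field_derivative_transform_within_open[where S = "{r0<..}"]) (use True in \<open>auto simp: \<zeta>_def\<close>)
    next
      case False
      then have "((\<lambda>_. 0) has_real_derivative \<zeta>' r) (at r)" by (simp add: \<zeta>'_def)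
      then show ?thesis
        by (rule has_field_derivative_transform_within_open[where S = "{..<r0 + \<delta>}"]) (use False \<delta> low in \<open>auto simp: \<zeta>_def\<close>)
    qed
    have c\<zeta>': "continuous_on UNIV \<zeta>'"
    proof -
      have den: "r powr (s + 1) + A \<noteq> 0" for r using A by (simp add: add_nonneg_pos less_imp_neq[symmetric])
      have "continuous_on {r0<..} (\<lambda>r. p r * y r * (\<kappa>1 r * \<kappa>2 r) + r * y r * (d1 r * \<kappa>2 r + d2 r * \<kappa>1 r))"
      proof -
        have c1: "continuous_on {r0<..} \<kappa>1" "continuous_on {r0<..} \<kappa>2"
          by (intro continuous_at_imp_continuous_on ballI DERIV_isCont[OF D1] DERIV_isCont[OF D2])+
        have c2: "continuous_on {r0<..} d1" "continuous_on {r0<..} d2"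
          unfolding d1_def d2_def using \<delta>
          by (intro continuous_intros continuous_on_compose2[OF continuous_smoothstep'[of UNIV]]; auto)+
        have c3: "continuous_on {r0<..} y" "continuous_on {r0<..} p"
          unfolding y_def p_def using r0 den by (intro continuous_intros; auto)+
        show ?thesis by (intro continuous_intros c1 c2 c3)
      qed
      then have "continuous_on {r0<..} \<zeta>'" by (rule continuous_on_eq) (auto simp: \<zeta>'_def)
      moreover have "continuous_on {..<r0 + \<delta>} \<zeta>'"
        by (rule continuous_on_eq[where f = "\<lambda>_. 0"]) (auto simp: \<zeta>'_def low)
      moreover have "{r0<..} \<union> {..<r0 + \<delta>} = UNIV" using \<delta> by auto
      ultimately show ?thesis using continuous_on_open_Un[of "{r0<..}" "{..<r0 + \<delta>}" \<zeta>'] by simp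
    qed
    have \<zeta>0: "\<zeta> r = 0" if "r \<notin> {r0 + \<delta><..<3/4}" for r
    proof (cases "r \<le> r0 + \<delta>")
      case True then show ?thesis using low by (simp add: \<zeta>_def)
    next
      case False
      then have "1 \<le> 4 * r - 2" using that by auto
      then show ?thesis by (simp add: \<zeta>_def \<kappa>2_def smoothstep_values)
    qed
    have bd: "e r * stability_form n k r (\<zeta> r) (\<zeta>' r)
      \<le> K1 * (indicator {r0+\<delta>..r0+2*\<delta>} r * ((r / \<delta>)\<^sup>2 * e r)) - \<kappa> / (4 * A\<^sup>2) * (indicator {a..\<rho>} r * e r) + K3 * (indicator {1/2..3/4} r * e r)"
      if r: "r \<in> {r0 + \<delta>..3/4}" for r
    proof -
      have rp: "0 < r" "r0 < r" "r \<le> 1" using r r0 \<delta> by auto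
      have er: "0 \<le> e r" using e(2) rp by simp
      have form: "stability_form n k r (\<zeta> r) (\<zeta>' r) = stability_form n k r (r * y r * (\<kappa>1 r * \<kappa>2 r)) (p r * y r * (\<kappa>1 r * \<kappa>2 r) + r * y r * (d1 r * \<kappa>2 r + d2 r * \<kappa>1 r))"
        using rp by (simp add: \<zeta>_def \<zeta>'_def)
      have \<kappa>b: "0 \<le> \<kappa>1 r" "\<kappa>1 r \<le> 1" "0 \<le> \<kappa>2 r" "\<kappa>2 r \<le> 1" using smoothstep_values(3,4) by (auto simp: \<kappa>1_def \<kappa>2_def)
      have \<kappa>12: "0 \<le> \<kappa>1 r * \<kappa>2 r" "\<kappa>1 r * \<kappa>2 r \<le> 1" using \<kappa>b mult_mono[of "\<kappa>1 r" 1 "\<kappa>2 r" 1] by auto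
      have ps: "- stability_exponent n k \<le> p r" "p r \<le> 1" using w2[OF rp(1)] by (auto simp: s_def)
      have up: "\<kappa>2 r = 1" "d2 r = 0" if "r \<le> 1/2" using that by (auto simp: \<kappa>2_def d2_def smoothstep_values)
      have dn: "\<kappa>1 r = 1" "d1 r = 0" if "r0 + 2 * \<delta> \<le> r"
      proof -
        have "1 \<le> (r - r0 - \<delta>) / \<delta>" using that \<delta> by (simp add: field_simps)
        then show "\<kappa>1 r = 1" "d1 r = 0" by (auto simp: \<kappa>1_def d1_def smoothstep_values)
      qed
      (* The three terms of the bound belong to the lower cut-off, the untouched weight, and the upper cut-off. *)
      consider (low) "r \<le> r0 + 2 * \<delta>" | (mid) "r0 + 2 * \<delta> < r" "r \<le> 1/2" | (high) "1/2 < r" by linarith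
      then show ?thesis
      proof cases
        case low
        then have r12: "r \<le> 1/2" "r < a" using \<delta> r0 by auto
        have dd: "\<bar>d1 r * \<kappa>2 r + d2 r * \<kappa>1 r\<bar> \<le> 2 / \<delta>"
          using up[OF r12(1)] smoothstep'_bound \<delta> by (simp add: d1_def divide_right_mono)
        have q1: "1 \<le> r / \<delta>" using r r0 \<delta> by (auto simp: pos_le_divide_eq)
        have "stability_form n k r (\<zeta> r) (\<zeta>' r) \<le> (1 / A)\<^sup>2 * (2 * (s + 1) * (r * (2 / \<delta>)) + (r * (2 / \<delta>))\<^sup>2)"
          unfolding form s_def
          by (rule stability_form_cutoff_bound[OF k rp(1) ps \<kappa>12 dd]) (use w2[OF rp(1)] in auto)
        also have "2 * (s + 1) * (r * (2 / \<delta>)) + (r * (2 / \<delta>))\<^sup>2 \<le> (4 * s + 8) * (r / \<delta>)\<^sup>2"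
        proof -
          have "(r / \<delta>) * 1 \<le> (r / \<delta>) * (r / \<delta>)" using q1 by (intro mult_left_mono) auto
          then have "(4 * s + 4) * (r / \<delta>) \<le> (4 * s + 4) * (r / \<delta>)\<^sup>2" using s1 by (intro mult_left_mono) (auto simp: power2_eq_square)
          moreover have "2 * (s + 1) * (r * (2 / \<delta>)) = (4 * s + 4) * (r / \<delta>)" "(r * (2 / \<delta>))\<^sup>2 = 4 * (r / \<delta>)\<^sup>2"
            by (auto simp: power2_eq_square field_simps)
          ultimately show ?thesis by (simp add: algebra_simps)
        qed
        finally have "stability_form n k r (\<zeta> r) (\<zeta>' r) \<le> K1 * (r / \<delta>)\<^sup>2" by (simp add: K1_def mult_left_mono)
        then have "e r * stability_form n k r (\<zeta> r) (\<zeta>' r) \<le> e r * (K1 * (r / \<delta>)\<^sup>2)" using er by (rule mult_left_mono)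
        moreover have "0 \<le> K3 * (indicator {1/2..3/4} r * e r)" using K3 er by simp
        ultimately show ?thesis using low r r12 by (simp add: ac_simps)
      next
        case mid
        have "\<zeta> r = r * y r * 1" "\<zeta>' r = p r * y r * 1 + r * y r * 0"
          using up dn mid rp by (auto simp: \<zeta>_def \<zeta>'_def)
        then have f: "stability_form n k r (\<zeta> r) (\<zeta>' r) = (y r)\<^sup>2 * stability_polynomial n k (p r)"
          using stability_form_cutoff[of r n k "y r" 1 "p r" 0] rp by simp
        have "stability_form n k r (\<zeta> r) (\<zeta>' r) \<le> - (\<kappa> / (4 * A\<^sup>2)) * indicator {a..\<rho>} r"
        proof (cases "r \<in> {a..\<rho>}")
          case True
          then have "stability_polynomial n k (p r) \<le> - \<kappa>" unfolding \<kappa>_def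
            using stability_polynomial_gap[OF k] w3[OF rp(1)] ps by (auto simp: s_def)
          then have "(y r)\<^sup>2 * stability_polynomial n k (p r) \<le> (y r)\<^sup>2 * - \<kappa>" by (rule mult_left_mono) simp
          also have "\<dots> \<le> (1 / A / 2)\<^sup>2 * - \<kappa>"
            using w3[OF rp(1)] True \<kappa> A by (intro mult_right_mono_neg power_mono) auto
          finally show ?thesis using True f by (simp add: power_divide)
        next
          case False
          have "(y r)\<^sup>2 * stability_polynomial n k (p r) \<le> 0"
            using stability_polynomial_nonpos[OF k ps] by (intro mult_nonneg_nonpos) auto
          then show ?thesis using False f by simp
        qed
        then have "e r * stability_form n k r (\<zeta> r) (\<zeta>' r) \<le> e r * (- (\<kappa> / (4 * A\<^sup>2)) * indicator {a..\<rho>} r)" using er by (rule mult_left_mono)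
        moreover have "0 \<le> K3 * (indicator {1/2..3/4} r * e r)" using K3 er by simp
        ultimately show ?thesis using mid by (simp add: ac_simps)
      next
        case high
        have dn': "\<kappa>1 r = 1" "d1 r = 0" using dn high \<delta> r0 by auto
        have nin: "r \<notin> {a..\<rho>}" using high r0 by auto
        have dd: "\<bar>d1 r * \<kappa>2 r + d2 r * \<kappa>1 r\<bar> \<le> 8"
          using dn' smoothstep'_bound[of "4 * r - 2"] by (simp add: d2_def)
        have y2: "y r \<le> 2 powr (s + 1)"
        proof -
          have "y r \<le> r powr - (s + 1)" by (rule w2(5)[OF rp(1)])
          also have "\<dots> = (1 / r) powr (s + 1)" unfolding powr_minus_divide using rp(1) by (simp add: powr_divide)
          also have "\<dots> \<le> 2 powr (s + 1)" using high rp(1) s1 by (intro powr_mono2) (auto simp: field_simps)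
          finally show ?thesis .
        qed
        have "stability_form n k r (\<zeta> r) (\<zeta>' r) \<le> (2 powr (s + 1))\<^sup>2 * (2 * (s + 1) * (r * 8) + (r * 8)\<^sup>2)"
          unfolding form s_def
          by (rule stability_form_cutoff_bound[OF k rp(1) ps \<kappa>12 dd]) (use w2[OF rp(1)] y2 in \<open>auto simp: s_def\<close>)
        also have "\<dots> \<le> K3"
        proof -
          have "2 * (s + 1) * (r * 8) \<le> 2 * (s + 1) * (1 * 8)" using rp s1 by (intro mult_left_mono mult_right_mono) auto
          moreover have "(r * 8)\<^sup>2 \<le> 8\<^sup>2" using rp by (intro power_mono) auto
          ultimately show ?thesis unfolding K3_def by (intro mult_left_mono) auto
        qed
        finally have "e r * stability_form n k r (\<zeta> r) (\<zeta>' r) \<le> e r * K3" using er by (rule mult_left_mono)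
        moreover have "0 \<le> K1 * (indicator {r0+\<delta>..r0+2*\<delta>} r * ((r / \<delta>)\<^sup>2 * e r))" using K1 er by simp
        ultimately show ?thesis using nin high r by (simp add: ac_simps)
      qed
    qed
    have cf: "continuous_on {r0 + \<delta>..3/4} (\<lambda>r. stability_form n k r (\<zeta> r) (\<zeta>' r))"
    proof -
      have "continuous_on {r0 + \<delta>..3/4} \<zeta>" by (intro continuous_at_imp_continuous_on ballI DERIV_isCont[OF d\<zeta>])
      moreover have "continuous_on {r0 + \<delta>..3/4} \<zeta>'" by (rule continuous_on_subset[OF c\<zeta>']) auto
      ultimately show ?thesis unfolding stability_form_def using r0 \<delta> by (intro continuous_intros) auto
    qed
    have sub: "{r0+\<delta>..r0+2*\<delta>} \<subseteq> {r0+\<delta>..3/4}" "{a..\<rho>} \<subseteq> {r0+\<delta>..3/4}" "{1/2..3/4} \<subseteq> {r0+\<delta>..3/4}"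
      using r0 \<delta> by auto
    have i1: "set_integrable lborel {r0+\<delta>..3/4} (\<lambda>r. indicator {r0+\<delta>..r0+2*\<delta>} r * ((r / \<delta>)\<^sup>2 * e r))"
      using r0 \<delta> by (intro set_integrable_indicator_subset[OF sub(1)] eint continuous_intros) auto
    have i2: "set_integrable lborel {r0+\<delta>..3/4} (\<lambda>r. indicator {a..\<rho>} r * e r)"
      using eint[of a \<rho> "\<lambda>_. 1"] r0 by (intro set_integrable_indicator_subset[OF sub(2)]) auto
    have i3: "set_integrable lborel {r0+\<delta>..3/4} (\<lambda>r. indicator {1/2..3/4} r * e r)"
      using eint[of "1/2" "3/4" "\<lambda>_. 1"] by (intro set_integrable_indicator_subset[OF sub(3)]) auto
    have "0 \<le> (LBINT r:{r0+\<delta>..3/4}. e r * stability_form n k r (\<zeta> r) (\<zeta>' r))"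
      by (rule stable[OF _ _ _ d\<zeta> c\<zeta>' \<zeta>0]) (use r0 \<delta> in auto)
    also have "\<dots> \<le> (LBINT r:{r0+\<delta>..3/4}. K1 * (indicator {r0+\<delta>..r0+2*\<delta>} r * ((r / \<delta>)\<^sup>2 * e r)) - \<kappa> / (4 * A\<^sup>2) * (indicator {a..\<rho>} r * e r) + K3 * (indicator {1/2..3/4} r * e r))"
    proof (rule set_integral_mono[OF _ _ bd])
      show "set_integrable lborel {r0+\<delta>..3/4} (\<lambda>r. e r * stability_form n k r (\<zeta> r) (\<zeta>' r))"
        using eint[OF _ _ cf] r0 \<delta> by (simp add: mult.commute)
      show "set_integrable lborel {r0+\<delta>..3/4} (\<lambda>r. K1 * (indicator {r0+\<delta>..r0+2*\<delta>} r * ((r / \<delta>)\<^sup>2 * e r)) - \<kappa> / (4 * A\<^sup>2) * (indicator {a..\<rho>} r * e r) + K3 * (indicator {1/2..3/4} r * e r))"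
        using i1 i2 i3 by (intro set_integral_add set_integral_diff set_integrable_mult_right) auto
    qed
    also have "\<dots> = K1 * (LBINT r:{r0+\<delta>..3/4}. indicator {r0+\<delta>..r0+2*\<delta>} r * ((r / \<delta>)\<^sup>2 * e r))
      - \<kappa> / (4 * A\<^sup>2) * (LBINT r:{r0+\<delta>..3/4}. indicator {a..\<rho>} r * e r) + K3 * (LBINT r:{r0+\<delta>..3/4}. indicator {1/2..3/4} r * e r)"
      using i1 i2 i3 by (simp add: set_integral_add set_integral_diff)
    finally show ?thesis by (simp only: LBINT_indicator_subset[OF sub(1)] LBINT_indicator_subset[OF sub(2)] LBINT_indicator_subset[OF sub(3)])
  qed
  have lim: "\<kappa> / (4 * A\<^sup>2) * (LBINT r:{a..\<rho>}. e r) \<le> K3 * (LBINT r:{1/2..3/4}. e r)"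
  proof (rule field_le_epsilon)
    fix \<epsilon> :: real assume "0 < \<epsilon>"
    then have "0 < \<epsilon> / K1" using K1 by simp
    then obtain \<delta>0 where d0: "0 < \<delta>0" "\<And>\<delta>. 0 < \<delta> \<Longrightarrow> \<delta> < \<delta>0 \<Longrightarrow> (LBINT r:{r0+\<delta>..r0+2*\<delta>}. (r / \<delta>)\<^sup>2 * e r) \<le> \<epsilon> / K1"
      using cutoff[OF \<open>0 < \<epsilon> / K1\<close>] by blast
    define \<delta> where "\<delta> = min (\<delta>0 / 2) ((a - r0) / 4)"
    have "\<delta> \<le> \<delta>0 / 2" "\<delta> \<le> (a - r0) / 4" unfolding \<delta>_def by (rule min.cobounded1 min.cobounded2)+
    moreover have "0 < \<delta>" using d0(1) r0 by (simp add: \<delta>_def)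
    ultimately have \<delta>: "0 < \<delta>" "\<delta> < \<delta>0" "r0 + 2 * \<delta> < a" using d0(1) r0 by auto
    have "K1 * (LBINT r:{r0+\<delta>..r0+2*\<delta>}. (r / \<delta>)\<^sup>2 * e r) \<le> \<epsilon>"
      using d0(2)[OF \<delta>(1,2)] K1 by (simp add: field_simps)
    then show "\<kappa> / (4 * A\<^sup>2) * (LBINT r:{a..\<rho>}. e r) \<le> K3 * (LBINT r:{1/2..3/4}. e r) + \<epsilon>"
      using main[OF \<delta>(1,3)] by linarith
  qed
  have "\<kappa> / 4 * (LBINT r:{a..\<rho>}. e r) = A\<^sup>2 * (\<kappa> / (4 * A\<^sup>2) * (LBINT r:{a..\<rho>}. e r))" using A by simp
  also have "\<dots> \<le> A\<^sup>2 * (K3 * (LBINT r:{1/2..3/4}. e r))" by (rule mult_left_mono[OF lim]) simp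
  finally show ?thesis by (simp add: \<kappa>_def K3_def A_def ac_simps)
qed

section \<open>Pointwise bounds for the first derivative\<close>

lemma mvt_Ioc:
  fixes f :: "real \<Rightarrow> real"
  assumes "\<And>s. s \<in> {0<..1} \<Longrightarrow> (f has_real_derivative f' s) (at s within {0<..1})" "0 < r" "r < t" "t \<le> 1"
  obtains s where "r < s" "s < t" "f t - f r = (t - r) * f' s"
proof -
  have d: "(f has_real_derivative f' x) (at x)" if "r < x" "x < t" for x
    using assms(1)[of x] assms(2,4) that by (simp add: at_within_Ioc)
  have "continuous_on {r..t} f"
    by (rule continuous_on_subset[OF continuous_on_Ioc_of_derivative[OF assms(1)]]) (use assms(2,4) in auto)
  then obtain l s where s: "r < s" "s < t" "(f has_real_derivative l) (at s)" "f t - f r = (t - r) * l"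
    using MVT[OF assms(3), of f] d real_differentiable_def by blast
  then have "l = f' s" using d[of s] DERIV_unique by blast
  then show ?thesis using s that by blast
qed

text \<open>Up to the area of the sphere, the density in \<open>r\<close> of \<open>\<integral> \<bar>x\<bar>\<^bsup>1-k\<^esup> \<bar>\<nabla>u\<bar>\<^bsup>k+1\<^esup> dx\<close>.\<close>

definition energy_density :: "nat \<Rightarrow> nat \<Rightarrow> (real \<Rightarrow> real) \<Rightarrow> real \<Rightarrow> real" where
  "energy_density n k z r = r ^ (n - k) * z r ^ (k + 1)"

text \<open>
  The energy in \<open>[r, 2r]\<close>, which is comparable to \<open>r\<^bsup>n-k+1\<^esup> z\<^bsup>k+1\<^esup>\<close>, is at most of order \<open>r\<^bsup>2s+2\<^esup>\<close>
  for the stability exponent \<open>s\<close>; this is the resulting power of \<open>r\<close>.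
\<close>

definition decay_exponent :: "nat \<Rightarrow> nat \<Rightarrow> real" where
  "decay_exponent n k = (2 * stability_exponent n k + 1 + real k - real n) / (real k + 1)"

definition inner_constant :: "nat \<Rightarrow> nat \<Rightarrow> real" where
  "inner_constant n k = (2 ^ (n - k)) ^ (k + 1) * (4 / stability_gap n k) *
     ((2 powr (stability_exponent n k + 1))\<^sup>2 * (16 * stability_exponent n k + 80) * (2 powr (stability_exponent n k + 1))\<^sup>2)"

definition outer_constant :: "nat \<Rightarrow> nat \<Rightarrow> real" where
  "outer_constant n k = 4 * 2 ^ (n - k) * (4 ^ (n - k)) ^ (k + 1) * 4 powr \<bar>(real k + 1) * decay_exponent n k\<bar>"

lemma powr_lower_bound:
  fixes r p :: real
  assumes "1 / 4 \<le> r" "r \<le> 1"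
  shows "1 \<le> 4 powr \<bar>p\<bar> * r powr p"
proof (cases "0 \<le> p")
  case True
  have "(1 / 4) powr p \<le> r powr p" using assms True by (intro powr_mono2) auto
  then have "4 powr p * (1 / 4) powr p \<le> 4 powr p * r powr p" by (intro mult_left_mono) auto
  then show ?thesis using True by (simp add: powr_divide)
next
  case False
  have "1 \<le> r powr p" using assms False powr_mono2'[of p r 1] by simp
  moreover have "1 \<le> (4::real) powr \<bar>p\<bar>" by (intro ge_one_powr_ge_zero) auto
  ultimately show ?thesis using mult_mono[of 1 "4 powr \<bar>p\<bar>" 1 "r powr p"] by simp
qed

context
  fixes n k :: nat and g v z :: "real \<Rightarrow> real"
  assumes prof: "regular_profile n k g v z" and k: "1 \<le> k" "2 * k < n"
begin

lemma profile_deriv: "r \<in> {0<..1} \<Longrightarrow> (v has_real_derivative z r) (at r within {0<..1})"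
  and profile_nonneg: "r \<in> {0<..1} \<Longrightarrow> 0 \<le> z r"
  and profile_cont: "continuous_on {0<..1} z"
  and flux_deriv: "r \<in> {0<..1} \<Longrightarrow> ((\<lambda>r. r ^ (n - k) * z r ^ k) has_real_derivative r ^ (n - 1) * g (v r) / c_const n k) (at r within {0<..1})"
  and flux_limit: "((\<lambda>r. r ^ (n - k) * z r ^ k) \<longlongrightarrow> 0) (at_right 0)"
  using prof unfolding regular_profile_def by blast+

lemma c_pos: "0 < c_const n k" using k by (intro c_const_pos) auto

lemma profile_mono:
  assumes "0 < r" "r \<le> t" "t \<le> 1"
  shows "v r \<le> v t"
proof (cases "r = t")
  case False
  then obtain s where s: "r < s" "s < t" "v t - v r = (t - r) * z s"
    using mvt_Ioc[OF profile_deriv, of r t] assms by (metis order_le_less)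
  then have "0 \<le> (t - r) * z s" using profile_nonneg[of s] assms by (intro mult_nonneg_nonneg) auto
  then show ?thesis using s by simp
qed simp

lemma continuous_on_g_profile:
  assumes "continuous_on UNIV g"
  shows "continuous_on {0<..1} (\<lambda>r. g (v r))"
  by (rule continuous_on_compose2[OF assms continuous_on_Ioc_of_derivative[OF profile_deriv]]) auto

context
  assumes g_nonneg: "\<And>t. 0 \<le> g t"
begin

lemma flux_mono:
  assumes "0 < r" "r \<le> t" "t \<le> 1"
  shows "r ^ (n - k) * z r ^ k \<le> t ^ (n - k) * z t ^ k"
proof (cases "r = t")
  case False
  then obtain s where s: "r < s" "s < t" "t ^ (n - k) * z t ^ k - r ^ (n - k) * z r ^ k = (t - r) * (s ^ (n - 1) * g (v s) / c_const n k)"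
    using mvt_Ioc[OF flux_deriv, of r t] assms by (metis order_le_less)
  have "0 \<le> (t - r) * (s ^ (n - 1) * g (v s) / c_const n k)"
    using s assms c_pos g_nonneg by (intro mult_nonneg_nonneg divide_nonneg_pos) auto
  then show ?thesis using s by simp
qed simp

text \<open>
  The flux is nondecreasing because \<open>g \<ge> 0\<close>. The factor \<open>q\<^bsup>n-k\<^esup>\<close> could be reduced to its \<open>k\<close>-th
  root, but constants do not matter.
\<close>

lemma profile_lower_bound:
  assumes "0 < r" "r \<le> t" "t \<le> 1" "t \<le> q * r"
  shows "z r / q ^ (n - k) \<le> z t"
proof -
  have "1 * r \<le> q * r" using assms by linarith
  then have q: "1 \<le> q" using assms(1) by (simp only: mult_le_cancel_right_pos)
  have zr: "0 \<le> z r" "0 \<le> z t" using profile_nonneg[of r] profile_nonneg[of t] assms(1-3) by auto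
  have q1: "0 < q ^ (n - k)" "1 \<le> q ^ (n - k)" using q by auto
  have "r ^ (n - k) * z r ^ k \<le> t ^ (n - k) * z t ^ k" by (rule flux_mono[OF assms(1-3)])
  also have "\<dots> \<le> (q * r) ^ (n - k) * z t ^ k"
    using assms zr by (intro mult_right_mono power_mono) auto
  finally have "r ^ (n - k) * z r ^ k \<le> r ^ (n - k) * (q ^ (n - k) * z t ^ k)" by (simp add: power_mult_distrib ac_simps)
  then have 1: "z r ^ k \<le> q ^ (n - k) * z t ^ k" using assms(1) by simp
  have "(z r / q ^ (n - k)) ^ k = z r ^ k / (q ^ (n - k)) ^ k" by (rule power_divide)
  also have "\<dots> \<le> z r ^ k / q ^ (n - k)"
    using q1 zr self_le_power[of "q ^ (n - k)" k] k(1) by (intro divide_left_mono) auto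
  also have "\<dots> \<le> z t ^ k" using 1 q1 by (simp add: divide_le_eq mult.commute)
  finally have le: "(z r / q ^ (n - k)) ^ k \<le> z t ^ k" .
  have "0 \<le> z r / q ^ (n - k)" using zr q1 by simp
  then show ?thesis using power_mono_iff[of "z r / q ^ (n - k)" "z t" k] le zr(2) k(1) by simp
qed

lemma profile_zero_before:
  assumes "z t = 0" "0 < r" "r \<le> t" "t \<le> 1"
  shows "z r = 0"
proof -
  have "r ^ (n - k) * z r ^ k \<le> 0" using flux_mono[OF assms(2-4)] assms(1) k(1) by (simp add: zero_power)
  moreover have "0 < r ^ (n - k)" using assms(2) by simp
  ultimately have "z r ^ k \<le> 0" by (simp add: mult_le_0_iff not_le)
  moreover have "0 \<le> z r" using profile_nonneg[of r] assms(2-4) by auto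
  moreover have "\<not> 0 < z r"
  proof
    assume "0 < z r"
    then have "0 < z r ^ k" by (rule zero_less_power)
    then show False using \<open>z r ^ k \<le> 0\<close> by linarith
  qed
  ultimately show ?thesis by simp
qed

lemma energy_density_cont: "continuous_on {0<..1} (energy_density n k z)"
  unfolding energy_density_def[abs_def] by (intro continuous_intros profile_cont)

lemma energy_density_nonneg: "r \<in> {0<..1} \<Longrightarrow> 0 \<le> energy_density n k z r"
  using profile_nonneg by (simp add: energy_density_def)

lemma energy_density_integrable:
  assumes "0 < a" "b \<le> 1" shows "set_integrable lborel {a..b} (energy_density n k z)"
  by (intro borel_integrable_atLeastAtMost' continuous_on_subset[OF energy_density_cont]) (use assms in auto)

text \<open>
  On the transition zone \<open>r / \<delta>\<close> is at most \<open>2\<close>, so this is the absolute continuity of the energy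
  integral.
\<close>

lemma cutoff_at_origin:
  assumes "set_integrable lborel {0<..<1} (energy_density n k z)" "0 < \<epsilon>"
  shows "\<exists>\<delta>0>0. \<forall>\<delta>. 0 < \<delta> \<and> \<delta> < \<delta>0 \<longrightarrow> (LBINT r:{0+\<delta>..0+2*\<delta>}. (r / \<delta>)\<^sup>2 * energy_density n k z r) \<le> \<epsilon>"
proof -
  have "(energy_density n k z) integrable_on {0<..<1}" using assms(1) by (rule set_borel_integral_eq_integral(1))
  then have ei: "(energy_density n k z) integrable_on {0..1}" by (simp add: integrable_on_Icc_iff_Ioo)
  have "continuous_on {0..1} (\<lambda>t. integral {0..t} (energy_density n k z))" by (rule indefinite_integral_continuous_1[OF ei])
  then have "continuous (at 0 within {0..1}) (\<lambda>t. integral {0..t} (energy_density n k z))"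
    by (auto simp: continuous_on_eq_continuous_within)
  then obtain d where d: "0 < d" "\<And>t. t \<in> {0..1} \<Longrightarrow> dist t 0 < d \<Longrightarrow> dist (integral {0..t} (energy_density n k z)) (integral {0..0} (energy_density n k z)) < \<epsilon> / 4"
    unfolding continuous_within_eps_delta using assms(2) by (metis zero_less_divide_iff zero_less_numeral)
  have "(LBINT r:{0+\<delta>..0+2*\<delta>}. (r / \<delta>)\<^sup>2 * energy_density n k z r) \<le> \<epsilon>" if \<delta>: "0 < \<delta>" "\<delta> < min (d / 2) (1 / 2)" for \<delta>
  proof -
    have i: "set_integrable lborel {\<delta>..2*\<delta>} (energy_density n k z)" using \<delta> by (intro energy_density_integrable) auto
    have "(LBINT r:{\<delta>..2*\<delta>}. (r / \<delta>)\<^sup>2 * energy_density n k z r) \<le> (LBINT r:{\<delta>..2*\<delta>}. 4 * energy_density n k z r)"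
    proof (rule set_integral_mono)
      show "set_integrable lborel {\<delta>..2*\<delta>} (\<lambda>r. (r / \<delta>)\<^sup>2 * energy_density n k z r)"
        using \<delta> by (intro borel_integrable_atLeastAtMost' continuous_intros continuous_on_subset[OF energy_density_cont]) auto
      show "set_integrable lborel {\<delta>..2*\<delta>} (\<lambda>r. 4 * energy_density n k z r)" using i by simp
      fix r assume r: "r \<in> {\<delta>..2*\<delta>}"
      have "(r / \<delta>)\<^sup>2 \<le> 2\<^sup>2" using r \<delta> by (intro power_mono) (auto simp: divide_le_eq)
      then show "(r / \<delta>)\<^sup>2 * energy_density n k z r \<le> 4 * energy_density n k z r"
        using energy_density_nonneg[of r] r \<delta> by (intro mult_right_mono) auto
    qed
    also have "\<dots> = 4 * integral {\<delta>..2*\<delta>} (energy_density n k z)" using set_borel_integral_eq_integral(2)[OF i] by simp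
    also have "integral {\<delta>..2*\<delta>} (energy_density n k z) \<le> integral {0..2*\<delta>} (energy_density n k z)"
    proof (rule integral_subset_le)
      show "\<forall>r\<in>{0..2*\<delta>}. 0 \<le> energy_density n k z r"
      proof
        fix r assume "r \<in> {0..2*\<delta>}"
        then show "0 \<le> energy_density n k z r"
          using energy_density_nonneg[of r] \<delta> k by (cases "r = 0") (auto simp: energy_density_def zero_power)
      qed
    qed (use \<delta> in \<open>auto intro: integrable_on_subinterval[OF ei]\<close>)
    also have "integral {0..2*\<delta>} (energy_density n k z) \<le> \<epsilon> / 4"
      using d(2)[of "2 * \<delta>"] \<delta> by (auto simp: dist_real_def)
    finally show ?thesis by simp
  qed
  then show ?thesis using d(1) by (intro exI[of _ "min (d / 2) (1 / 2)"]) auto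
qed

text \<open>
  At a positive radius \<open>r0\<close> where \<open>z\<close> starts from \<open>0\<close>, the equation gives \<open>z\<^sup>k \<le> C (r - r0)\<^sup>2 sup z\<close>, because
  \<open>g (v r0) = 0\<close> and \<open>g\<close> is Lipschitz; this is the decay that the cut-off needs.
\<close>

lemma cutoff_at_positive_radius:
  assumes g: "locally_lipschitz g" and r0: "0 < r0" "r0 < 1" "z r0 = 0" and \<epsilon>: "0 < \<epsilon>"
  shows "\<exists>\<delta>0>0. \<forall>\<delta>. 0 < \<delta> \<and> \<delta> < \<delta>0 \<longrightarrow> (LBINT r:{r0+\<delta>..r0+2*\<delta>}. (r / \<delta>)\<^sup>2 * energy_density n k z r) \<le> \<epsilon>"
proof -
  let ?M = "\<lambda>r. r ^ (n - k) * z r ^ k"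
  have gc: "continuous_on UNIV g" by (rule locally_lipschitz_continuous[OF g])
  have z0: "z s = 0" if "0 < s" "s \<le> r0" for s using profile_zero_before[OF r0(3)] that r0 by auto
  have g0: "g (v s) = 0" if "0 < s" "s < r0" for s
  proof -
    have "(?M has_real_derivative s ^ (n - 1) * g (v s) / c_const n k) (at s)"
      using flux_deriv[of s] that r0 by (simp add: at_within_Ioc)
    moreover have "(?M has_real_derivative 0) (at s)"
      by (rule has_field_derivative_transform_within_open[where S = "{0<..<r0}" and f = "\<lambda>_. 0"])
        (use that z0 k(1) in \<open>auto simp: zero_power\<close>)
    ultimately have "s ^ (n - 1) * g (v s) / c_const n k = 0" using DERIV_unique by blast
    then show ?thesis using that c_pos by simp
  qed
  have "g (v r0) = 0"
  proof -
    have "((\<lambda>r. g (v r)) \<longlongrightarrow> g (v r0)) (at r0 within {0<..1})"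
      using continuous_on_g_profile[OF gc] r0 by (auto simp: continuous_on_def)
    then have 1: "((\<lambda>r. g (v r)) \<longlongrightarrow> g (v r0)) (at r0 within {0<..<r0})" by (rule tendsto_within_subset) (use r0 in auto)
    have 2: "((\<lambda>r. g (v r)) \<longlongrightarrow> 0) (at r0 within {0<..<r0})"
      by (rule tendsto_eventually) (auto simp: eventually_at_filter g0)
    have "at r0 within {0<..<r0} \<noteq> bot" using r0 by (simp add: at_within_eq_bot_iff)
    then show ?thesis using tendsto_unique[OF _ 1 2] by simp
  qed
  obtain L where L: "L-lipschitz_on {v r0..v 1} g" using locally_lipschitz_compact[OF g] by blast
  have L0: "0 \<le> L" using L by (rule lipschitz_on_nonneg)
  have "bounded (z ` {r0..1})"
    by (intro compact_imp_bounded compact_continuous_image continuous_on_subset[OF profile_cont]) (use r0 in auto)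
  then obtain B where B: "\<forall>x\<in>{r0..1}. \<bar>z x\<bar> \<le> B" unfolding bounded_iff ball_simps real_norm_def by blast
  define C where "C = 4 * L / (c_const n k * r0 ^ (n - k))"
  have C0: "0 \<le> C" using L0 c_pos r0 by (simp add: C_def)
  have bound: "(LBINT r:{r0+\<delta>..r0+2*\<delta>}. (r / \<delta>)\<^sup>2 * energy_density n k z r) \<le> \<delta> * (C * B\<^sup>2)" if \<delta>: "0 < \<delta>" "\<delta> < (1 - r0) / 2" for \<delta>
  proof -
    have d1: "r0 + 2 * \<delta> \<le> 1" using \<delta> by (simp add: field_simps)
    have "continuous_on {r0..r0+2*\<delta>} z" by (rule continuous_on_subset[OF profile_cont]) (use r0 d1 in auto)
    then obtain m where m: "m \<in> {r0..r0+2*\<delta>}" "\<And>r. r \<in> {r0..r0+2*\<delta>} \<Longrightarrow> z r \<le> z m"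
      using continuous_attains_sup[of "{r0..r0+2*\<delta>}" z] \<delta> by auto
    have m1: "m \<in> {0<..1}" "m \<in> {r0..1}" using m(1) r0 d1 by auto
    have zm: "0 \<le> z m" "z m \<le> B" using profile_nonneg[OF m1(1)] bspec[OF B m1(2)] by auto
    (* Two applications of the mean value theorem: the flux grows from 0 by the source, and the source grows from 0 by the increment of v. *)
    have "z m ^ k \<le> C * \<delta>\<^sup>2 * z m"
    proof (cases "m = r0")
      case True then show ?thesis using r0(3) k(1) by (simp add: zero_power)
    next
      case False
      then have mr: "r0 < m" "m \<le> 1" using m1 by auto
      obtain s where s: "r0 < s" "s < m" "?M m - ?M r0 = (m - r0) * (s ^ (n - 1) * g (v s) / c_const n k)"
        using mvt_Ioc[OF flux_deriv r0(1) mr] by metis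
      obtain t where t: "r0 < t" "t < s" "v s - v r0 = (s - r0) * z t"
        using mvt_Ioc[OF profile_deriv r0(1) s(1)] s(2) mr by (metis order_trans less_imp_le)
      have "z t \<le> z m" using m(2)[of t] t s m(1) by auto
      then have vs: "v s - v r0 \<le> (2 * \<delta>) * z m"
        unfolding t(3) using s m(1) zm profile_nonneg[of t] t r0 mr by (intro mult_mono) auto
      have "g (v s) = \<bar>g (v s) - g (v r0)\<bar>" using \<open>g (v r0) = 0\<close> g_nonneg by simp
      also have "\<dots> \<le> L * \<bar>v s - v r0\<bar>"
        using lipschitz_onD[OF L, of "v s" "v r0"] profile_mono[of r0 s] profile_mono[of s 1] profile_mono[of r0 1] s mr r0
        by (simp add: dist_real_def)
      also have "\<dots> = L * (v s - v r0)" using profile_mono[of r0 s] s mr r0 by simp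
      also have "\<dots> \<le> L * ((2 * \<delta>) * z m)" by (rule mult_left_mono[OF vs L0])
      finally have gs: "g (v s) \<le> L * (2 * \<delta> * z m)" .
      have "r0 ^ (n - k) * z m ^ k \<le> ?M m" using m1 r0 zm by (intro mult_right_mono power_mono) auto
      also have "\<dots> = (m - r0) * (s ^ (n - 1) * g (v s) / c_const n k)" using s(3) r0(3) k(1) by (simp add: zero_power)
      also have "\<dots> \<le> (2 * \<delta>) * (1 * (L * (2 * \<delta> * z m)) / c_const n k)"
        using s m(1) mr r0 gs g_nonneg c_pos zm \<delta>
        by (intro mult_mono divide_right_mono) (auto simp: power_le_one)
      finally show ?thesis using c_pos r0 by (simp add: C_def power2_eq_square field_simps)
    qed
    then have "z m * z m ^ k \<le> z m * (C * \<delta>\<^sup>2 * z m)" using zm by (intro mult_left_mono)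
    also have "\<dots> = C * \<delta>\<^sup>2 * (z m)\<^sup>2" by (simp add: power2_eq_square)
    also have "\<dots> \<le> C * \<delta>\<^sup>2 * B\<^sup>2" using C0 zm by (intro mult_left_mono power_mono) auto
    finally have zk: "z m ^ (k + 1) \<le> C * \<delta>\<^sup>2 * B\<^sup>2" by simp
    have "(LBINT r:{r0+\<delta>..r0+2*\<delta>}. (r / \<delta>)\<^sup>2 * energy_density n k z r) \<le> (LBINT r:{r0+\<delta>..r0+2*\<delta>}. C * B\<^sup>2)"
    proof (rule set_integral_mono)
      show "set_integrable lborel {r0+\<delta>..r0+2*\<delta>} (\<lambda>r. (r / \<delta>)\<^sup>2 * energy_density n k z r)"
        using \<delta> r0 d1 by (intro borel_integrable_atLeastAtMost' continuous_intros continuous_on_subset[OF energy_density_cont]) auto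
      show "set_integrable lborel {r0+\<delta>..r0+2*\<delta>} (\<lambda>r. C * B\<^sup>2)"
        by (intro borel_integrable_atLeastAtMost' continuous_intros)
      fix r assume r: "r \<in> {r0+\<delta>..r0+2*\<delta>}"
      then have r': "0 < r" "r \<le> 1" "0 \<le> z r" "z r \<le> z m" using r0 \<delta> d1 m(2)[of r] profile_nonneg[of r] by auto
      have "(r / \<delta>)\<^sup>2 * energy_density n k z r = (r\<^sup>2 * r ^ (n - k)) * z r ^ (k + 1) / \<delta>\<^sup>2"
        by (simp add: energy_density_def power_divide)
      also have "\<dots> \<le> 1 * z m ^ (k + 1) / \<delta>\<^sup>2"
        using r' zm by (intro divide_right_mono mult_mono power_mono) (auto intro!: mult_le_one power_le_one)
      also have "\<dots> \<le> C * B\<^sup>2" using zk \<delta> by (simp add: divide_le_eq ac_simps)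
      finally show "(r / \<delta>)\<^sup>2 * energy_density n k z r \<le> C * B\<^sup>2" .
    qed
    also have "\<dots> = \<delta> * (C * B\<^sup>2)" using \<delta> by (simp add: set_lebesgue_integral_def)
    finally show ?thesis .
  qed
  define \<delta>0 where "\<delta>0 = min ((1 - r0) / 2) (\<epsilon> / (C * B\<^sup>2 + 1))"
  have CB: "0 \<le> C * B\<^sup>2" using C0 by simp
  have "0 < \<delta>0" using r0 \<epsilon> CB by (simp add: \<delta>0_def)
  moreover have "(LBINT r:{r0+\<delta>..r0+2*\<delta>}. (r / \<delta>)\<^sup>2 * energy_density n k z r) \<le> \<epsilon>" if "0 < \<delta>" "\<delta> < \<delta>0" for \<delta>
  proof -
    have d: "\<delta> < (1 - r0) / 2" "\<delta> < \<epsilon> / (C * B\<^sup>2 + 1)" using that by (auto simp: \<delta>0_def)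
    have "\<delta> * (C * B\<^sup>2) \<le> \<delta> * (C * B\<^sup>2 + 1)" using that by (intro mult_left_mono) auto
    also have "\<dots> \<le> \<epsilon>" using d(2) CB by (simp add: field_simps)
    finally show ?thesis using bound[OF that(1) d(1)] by linarith
  qed
  ultimately show ?thesis by blast
qed

text \<open>The vanishing set of \<open>z\<close> is an initial interval, and its right end \<open>r0\<close> is where the test functions start.\<close>

lemma positivity_radius:
  assumes r: "0 < r" "r < 1" "0 < z r"
  obtains r0 where "0 \<le> r0" "r0 < r" "\<And>t. r0 < t \<Longrightarrow> t < 1 \<Longrightarrow> 0 < z t" "r0 = 0 \<or> z r0 = 0"
proof (cases "\<exists>t\<in>{0<..<1}. z t = 0")
  case False
  then have "0 < z t" if "0 < t" "t < 1" for t using profile_nonneg[of t] that by force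
  then show ?thesis using r by (intro that[of 0]) auto
next
  case True
  define S where "S = {t \<in> {0<..r}. z t = 0}"
  have le_r: "t < r" if "t \<in> {0<..<1}" "z t = 0" for t
    using profile_zero_before[of t r] that r by (cases "r \<le> t") auto
  then have ne: "S \<noteq> {}" using True by (force simp: S_def)
  obtain t0 where t0: "t0 \<in> S" using ne by blast
  have bdd: "bdd_above S" by (auto simp: S_def bdd_above_def)
  define r0 where "r0 = Sup S"
  have "t0 \<le> r0" "r0 \<le> r" unfolding r0_def using t0 bdd ne by (auto intro: cSup_upper cSup_least simp: S_def)
  have r0p: "0 < r0" using t0 \<open>t0 \<le> r0\<close> by (auto simp: S_def)
  have zs: "z t = 0" if "0 < t" and t: "t < r0" for t
  proof -
    obtain t' where "t' \<in> S" "t < t'" using less_cSup_iff[OF ne bdd, of t] t unfolding r0_def by blast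
    then show ?thesis using profile_zero_before[of t' t] that r by (auto simp: S_def)
  qed
  have zr0: "z r0 = 0"
  proof -
    have "(z \<longlongrightarrow> z r0) (at r0 within {0<..1})" using profile_cont r0p \<open>r0 \<le> r\<close> r by (auto simp: continuous_on_def)
    then have 1: "(z \<longlongrightarrow> z r0) (at r0 within {0<..<r0})" by (rule tendsto_within_subset) (use \<open>r0 \<le> r\<close> r in auto)
    have 2: "(z \<longlongrightarrow> 0) (at r0 within {0<..<r0})" by (rule tendsto_eventually) (auto simp: eventually_at_filter zs)
    have "at r0 within {0<..<r0} \<noteq> bot" using r0p by (simp add: at_within_eq_bot_iff)
    then show ?thesis using tendsto_unique[OF _ 1 2] by simp
  qed
  show ?thesis
  proof (rule that[of r0])
    show "r0 < r" using zr0 r \<open>r0 \<le> r\<close> by (cases "r0 = r") auto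
    fix t assume t: "r0 < t" "t < 1"
    have "z t \<noteq> 0"
    proof
      assume "z t = 0"
      then have "t \<in> S" using le_r[of t] t r0p by (auto simp: S_def)
      from cSup_upper[OF this bdd] show False using t by (simp add: r0_def)
    qed
    then show "0 < z t" using profile_nonneg[of t] t r0p by force
  qed (use r0p zr0 in auto)
qed

context
  assumes g_lip: "locally_lipschitz g" and energy: "set_integrable lborel {0<..<1} (energy_density n k z)"
    and stable: "\<And>r0 \<alpha> \<beta> \<zeta> \<zeta>'. 0 \<le> r0 \<Longrightarrow> (\<And>t. r0 < t \<Longrightarrow> t < 1 \<Longrightarrow> 0 < z t) \<Longrightarrow> r0 < \<alpha> \<Longrightarrow> \<alpha> < \<beta> \<Longrightarrow> \<beta> < 1 \<Longrightarrow>
       (\<And>r. (\<zeta> has_real_derivative \<zeta>' r) (at r)) \<Longrightarrow> continuous_on UNIV \<zeta>' \<Longrightarrow> (\<And>r. r \<notin> {\<alpha><..<\<beta>} \<Longrightarrow> \<zeta> r = 0) \<Longrightarrow>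
       0 \<le> (LBINT r:{\<alpha>..\<beta>}. energy_density n k z r * stability_form n k r (\<zeta> r) (\<zeta>' r))"
begin

lemma outer_energy_nonneg: "0 \<le> (LBINT r:{1/2..3/4}. energy_density n k z r)"
  unfolding set_lebesgue_integral_def
  by (rule integral_nonneg_AE) (auto simp: indicator_def intro!: energy_density_nonneg)

text \<open>
  The energy in \<open>[r, 2r]\<close> is bounded from above by \<open>energy_decay\<close> and from below by monotonicity of
  the flux.
\<close>

lemma inner_profile_bound:
  assumes r: "0 < r" "r \<le> 1/4"
  shows "z r ^ (k + 1) \<le> inner_constant n k * (LBINT r:{1/2..3/4}. energy_density n k z r) * r powr ((real k + 1) * decay_exponent n k)"
proof (cases "z r = 0")
  case True
  have "0 \<le> inner_constant n k"
    using stability_gap_pos[OF k] stability_exponent_bounds(2)[OF k] by (simp add: inner_constant_def)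
  then show ?thesis using True outer_energy_nonneg by (simp add: zero_power)
next
  case False
  define s where "s = stability_exponent n k"
  let ?I = "LBINT r:{1/2..3/4}. energy_density n k z r"
  have zr: "0 < z r" using False profile_nonneg[of r] r by simp
  obtain r0 where r0: "0 \<le> r0" "r0 < r" "\<And>t. r0 < t \<Longrightarrow> t < 1 \<Longrightarrow> 0 < z t" "r0 = 0 \<or> z r0 = 0"
    using positivity_radius[of r] zr r by auto
  have cut: "\<exists>\<delta>0>0. \<forall>\<delta>. 0 < \<delta> \<and> \<delta> < \<delta>0 \<longrightarrow> (LBINT r:{r0+\<delta>..r0+2*\<delta>}. (r / \<delta>)\<^sup>2 * energy_density n k z r) \<le> \<epsilon>" if "0 < \<epsilon>" for \<epsilon>
  proof (cases "r0 = 0")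
    case True then show ?thesis using cutoff_at_origin[OF energy that] by simp
  next
    case False then show ?thesis using cutoff_at_positive_radius[OF g_lip _ _ _ that, of r0] r0 r by auto
  qed
  have dec: "stability_gap n k / 4 * (LBINT t:{r..2*r}. energy_density n k z t)
     \<le> (2 powr (s + 1))\<^sup>2 * (16 * s + 80) * ((2 * r) powr (s + 1))\<^sup>2 * ?I"
    unfolding s_def
    by (rule energy_decay[OF k r0(1,2) _ _ energy_density_cont energy_density_nonneg stable[OF r0(1,3)] cut]) (use r in auto)
  have low: "r * (r ^ (n - k) * z r ^ (k + 1) / (2 ^ (n - k)) ^ (k + 1)) \<le> (LBINT t:{r..2*r}. energy_density n k z t)"
  proof -
    have "(LBINT t:{r..2*r}. r ^ (n - k) * z r ^ (k + 1) / (2 ^ (n - k)) ^ (k + 1)) \<le> (LBINT t:{r..2*r}. energy_density n k z t)"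
    proof (rule set_integral_mono)
      show "set_integrable lborel {r..2*r} (energy_density n k z)" using r by (intro energy_density_integrable) auto
      show "set_integrable lborel {r..2*r} (\<lambda>t. r ^ (n - k) * z r ^ (k + 1) / (2 ^ (n - k)) ^ (k + 1))"
        by (intro borel_integrable_atLeastAtMost' continuous_intros)
      fix t assume t: "t \<in> {r..2*r}"
      have "(z r / 2 ^ (n - k)) ^ (k + 1) \<le> z t ^ (k + 1)"
        using profile_lower_bound[of r t 2] t r zr by (intro power_mono) auto
      moreover have "r ^ (n - k) \<le> t ^ (n - k)" using t r by (intro power_mono) auto
      ultimately have "r ^ (n - k) * (z r / 2 ^ (n - k)) ^ (k + 1) \<le> t ^ (n - k) * z t ^ (k + 1)"
        using r zr t by (intro mult_mono) auto
      then show "r ^ (n - k) * z r ^ (k + 1) / (2 ^ (n - k)) ^ (k + 1) \<le> energy_density n k z t"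
        by (simp add: energy_density_def power_divide)
    qed
    moreover have "(LBINT t:{r..2*r}. c) = r * c" for c :: real using r by (simp add: set_lebesgue_integral_def)
    ultimately show ?thesis by (simp add: ac_simps)
  qed
  define E where "E = (LBINT t:{r..2*r}. energy_density n k z t)"
  define Q :: real where "Q = (2 ^ (n - k)) ^ (k + 1)"
  define B where "B = (2 powr (s + 1))\<^sup>2"
  define q where "q = r powr ((real k + 1) * decay_exponent n k)"
  define \<gamma> where "\<gamma> = stability_gap n k"
  have Q: "0 < Q" by (simp add: Q_def)
  have \<gamma>: "0 < \<gamma>" unfolding \<gamma>_def by (rule stability_gap_pos[OF k])
  have rs: "((2 * r) powr (s + 1))\<^sup>2 = B * (r ^ (n - k + 1) * q)"
  proof -
    have "(r powr (s + 1))\<^sup>2 = r powr ((s + 1) + (s + 1))" by (simp only: powr_add power2_eq_square)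
    also have "(s + 1) + (s + 1) = real (n - k + 1) + (real k + 1) * decay_exponent n k"
      using k by (simp add: decay_exponent_def s_def of_nat_diff)
    also have "r powr \<dots> = r ^ (n - k + 1) * q" using r by (simp only: powr_add powr_realpow q_def)
    finally show ?thesis using r by (simp add: B_def powr_mult power_mult_distrib)
  qed
  have "(r * r ^ (n - k)) * z r ^ (k + 1) = Q * (r * (r ^ (n - k) * z r ^ (k + 1) / Q))" using Q by simp
  also have "\<dots> \<le> Q * E" unfolding Q_def E_def using low by (intro mult_left_mono) auto
  also have "\<dots> = Q * (4 / \<gamma>) * (\<gamma> / 4 * E)" using \<gamma> by simp
  also have "\<dots> \<le> Q * (4 / \<gamma>) * (B * (16 * s + 80) * (B * (r ^ (n - k + 1) * q)) * ?I)"
    using dec Q \<gamma> unfolding rs unfolding B_def \<gamma>_def E_def by (intro mult_left_mono) auto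
  also have "\<dots> = (r * r ^ (n - k)) * (inner_constant n k * ?I * q)"
    by (simp add: inner_constant_def Q_def B_def \<gamma>_def s_def ac_simps)
  finally have le: "(r * r ^ (n - k)) * z r ^ (k + 1) \<le> (r * r ^ (n - k)) * (inner_constant n k * ?I * q)" .
  have "0 < r * r ^ (n - k)" using r by simp
  from mult_left_le_imp_le[OF le this] show ?thesis by (simp only: q_def)
qed

text \<open>Here \<open>2 r\<close> may exceed \<open>1/2\<close>, and \<open>z r\<close> is compared with the energy in \<open>[1/2, 3/4]\<close> directly.\<close>

lemma outer_profile_bound:
  assumes r: "1/4 \<le> r" "r \<le> 1/2"
  shows "z r ^ (k + 1) \<le> outer_constant n k * (LBINT r:{1/2..3/4}. energy_density n k z r) * r powr ((real k + 1) * decay_exponent n k)"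
proof -
  let ?I = "LBINT r:{1/2..3/4}. energy_density n k z r"
  define c :: real where "c = (1/2) ^ (n - k) * (z r / 4 ^ (n - k)) ^ (k + 1)"
  define p where "p = (real k + 1) * decay_exponent n k"
  have zr: "0 \<le> z r" using profile_nonneg[of r] r by simp
  have "(LBINT t:{1/2..3/4::real}. c) \<le> ?I"
  proof (rule set_integral_mono)
    show "set_integrable lborel {1/2..3/4} (energy_density n k z)" by (intro energy_density_integrable) auto
    show "set_integrable lborel {1/2..3/4::real} (\<lambda>t. c)" by (intro borel_integrable_atLeastAtMost' continuous_intros)
    fix t :: real assume t: "t \<in> {1/2..3/4}"
    have "(z r / 4 ^ (n - k)) ^ (k + 1) \<le> z t ^ (k + 1)"
      using profile_lower_bound[of r t 4] t r zr by (intro power_mono) auto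
    moreover have "(1/2) ^ (n - k) \<le> t ^ (n - k)" using t by (intro power_mono) auto
    ultimately show "c \<le> energy_density n k z t" using t zr unfolding c_def energy_density_def by (intro mult_mono) auto
  qed
  moreover have "(LBINT t:{1/2..3/4::real}. c) = 1 / 4 * c" by (simp add: set_lebesgue_integral_def)
  ultimately have cI: "1 / 4 * c \<le> ?I" by simp
  define Q :: real where "Q = 4 * 2 ^ (n - k) * (4 ^ (n - k)) ^ (k + 1)"
  have Q: "0 < Q" by (simp add: Q_def)
  have "z r ^ (k + 1) = Q * (1 / 4 * c)" by (simp add: c_def Q_def power_divide field_simps)
  also have "\<dots> \<le> Q * ?I" using cI Q by (intro mult_left_mono) auto
  also have "\<dots> = Q * ?I * 1" by simp
  also have "\<dots> \<le> Q * ?I * (4 powr \<bar>p\<bar> * r powr p)"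
    using powr_lower_bound[of r p] r Q outer_energy_nonneg by (intro mult_left_mono mult_nonneg_nonneg) auto
  finally show ?thesis by (simp add: outer_constant_def Q_def p_def ac_simps)
qed

lemma profile_bound:
  assumes r: "0 < r" "r \<le> 1/2"
  shows "z r ^ (k + 1) \<le> (inner_constant n k + outer_constant n k) * (LBINT r:{1/2..3/4}. energy_density n k z r) * r powr ((real k + 1) * decay_exponent n k)"
proof -
  let ?w = "(LBINT r:{1/2..3/4}. energy_density n k z r) * r powr ((real k + 1) * decay_exponent n k)"
  have "0 \<le> inner_constant n k"
    using stability_gap_pos[OF k] stability_exponent_bounds(2)[OF k] by (simp add: inner_constant_def)
  moreover have "0 \<le> outer_constant n k" by (simp add: outer_constant_def)
  moreover have "0 \<le> ?w" using outer_energy_nonneg by simp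
  ultimately have "0 \<le> inner_constant n k * ?w" "0 \<le> outer_constant n k * ?w" by simp_all
  moreover have "z r ^ (k + 1) \<le> inner_constant n k * ?w \<or> z r ^ (k + 1) \<le> outer_constant n k * ?w"
    using inner_profile_bound[of r] outer_profile_bound[of r] r by (cases "r \<le> 1/4") (auto simp: ac_simps)
  ultimately have "z r ^ (k + 1) \<le> inner_constant n k * ?w + outer_constant n k * ?w" by linarith
  then show ?thesis by (simp add: algebra_simps)
qed

end
end
end

section \<open>Nonincreasing and convex right-hand sides\<close>

lemma nonneg_derivative_of_left_max:
  fixes f :: "real \<Rightarrow> real"
  assumes "(f has_real_derivative l) (at r within {0<..1})" "r \<in> {0<..1}" "a < r" "\<And>t. a < t \<Longrightarrow> 0 < t \<Longrightarrow> t < r \<Longrightarrow> f t \<le> f r"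
  shows "0 \<le> l"
proof (rule ccontr)
  assume "\<not> 0 \<le> l"
  then obtain d where d: "d > 0" "\<And>h. h > 0 \<Longrightarrow> r - h \<in> {0<..1} \<Longrightarrow> h < d \<Longrightarrow> f r < f (r - h)"
    using has_real_derivative_neg_dec_left[OF assms(1)] by (auto simp: not_le)
  define h where "h = min (d / 2) (min (r / 2) ((r - a) / 2))"
  have "h > 0" using d(1) assms(2,3) by (simp add: h_def)
  moreover have "h \<le> d / 2" "h \<le> r / 2" "h \<le> (r - a) / 2" unfolding h_def by linarith+
  ultimately have h: "h > 0" "h < d" "h \<le> r / 2" "h \<le> (r - a) / 2" using d(1) by linarith+
  have "f r < f (r - h)" using d(2)[of h] h assms(2) by auto
  moreover have "f (r - h) \<le> f r" using h assms(2,3) by (intro assms(4)) auto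
  ultimately show False by simp
qed

context
  fixes n k :: nat and g v z :: "real \<Rightarrow> real"
  assumes prof: "regular_profile n k g v z" and k: "1 \<le> k" "2 * k < n"
    and g_nonneg: "\<And>t. 0 \<le> g t" and g_anti: "antimono g"
begin

text \<open>
  For a fixed \<open>r\<close>, the flux at \<open>s\<close> minus \<open>g(v r) s\<^sup>n / (n c)\<close> is nondecreasing in \<open>s \<le> r\<close>, since
  \<open>g(v s) \<ge> g(v r)\<close>, and it tends to \<open>0\<close> at the origin.
\<close>

lemma source_le_flux:
  assumes r: "r \<in> {0<..1}"
  shows "r ^ n * g (v r) / c_const n k \<le> real n * (r ^ (n - k) * z r ^ k)"
proof -
  define \<phi> where "\<phi> s = s ^ (n - k) * z s ^ k - g (v r) / c_const n k * (s ^ n / real n)" for s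
  note c = c_pos[OF prof k]
  have n: "0 < n" using k by simp
  have d: "(\<phi> has_real_derivative s ^ (n - 1) * g (v s) / c_const n k - g (v r) / c_const n k * s ^ (n - 1)) (at s within {0<..1})"
    if "s \<in> {0<..1}" for s
    unfolding \<phi>_def[abs_def] using n
    by (intro DERIV_diff flux_deriv[OF prof k that] DERIV_cmult) (auto intro!: derivative_eq_intros)
  have le: "\<phi> s \<le> \<phi> r" if s: "0 < s" "s < r" for s
  proof -
    obtain t where t: "s < t" "t < r" "\<phi> r - \<phi> s = (r - s) * (t ^ (n - 1) * g (v t) / c_const n k - g (v r) / c_const n k * t ^ (n - 1))"
      using mvt_Ioc[OF d s] r by auto
    have "g (v r) \<le> g (v t)" using profile_mono[OF prof k, of t r] t s r by (intro antimonoD[OF g_anti]) auto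
    then have "g (v r) / c_const n k * t ^ (n - 1) \<le> g (v t) / c_const n k * t ^ (n - 1)"
      using c t s by (intro mult_right_mono divide_right_mono) auto
    then have "0 \<le> t ^ (n - 1) * g (v t) / c_const n k - g (v r) / c_const n k * t ^ (n - 1)" by (simp add: mult.commute)
    then have "0 \<le> \<phi> r - \<phi> s" unfolding t(3) using s by (intro mult_nonneg_nonneg) auto
    then show ?thesis by simp
  qed
  have "((\<lambda>s. s ^ n / real n) \<longlongrightarrow> 0 ^ n / real n) (at_right 0)" by (intro tendsto_intros) (use n in auto)
  from tendsto_diff[OF flux_limit[OF prof k] tendsto_mult_left[OF this, of "g (v r) / c_const n k"]]
  have "(\<phi> \<longlongrightarrow> 0) (at_right 0)" using n by (simp add: \<phi>_def[abs_def] zero_power)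
  moreover have "eventually (\<lambda>s. \<phi> s \<le> \<phi> r) (at_right 0)"
    by (rule eventually_at_rightI[of 0 r]) (use r le in auto)
  ultimately have "0 \<le> \<phi> r" by (intro tendsto_upperbound) auto
  then have "real n * (g (v r) / c_const n k * (r ^ n / real n)) \<le> real n * (r ^ (n - k) * z r ^ k)"
    by (intro mult_left_mono) (simp_all add: \<phi>_def)
  then show ?thesis using n by (simp add: mult.commute)
qed

text \<open>
  The \<open>k\<close>-th power of \<open>z / r\<close> is the flux divided by \<open>r\<^sup>n\<close>, whose derivative is nonpositive by the
  previous lemma.
\<close>

lemma profile_ratio_antimono:
  assumes r: "0 < r" "r \<le> t" "t \<le> 1"
  shows "z t / t \<le> z r / r"
proof (cases "r = t")
  case False
  then have rt: "r < t" using r by simp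
  define w where "w s = s ^ (n - k) * z s ^ k / s ^ n" for s
  define w' where "w' s = (s ^ (n - 1) * g (v s) / c_const n k * s ^ n - s ^ (n - k) * z s ^ k * (real n * s ^ (n - 1))) / (s ^ n * s ^ n)" for s
  have n: "0 < n" using k by simp
  have d: "(w has_real_derivative w' s) (at s within {0<..1})" if "s \<in> {0<..1}" for s
    unfolding w_def[abs_def] w'_def using n that
    by (intro DERIV_divide flux_deriv[OF prof k that]) (auto intro!: derivative_eq_intros)
  obtain s where s: "r < s" "s < t" "w t - w r = (t - r) * w' s" using mvt_Ioc[OF d r(1) rt r(3)] by blast
  have "s ^ (n - 1) * (s ^ n * g (v s) / c_const n k) \<le> s ^ (n - 1) * (real n * (s ^ (n - k) * z s ^ k))"
    using source_le_flux[of s] s r by (intro mult_left_mono) auto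
  then have "w' s \<le> 0" unfolding w'_def by (intro divide_nonpos_nonneg) (auto simp: ac_simps)
  then have "w t - w r \<le> 0" unfolding s(3) using rt by (intro mult_nonneg_nonpos) auto
  moreover have wr: "w s = (z s / s) ^ k" if "0 < s" for s
  proof -
    have "s ^ n = s ^ (n - k) * s ^ k" using k by (simp flip: power_add)
    then show ?thesis using that by (simp add: w_def power_divide)
  qed
  ultimately have "(z t / t) ^ k \<le> (z r / r) ^ k" using wr[of t] wr[of r] r by simp
  then show ?thesis using power_mono_iff[of "z t / t" "z r / r" k] profile_nonneg[OF prof k, of t] profile_nonneg[OF prof k, of r] r k(1)
    by simp
qed simp

lemma profile_zero_or_positive: "(\<forall>r\<in>{0<..1}. z r = 0) \<or> (\<forall>r\<in>{0<..1}. 0 < z r)"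
proof (rule disjCI)
  assume "\<not> (\<forall>r\<in>{0<..1}. 0 < z r)"
  then obtain s where s: "s \<in> {0<..1}" "z s = 0" using profile_nonneg[OF prof k] by (force simp: not_less)
  show "\<forall>r\<in>{0<..1}. z r = 0"
  proof
    fix r :: real assume r: "r \<in> {0<..1}"
    show "z r = 0"
    proof (cases "r \<le> s")
      case True then show ?thesis using profile_zero_before[OF prof k g_nonneg s(2), of r] r s(1) by auto
    next
      case False
      then have "z r / r \<le> 0" using profile_ratio_antimono[of s r] s r by auto
      then have "z r \<le> 0" using r by (simp add: divide_le_0_iff)
      then show ?thesis using profile_nonneg[OF prof k r] by simp
    qed
  qed
qed

text \<open>In the formula for \<open>z'\<close> both the source term and the damping term lie between \<open>0\<close> and \<open>n z\<^sup>k / r\<close>.\<close>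

lemma profile_slope_bound:
  assumes r: "r \<in> {0<..1}" "0 < z r"
  shows "\<bar>profile_slope n k g v z r\<bar> \<le> real n / real k * (z r / r)"
proof -
  define S where "S = r ^ (k - 1) * g (v r) / c_const n k"
  note c = c_pos[OF prof k]
  have r0: "0 < r" using r by simp
  have "S \<le> real n * z r ^ k / r"
  proof -
    have e: "r ^ n = r ^ (n - k) * (r * r ^ (k - 1))"
      using k by (simp flip: power_add power_Suc)
    have "r ^ (n - k) * (r * S) \<le> r ^ (n - k) * (real n * z r ^ k)"
      using source_le_flux[OF r(1)] unfolding e S_def by (simp add: ac_simps)
    then have "r * S \<le> real n * z r ^ k" using r0 by simp
    then show ?thesis using r0 by (simp add: field_simps)
  qed
  moreover have "0 \<le> S" unfolding S_def using c g_nonneg r0 by (intro divide_nonneg_pos mult_nonneg_nonneg) auto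
  moreover have "0 \<le> (real n - real k) * z r ^ k / r" "(real n - real k) * z r ^ k / r \<le> real n * z r ^ k / r"
    using k r0 r(2) by (auto intro!: divide_right_mono mult_right_mono)
  ultimately have "\<bar>S - (real n - real k) * z r ^ k / r\<bar> \<le> real n * z r ^ k / r" by (intro abs_leI) linarith+
  then have "\<bar>S - (real n - real k) * z r ^ k / r\<bar> / (real k * z r ^ (k - 1)) \<le> (real n * z r ^ k / r) / (real k * z r ^ (k - 1))"
    using r k by (intro divide_right_mono) auto
  also have "\<dots> = real n / real k * (z r / r)"
  proof -
    have "z r ^ k = z r * z r ^ (k - 1)" using k by (simp flip: power_Suc)
    then show ?thesis using r k by simp
  qed
  finally show ?thesis using r k by (simp add: profile_slope_def S_def)
qed

text \<open>
  As \<open>r\<close> grows from \<open>1/2\<close> to \<open>1\<close>, the monotone flux keeps \<open>z\<close> from dropping and the monotone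
  quotient \<open>z / r\<close> keeps it from growing by more than a fixed factor.
\<close>

lemma profile_comparable:
  assumes "t \<in> {1/2..1}" "t' \<in> {1/2..1}"
  shows "z t \<le> 2 ^ n * z t'"
proof -
  have nn: "0 \<le> z t" "0 \<le> z t'" using profile_nonneg[OF prof k] assms by auto
  show ?thesis
  proof (cases "t \<le> t'")
    case True
    have "z t / 2 ^ (n - k) \<le> z t'" using profile_lower_bound[OF prof k g_nonneg, of t t' 2] True assms by auto
    then have "z t \<le> 2 ^ (n - k) * z t'" by (simp add: divide_le_eq mult.commute)
    also have "\<dots> \<le> 2 ^ n * z t'" using nn by (intro mult_right_mono power_increasing) auto
    finally show ?thesis .
  next
    case False
    then have "z t / t \<le> z t' / t'" using profile_ratio_antimono[of t' t] assms by auto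
    then have "z t \<le> t * (z t' / t')" using assms by (simp add: divide_le_eq mult.commute)
    also have "\<dots> = (t / t') * z t'" by simp
    also have "\<dots> \<le> 2 * z t'" using assms nn by (intro mult_right_mono) (auto simp: divide_le_eq)
    also have "\<dots> \<le> 2 ^ n * z t'" using nn k power_increasing[of 1 n "2::real"] by (intro mult_right_mono) auto
    finally show ?thesis .
  qed
qed

lemma profile_le_infimum:
  assumes "t \<in> {1/2..1}" shows "z t \<le> 2 ^ n * (INF s\<in>{1/2..1}. z s)"
proof -
  have "z t / 2 ^ n \<le> (INF s\<in>{1/2..1}. z s)"
    using profile_comparable[OF assms] by (intro cINF_greatest) (auto simp: divide_le_eq mult.commute)
  then show ?thesis by (simp add: divide_le_eq mult.commute)
qed

lemma infimum_nonneg: "0 \<le> (INF s\<in>{1/2..1}. z s)"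
  using profile_nonneg[OF prof k] by (intro cINF_greatest) auto

text \<open>
  By convexity the slope of \<open>g\<close> at \<open>v r\<close> is at least that of the secant from \<open>v (r/2)\<close>, whose
  absolute value is at most \<open>g(v(r/2)) / (v r - v(r/2))\<close> as \<open>g \<ge> 0\<close>. The denominator is of order \<open>r
  z r\<close> and the numerator is controlled by the flux.
\<close>

lemma source_derivative_bound:
  assumes convex: "convex_on UNIV g" and r: "r \<in> {0<..1}" and pos: "\<And>s. s \<in> {0<..1} \<Longrightarrow> 0 < z s"
    and D: "((\<lambda>r. g (v r)) has_real_derivative D) (at r within {0<..1})"
  shows "D \<le> 0" "- D \<le> 4 * (real n * c_const n k * 2 ^ n * z r ^ k / r ^ k) / r"
proof -
  have r0: "0 < r" "r \<le> 1" using r by auto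
  note c = c_pos[OF prof k]
  have vm: "v s < v t" if st: "0 < s" "s < t" "t \<le> 1" for s t
  proof -
    obtain x where x: "s < x" "x < t" "v t - v s = (t - s) * z x" using mvt_Ioc[OF profile_deriv[OF prof k] st] by blast
    have "0 < (t - s) * z x" using x st by (intro mult_pos_pos pos) auto
    then show ?thesis using x by simp
  qed
  have "((\<lambda>r. - g (v r)) has_real_derivative - D) (at r within {0<..1})" by (rule DERIV_minus[OF D])
  then have "0 \<le> - D"
    by (rule nonneg_derivative_of_left_max[OF _ r r0(1)]) (use antimonoD[OF g_anti] vm r0 in \<open>auto simp: less_imp_le\<close>)
  then show "D \<le> 0" by simp
  (* The function g o v + K v has a maximum over the interval from r / 2 to r at its right end. *)
  define K where "K = g (v (r / 2)) / (v r - v (r / 2))"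
  have vr: "0 < v r - v (r / 2)" using vm[of "r / 2" r] r0 by simp
  have "((\<lambda>r. g (v r) + K * v r) has_real_derivative D + K * z r) (at r within {0<..1})"
    by (intro DERIV_add D DERIV_cmult profile_deriv[OF prof k r])
  then have "0 \<le> D + K * z r"
  proof (rule nonneg_derivative_of_left_max[OF _ r, where a = "r / 2"])
    fix t assume t: "r / 2 < t" "0 < t" "t < r"
    have v: "v (r / 2) < v t" "v t < v r" using vm[of "r / 2" t] vm[of t r] t r0 by auto
    have "(g (v (r / 2)) - g (v r)) / (v (r / 2) - v r) \<le> (g (v t) - g (v r)) / (v t - v r)"
      by (rule convex_on_slope_le(2)[OF convex _ _ v]) auto
    moreover have "- K \<le> (g (v (r / 2)) - g (v r)) / (v (r / 2) - v r)"
    proof -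
      have "(g (v (r / 2)) - g (v r)) / (v (r / 2) - v r) = (g (v r) - g (v (r / 2))) / (v r - v (r / 2))"
        by (metis minus_diff_eq minus_divide_divide)
      moreover have "- g (v (r / 2)) / (v r - v (r / 2)) \<le> (g (v r) - g (v (r / 2))) / (v r - v (r / 2))"
        using vr g_nonneg[of "v r"] by (intro divide_right_mono) auto
      ultimately show ?thesis by (simp add: K_def)
    qed
    ultimately have "- K \<le> (g (v t) - g (v r)) / (v t - v r)" by linarith
    then show "g (v t) + K * v t \<le> g (v r) + K * v r" using v by (simp add: field_simps)
  qed (use r0 in auto)
  moreover have "K * z r \<le> 4 * g (v (r / 2)) / r"
  proof -
    obtain s where s: "r / 2 < s" "s < r" "v r - v (r / 2) = (r - r / 2) * z s"
      using mvt_Ioc[OF profile_deriv[OF prof k], of "r / 2" r] r0 by auto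
    have "z r / r \<le> z s / s" using profile_ratio_antimono[of s r] s r0 by auto
    then have "z r * s \<le> z s * r" using s r0 by (simp add: field_simps)
    moreover have "z r * (r / 2) \<le> z r * s" using s pos[OF r] by (intro mult_left_mono) auto
    ultimately have "(z r / 2) * r \<le> z s * r" by (simp add: mult.commute)
    then have "z r / 2 \<le> z s" using r0 by simp
    then have "r / 2 * (z r / 2) \<le> v r - v (r / 2)" unfolding s(3) using r0 pos[OF r] by (intro mult_mono) auto
    then have "z r * r \<le> 4 * (v r - v (r / 2))" by (simp add: algebra_simps)
    then have "g (v (r / 2)) * (z r * r) \<le> g (v (r / 2)) * (4 * (v r - v (r / 2)))" by (rule mult_left_mono) (rule g_nonneg)
    then show ?thesis unfolding K_def using vr r0 by (simp add: field_simps)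
  qed
  moreover have "g (v (r / 2)) \<le> real n * c_const n k * 2 ^ n * z r ^ k / r ^ k"
  proof -
    have "(r / 2) ^ n * g (v (r / 2)) / c_const n k \<le> real n * ((r / 2) ^ (n - k) * z (r / 2) ^ k)"
      using source_le_flux[of "r / 2"] r0 by auto
    also have "\<dots> \<le> real n * (r ^ (n - k) * z r ^ k)"
      using flux_mono[OF prof k g_nonneg, of "r / 2" r] r0 by (intro mult_left_mono) auto
    finally have le: "(r / 2) ^ n * g (v (r / 2)) / c_const n k \<le> real n * (r ^ (n - k) * z r ^ k)" .
    have e: "r ^ n = r ^ (n - k) * r ^ k" using k by (simp flip: power_add)
    have "r ^ (n - k) * (r ^ k * g (v (r / 2))) \<le> r ^ (n - k) * (real n * c_const n k * 2 ^ n * z r ^ k)"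
      using le c unfolding power_divide e by (simp add: field_simps)
    then have "r ^ k * g (v (r / 2)) \<le> real n * c_const n k * 2 ^ n * z r ^ k" using r0 by simp
    then show ?thesis using r0 by (simp add: field_simps)
  qed
  then have "4 * g (v (r / 2)) / r \<le> 4 * (real n * c_const n k * 2 ^ n * z r ^ k / r ^ k) / r"
    using r0 by (intro divide_right_mono mult_left_mono) auto
  ultimately show "- D \<le> 4 * (real n * c_const n k * 2 ^ n * z r ^ k / r ^ k) / r" by linarith
qed

end

text \<open>
  If no line of rational slope supports \<open>g\<close> at \<open>x\<close> only, then no rational lies between the one-sided slopes
  at \<open>x\<close>, so these agree. Since a rational slope belongs to at most one such \<open>x\<close>, there are only countably many kinks.
\<close>

lemma countable_kinks_convex:
  fixes g :: "real \<Rightarrow> real"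
  assumes g: "convex_on UNIV g"
  shows "countable {x. \<not> (\<exists>d. (g has_real_derivative d) (at x))}"
proof -
  let ?P = "\<lambda>q x. \<forall>y. y \<noteq> x \<longrightarrow> g x - q * x < g y - q * y"
  have uniq: "x = x'" if "?P q x" "?P q x'" for q x x' using that by (metis less_asym)
  have "\<exists>d. (g has_real_derivative d) (at x)" if no: "\<And>q. q \<in> \<rat> \<Longrightarrow> \<not> ?P q x" for x
  proof -
    define S where "S y = (g y - g x) / (y - x)" for y
    have S_mono: "S y \<le> S y'" if yy: "y < y'" "y \<noteq> x" "y' \<noteq> x" for y y'
    proof -
      have sw: "(g x - g y) / (x - y) = S y" for y unfolding S_def by (metis minus_diff_eq minus_divide_divide)
      consider "y' < x" | "y < x" "x < y'" | "x < y" using yy by linarith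
      then show ?thesis
      proof cases
        case 1 then show ?thesis using convex_on_slope_le(2)[OF g _ _ yy(1) 1] by (simp add: S_def)
      next
        case 2
        have "S y \<le> (g y - g y') / (y - y')" using convex_on_slope_le(1)[OF g _ _ 2] by (simp add: S_def)
        also have "\<dots> \<le> (g x - g y') / (x - y')" using convex_on_slope_le(2)[OF g _ _ 2] by simp
        finally show ?thesis by (simp add: sw)
      next
        case 3 then show ?thesis using convex_on_slope_le(1)[OF g _ _ 3 yy(1)] by (simp add: sw)
      qed
    qed
    define R where "R = (INF y\<in>{x<..}. S y)"
    have bdd: "bdd_below (S ` {x<..})" by (rule bdd_belowI2[of _ "S (x - 1)"]) (auto intro: S_mono)
    have "(S \<longlongrightarrow> R) (at x)"
    proof (rule order_tendstoI)
      fix a assume "R < a"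
      then obtain y where y: "x < y" "S y < a" unfolding R_def using cINF_less_iff[OF _ bdd] by auto
      have "eventually (\<lambda>t. t \<in> {..<y} - {x}) (at x)" by (rule eventually_at_in_open) (use y in auto)
      then show "eventually (\<lambda>t. S t < a) (at x)"
        by eventually_elim (use y S_mono in \<open>auto intro: le_less_trans\<close>)
    next
      fix a assume "a < R"
      then obtain q where q: "q \<in> \<rat>" "a < q" "q < R" using Rats_dense_in_real by blast
      then obtain y where y: "y \<noteq> x" "g y - q * y \<le> g x - q * x" using no[of q] by (auto simp: not_less)
      have "y < x"
      proof (rule ccontr)
        assume "\<not> y < x"
        then have xy: "x < y" using y by simp
        then have "S y \<le> q" using y unfolding S_def by (simp add: divide_le_eq algebra_simps)
        moreover have "R \<le> S y" unfolding R_def by (rule cINF_lower[OF bdd]) (use xy in simp)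
        ultimately show False using q by simp
      qed
      then have "q \<le> S y" using y unfolding S_def by (simp add: neg_le_divide_eq algebra_simps)
      then have y': "y < x" "a < S y" using q \<open>y < x\<close> by auto
      have "eventually (\<lambda>t. t \<in> {y<..} - {x}) (at x)" by (rule eventually_at_in_open) (use y' in auto)
      then show "eventually (\<lambda>t. a < S t) (at x)"
        by eventually_elim (use y' S_mono in \<open>auto intro: less_le_trans\<close>)
    qed
    then have "(g has_real_derivative R) (at x)" by (simp add: has_field_derivative_iff S_def[abs_def])
    then show ?thesis by blast
  qed
  then have "{x. \<not> (\<exists>d. (g has_real_derivative d) (at x))} \<subseteq> (\<lambda>q. THE x. ?P q x) ` \<rat>"
  proof (intro subsetI)
    fix x assume ex: "\<And>x. (\<And>q. q \<in> \<rat> \<Longrightarrow> \<not> ?P q x) \<Longrightarrow> \<exists>d. (g has_real_derivative d) (at x)"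
      and "x \<in> {x. \<not> (\<exists>d. (g has_real_derivative d) (at x))}"
    then obtain q where q: "q \<in> \<rat>" "?P q x" by blast
    have "(THE x. ?P q x) = x"
    proof (rule the_equality)
      show "?P q x" by (rule q(2))
      show "y = x" if "?P q y" for y by (rule uniq[OF that q(2)])
    qed
    then show "x \<in> (\<lambda>q. THE x. ?P q x) ` \<rat>" using q(1) by (intro image_eqI[of _ _ q]) auto
  qed
  moreover have "countable (\<rat> :: real set)" by (rule countable_rat)
  ultimately show ?thesis by (meson countable_image countable_subset)
qed

section \<open>The estimates\<close>

lemma rderiv_eqI:
  assumes "(f has_real_derivative d) (at r within {0<..1})" "r \<in> {0<..1}"
  shows "rdifferentiable f r" "rderiv f r = d"
proof -
  have "(f has_vector_derivative d) (at r within {0<..1})" using assms(1) by (simp add: has_real_derivative_iff_has_vector_derivative)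
  moreover have "at r within {0<..1} \<noteq> bot"
  proof
    assume "at r within {0<..1} = bot"
    moreover have "{0<..<r} \<subseteq> {0<..1}" using assms(2) by auto
    then have "at r within {0<..<r} \<le> at r within {0<..1}" by (rule at_le)
    ultimately have "at r within {0<..<r} = bot" by (simp add: bot.extremum_unique)
    then show False using assms(2) by (simp add: at_within_eq_bot_iff)
  qed
  ultimately show "rdifferentiable f r" "rderiv f r = d"
    unfolding rdifferentiable_def rderiv_def
    by (auto intro: vector_derivative_within differentiableI_vector)
qed

lemma rdifferentiableD:
  "rdifferentiable f r \<Longrightarrow> (f has_real_derivative rderiv f r) (at r within {0<..1})"
  unfolding rdifferentiable_def rderiv_def
  by (simp add: has_real_derivative_iff_has_vector_derivative vector_derivative_works)

lemma has_derivative_Ioc_cong: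
  assumes "\<And>s. s \<in> {0<..1} \<Longrightarrow> f s = h s" "r \<in> {0<..1}"
  shows "(f has_real_derivative d) (at r within {0<..1}) \<longleftrightarrow> (h has_real_derivative d) (at r within {0<..1})"
  by (rule has_field_derivative_cong_eventually) (use assms in \<open>auto simp: eventually_at_filter\<close>)

lemma root_power:
  fixes C :: real
  assumes "0 \<le> C"
  shows "(C powr (1 / (real k + 1))) ^ (k + 1) = C"
proof (cases "C = 0")
  case False
  then have "0 < C powr (1 / (real k + 1))" by simp
  then have "(C powr (1 / (real k + 1))) ^ (k + 1) = (C powr (1 / (real k + 1))) powr real (k + 1)" by (simp only: powr_realpow)
  also have "\<dots> = C powr (1 / (real k + 1) * real (k + 1))" by (rule powr_powr)
  also have "1 / (real k + 1) * real (k + 1) = 1" by simp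
  finally show ?thesis using assms by simp
qed simp

lemma root_bound:
  fixes x C y p r :: real
  assumes "0 \<le> x" "0 \<le> y" "0 \<le> C" "0 < r" "x ^ (k + 1) \<le> C * y ^ (k + 1) * r powr ((real k + 1) * p)"
  shows "x \<le> C powr (1 / (real k + 1)) * y * r powr p"
proof -
  have "(C powr (1 / (real k + 1)) * y * r powr p) ^ (k + 1) = C * y ^ (k + 1) * r powr ((real k + 1) * p)"
  proof -
    have "(C powr (1 / (real k + 1))) ^ (k + 1) = C" by (rule root_power[OF assms(3)])
    moreover have "(r powr p) ^ (k + 1) = r powr ((real k + 1) * p)"
    proof -
      have "(r powr p) ^ (k + 1) = (r powr p) powr real (k + 1)" using assms(4) by (simp only: powr_realpow powr_gt_zero)
      also have "\<dots> = r powr (p * real (k + 1))" by (rule powr_powr)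
      finally show ?thesis by (simp add: algebra_simps)
    qed
    ultimately show ?thesis by (simp only: power_mult_distrib)
  qed
  then have "x ^ (k + 1) \<le> (C powr (1 / (real k + 1)) * y * r powr p) ^ (k + 1)" using assms(5) by (simp only:)
  then show ?thesis using assms(2) by (intro power_le_imp_le_base[of x k]) auto
qed

text \<open>
  Since \<open>G x \<bullet> x = \<bar>x\<bar> z \<bar>x\<bar>\<close>, the norm of the gradient dominates \<open>z\<close>, and the Jacobian \<open>r\<^bsup>n-1\<^esup>\<close>
  times the weight \<open>r\<^bsup>1-k\<^esup>\<close> is \<open>r\<^bsup>n-k\<^esup>\<close>.
\<close>

lemma gradient_energy:
  fixes G :: "real^'n \<Rightarrow> real^'n" and k :: nat
  defines "A \<equiv> ball 0 1 - cball 0 (1/2) :: (real^'n) set"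
  assumes k: "1 \<le> k" "k < CARD('n)"
    and int: "integrable (lebesgue_on (ball 0 1)) (\<lambda>x. norm x powr (1 - real k) * norm (G x) ^ (k + 1))"
    and Gz: "AE x in lebesgue_on (ball 0 1). G x \<bullet> x = norm x * z (norm x)"
    and z: "continuous_on {0<..1} z" "\<And>r. r \<in> {0<..1} \<Longrightarrow> 0 \<le> z r"
  shows "set_integrable lborel {0<..<1} (\<lambda>r. r ^ (CARD('n) - k) * z r ^ (k + 1))"
    and "sphere_area TYPE(real^'n) * (LBINT r:{1/2..3/4}. r ^ (CARD('n) - k) * z r ^ (k + 1))
       \<le> (LINT x|lebesgue_on A. norm x powr (1 - real k) * norm (G x) ^ (k + 1))"
proof -
  let ?n = "CARD('n)" let ?B = "ball 0 1 :: (real^'n) set" let ?L = "lebesgue_on ?B"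
  define F where "F x = norm x powr (1 - real k) * norm (G x) ^ (k + 1)" for x
  define E where "E r = r ^ (?n - k) * z r ^ (k + 1)" for r
  define f where "f I r = indicator I r * (r powr (1 - real k) * z r ^ (k + 1))" for I :: "real set" and r
  have F0: "0 \<le> F x" for x by (simp add: F_def)
  have E0: "0 \<le> E r" if "r \<in> {0<..1}" for r using z(2)[OF that] that by (simp add: E_def)
  have meas: "f I \<in> borel_measurable borel" if I: "I \<subseteq> {0<..1}" "I \<in> sets borel" for I
  proof -
    have "continuous_on I (\<lambda>r. r powr (1 - real k) * z r ^ (k + 1))"
      using I(1) by (intro continuous_intros continuous_on_subset[OF z(1)]) auto
    from borel_measurable_continuous_on_indicator[OF I(2) this] show ?thesis by (simp add: f_def[abs_def])
  qed
  have mE: "(\<lambda>r. indicator I r * E r) \<in> borel_measurable borel" if I: "I \<subseteq> {0<..1}" "I \<in> sets borel" for I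
  proof -
    have "continuous_on I E" unfolding E_def using I(1) by (intro continuous_intros continuous_on_subset[OF z(1)]) auto
    from borel_measurable_continuous_on_indicator[OF I(2) this] show ?thesis by simp
  qed
  have fE: "r ^ (DIM(real^'n) - 1) * f I r = indicator I r * E r" if "0 < r" for I r
  proof -
    have "r ^ (?n - 1) * r powr (1 - real k) = r powr (real (?n - 1) + (1 - real k))"
      using that by (simp only: powr_add powr_realpow)
    also have "real (?n - 1) + (1 - real k) = real (?n - k)" using k by (simp add: of_nat_diff)
    finally have "r ^ (?n - 1) * r powr (1 - real k) = r ^ (?n - k)" using that by (simp add: powr_realpow)
    then show ?thesis by (simp add: f_def E_def flip: mult.assoc)
  qed
  have fF: "AE x in ?L. \<bar>f I (norm x)\<bar> \<le> indicator I (norm x) * F x" if I: "I \<subseteq> {0<..1}" for I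
    using Gz
  proof eventually_elim
    case (elim x)
    show ?case
    proof (cases "norm x \<in> I")
      case True
      then have x: "0 < norm x" "norm x \<in> {0<..1}" using I by auto
      have "norm x * z (norm x) \<le> norm (G x) * norm x" using norm_cauchy_schwarz[of "G x" x] elim by simp
      then have "z (norm x) \<le> norm (G x)" using x(1) by (simp add: mult.commute)
      then have "z (norm x) ^ (k + 1) \<le> norm (G x) ^ (k + 1)" using z(2)[OF x(2)] by (rule power_mono)
      then have "norm x powr (1 - real k) * z (norm x) ^ (k + 1) \<le> F x" unfolding F_def by (rule mult_left_mono) simp
      then show ?thesis using True z(2)[OF x(2)] by (simp add: f_def abs_mult)
    qed (simp add: f_def)
  qed
  have intF: "integrable ?L F" using int by (simp add: F_def[abs_def])
  have intf: "integrable ?L (\<lambda>x. f I (norm x))" if I: "I \<subseteq> {0<..1}" "I \<in> sets borel" for I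
  proof (rule Bochner_Integration.integrable_bound[OF intF])
    have "norm \<in> borel_measurable ?L" by (intro measurable_restrict_space1 measurable_completion) simp
    then show "(\<lambda>x. f I (norm x)) \<in> borel_measurable ?L" by (rule measurable_compose[OF _ meas[OF I]])
    show "AE x in ?L. norm (f I (norm x)) \<le> norm (F x)"
      using fF[OF I(1)] proof eventually_elim
      case (elim x)
      have "indicator I (norm x) * F x \<le> F x" using F0[of x] by (simp add: indicator_def)
      with elim show ?case using F0[of x] by simp
    qed
  qed
  have "set_integrable lborel {0<..<1} (\<lambda>r. r ^ (DIM(real^'n) - 1) * f {0<..<1} r)"
  proof -
    have sub: "{0<..<1::real} \<subseteq> {0<..1}" by auto
    show ?thesis using polar_integral(1)[OF meas[OF sub], where 'a = "real^'n"] intf[OF sub] by simp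
  qed
  then show "set_integrable lborel {0<..<1} (\<lambda>r. r ^ (?n - k) * z r ^ (k + 1))"
    by (rule set_integrable_cong[THEN iffD1, rotated -1]) (use fE in \<open>auto simp: E_def\<close>)
  let ?I = "{1/2<..3/4::real}"
  have sub: "?I \<subseteq> {0<..1}" "?I \<in> sets borel" by auto
  have "(LBINT r:{1/2..3/4}. E r) = (LBINT r:?I. E r)"
    unfolding set_lebesgue_integral_def real_scaleR_def
  proof (rule integral_cong_AE)
    show "(\<lambda>r. indicator {1/2..3/4} r * E r) \<in> borel_measurable lborel" "(\<lambda>r. indicator ?I r * E r) \<in> borel_measurable lborel"
      by (auto intro!: mE)
    show "AE r in lborel. indicator {1/2..3/4} r * E r = indicator ?I r * E r"
      using AE_lborel_singleton[of "1/2::real"] by eventually_elim (auto simp: indicator_def)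
  qed
  also have "\<dots> = (LBINT r:{0<..<1}. indicator ?I r * E r)" by (rule LBINT_indicator_subset[symmetric]) auto
  also have "\<dots> = (LBINT r:{0<..<1}. r ^ (DIM(real^'n) - 1) * f ?I r)"
    by (rule set_lebesgue_integral_cong) (use fE in auto)
  finally have "sphere_area TYPE(real^'n) * (LBINT r:{1/2..3/4}. E r) = (LINT x|?L. f ?I (norm x))"
    using polar_integral(2)[OF meas[OF sub], where 'a = "real^'n"] by simp
  also have "\<dots> \<le> (LINT x|?L. indicator A x * F x)"
  proof (rule integral_mono_AE)
    show "integrable ?L (\<lambda>x. f ?I (norm x))" by (rule intf) auto
    have "A \<in> sets ?L" by (auto simp: A_def sets_restrict_space_iff)
    then show "integrable ?L (\<lambda>x. indicator A x * F x)" using integrable_mult_indicator[OF _ intF] by simp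
    show "AE x in ?L. f ?I (norm x) \<le> indicator A x * F x"
      using fF[OF sub(1)]
    proof eventually_elim
      case (elim x)
      have "indicator ?I (norm x) * F x \<le> indicator A x * F x" using F0[of x] by (simp add: A_def indicator_def)
      with elim show ?case by linarith
    qed
  qed
  also have "\<dots> = (LINT x|lebesgue_on A. F x)"
  proof -
    have "(LINT x|?L. indicator A x * F x) = (LINT x|lebesgue. indicator ?B x * (indicator A x * F x))"
      by (subst integral_restrict_space) auto
    also have "\<dots> = (LINT x|lebesgue. indicator A x * F x)"
      by (rule Bochner_Integration.integral_cong) (auto simp: A_def indicator_def)
    also have "\<dots> = (LINT x|lebesgue_on A. F x)" by (subst integral_restrict_space) (auto simp: A_def)
    finally show ?thesis .
  qed
  finally show "sphere_area TYPE(real^'n) * (LBINT r:{1/2..3/4}. r ^ (?n - k) * z r ^ (k + 1))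
       \<le> (LINT x|lebesgue_on A. norm x powr (1 - real k) * norm (G x) ^ (k + 1))" by (simp add: E_def F_def)
qed

definition profile_constant :: "nat \<Rightarrow> nat \<Rightarrow> real" where
  "profile_constant n k = inner_constant n k + outer_constant n k"

definition decay_constant :: "nat \<Rightarrow> nat \<Rightarrow> real" where
  "decay_constant n k = 2 ^ n * (profile_constant n k powr (1 / (real k + 1)) + 4 powr \<bar>decay_exponent n k\<bar>)"

definition third_derivative_constant :: "nat \<Rightarrow> nat \<Rightarrow> real" where
  "third_derivative_constant n k = real n * (real k * (1 + real n)) + 4 * (real n * 2 ^ n) + real n * (real n + 1)"

lemma profile_constant_nonneg:
  assumes "1 \<le> k" "2 * k < n" shows "0 \<le> profile_constant n k"
  using stability_gap_pos[OF assms] stability_exponent_bounds(2)[OF assms]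
  by (simp add: profile_constant_def inner_constant_def outer_constant_def)

lemma decay_constant_nonneg: "0 \<le> decay_constant n k"
  by (simp add: decay_constant_def)

lemma energy_le_of_bound:
  assumes "continuous_on {0<..1} z" "\<And>r. r \<in> {1/2..3/4} \<Longrightarrow> 0 \<le> z r" "\<And>r. r \<in> {1/2..3/4} \<Longrightarrow> z r \<le> y"
  shows "(LBINT r:{1/2..3/4}. energy_density n k z r) \<le> y ^ (k + 1)"
proof -
  have y: "0 \<le> y" using assms(2,3)[of "1/2"] by simp
  have "(LBINT r:{1/2..3/4}. energy_density n k z r) \<le> (LBINT r:{1/2..3/4::real}. y ^ (k + 1))"
  proof (rule set_integral_mono)
    show "set_integrable lborel {1/2..3/4} (energy_density n k z)"
      unfolding energy_density_def[abs_def]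
      by (intro borel_integrable_atLeastAtMost' continuous_intros continuous_on_subset[OF assms(1)]) auto
    show "set_integrable lborel {1/2..3/4::real} (\<lambda>r. y ^ (k + 1))"
      by (intro borel_integrable_atLeastAtMost' continuous_intros)
    fix r :: real assume r: "r \<in> {1/2..3/4}"
    have "r ^ (n - k) * z r ^ (k + 1) \<le> 1 * y ^ (k + 1)"
      using r assms(2,3)[OF r] by (intro mult_mono power_mono power_le_one) auto
    then show "energy_density n k z r \<le> y ^ (k + 1)" by (simp add: energy_density_def)
  qed
  also have "\<dots> = 1 / 4 * y ^ (k + 1)" by (simp add: set_lebesgue_integral_def)
  also have "\<dots> \<le> y ^ (k + 1)" using y by simp
  finally show ?thesis .
qed

context
  fixes n k :: nat and g v z :: "real \<Rightarrow> real"
  assumes prof: "regular_profile n k g v z" and k: "1 \<le> k" "2 * k < n"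
    and g_nonneg: "\<And>t. 0 \<le> g t" and g_anti: "antimono g"
    and core: "\<And>r. 0 < r \<Longrightarrow> r \<le> 1/2 \<Longrightarrow> z r ^ (k + 1) \<le>
      profile_constant n k * (LBINT r:{1/2..3/4}. energy_density n k z r) * r powr ((real k + 1) * decay_exponent n k)"
begin

text \<open>
  For \<open>r \<le> 1/2\<close> the energy in \<open>[1/2, 3/4]\<close> is estimated by the minimum of \<open>z\<close> near the boundary, and
  for \<open>r \<ge> 1/2\<close> all values of \<open>z\<close> are comparable.
\<close>

lemma profile_decay:
  assumes r: "r \<in> {0<..1}"
  shows "z r \<le> decay_constant n k * (INF s\<in>{1/2..1}. z s) * r powr decay_exponent n k"
proof -
  define m where "m = (INF s\<in>{1/2..1}. z s)"
  have m: "0 \<le> m" unfolding m_def by (rule infimum_nonneg[OF prof k g_nonneg g_anti])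
  have zm: "z t \<le> 2 ^ n * m" if "t \<in> {1/2..1}" for t
    unfolding m_def by (rule profile_le_infimum[OF prof k g_nonneg g_anti that])
  have nn: "0 \<le> z t" if "t \<in> {0<..1}" for t by (rule profile_nonneg[OF prof k that])
  let ?p = "r powr decay_exponent n k"
  show ?thesis
  proof (cases "r \<le> 1/2")
    case True
    have "(LBINT r:{1/2..3/4}. energy_density n k z r) \<le> (2 ^ n * m) ^ (k + 1)"
      by (rule energy_le_of_bound[OF profile_cont[OF prof k]]) (auto intro: zm nn)
    then have "profile_constant n k * (LBINT r:{1/2..3/4}. energy_density n k z r) * r powr ((real k + 1) * decay_exponent n k)
        \<le> profile_constant n k * (2 ^ n * m) ^ (k + 1) * r powr ((real k + 1) * decay_exponent n k)"
      using profile_constant_nonneg[OF k] by (intro mult_right_mono mult_left_mono) auto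
    then have "z r ^ (k + 1) \<le> profile_constant n k * (2 ^ n * m) ^ (k + 1) * r powr ((real k + 1) * decay_exponent n k)"
      using core[of r] True r by auto
    then have "z r \<le> profile_constant n k powr (1 / (real k + 1)) * (2 ^ n * m) * ?p"
      by (intro root_bound) (use profile_constant_nonneg[OF k] nn[OF r] r m in auto)
    also have "\<dots> \<le> decay_constant n k * m * ?p"
    proof -
      have "profile_constant n k powr (1 / (real k + 1)) * (2 ^ n * m) = (2 ^ n * profile_constant n k powr (1 / (real k + 1))) * m" by simp
      also have "\<dots> \<le> decay_constant n k * m"
        unfolding decay_constant_def by (intro mult_right_mono[OF _ m] mult_left_mono) auto
      finally show ?thesis by (rule mult_right_mono) simp
    qed
    finally show ?thesis by (simp add: m_def)
  next
    case False
    have "z r \<le> (2 ^ n * m) * 1" using zm[of r] False r by auto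
    also have "\<dots> \<le> (2 ^ n * m) * (4 powr \<bar>decay_exponent n k\<bar> * ?p)"
      using powr_lower_bound[of r "decay_exponent n k"] False r m by (intro mult_left_mono) auto
    also have "\<dots> = (2 ^ n * 4 powr \<bar>decay_exponent n k\<bar>) * m * ?p" by simp
    also have "\<dots> \<le> decay_constant n k * m * ?p"
      unfolding decay_constant_def by (intro mult_right_mono[OF _ powr_ge_zero] mult_right_mono[OF _ m] mult_left_mono) auto
    finally show ?thesis by (simp add: m_def)
  qed
qed

lemma profile_over_power_decay:
  assumes r: "r \<in> {0<..1}"
  shows "z r / r ^ j \<le> decay_constant n k * (INF s\<in>{1/2..1}. z s) * r powr (decay_exponent n k - real j)"
proof -
  have "z r / r ^ j \<le> decay_constant n k * (INF s\<in>{1/2..1}. z s) * r powr decay_exponent n k / r ^ j"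
    using profile_decay[OF r] r by (intro divide_right_mono) auto
  also have "\<dots> = decay_constant n k * (INF s\<in>{1/2..1}. z s) * (r powr decay_exponent n k / r powr real j)"
    using r by (simp add: powr_realpow)
  finally show ?thesis by (simp only: powr_diff)
qed

lemma profile_second_derivative:
  assumes r: "r \<in> {0<..1}"
  shows "\<exists>d. (z has_real_derivative d) (at r within {0<..1}) \<and> \<bar>d\<bar> \<le> real n * (z r / r)"
proof (cases "\<forall>s\<in>{0<..1}. z s = 0")
  case True
  then have "(z has_real_derivative 0) (at r within {0<..1})" using has_derivative_Ioc_cong[OF _ r, of z "\<lambda>_. 0"] by simp
  then show ?thesis using True r by auto
next
  case False
  then have zr: "0 < z r" using profile_zero_or_positive[OF prof k g_nonneg g_anti] r by blast
  have "\<bar>profile_slope n k g v z r\<bar> \<le> real n / real k * (z r / r)" by (rule profile_slope_bound[OF prof k g_nonneg g_anti r zr])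
  also have "\<dots> \<le> real n * (z r / r)" using k r zr by (intro mult_right_mono) (auto simp: divide_le_eq)
  finally show ?thesis using regular_profile_slope[OF prof k(1) _ r zr] k by auto
qed

text \<open>
  The equation reads \<open>z' = \<tau> \<cdot> (g \<circ> v) - \<sigma>\<close> with \<open>\<tau>, \<sigma>\<close> depending on \<open>r\<close> and \<open>z\<close> only. If \<open>z'\<close> has a
  derivative then so does \<open>g \<circ> v\<close>, and the three terms of the differentiated equation are bounded
  separately, each by a multiple of \<open>z / r\<^sup>2\<close>.
\<close>

lemma profile_third_derivative:
  assumes convex: "convex_on UNIV g" and r: "r \<in> {0<..1}"
    and d1: "\<And>s. s \<in> {0<..1} \<Longrightarrow> (z has_real_derivative z' s) (at s within {0<..1})"
    and d2: "(z' has_real_derivative d) (at r within {0<..1})"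
  shows "\<bar>d\<bar> \<le> third_derivative_constant n k * (z r / r\<^sup>2)"
proof (cases "\<forall>s\<in>{0<..1}. z s = 0")
  case True
  have "z' s = 0" if s: "s \<in> {0<..1}" for s
  proof -
    have "(z has_real_derivative 0) (at s within {0<..1})" using has_derivative_Ioc_cong[OF _ s, of z "\<lambda>_. 0"] True by simp
    then show ?thesis using rderiv_eqI(2)[OF _ s] d1[OF s] by metis
  qed
  then have "((\<lambda>_. 0) has_real_derivative d) (at r within {0<..1})" using has_derivative_Ioc_cong[OF _ r, of z' "\<lambda>_. 0"] d2 by simp
  then have "d = 0" using rderiv_eqI(2)[OF _ r, of "\<lambda>_. 0"] DERIV_const by metis
  then show ?thesis using True r by (simp add: third_derivative_constant_def)
next
  case False
  then have pos: "0 < z s" if "s \<in> {0<..1}" for s using profile_zero_or_positive[OF prof k g_nonneg g_anti] that by blast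
  note c = c_pos[OF prof k]
  have r0: "0 < r" "r \<le> 1" and zr: "0 < z r" using r pos by auto
  define c0 where "c0 = c_const n k * real k"
  have c0: "0 < c0" using c k by (simp add: c0_def)
  (* The coefficients of the equation solved for the derivative of z. *)
  define \<tau> where "\<tau> s = s ^ (k - 1) / (c0 * z s ^ (k - 1))" for s
  define \<sigma> where "\<sigma> s = (real n - real k) / real k * (z s / s)" for s
  define \<gamma> where "\<gamma> s = g (v s)" for s
  define T where "T = \<tau> r * (real (k - 1) * (1 / r - z' r / z r))"
  define \<Sigma> where "\<Sigma> = (real n - real k) / real k * ((z' r * r - z r) / r\<^sup>2)"
  have slope: "z' s = profile_slope n k g v z s" if "s \<in> {0<..1}" for s
  proof -
    have "(z has_real_derivative profile_slope n k g v z s) (at s within {0<..1})"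
      by (rule regular_profile_slope[OF prof k(1) _ that pos[OF that]]) (use k in simp)
    then show ?thesis using rderiv_eqI(2)[OF _ that] d1[OF that] by metis
  qed
  have z'_eq: "z' s = \<tau> s * \<gamma> s - \<sigma> s" if s: "s \<in> {0<..1}" for s
  proof -
    have e: "z s ^ k = z s * z s ^ (k - 1)" using k by (simp flip: power_Suc)
    show ?thesis unfolding slope[OF s] profile_slope_def e \<tau>_def \<sigma>_def \<gamma>_def c0_def
      using pos[OF s] s k c by (simp add: field_simps)
  qed
  have \<tau>_pos: "0 < \<tau> s" if "s \<in> {0<..1}" for s using that pos[OF that] c0 by (simp add: \<tau>_def)
  have d\<tau>: "(\<tau> has_real_derivative T) (at r within {0<..1})"
  proof (cases "k = 1")
    case True then show ?thesis by (simp add: \<tau>_def[abs_def] T_def)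
  next
    case False
    then obtain j where j: "k - 1 = Suc j" using k by (cases "k - 1") auto
    have "((\<lambda>s. s ^ Suc j) has_real_derivative (1 + real j) * r ^ j) (at r within {0<..1})"
      using DERIV_power_Suc[OF DERIV_ident, where n = j and x = r and s = "{0<..1}"] by (simp add: algebra_simps)
    moreover have "((\<lambda>s. c0 * z s ^ Suc j) has_real_derivative c0 * ((1 + real j) * (z' r * z r ^ j))) (at r within {0<..1})"
      using DERIV_cmult[OF DERIV_power_Suc[OF d1[OF r], where n = j], of c0] by (simp add: algebra_simps)
    ultimately have "((\<lambda>s. s ^ Suc j / (c0 * z s ^ Suc j)) has_real_derivative
        ((1 + real j) * r ^ j * (c0 * z r ^ Suc j) - r ^ Suc j * (c0 * ((1 + real j) * (z' r * z r ^ j)))) / ((c0 * z r ^ Suc j) * (c0 * z r ^ Suc j)))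
        (at r within {0<..1})"
      by (rule DERIV_divide) (use c0 zr in auto)
    moreover have "((1 + real j) * r ^ j * (c0 * z r ^ Suc j) - r ^ Suc j * (c0 * ((1 + real j) * (z' r * z r ^ j)))) / ((c0 * z r ^ Suc j) * (c0 * z r ^ Suc j)) = T"
      unfolding T_def \<tau>_def j using c0 zr r0 by (simp add: field_simps)
    ultimately show ?thesis unfolding \<tau>_def[abs_def] j by (simp only:)
  qed
  have d\<sigma>: "(\<sigma> has_real_derivative \<Sigma>) (at r within {0<..1})"
  proof -
    have "((\<lambda>s. z s / s) has_real_derivative (z' r * r - z r * 1) / (r * r)) (at r within {0<..1})"
      by (rule DERIV_divide[OF d1[OF r] DERIV_ident]) (use r0 in simp)
    from DERIV_cmult[OF this, of "(real n - real k) / real k"] show ?thesis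
      by (simp add: \<sigma>_def[abs_def] \<Sigma>_def power2_eq_square)
  qed
  define D where "D = (d + \<Sigma> - T * \<gamma> r) / \<tau> r"
  have d\<gamma>: "(\<gamma> has_real_derivative D) (at r within {0<..1})"
  proof -
    have "((\<lambda>s. (z' s + \<sigma> s) / \<tau> s) has_real_derivative ((d + \<Sigma>) * \<tau> r - (z' r + \<sigma> r) * T) / (\<tau> r * \<tau> r)) (at r within {0<..1})"
      by (rule DERIV_divide[OF DERIV_add[OF d2 d\<sigma>] d\<tau>]) (use \<tau>_pos[OF r] in simp)
    moreover have "((d + \<Sigma>) * \<tau> r - (z' r + \<sigma> r) * T) / (\<tau> r * \<tau> r) = D"
      unfolding D_def using z'_eq[OF r] \<tau>_pos[OF r] by (simp add: field_simps)
    moreover have "(z' s + \<sigma> s) / \<tau> s = \<gamma> s" if "s \<in> {0<..1}" for s using z'_eq[OF that] \<tau>_pos[OF that] by simp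
    ultimately show ?thesis using has_derivative_Ioc_cong[OF _ r, of "\<lambda>s. (z' s + \<sigma> s) / \<tau> s" \<gamma>] by simp
  qed
  define q where "q = z r / r\<^sup>2"
  have q: "0 < q" using zr r0 by (simp add: q_def)
  have nk: "1 \<le> real k" "real k \<le> real n" using k by auto
  have z'b: "\<bar>z' r\<bar> \<le> real n * (z r / r)"
  proof -
    have "\<bar>z' r\<bar> \<le> real n / real k * (z r / r)" using profile_slope_bound[OF prof k g_nonneg g_anti r zr] slope[OF r] by simp
    also have "\<dots> \<le> real n * (z r / r)" using k r0 zr by (intro mult_right_mono) (auto simp: divide_le_eq)
    finally show ?thesis .
  qed
  have dec: "d = T * \<gamma> r + \<tau> r * D - \<Sigma>" unfolding D_def using \<tau>_pos[OF r] by simp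
  have "\<bar>T * \<gamma> r\<bar> \<le> real n * (real k * (1 + real n)) * q"
  proof -
    have e: "r ^ n = r ^ (n - k) * (r * r ^ (k - 1))" "z r ^ k = z r * z r ^ (k - 1)" using k by (simp_all flip: power_add power_Suc)
    have "r ^ (n - k) * (r * (r ^ (k - 1) * \<gamma> r)) \<le> r ^ (n - k) * (real n * c_const n k * (z r * z r ^ (k - 1)))"
      using source_le_flux[OF prof k g_nonneg g_anti r] c unfolding e \<gamma>_def by (simp add: field_simps)
    then have "r * (r ^ (k - 1) * \<gamma> r) \<le> real n * c_const n k * (z r * z r ^ (k - 1))" using r0 by simp
    also have "\<dots> \<le> real k * (real n * c_const n k * (z r * z r ^ (k - 1)))"
      using mult_right_mono[OF nk(1), of "real n * c_const n k * (z r * z r ^ (k - 1))"] c zr by simp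
    finally have "\<tau> r * \<gamma> r \<le> real n * (z r / r)" unfolding \<tau>_def c0_def using c k zr r0 by (simp add: field_simps)
    moreover have "0 \<le> \<tau> r * \<gamma> r" using \<tau>_pos[OF r] g_nonneg by (simp add: \<gamma>_def)
    moreover have "\<bar>real (k - 1) * (1 / r - z' r / z r)\<bar> \<le> real k * ((1 + real n) * (1 / r))"
    proof -
      have "\<bar>z' r / z r\<bar> \<le> real n * (1 / r)" using z'b zr by (simp add: abs_divide divide_le_eq)
      moreover have "0 \<le> 1 / r" using r0 by simp
      ultimately have "\<bar>1 / r - z' r / z r\<bar> \<le> 1 / r + real n * (1 / r)" by linarith
      then have "\<bar>1 / r - z' r / z r\<bar> \<le> (1 + real n) * (1 / r)" by (simp add: algebra_simps)
      then show ?thesis unfolding abs_mult by (intro mult_mono) auto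
    qed
    ultimately have "(\<tau> r * \<gamma> r) * \<bar>real (k - 1) * (1 / r - z' r / z r)\<bar> \<le> (real n * (z r / r)) * (real k * ((1 + real n) * (1 / r)))"
      using zr r0 by (intro mult_mono[of "\<tau> r * \<gamma> r" "real n * (z r / r)"]) auto
    moreover have "\<bar>T * \<gamma> r\<bar> = (\<tau> r * \<gamma> r) * \<bar>real (k - 1) * (1 / r - z' r / z r)\<bar>"
      using \<tau>_pos[OF r] g_nonneg[of "v r"] by (simp add: T_def \<gamma>_def abs_mult)
    moreover have "(real n * (z r / r)) * (real k * ((1 + real n) * (1 / r))) = real n * (real k * (1 + real n)) * q"
      by (simp add: q_def power2_eq_square)
    ultimately show ?thesis by simp
  qed
  moreover have "\<bar>\<tau> r * D\<bar> \<le> 4 * (real n * 2 ^ n) * q"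
  proof -
    have "(\<lambda>s. g (v s)) = \<gamma>" by (simp add: \<gamma>_def[abs_def])
    then have D: "D \<le> 0" "- D \<le> 4 * (real n * c_const n k * 2 ^ n * z r ^ k / r ^ k) / r"
      using source_derivative_bound[OF prof k g_nonneg g_anti convex r pos, of D] d\<gamma> by auto
    have "\<bar>\<tau> r * D\<bar> = \<tau> r * - D" using D(1) \<tau>_pos[OF r] by (simp add: abs_mult)
    also have "\<dots> \<le> \<tau> r * (4 * (real n * c_const n k * 2 ^ n * z r ^ k / r ^ k) / r)"
      using D(2) \<tau>_pos[OF r] by (intro mult_left_mono) auto
    also have "\<dots> = 4 * (real n * 2 ^ n) * q / real k"
    proof -
      have e: "r ^ k = r * r ^ (k - 1)" "z r ^ k = z r * z r ^ (k - 1)" using k by (simp_all flip: power_Suc)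
      show ?thesis unfolding \<tau>_def c0_def q_def e power2_eq_square using c k zr r0 by (simp add: ac_simps)
    qed
    also have "\<dots> \<le> 4 * (real n * 2 ^ n) * q / 1" using nk(1) q by (intro divide_left_mono) auto
    finally show ?thesis by simp
  qed
  moreover have "\<bar>\<Sigma>\<bar> \<le> real n * (real n + 1) * q"
  proof -
    have "\<bar>z' r * r - z r\<bar> \<le> \<bar>z' r\<bar> * r + z r" using zr r0 abs_triangle_ineq4[of "z' r * r" "z r"] by (simp add: abs_mult)
    also have "\<dots> \<le> real n * (z r / r) * r + z r" using z'b r0 by (intro add_right_mono mult_right_mono) auto
    also have "\<dots> = (real n + 1) * z r" using r0 by (simp add: algebra_simps)
    finally have 1: "\<bar>z' r * r - z r\<bar> / r\<^sup>2 \<le> (real n + 1) * z r / r\<^sup>2" by (rule divide_right_mono) simp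
    have "\<bar>(real n - real k) / real k\<bar> = (real n - real k) / real k" using nk by simp
    also have "\<dots> \<le> real n / 1" using nk by (intro frac_le) auto
    finally have "\<bar>(real n - real k) / real k\<bar> \<le> real n" by simp
    from mult_mono[OF this 1] have "\<bar>(real n - real k) / real k\<bar> * (\<bar>z' r * r - z r\<bar> / r\<^sup>2) \<le> real n * ((real n + 1) * z r / r\<^sup>2)" by simp
    then show ?thesis by (simp add: \<Sigma>_def q_def abs_mult)
  qed
  ultimately have "\<bar>d\<bar> \<le> real n * (real k * (1 + real n)) * q + 4 * (real n * 2 ^ n) * q + real n * (real n + 1) * q"
    unfolding dec by linarith
  then show ?thesis by (simp only: third_derivative_constant_def q_def distrib_right)
qed

text \<open>
  By the equation \<open>z'\<close> is differentiable at \<open>r\<close> if \<open>g\<close> is differentiable at \<open>v r\<close>, and \<open>v\<close> is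
  injective unless \<open>z\<close> vanishes identically.
\<close>

lemma countable_profile_kinks:
  assumes convex: "convex_on UNIV g" and d1: "\<And>s. s \<in> {0<..1} \<Longrightarrow> (z has_real_derivative z' s) (at s within {0<..1})"
  shows "countable {r \<in> {0<..1}. \<not> rdifferentiable z' r}"
proof (cases "\<forall>s\<in>{0<..1}. z s = 0")
  case True
  have "z' s = 0" if s: "s \<in> {0<..1}" for s
  proof -
    have "(z has_real_derivative 0) (at s within {0<..1})" using has_derivative_Ioc_cong[OF _ s, of z "\<lambda>_. 0"] True by simp
    then show ?thesis using rderiv_eqI(2)[OF _ s] d1[OF s] by metis
  qed
  then have "(z' has_real_derivative 0) (at s within {0<..1})" if "s \<in> {0<..1}" for s
    using has_derivative_Ioc_cong[OF _ that, of z' "\<lambda>_. 0"] by simp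
  then have "{r \<in> {0<..1}. \<not> rdifferentiable z' r} = {}" using rderiv_eqI(1) by blast
  then show ?thesis by (simp only: countable_empty)
next
  case False
  then have pos: "0 < z s" if "s \<in> {0<..1}" for s using profile_zero_or_positive[OF prof k g_nonneg g_anti] that by blast
  note c = c_pos[OF prof k]
  let ?N = "{x. \<not> (\<exists>d. (g has_real_derivative d) (at x))}"
  have inj: "inj_on v {0<..1}"
  proof (rule linorder_inj_onI)
    fix s t :: real assume st: "s < t" "s \<in> {0<..1}" "t \<in> {0<..1}"
    then have st': "0 < s" "s < t" "t \<le> 1" by auto
    obtain x where x: "s < x" "x < t" "v t - v s = (t - s) * z x" using mvt_Ioc[OF profile_deriv[OF prof k] st'] by blast
    have "0 < (t - s) * z x" using x st' by (intro mult_pos_pos pos) auto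
    then show "v s \<noteq> v t" using x by simp
  qed auto
  have "v r \<in> ?N" if r: "r \<in> {0<..1}" and nd: "\<not> rdifferentiable z' r" for r
  proof (rule ccontr)
    assume "v r \<notin> ?N"
    then obtain d where d: "(g has_real_derivative d) (at (v r))" by blast
    have gv: "((\<lambda>s. g (v s)) has_real_derivative d * z r) (at r within {0<..1})"
      by (rule DERIV_chain2[OF d profile_deriv[OF prof k r]])
    have "\<exists>D. (profile_slope n k g v z has_real_derivative D) (at r within {0<..1})"
      unfolding profile_slope_def[abs_def]
      by (rule exI) (rule derivative_eq_intros gv d1[OF r] refl | use r pos[OF r] k c in simp)+
    then obtain D where D: "(profile_slope n k g v z has_real_derivative D) (at r within {0<..1})" by blast
    have "z' s = profile_slope n k g v z s" if "s \<in> {0<..1}" for s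
    proof -
      have "(z has_real_derivative profile_slope n k g v z s) (at s within {0<..1})"
        by (rule regular_profile_slope[OF prof k(1) _ that pos[OF that]]) (use k in simp)
      then show ?thesis using rderiv_eqI(2)[OF _ that] d1[OF that] by metis
    qed
    then have "(z' has_real_derivative D) (at r within {0<..1})"
      using has_derivative_Ioc_cong[OF _ r, of z' "profile_slope n k g v z"] D by simp
    then show False using rderiv_eqI(1)[OF _ r] nd by blast
  qed
  then have "v ` {r \<in> {0<..1}. \<not> rdifferentiable z' r} \<subseteq> ?N" by blast
  then have "countable (v ` {r \<in> {0<..1}. \<not> rdifferentiable z' r})"
    using countable_kinks_convex[OF convex] countable_subset by blast
  moreover have "inj_on v {r \<in> {0<..1}. \<not> rdifferentiable z' r}" by (rule inj_on_subset[OF inj]) auto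
  ultimately show ?thesis by (rule countable_image_inj_on)
qed

end

lemma radial_solution_profile:
  fixes u :: "real^'n \<Rightarrow> real" and G :: "real^'n \<Rightarrow> real^'n"
  assumes k: "1 \<le> k" "2 * k < CARD('n)" and g: "locally_lipschitz g" "\<And>t. 0 \<le> g t"
    and sob: "weighted_sobolev k u G" and sol: "radial_solution k g u G v"
  obtains z where "regular_profile CARD('n) k g v z" "AE x in lebesgue_on (ball 0 1). G x \<bullet> x = norm x * z (norm x)"
proof -
  have gc: "continuous_on UNIV g" by (rule locally_lipschitz_continuous[OF g(1)])
  have v: "continuous_on {0<..1} v" and Gp: "AE x in lebesgue_on (ball 0 1). G x \<bullet> x \<ge> 0"
    and uv: "\<And>x. x \<in> ball 0 1 \<Longrightarrow> u x = v (norm x)"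
    using sol by (auto simp: radial_solution_def)
  from sol consider "weak_radial_solution k g u G" | "classical_solution k g u" by (auto simp: radial_solution_def)
  then show ?thesis
  proof cases
    case 1
    show ?thesis by (rule weak_solution_profile[OF k gc g(2) v uv 1 Gp that])
  next
    case 2
    have wg: "weak_gradient_on (ball 0 1) u G" using sob by (simp add: weighted_sobolev_def)
    have kn: "k < CARD('n)" using k by simp
    show ?thesis by (rule classical_solution_profile[OF k(1) kn gc v uv 2 wg that])
  qed
qed

lemma semistable_profile_bound:
  fixes u :: "real^'n \<Rightarrow> real" and G :: "real^'n \<Rightarrow> real^'n"
  assumes k: "1 \<le> k" "2 * k < CARD('n)" and g: "locally_lipschitz g" "\<And>t. 0 \<le> g t"
    and sob: "weighted_sobolev k u G" and sol: "radial_solution k g u G v" and semi: "semistable k g u"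
    and prof: "regular_profile CARD('n) k g v z" and Gz: "AE x in lebesgue_on (ball 0 1). G x \<bullet> x = norm x * z (norm x)"
    and r: "0 < r" "r \<le> 1/2"
  shows "z r ^ (k + 1) \<le> profile_constant CARD('n) k * (LBINT r:{1/2..3/4}. energy_density CARD('n) k z r)
      * r powr ((real k + 1) * decay_exponent CARD('n) k)"
  unfolding profile_constant_def
proof (rule profile_bound[OF prof k g(2,1) _ _ r])
  have "k < CARD('n)" using k by simp
  then show "set_integrable lborel {0<..<1} (energy_density CARD('n) k z)"
    using gradient_energy(1)[OF k(1) _ _ Gz profile_cont[OF prof k] profile_nonneg[OF prof k]] sob
    by (simp add: energy_density_def[abs_def] weighted_sobolev_def)
  have uv: "\<And>x. x \<in> ball 0 1 \<Longrightarrow> u x = v (norm x)" using sol by (auto simp: radial_solution_def)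
  show "0 \<le> (LBINT r:{\<alpha>..\<beta>}. energy_density CARD('n) k z r * stability_form CARD('n) k r (\<zeta> r) (\<zeta>' r))"
    if "0 \<le> r0" "\<And>t. r0 < t \<Longrightarrow> t < 1 \<Longrightarrow> 0 < z t" "r0 < \<alpha>" "\<alpha> < \<beta>" "\<beta> < 1"
      "\<And>r. (\<zeta> has_real_derivative \<zeta>' r) (at r)" "continuous_on UNIV \<zeta>'" "\<And>r. r \<notin> {\<alpha><..<\<beta>} \<Longrightarrow> \<zeta> r = 0" for r0 \<alpha> \<beta> \<zeta> \<zeta>'
    unfolding energy_density_def by (rule semistable_radial_inequality[OF prof k g(1) uv semi that])
qed

lemma weighted_grad_norm_power:
  fixes G :: "real^'n \<Rightarrow> real^'n"
  shows "0 \<le> weighted_grad_norm k A G"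
    and "weighted_grad_norm k A G ^ (k + 1) = (LINT x|lebesgue_on A. norm x powr (1 - real k) * norm (G x) ^ (k + 1))"
proof -
  define J where "J = (LINT x|lebesgue_on A. norm x powr (1 - real k) * norm (G x) ^ (k + 1))"
  have J: "0 \<le> J" unfolding J_def by (rule Bochner_Integration.integral_nonneg) simp
  have N: "weighted_grad_norm k A G = J powr (1 / real (k + 1))" by (simp add: weighted_grad_norm_def J_def)
  show "0 \<le> weighted_grad_norm k A G" by (simp add: N)
  have "(J powr (1 / real (k + 1))) ^ (k + 1) = J" using root_power[OF J, of k] by (simp add: add.commute)
  then show "weighted_grad_norm k A G ^ (k + 1) = (LINT x|lebesgue_on A. norm x powr (1 - real k) * norm (G x) ^ (k + 1))"
    by (simp only: N J_def)
qed

text \<open>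
  With \<open>j = 0, 1, 2\<close> these are the powers of \<open>r\<close> in the estimates of the first, second and third
  derivative.
\<close>

lemma decay_exponent_minus:
  "decay_exponent n k - j = (- (real k + 1) * real n + 2 * sqrt (2 * (real k + 1) * real n - 4 * real k)
     + (real k)\<^sup>2 + 4 * real k - 1 - j * (real k + 1)\<^sup>2) / (real k + 1)\<^sup>2"
proof -
  define w where "w = sqrt (2 * (real k + 1) * real n - 4 * real k)"
  define K where "K = real k + 1"
  have K: "0 < K" "real k = K - 1" by (auto simp: K_def)
  show ?thesis
    unfolding decay_exponent_def stability_exponent_def w_def[symmetric] K_def[symmetric] unfolding K(2)
    using K(1) by (simp add: field_simps power2_eq_square)
qed

theorem theorem1p10:
  fixes k :: nat
  assumes "k \<ge> 1" and "CARD('n::finite) \<ge> 2 * k + 8"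
  shows "\<exists>D D' :: real. \<forall>(g :: real \<Rightarrow> real) (u :: real^'n \<Rightarrow> real) (G :: real^'n \<Rightarrow> real^'n) (v :: real \<Rightarrow> real).
    locally_lipschitz g \<and> weighted_sobolev k u G \<and> radial_solution k g u G v \<and> semistable k g u \<longrightarrow>
    ((\<forall>t. g t \<ge> 0) \<longrightarrow>
       (\<forall>r\<in>{0<..1/2}. rdifferentiable v r \<and>
          rderiv v r \<le> D * weighted_grad_norm k (ball 0 1 - cball 0 (1/2)) G *
            r powr ((- (real k + 1) * real CARD('n)
                     + 2 * sqrt (2 * (real k + 1) * real CARD('n) - 4 * real k)
                     + (real k)\<^sup>2 + 4 * real k - 1) / (real k + 1)\<^sup>2))) \<and>
    ((\<forall>t. g t \<ge> 0) \<and> antimono g \<longrightarrow>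
       (\<forall>i\<in>{1, 2::nat}. \<forall>r\<in>{0<..1}. rdifferentiable ((rderiv ^^ (i - 1)) v) r \<and>
          \<bar>(rderiv ^^ i) v r\<bar> \<le> D' * (INF t\<in>{1/2..1}. rderiv v t) *
            r powr ((- (real k + 1) * real CARD('n)
                     + 2 * sqrt (2 * (real k + 1) * real CARD('n) - 4 * real k)
                     + (2 - real i) * (real k)\<^sup>2 + 2 * (3 - real i) * real k - real i) / (real k + 1)\<^sup>2))) \<and>
    ((\<forall>t. g t \<ge> 0) \<and> antimono g \<and> convex_on UNIV g \<longrightarrow>
       countable {r\<in>{0<..1}. \<not> rdifferentiable ((rderiv ^^ 2) v) r} \<and>
       (\<forall>r\<in>{0<..1}. rdifferentiable ((rderiv ^^ 2) v) r \<longrightarrow>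
          \<bar>(rderiv ^^ 3) v r\<bar> \<le> D' * (INF t\<in>{1/2..1}. rderiv v t) *
            r powr ((- (real k + 1) * real CARD('n)
                     + 2 * sqrt (2 * (real k + 1) * real CARD('n) - 4 * real k)
                     - (real k)\<^sup>2 - 3) / (real k + 1)\<^sup>2)))"
proof -
  let ?n = "CARD('n)" let ?A = "ball 0 1 - cball 0 (1/2) :: (real^'n) set"
  define e where "e j = decay_exponent ?n k - real j" for j :: nat
  (* The area converts the energy in polar coordinates into the integral over the shell. *)
  define D where "D = (profile_constant ?n k / sphere_area TYPE(real^'n)) powr (1 / (real k + 1))"
  (* The summands serve the first, second and third derivative. *)
  define D' where "D' = (1 + real ?n + third_derivative_constant ?n k) * decay_constant ?n k"
  have k: "1 \<le> k" "2 * k < ?n" using assms by auto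
  have area: "0 < sphere_area TYPE(real^'n)" by (rule sphere_area_pos)
  have third: "0 \<le> third_derivative_constant ?n k" by (simp add: third_derivative_constant_def)
  have exps:
    "(- (real k + 1) * real ?n + 2 * sqrt (2 * (real k + 1) * real ?n - 4 * real k) + (real k)\<^sup>2 + 4 * real k - 1) / (real k + 1)\<^sup>2 = e 0"
    "(- (real k + 1) * real ?n + 2 * sqrt (2 * (real k + 1) * real ?n - 4 * real k)
      + (2 - real 1) * (real k)\<^sup>2 + 2 * (3 - real 1) * real k - real 1) / (real k + 1)\<^sup>2 = e 0"
    "(- (real k + 1) * real ?n + 2 * sqrt (2 * (real k + 1) * real ?n - 4 * real k)
      + (2 - real 2) * (real k)\<^sup>2 + 2 * (3 - real 2) * real k - real 2) / (real k + 1)\<^sup>2 = e 1"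
    "(- (real k + 1) * real ?n + 2 * sqrt (2 * (real k + 1) * real ?n - 4 * real k) - (real k)\<^sup>2 - 3) / (real k + 1)\<^sup>2 = e 2"
    unfolding e_def decay_exponent_minus by (rule arg_cong[where f = "\<lambda>x. x / (real k + 1)\<^sup>2"], simp add: power2_eq_square algebra_simps)+
  show ?thesis
  proof (rule exI[of _ D], rule exI[of _ D'], intro allI impI)
    fix g :: "real \<Rightarrow> real" and u :: "real^'n \<Rightarrow> real" and G :: "real^'n \<Rightarrow> real^'n" and v :: "real \<Rightarrow> real"
    assume asm: "locally_lipschitz g \<and> weighted_sobolev k u G \<and> radial_solution k g u G v \<and> semistable k g u"
    have first: "\<forall>r\<in>{0<..1/2}. rdifferentiable v r \<and> rderiv v r \<le> D * weighted_grad_norm k ?A G * r powr e 0"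
      if g0: "\<forall>t. g t \<ge> 0"
    proof
      fix r :: real assume r: "r \<in> {0<..1/2}"
      obtain z where prof: "regular_profile ?n k g v z" and Gz: "AE x in lebesgue_on (ball 0 1). G x \<bullet> x = norm x * z (norm x)"
        using radial_solution_profile[OF k, where g = g and u = u and G = G and v = v] asm g0 by blast
      have r1: "r \<in> {0<..1}" and r2: "0 < r" "r \<le> 1/2" using r by auto
      let ?I = "LBINT r:{1/2..3/4}. energy_density ?n k z r"
      let ?N = "weighted_grad_norm k ?A G" let ?S = "sphere_area TYPE(real^'n)"
      have "k < ?n" using k by simp
      then have "?S * ?I \<le> ?N ^ (k + 1)"
        unfolding weighted_grad_norm_power(2) energy_density_def
        using gradient_energy(2)[OF k(1) _ _ Gz profile_cont[OF prof k] profile_nonneg[OF prof k]] asm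
        by (simp only: weighted_sobolev_def)
      then have I: "?I \<le> ?N ^ (k + 1) / ?S" using area by (simp add: field_simps)
      have "z r ^ (k + 1) \<le> profile_constant ?n k * ?I * r powr ((real k + 1) * decay_exponent ?n k)"
        using semistable_profile_bound[OF k _ _ _ _ _ prof Gz r2] asm g0 by blast
      also have "\<dots> \<le> profile_constant ?n k * (?N ^ (k + 1) / ?S) * r powr ((real k + 1) * decay_exponent ?n k)"
        using I profile_constant_nonneg[OF k] by (intro mult_right_mono mult_left_mono) auto
      finally have "z r ^ (k + 1) \<le> profile_constant ?n k / ?S * ?N ^ (k + 1) * r powr ((real k + 1) * decay_exponent ?n k)" by simp
      then have "z r \<le> D * ?N * r powr decay_exponent ?n k"
        unfolding D_def using profile_nonneg[OF prof k r1] weighted_grad_norm_power(1) profile_constant_nonneg[OF k] area r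
        by (intro root_bound) auto
      then show "rdifferentiable v r \<and> rderiv v r \<le> D * ?N * r powr e 0"
        using rderiv_eqI[OF profile_deriv[OF prof k r1] r1] by (simp add: e_def)
    qed
    have rest: "(\<forall>r\<in>{0<..1}. rdifferentiable v r \<and> \<bar>rderiv v r\<bar> \<le> D' * (INF t\<in>{1/2..1}. rderiv v t) * r powr e 0) \<and>
      (\<forall>r\<in>{0<..1}. rdifferentiable (rderiv v) r \<and> \<bar>rderiv (rderiv v) r\<bar> \<le> D' * (INF t\<in>{1/2..1}. rderiv v t) * r powr e 1) \<and>
      (convex_on UNIV g \<longrightarrow> countable {r\<in>{0<..1}. \<not> rdifferentiable (rderiv (rderiv v)) r} \<and>
        (\<forall>r\<in>{0<..1}. rdifferentiable (rderiv (rderiv v)) r \<longrightarrow>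
          \<bar>rderiv (rderiv (rderiv v)) r\<bar> \<le> D' * (INF t\<in>{1/2..1}. rderiv v t) * r powr e 2))"
      if g0: "\<forall>t. g t \<ge> 0" and anti: "antimono g"
    proof -
      obtain z where prof: "regular_profile ?n k g v z" and Gz: "AE x in lebesgue_on (ball 0 1). G x \<bullet> x = norm x * z (norm x)"
        using radial_solution_profile[OF k, where g = g and u = u and G = G and v = v] asm g0 by blast
      have gn: "\<And>t. 0 \<le> g t" using g0 by blast
      have core: "z r ^ (k + 1) \<le> profile_constant ?n k * (LBINT r:{1/2..3/4}. energy_density ?n k z r)
          * r powr ((real k + 1) * decay_exponent ?n k)" if "0 < r" "r \<le> 1/2" for r
        using semistable_profile_bound[OF k _ _ _ _ _ prof Gz that] asm g0 by blast
      note P = prof k gn anti core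
      define z' where "z' = rderiv z"
      have v: "rdifferentiable v r" "rderiv v r = z r" if "r \<in> {0<..1}" for r
        using rderiv_eqI[OF profile_deriv[OF prof k that] that] by auto
      have z: "(z has_real_derivative z' r) (at r within {0<..1})" "\<bar>z' r\<bar> \<le> real ?n * (z r / r)" if r: "r \<in> {0<..1}" for r
      proof -
        obtain d where d: "(z has_real_derivative d) (at r within {0<..1})" "\<bar>d\<bar> \<le> real ?n * (z r / r)"
          using profile_second_derivative[OF P r] by blast
        moreover have "z' r = d" unfolding z'_def by (rule rderiv_eqI(2)[OF d(1) r])
        ultimately show "(z has_real_derivative z' r) (at r within {0<..1})" "\<bar>z' r\<bar> \<le> real ?n * (z r / r)" by auto
      qed
      have v1: "rdifferentiable (rderiv v) r" "rderiv (rderiv v) r = z' r" if r: "r \<in> {0<..1}" for r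
        using rderiv_eqI[OF _ r, of "rderiv v" "z' r"] has_derivative_Ioc_cong[OF v(2) r] z(1)[OF r] by auto
      have v2: "(rderiv (rderiv v) has_real_derivative d) (at r within {0<..1}) \<longleftrightarrow> (z' has_real_derivative d) (at r within {0<..1})"
        if r: "r \<in> {0<..1}" for r d by (rule has_derivative_Ioc_cong[OF v1(2) r])
      have m: "(INF t\<in>{1/2..1}. rderiv v t) = (INF t\<in>{1/2..1}. z t)" by (rule INF_cong) (use v(2) in auto)
      have m0: "0 \<le> (INF t\<in>{1/2..1}. z t)" by (rule infimum_nonneg[OF prof k gn anti])
      have bound: "c * (z r / r ^ j) \<le> D' * (INF t\<in>{1/2..1}. rderiv v t) * r powr e j"
        if "r \<in> {0<..1}" "0 \<le> c" "c \<le> 1 + real ?n + third_derivative_constant ?n k" for c r j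
      proof -
        let ?w = "decay_constant ?n k * (INF t\<in>{1/2..1}. z t) * r powr e j"
        have "c * (z r / r ^ j) \<le> c * ?w"
          unfolding e_def by (rule mult_left_mono[OF profile_over_power_decay[OF P that(1)] that(2)])
        also have "\<dots> \<le> (1 + real ?n + third_derivative_constant ?n k) * ?w"
          by (rule mult_right_mono[OF that(3)]) (intro mult_nonneg_nonneg decay_constant_nonneg m0 powr_ge_zero)
        finally show ?thesis by (simp add: m D'_def ac_simps)
      qed
      show ?thesis
      proof (intro conjI ballI impI)
        fix r :: real assume r: "r \<in> {0<..1}"
        show "rdifferentiable v r" by (rule v(1)[OF r])
        show "\<bar>rderiv v r\<bar> \<le> D' * (INF t\<in>{1/2..1}. rderiv v t) * r powr e 0"
          using bound[OF r, of 1 0] v(2)[OF r] profile_nonneg[OF prof k r] third by simp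
        show "rdifferentiable (rderiv v) r" by (rule v1(1)[OF r])
        show "\<bar>rderiv (rderiv v) r\<bar> \<le> D' * (INF t\<in>{1/2..1}. rderiv v t) * r powr e 1"
          using bound[OF r, of "real ?n" 1] v1(2)[OF r] z(2)[OF r] third by simp
      next
        assume convex: "convex_on UNIV g"
        have "{r\<in>{0<..1}. \<not> rdifferentiable (rderiv (rderiv v)) r} \<subseteq> {r\<in>{0<..1}. \<not> rdifferentiable z' r}"
          using v2 rderiv_eqI(1) rdifferentiableD by blast
        then show "countable {r\<in>{0<..1}. \<not> rdifferentiable (rderiv (rderiv v)) r}"
          using countable_profile_kinks[OF P convex z(1)] countable_subset by blast
        fix r :: real assume r: "r \<in> {0<..1}" and d: "rdifferentiable (rderiv (rderiv v)) r"
        have "\<bar>rderiv (rderiv (rderiv v)) r\<bar> \<le> third_derivative_constant ?n k * (z r / r\<^sup>2)"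
          using profile_third_derivative[OF P convex r z(1)] rdifferentiableD[OF d] v2[OF r] by blast
        then show "\<bar>rderiv (rderiv (rderiv v)) r\<bar> \<le> D' * (INF t\<in>{1/2..1}. rderiv v t) * r powr e 2"
          using bound[OF r third, of 2] by simp
      qed
    qed
    have it: "(rderiv ^^ (1 - 1)) v = v" "(rderiv ^^ 1) v = rderiv v" "(rderiv ^^ (2 - 1)) v = rderiv v"
      "(rderiv ^^ 2) v = rderiv (rderiv v)" "(rderiv ^^ 3) v = rderiv (rderiv (rderiv v))"
      by (simp_all add: numeral_2_eq_2 numeral_3_eq_3)
    show "((\<forall>t. g t \<ge> 0) \<longrightarrow>
       (\<forall>r\<in>{0<..1/2}. rdifferentiable v r \<and>
          rderiv v r \<le> D * weighted_grad_norm k (ball 0 1 - cball 0 (1/2)) G *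
            r powr ((- (real k + 1) * real CARD('n)
                     + 2 * sqrt (2 * (real k + 1) * real CARD('n) - 4 * real k)
                     + (real k)\<^sup>2 + 4 * real k - 1) / (real k + 1)\<^sup>2))) \<and>
    ((\<forall>t. g t \<ge> 0) \<and> antimono g \<longrightarrow>
       (\<forall>i\<in>{1, 2::nat}. \<forall>r\<in>{0<..1}. rdifferentiable ((rderiv ^^ (i - 1)) v) r \<and>
          \<bar>(rderiv ^^ i) v r\<bar> \<le> D' * (INF t\<in>{1/2..1}. rderiv v t) *
            r powr ((- (real k + 1) * real CARD('n)
                     + 2 * sqrt (2 * (real k + 1) * real CARD('n) - 4 * real k)
                     + (2 - real i) * (real k)\<^sup>2 + 2 * (3 - real i) * real k - real i) / (real k + 1)\<^sup>2))) \<and>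
    ((\<forall>t. g t \<ge> 0) \<and> antimono g \<and> convex_on UNIV g \<longrightarrow>
       countable {r\<in>{0<..1}. \<not> rdifferentiable ((rderiv ^^ 2) v) r} \<and>
       (\<forall>r\<in>{0<..1}. rdifferentiable ((rderiv ^^ 2) v) r \<longrightarrow>
          \<bar>(rderiv ^^ 3) v r\<bar> \<le> D' * (INF t\<in>{1/2..1}. rderiv v t) *
            r powr ((- (real k + 1) * real CARD('n)
                     + 2 * sqrt (2 * (real k + 1) * real CARD('n) - 4 * real k)
                     - (real k)\<^sup>2 - 3) / (real k + 1)\<^sup>2)))"
      unfolding ball_simps(5,7) it exps using first rest by simp
  qed
qed

end
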